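(* Let $G$ be a cofinal graph and $\phi : \mathcal P(G) \to \mathbb R$ a function such that $\lim_{k \to \infty} \operatorname{var}_k(\phi) = 0$. Consider the one-parameter group $\alpha^\phi$ on the graph $C^*$-algebra $C^*(G)$, and let $\beta \in \mathbb R$. 1) Assume that $NW_G = \emptyset$. Then there is a gauge-invariant $\beta$-KMS weight for $\alpha^\phi$ for all $\beta \in \mathbb R$. 2) Assume that $NW_G$ is non-empty and finite, and that $\phi$ satisfies Bowen's condition on $NW_G$. Then there is a gauge-invariant $\beta$-KMS weight for $\alpha^\phi$ if and only if $\mathbb P(-\beta\phi) = 0$, and if it exists this gauge-invariant $\beta$-KMS weight is unique up to multiplication by a scalar. 3) Assume that $NW_G$ is infinite. Then there is a gauge-invariant $\beta$-KMS weight for $\alpha^\phi$ if and only if $\mathbb P(-\beta\phi) \leq 0$.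
   Context: Graphs. $G$ is a directed graph with countable vertex set $V_G$ and countable edge set; $r(e)$, $s(e)$ are the range and source of an edge. An infinite path is a sequence $p = (p_i)_{i=1}^\infty$ of edges with $r(p_i)=s(p_{i+1})$; finite paths $\mu = e_1\cdots e_n$ are defined similarly, with $s(\mu)=s(e_1)$, $r(\mu)=r(e_n)$. $\mathcal P(G)$ is the set of infinite paths with the topology having as base the cylinders $Z(\mu) = \{p : p_i=e_i,\ i=1,\dots,n\}$; the left shift $\sigma$ is a local homeomorphism of the locally compact second countable Hausdorff space $\mathcal P(G)$. "$G$ is cofinal" means: every vertex emits only finitely many edges, every vertex emits at least one edge, and for every $v \in V_G$ and $p \in \mathcal P(G)$ there are a finite path $\mu$ and $i \in \mathbb N$ with $s(\mu)=v$, $r(\mu) = s(p_i)$. $NW_G$ is the set of vertices $v$ for which there is a finite path $\mu$ with $s(\mu)=r(\mu)=v$; it also denotes the subgraph formed by these vertices and the edges they emit. $\operatorname{var}_k(\phi) = \sup\{|\phi(x)-\phi(y)| : x_i = y_i,\ i = 1,\dots,k\}$. $\phi$ satisfies Bowen's condition on $NW_G$ when there is $C>0$ such that $\left|\sum_{i=0}^{n-1}[\phi(\sigma^i(x)) - \phi(\sigma^i(y))]\right| \leq C$ for all $n \geq 1$ and all $x,y \in \mathcal P(NW_G)$ whose first $n$ edges agree. Pressure. For continuous $\psi : \mathcal P(G) \to \mathbb R$ put $L_\psi(f)(x) = \sum_{y \in \sigma^{-1}(x)} e^{\psi(y)} f(y)$, $f \in C_c(\mathcal P(G))$. Then $\mathbb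 P(\psi) = \sup_{x} \mathbb P_x(\psi)$ with $\mathbb P_x(\psi) = \log\left(\limsup_n (L_\psi^n(f)(x))^{1/n}\right) \in [-\infty,\infty]$ ($\log 0=-\infty$, $\log\infty=\infty$) for any non-negative non-zero $f \in C_c(\mathcal P(G))$; this is independent of $f$. $C^*$-algebra. Let $X = \mathcal P(G)$ and $\Gamma_\sigma = \{(x,k,y) \in X\times\mathbb Z\times X : \exists n,m \in \mathbb N,\ k=n-m,\ \sigma^n(x)=\sigma^m(y)\}$, a groupoid with $(x,k,y)(y,k',y')=(x,k+k',y')$ and $(x,k,y)^{-1}=(y,-k,x)$. A base for its topology is given by the sets $\{(x,n-m,y) : x \in U,\ y\in V,\ \sigma^n(x)=\sigma^m(y)\}$ with $U,V \subseteq X$ open, $\sigma^n$ injective on $U$ and $\sigma^m$ injective on $V$; this makes $\Gamma_\sigma$ a locally compact Hausdorff étale groupoid. $C_c(\Gamma_\sigma)$ is a $*$-algebra with $fg(x,k,y)=\sum_{z,\, n+m=k} f(x,n,z)g(z,m,y)$ and $f^*(x,k,y)=\overline{f(y,-k,x)}$. $C^*(\Gamma_\sigma)$ is its completion in the groupoid $C^*$-norm (this groupoid is amenable, so the full and reduced norms agree), and $C^*(G) = C^*(\Gamma_\sigma)$. Actions. With $\phi_n = \sum_{j=0}^{n-1}\phi\circ\sigma^j$, the one-parameter automorphism group $\alpha^\phi$ is determined by $\alpha^\phi_t(f)(x,k,y) = \lim_{n\to\infty} e^{it(\phi_{k+n}(x)-\phi_n(y))} f(x,k,y)$ for $f \in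 C_c(\Gamma_\sigma)$. The gauge action is $\alpha^{\phi}$ with $\phi = 1$, and a weight is gauge-invariant when it is invariant under the gauge action. KMS weights. A weight on a $C^*$-algebra $A$ is a map $\psi : A_+ \to [0,\infty]$ that is additive and positively homogeneous; it is densely defined when $\{a \in A_+ : \psi(a)<\infty\}$ is dense in $A_+$, and lower semi-continuous when $\{a \in A_+ : \psi(a)\leq c\}$ is closed for all $c \geq 0$. Let $\mathcal N_\psi = \{a : \psi(a^*a)<\infty\}$; $\psi$ extends linearly to the span of $\mathcal N_\psi^*\mathcal N_\psi$. A non-zero densely defined lower semi-continuous weight $\psi$ is a $\beta$-KMS weight for a one-parameter group $\alpha$ when $\psi\circ\alpha_t=\psi$ for all $t$ and, for all $a,b \in \mathcal N_\psi\cap\mathcal N_\psi^*$, there is a continuous bounded function $F$ on the closed horizontal strip between $\mathbb R$ and $\mathbb R+i\beta$, holomorphic in its interior, with $F(t)=\psi(a\alpha_t(b))$ and $F(t+i\beta)=\psi(\alpha_t(b)a)$ for all $t\in\mathbb R$. *)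

theory Defs
  imports "HOL-Analysis.Analysis" "Graph_Theory.Arc_Walk"
begin

section \<open>Graphs and their infinite paths\<close>

text \<open>
  The source and range of an edge are its \<^const>\<open>tail\<close> and \<^const>\<open>head\<close>. Infinite paths are
  indexed from 0, so that the edge written $p_{i+1}$ in the literature is \<open>p i\<close>. Finite paths
  have at least one edge.
\<close>

definition inf_paths :: "('v, 'e) pre_digraph \<Rightarrow> (nat \<Rightarrow> 'e) set" where
  "inf_paths G = {p. \<forall>i. p i \<in> arcs G \<and> head G (p i) = tail G (p (Suc i))}"

definition fin_path :: "('v, 'e) pre_digraph \<Rightarrow> 'v \<Rightarrow> 'e list \<Rightarrow> 'v \<Rightarrow> bool" where
  "fin_path G u \<mu> v \<longleftrightarrow> \<mu> \<noteq> [] \<and> pre_digraph.awalk G u \<mu> v"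

definition cylinder :: "('v, 'e) pre_digraph \<Rightarrow> 'e list \<Rightarrow> (nat \<Rightarrow> 'e) set" where
  "cylinder G \<mu> = {p \<in> inf_paths G. \<forall>i < length \<mu>. p i = \<mu> ! i}"

definition path_topology :: "('v, 'e) pre_digraph \<Rightarrow> (nat \<Rightarrow> 'e) topology" where
  "path_topology G = topology_generated_by {cylinder G \<mu> | u \<mu> v. fin_path G u \<mu> v}"

definition shift :: "(nat \<Rightarrow> 'e) \<Rightarrow> (nat \<Rightarrow> 'e)" where
  "shift p = (\<lambda>i. p (Suc i))"

definition cofinal_graph :: "('v, 'e) pre_digraph \<Rightarrow> bool" where
  "cofinal_graph G \<longleftrightarrow>
     (\<forall>v \<in> verts G. finite (out_arcs G v)) \<and>
     (\<forall>v \<in> verts G. out_arcs G v \<noteq> {}) \<and>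
     (\<forall>v \<in> verts G. \<forall>p \<in> inf_paths G. \<exists>\<mu> i. fin_path G v \<mu> (tail G (p i)))"

definition NW :: "('v, 'e) pre_digraph \<Rightarrow> 'v set" where
  "NW G = {v \<in> verts G. \<exists>\<mu>. fin_path G v \<mu> v}"

definition NW_graph :: "('v, 'e) pre_digraph \<Rightarrow> ('v, 'e) pre_digraph" where
  "NW_graph G = G\<lparr>verts := NW G, arcs := {e \<in> arcs G. tail G e \<in> NW G}\<rparr>"

definition birkhoff_sum :: "((nat \<Rightarrow> 'e) \<Rightarrow> real) \<Rightarrow> nat \<Rightarrow> (nat \<Rightarrow> 'e) \<Rightarrow> real" where
  "birkhoff_sum \<phi> n x = (\<Sum>j<n. \<phi> ((shift ^^ j) x))"

text \<open>The variation may be infinite for small \<open>k\<close>.\<close>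

definition var :: "('v, 'e) pre_digraph \<Rightarrow> ((nat \<Rightarrow> 'e) \<Rightarrow> real) \<Rightarrow> nat \<Rightarrow> ennreal" where
  "var G \<phi> k = Sup {ennreal \<bar>\<phi> x - \<phi> y\<bar> | x y.
     x \<in> inf_paths G \<and> y \<in> inf_paths G \<and> (\<forall>i<k. x i = y i)}"

definition bowen_on_NW :: "('v, 'e) pre_digraph \<Rightarrow> ((nat \<Rightarrow> 'e) \<Rightarrow> real) \<Rightarrow> bool" where
  "bowen_on_NW G \<phi> \<longleftrightarrow>
     (\<exists>C>0. \<forall>n\<ge>1. \<forall>x \<in> inf_paths (NW_graph G). \<forall>y \<in> inf_paths (NW_graph G).
        (\<forall>i<n. x i = y i) \<longrightarrow> \<bar>\<Sum>i<n. \<phi> ((shift ^^ i) x) - \<phi> ((shift ^^ i) y)\<bar> \<le> C)"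


section \<open>Pressure\<close>

text \<open>
  Continuous functions of compact support, extended by 0 outside the space. All spaces below are
  Hausdorff, so vanishing off a compact set is the same as having compact support.
\<close>

definition Cc :: "'a topology \<Rightarrow> ('a \<Rightarrow> 'b::real_normed_vector) set" where
  "Cc X = {f. continuous_map X euclidean f \<and> (\<exists>K. compactin X K \<and> (\<forall>x. x \<notin> K \<longrightarrow> f x = 0))}"

definition transfer_op ::
    "('v, 'e) pre_digraph \<Rightarrow> ((nat \<Rightarrow> 'e) \<Rightarrow> real) \<Rightarrow> ((nat \<Rightarrow> 'e) \<Rightarrow> real) \<Rightarrow> (nat \<Rightarrow> 'e) \<Rightarrow> real" where
  "transfer_op G \<psi> f x = (\<Sum>\<^sub>\<infinity>y \<in> {y \<in> inf_paths G. shift y = x}. exp (\<psi> y) * f y)"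

definition elog :: "ereal \<Rightarrow> ereal" where
  "elog a = (if a \<le> 0 then -\<infinity> else if a = \<infinity> then \<infinity> else ereal (ln (real_of_ereal a)))"

definition pressure_at ::
    "('v, 'e) pre_digraph \<Rightarrow> ((nat \<Rightarrow> 'e) \<Rightarrow> real) \<Rightarrow> ((nat \<Rightarrow> 'e) \<Rightarrow> real) \<Rightarrow> (nat \<Rightarrow> 'e) \<Rightarrow> ereal" where
  "pressure_at G \<psi> f x = elog (limsup (\<lambda>n. ereal (root n (((transfer_op G \<psi> ^^ n) f) x))))"

text \<open>
  The value does not depend on the choice of the non-negative non-zero test function \<open>f\<close>.
\<close>

definition pressure :: "('v, 'e) pre_digraph \<Rightarrow> ((nat \<Rightarrow> 'e) \<Rightarrow> real) \<Rightarrow> ereal" where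
  "pressure G \<psi> =
     (let f = (SOME f. f \<in> Cc (path_topology G) \<and> (\<forall>x. 0 \<le> f x) \<and> (\<exists>x. f x \<noteq> 0))
      in SUP x \<in> inf_paths G. pressure_at G \<psi> f x)"


section \<open>The groupoid and its convolution\<close>

type_synonym 'e gpd = "(nat \<Rightarrow> 'e) \<times> int \<times> (nat \<Rightarrow> 'e)"

definition path_groupoid :: "('v, 'e) pre_digraph \<Rightarrow> 'e gpd set" where
  "path_groupoid G = {(x, k, y). x \<in> inf_paths G \<and> y \<in> inf_paths G \<and>
     (\<exists>n m. k = int n - int m \<and> (shift ^^ n) x = (shift ^^ m) y)}"

definition groupoid_topology :: "('v, 'e) pre_digraph \<Rightarrow> 'e gpd topology" where
  "groupoid_topology G = topology_generated_by
     {{(x, int n - int m, y) | x y. x \<in> U \<and> y \<in> V \<and> (shift ^^ n) x = (shift ^^ m) y} | U V n m.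
        openin (path_topology G) U \<and> openin (path_topology G) V \<and>
        inj_on (shift ^^ n) U \<and> inj_on (shift ^^ m) V}"

definition convolution ::
    "('v, 'e) pre_digraph \<Rightarrow> ('e gpd \<Rightarrow> complex) \<Rightarrow> ('e gpd \<Rightarrow> complex) \<Rightarrow> 'e gpd \<Rightarrow> complex" where
  "convolution G f g = (\<lambda>(x, k, y).
     \<Sum>\<^sub>\<infinity>(z, n, m) \<in> {(z, n, m). n + m = k \<and> (x, n, z) \<in> path_groupoid G \<and> (z, m, y) \<in> path_groupoid G}.
       f (x, n, z) * g (z, m, y))"


section \<open>The Hilbert space of square-summable families\<close>

typedef 'a ell2 = "{f :: 'a \<Rightarrow> complex. (\<lambda>i. (norm (f i))\<^sup>2) summable_on UNIV}"
  morphisms coord Abs_ell2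
  by (rule exI[of _ "\<lambda>_. 0"]) simp

lemma coord_summable: "(\<lambda>i. (norm (coord x i))\<^sup>2) summable_on UNIV"
  using coord[of x] by simp

lemma coord_inner_summable: "(\<lambda>i. coord x i \<bullet> coord y i) summable_on UNIV"
proof -
  have "(\<lambda>i. (norm (coord x i))\<^sup>2 + (norm (coord y i))\<^sup>2) summable_on UNIV"
    by (intro summable_on_add coord_summable)
  then have "(\<lambda>i. norm (coord x i \<bullet> coord y i)) summable_on UNIV"
  proof (rule summable_on_comparison_test)
    fix i
    have "norm (coord x i \<bullet> coord y i) \<le> norm (coord x i) * norm (coord y i)"
      using Cauchy_Schwarz_ineq2 by simp
    also have "\<dots> \<le> (norm (coord x i))\<^sup>2 + (norm (coord y i))\<^sup>2"
    proof -
      have "0 \<le> (norm (coord x i) - norm (coord y i))\<^sup>2" by simp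
      moreover have "0 \<le> norm (coord x i) * norm (coord y i)" by simp
      ultimately show ?thesis unfolding power2_diff by linarith
    qed
    finally show "norm (coord x i \<bullet> coord y i) \<le> (norm (coord x i))\<^sup>2 + (norm (coord y i))\<^sup>2" .
  qed auto
  then show ?thesis by (rule abs_summable_summable)
qed

lemma add_square_summable:
  fixes f g :: "'a \<Rightarrow> complex"
  assumes "(\<lambda>i. (norm (f i))\<^sup>2) summable_on UNIV" "(\<lambda>i. (norm (g i))\<^sup>2) summable_on UNIV"
  shows "(\<lambda>i. (norm (f i + g i))\<^sup>2) summable_on UNIV"
proof (rule summable_on_comparison_test)
  show "(\<lambda>i. 2 * (norm (f i))\<^sup>2 + 2 * (norm (g i))\<^sup>2) summable_on UNIV"
    by (intro summable_on_add summable_on_cmult_right assms)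
  fix i
  have "(norm (f i + g i))\<^sup>2 \<le> (norm (f i) + norm (g i))\<^sup>2"
    by (intro power_mono norm_triangle_ineq) auto
  moreover have "0 \<le> (norm (f i) - norm (g i))\<^sup>2" by simp
  ultimately show "(norm (f i + g i))\<^sup>2 \<le> 2 * (norm (f i))\<^sup>2 + 2 * (norm (g i))\<^sup>2"
    unfolding power2_diff power2_sum by linarith
qed auto

lemma scale_square_summable:
  fixes f :: "'a \<Rightarrow> complex"
  assumes "(\<lambda>i. (norm (f i))\<^sup>2) summable_on UNIV"
  shows "(\<lambda>i. (norm (c * f i))\<^sup>2) summable_on UNIV"
  using summable_on_cmult_right[OF assms, of "(norm c)\<^sup>2"]
  by (simp add: norm_mult power_mult_distrib)

instantiation ell2 :: (type) real_vector
begin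

definition "0 = Abs_ell2 (\<lambda>_. 0)"
definition "x + y = Abs_ell2 (\<lambda>i. coord x i + coord y i)"
definition "- x = Abs_ell2 (\<lambda>i. - coord x i)" for x :: "'a ell2"
definition "x - y = Abs_ell2 (\<lambda>i. coord x i - coord y i)"
definition scaleR_ell2 :: "real \<Rightarrow> 'a ell2 \<Rightarrow> 'a ell2" where
  "scaleR_ell2 r x = Abs_ell2 (\<lambda>i. r *\<^sub>R coord x i)"

lemma coord_zero [simp]: "coord (0 :: 'a ell2) i = 0"
  by (simp add: zero_ell2_def Abs_ell2_inverse)

lemma coord_add [simp]: "coord (x + y :: 'a ell2) i = coord x i + coord y i"
  by (simp add: plus_ell2_def Abs_ell2_inverse add_square_summable coord_summable)

lemma coord_minus [simp]: "coord (- x :: 'a ell2) i = - coord x i"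
  by (simp add: uminus_ell2_def Abs_ell2_inverse coord_summable)

lemma coord_diff [simp]: "coord (x - y :: 'a ell2) i = coord x i - coord y i"
  using add_square_summable[OF coord_summable[of x] coord_summable[of "- y"]]
  by (simp add: minus_ell2_def Abs_ell2_inverse)

lemma coord_scaleR [simp]: "coord (r *\<^sub>R x :: 'a ell2) i = r *\<^sub>R coord x i"
  using scale_square_summable[OF coord_summable[of x], of "of_real r"]
  by (simp add: scaleR_ell2_def Abs_ell2_inverse norm_mult)

lemma ell2_eqI: "(\<And>i. coord x i = coord y i) \<Longrightarrow> x = (y :: 'a ell2)"
  by (rule coord_inject[THEN iffD1]) (rule ext)

instance
  by standard (auto intro!: ell2_eqI simp: algebra_simps)

end

instantiation ell2 :: (type) real_inner
begin

text \<open>The real part of the usual complex inner product.\<close>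
definition "x \<bullet> y = (\<Sum>\<^sub>\<infinity>i. coord x i \<bullet> coord y i)" for x y :: "'a ell2"
definition "norm x = sqrt (x \<bullet> x)" for x :: "'a ell2"
definition "sgn x = x /\<^sub>R norm x" for x :: "'a ell2"
definition "dist x y = norm (x - y)" for x y :: "'a ell2"
definition "(uniformity :: ('a ell2 \<times> 'a ell2) filter) = (INF e\<in>{0<..}. principal {(x, y). dist x y < e})"
definition "open U \<longleftrightarrow> (\<forall>x\<in>U. eventually (\<lambda>(x', y). x' = x \<longrightarrow> y \<in> U) uniformity)" for U :: "'a ell2 set"

instance
proof
  fix x y z :: "'a ell2" and r :: real
  show "x \<bullet> y = y \<bullet> x"
    by (simp add: inner_ell2_def inner_commute)
  show "(x + y) \<bullet> z = x \<bullet> z + y \<bullet> z"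
    unfolding inner_ell2_def by (simp add: inner_add_left infsum_add coord_inner_summable)
  show "(r *\<^sub>R x) \<bullet> y = r * (x \<bullet> y)"
    unfolding inner_ell2_def by (simp add: infsum_cmult_right')
  show "0 \<le> x \<bullet> x"
    unfolding inner_ell2_def by (intro infsum_nonneg) simp
  show "(x \<bullet> x = 0) = (x = 0)"
  proof
    assume "x \<bullet> x = 0"
    then have "coord x i \<bullet> coord x i = 0" for i
      unfolding inner_ell2_def
      by (intro nonneg_infsum_le_0D[of _ UNIV]) (auto simp: coord_inner_summable)
    then show "x = 0" by (auto intro!: ell2_eqI)
  qed (simp add: inner_ell2_def)
qed (rule norm_ell2_def sgn_ell2_def dist_ell2_def uniformity_ell2_def open_ell2_def)+

end

definition mult_i :: "'a ell2 \<Rightarrow>\<^sub>L 'a ell2" where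
  "mult_i = Blinfun (\<lambda>x. Abs_ell2 (\<lambda>j. \<i> * coord x j))"

lemma coord_mult_i [simp]: "coord (mult_i x) j = \<i> * coord x j"
proof -
  have c: "coord (Abs_ell2 (\<lambda>j. \<i> * coord y j)) k = \<i> * coord y k" for y :: "'a ell2" and k
    using scale_square_summable[OF coord_summable[of y], of \<i>] by (simp add: Abs_ell2_inverse)
  have "bounded_linear (\<lambda>x :: 'a ell2. Abs_ell2 (\<lambda>j. \<i> * coord x j))"
  proof (rule bounded_linear_intro[where K = 1], goal_cases)
    case (1 x y)
    show ?case by (rule ell2_eqI) (unfold c, simp add: c algebra_simps)
  next
    case (2 r x)
    show ?case by (rule ell2_eqI) (unfold c, simp add: c)
  next
    case (3 x)
    show ?case unfolding norm_ell2_def inner_ell2_def c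
      by (simp add: power2_norm_eq_inner[symmetric] norm_mult)
  qed
  from bounded_linear_Blinfun_apply[OF this] c show ?thesis
    by (simp add: mult_i_def)
qed

text \<open>
  Bounded operators are, for the library, real-linear operators. This is multiplication of such an
  operator by a complex number; the complex-linear operators are the ones commuting with
  \<^const>\<open>mult_i\<close>, and all operators in the $C^*$-algebra defined below are of this kind.
\<close>

definition cscale :: "complex \<Rightarrow> ('a ell2 \<Rightarrow>\<^sub>L 'a ell2) \<Rightarrow> ('a ell2 \<Rightarrow>\<^sub>L 'a ell2)" where
  "cscale c T = Re c *\<^sub>R T + Im c *\<^sub>R (mult_i o\<^sub>L T)"

lemma coord_cscale [simp]: "coord (cscale c T x) j = c * coord (T x) j"
  by (simp add: cscale_def blinfun.add_left blinfun.scaleR_left scaleR_conv_of_real)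
     (simp add: complex_eq_iff algebra_simps)

interpretation cop: vector_space "cscale :: complex \<Rightarrow> ('a ell2 \<Rightarrow>\<^sub>L 'a ell2) \<Rightarrow> _"
  by unfold_locales
     (auto intro!: blinfun_eqI ell2_eqI simp: blinfun.add_left algebra_simps)

text \<open>
  The Hilbert space adjoint: the library's \<^const>\<open>adjoint\<close> is taken with respect to the real part
  of the inner product, which for complex-linear operators gives the usual adjoint.
\<close>

definition hadj :: "('a ell2 \<Rightarrow>\<^sub>L 'a ell2) \<Rightarrow> ('a ell2 \<Rightarrow>\<^sub>L 'a ell2)" where
  "hadj T = Blinfun (adjoint (blinfun_apply T))"


section \<open>The graph $C^*$-algebra and the one-parameter groups\<close>

text \<open>
  The representation of $C_c(\Gamma)$ on $\ell^2(\Gamma)$ by left convolution. It is the direct sum,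
  over the units $x$, of the regular representations on $\ell^2(\{\gamma : s(\gamma) = x\})$, so
  that its operator norm is the reduced groupoid norm (for this amenable groupoid, also the full
  one), and the norm closure of its image is the completion of $C_c(\Gamma)$. The vectors
  supported outside $\Gamma$ are sent to 0. For \<open>f\<close> in $C_c(\Gamma)$ the sums in the convolution
  are finite and the operator is bounded, since the support of \<open>f\<close> is covered by finitely many
  of the basic open sets, each meeting every range fibre and every source fibre at most once.
\<close>

definition lreg ::
    "('v, 'e) pre_digraph \<Rightarrow> ('e gpd \<Rightarrow> complex) \<Rightarrow> ('e gpd ell2 \<Rightarrow>\<^sub>L 'e gpd ell2)" where
  "lreg G f = Blinfun (\<lambda>\<xi>. Abs_ell2 (convolution G f (coord \<xi>)))"

definition graph_algebra :: "('v, 'e) pre_digraph \<Rightarrow> ('e gpd ell2 \<Rightarrow>\<^sub>L 'e gpd ell2) set" where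
  "graph_algebra G = closure (lreg G ` Cc (groupoid_topology G))"

definition pos_cone :: "('a ell2 \<Rightarrow>\<^sub>L 'a ell2) set \<Rightarrow> ('a ell2 \<Rightarrow>\<^sub>L 'a ell2) set" where
  "pos_cone A = {hadj a o\<^sub>L a | a. a \<in> A}"

text \<open>
  For each point $(x,k,y)$ of the groupoid the sequence below is eventually constant; the
  truncation by \<^const>\<open>nat\<close> only affects the finitely many \<open>n\<close> with \<open>k + n < 0\<close>.
\<close>

definition act_Cc ::
    "((nat \<Rightarrow> 'e) \<Rightarrow> real) \<Rightarrow> real \<Rightarrow> ('e gpd \<Rightarrow> complex) \<Rightarrow> 'e gpd \<Rightarrow> complex" where
  "act_Cc \<phi> t f = (\<lambda>(x, k, y).
     lim (\<lambda>n. exp (\<i> * of_real (t * (birkhoff_sum \<phi> (nat (k + int n)) x - birkhoff_sum \<phi> n y)))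
              * f (x, k, y)))"

text \<open>The extension by continuity from $C_c(\Gamma)$ to its completion.\<close>

definition act ::
    "('v, 'e) pre_digraph \<Rightarrow> ((nat \<Rightarrow> 'e) \<Rightarrow> real) \<Rightarrow> real
      \<Rightarrow> ('e gpd ell2 \<Rightarrow>\<^sub>L 'e gpd ell2) \<Rightarrow> ('e gpd ell2 \<Rightarrow>\<^sub>L 'e gpd ell2)" where
  "act G \<phi> t a = (THE b. \<forall>f. (\<forall>j. f j \<in> Cc (groupoid_topology G)) \<and> (\<lambda>j. lreg G (f j)) \<longlonglongrightarrow> a
     \<longrightarrow> (\<lambda>j. lreg G (act_Cc \<phi> t (f j))) \<longlonglongrightarrow> b)"


section \<open>KMS weights\<close>

text \<open>
  Only the values of a weight on the positive cone of \<open>A\<close> are meaningful.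
\<close>

definition weight_on ::
    "('a ell2 \<Rightarrow>\<^sub>L 'a ell2) set \<Rightarrow> (('a ell2 \<Rightarrow>\<^sub>L 'a ell2) \<Rightarrow> ennreal) \<Rightarrow> bool" where
  "weight_on A \<psi> \<longleftrightarrow>
     (\<forall>a \<in> pos_cone A. \<forall>b \<in> pos_cone A. \<psi> (a + b) = \<psi> a + \<psi> b) \<and>
     (\<forall>a \<in> pos_cone A. \<forall>r\<ge>0. \<psi> (r *\<^sub>R a) = ennreal r * \<psi> a)"

definition densely_defined_on ::
    "('a ell2 \<Rightarrow>\<^sub>L 'a ell2) set \<Rightarrow> (('a ell2 \<Rightarrow>\<^sub>L 'a ell2) \<Rightarrow> ennreal) \<Rightarrow> bool" where
  "densely_defined_on A \<psi> \<longleftrightarrow> pos_cone A \<subseteq> closure {a \<in> pos_cone A. \<psi> a < \<infinity>}"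

definition lsc_on ::
    "('a ell2 \<Rightarrow>\<^sub>L 'a ell2) set \<Rightarrow> (('a ell2 \<Rightarrow>\<^sub>L 'a ell2) \<Rightarrow> ennreal) \<Rightarrow> bool" where
  "lsc_on A \<psi> \<longleftrightarrow>
     (\<forall>c::real. 0 \<le> c \<longrightarrow> closedin (top_of_set (pos_cone A)) {a \<in> pos_cone A. \<psi> a \<le> ennreal c})"

definition weight_N ::
    "('a ell2 \<Rightarrow>\<^sub>L 'a ell2) set \<Rightarrow> (('a ell2 \<Rightarrow>\<^sub>L 'a ell2) \<Rightarrow> ennreal) \<Rightarrow> ('a ell2 \<Rightarrow>\<^sub>L 'a ell2) set" where
  "weight_N A \<psi> = {a \<in> A. \<psi> (hadj a o\<^sub>L a) < \<infinity>}"

text \<open>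
  A complex-linear functional extending the finite values of the weight. Its restriction to the
  span of $\mathcal N_\psi^* \mathcal N_\psi$, which is also the span of the positive elements of
  finite weight, is unique; it is only ever evaluated there.
\<close>

definition weight_ext ::
    "('a ell2 \<Rightarrow>\<^sub>L 'a ell2) set \<Rightarrow> (('a ell2 \<Rightarrow>\<^sub>L 'a ell2) \<Rightarrow> ennreal) \<Rightarrow> ('a ell2 \<Rightarrow>\<^sub>L 'a ell2) \<Rightarrow> complex" where
  "weight_ext A \<psi> = (SOME L. Vector_Spaces.linear cscale (*) L \<and>
     (\<forall>a \<in> pos_cone A. \<psi> a < \<infinity> \<longrightarrow> L a = of_real (enn2real (\<psi> a))))"

definition invariant_weight ::
    "('a ell2 \<Rightarrow>\<^sub>L 'a ell2) set \<Rightarrow> (real \<Rightarrow> ('a ell2 \<Rightarrow>\<^sub>L 'a ell2) \<Rightarrow> ('a ell2 \<Rightarrow>\<^sub>L 'a ell2))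
      \<Rightarrow> (('a ell2 \<Rightarrow>\<^sub>L 'a ell2) \<Rightarrow> ennreal) \<Rightarrow> bool" where
  "invariant_weight A \<alpha> \<psi> \<longleftrightarrow> (\<forall>t. \<forall>a \<in> pos_cone A. \<psi> (\<alpha> t a) = \<psi> a)"

text \<open>Here \<open>\<beta>\<close> may be negative or 0; in the latter case the strip degenerates to the real line.\<close>

definition strip :: "real \<Rightarrow> complex set" where
  "strip \<beta> = {z. min 0 \<beta> \<le> Im z \<and> Im z \<le> max 0 \<beta>}"

definition KMS_weight ::
    "('a ell2 \<Rightarrow>\<^sub>L 'a ell2) set \<Rightarrow> (real \<Rightarrow> ('a ell2 \<Rightarrow>\<^sub>L 'a ell2) \<Rightarrow> ('a ell2 \<Rightarrow>\<^sub>L 'a ell2))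
      \<Rightarrow> real \<Rightarrow> (('a ell2 \<Rightarrow>\<^sub>L 'a ell2) \<Rightarrow> ennreal) \<Rightarrow> bool" where
  "KMS_weight A \<alpha> \<beta> \<psi> \<longleftrightarrow>
     weight_on A \<psi> \<and> (\<exists>a \<in> pos_cone A. \<psi> a \<noteq> 0) \<and> densely_defined_on A \<psi> \<and> lsc_on A \<psi> \<and>
     invariant_weight A \<alpha> \<psi> \<and>
     (\<forall>a b. a \<in> weight_N A \<psi> \<and> hadj a \<in> weight_N A \<psi> \<and> b \<in> weight_N A \<psi> \<and> hadj b \<in> weight_N A \<psi> \<longrightarrow>
        (\<exists>F. continuous_on (strip \<beta>) F \<and> bounded (F ` strip \<beta>) \<and> F holomorphic_on interior (strip \<beta>) \<and>
             (\<forall>t::real. F (of_real t) = weight_ext A \<psi> (a o\<^sub>L \<alpha> t b) \<and>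
                        F (of_real t + \<i> * of_real \<beta>) = weight_ext A \<psi> (\<alpha> t b o\<^sub>L a))))"

definition gauge_invariant :: "('v, 'e) pre_digraph \<Rightarrow> (('e gpd ell2 \<Rightarrow>\<^sub>L 'e gpd ell2) \<Rightarrow> ennreal) \<Rightarrow> bool" where
  "gauge_invariant G \<psi> \<longleftrightarrow> invariant_weight (graph_algebra G) (act G (\<lambda>_. 1)) \<psi>"

definition gauge_inv_KMS_weight ::
    "('v, 'e) pre_digraph \<Rightarrow> ((nat \<Rightarrow> 'e) \<Rightarrow> real) \<Rightarrow> real
      \<Rightarrow> (('e gpd ell2 \<Rightarrow>\<^sub>L 'e gpd ell2) \<Rightarrow> ennreal) \<Rightarrow> bool" where
  "gauge_inv_KMS_weight G \<phi> \<beta> \<psi> \<longleftrightarrow>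
     KMS_weight (graph_algebra G) (act G \<phi>) \<beta> \<psi> \<and> gauge_invariant G \<psi>"

end

theory Submission
  imports Defs "HOL-Complex_Analysis.Complex_Analysis"
begin

text \<open>
  A gauge-invariant \<open>\<beta>\<close>-KMS weight \<open>\<psi>\<close> is determined by its values \<open>m(\<mu>) = \<psi>(1\<^bsub>Z(\<mu>)\<^esub>)\<close> on cylinders. These
  are finite: averaging along the flow and shifting the contour in the KMS condition bounds them by values
  on a dense hereditary part. Comparing analytic continuations shows that \<open>m\<close> is conformal, i.e. that
  \<open>m(e \<mu>) = \<integral> exp (- \<beta> \<phi>(e x)) dm(x)\<close> over \<open>Z(\<mu>)\<close>, and by gauge invariance all off-diagonal values vanish.
  Conversely a conformal \<open>m\<close> yields a weight as a limit of Riemann sums of diagonal vector states; the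
  KMS condition is checked on matrix units and extended by the maximum principle on the strip.
  Conformal functions are obtained as limits of normalised resolvents of the transfer operator at points
  that leave every finite set of edges, or that approach the critical exponent of a finite \<open>NW\<close>. Their
  existence forces the pressure to be at most 0; if \<open>NW\<close> is finite it is exactly 0, and then
  Bowen's condition makes any two of them comparable, hence proportional.
\<close>

text \<open>Measures never appear. A conformal measure is replaced by its values on cylinders of
  non-empty words, with conformality stated as two-sided bounds; the exact relation is recovered by
  refining cylinders, because the variation of the potential tends to 0. Compactness of cylinders
  enters as an induction over words (\<open>bar_induct\<close>). The obstacle on the operator side
  is that a weight is only densely defined: nothing says a priori that a cylinder projection p has
  finite weight. There are elements u, x of finite weight near p, and x bounds the weight of the
  product u p x in one order of multiplication, uniformly in u. The KMS condition has to carry this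
  bound to the other order. In the sums over n with coefficients lambda^n, shifting the index passes
  from a word to the word with one edge prepended, except for the term n = 0. After division by the
  value at a fixed cylinder this defect vanishes, either because the points leave every cylinder or
  because the divisor tends to infinity; each hypothesis on \<open>NW\<close> provides one of the
  two.\<close>

notation blinfun_compose (infixl "oL" 55)
notation LIMSEQ ("(_) ----> (_)" [60, 60] 60)

section \<open>Operators on square-summable families\<close>

lemma norm_ell2_sq: "(norm x)\<^sup>2 = (\<Sum>\<^sub>\<infinity>i. (norm (coord x i))\<^sup>2)" for x :: "'a ell2"
  by (auto simp: power2_norm_eq_inner inner_ell2_def)

lemma sum_coord_le: "finite F ==> (SUM i:F. (norm (coord x i))\<^sup>2) <= (norm x)\<^sup>2" for x :: "'a ell2"
  unfolding norm_ell2_sq by (rule finite_sum_le_infsum) (auto simp: coord_summable)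

lemma norm_coord_le: "norm (coord x i) <= norm x" for x :: "'a ell2"
  using sum_coord_le[of "{i}" x] by (simp add: abs_le_square_iff)

text \<open>Bounds on finite partial sums give membership and norm bound together; vectors defined
  by explicit coordinates pass through this criterion.\<close>

lemma ell2I:
  assumes "!!F. finite F ==> (SUM i:F. (norm (f i))\<^sup>2) <= B\<^sup>2" "B >= 0"
  shows "!!i. coord (Abs_ell2 f) i = f i" "norm (Abs_ell2 f) <= B"
proof -
  have s: "(%i. (norm (f i))\<^sup>2) summable_on UNIV"
    by (rule nonneg_bdd_above_summable_on) (auto intro!: assms(1))
  show c: "coord (Abs_ell2 f) i = f i" for i using s by (simp add: Abs_ell2_inverse)
  have "(norm (Abs_ell2 f))\<^sup>2 <= B\<^sup>2"
    unfolding norm_ell2_sq c by (rule infsum_le_finite_sums[OF s]) (use assms in auto)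
  then show "norm (Abs_ell2 f) <= B" using assms(2) by (simp add: power2_le_iff_abs_le)
qed

text \<open>Completeness is inherited by the space of bounded operators, where it supplies the
  limits for square roots and adjoints.\<close>

instance ell2 :: (type) banach
proof
  fix X :: "nat => 'a ell2" assume C: "Cauchy X"
  have "Cauchy (%n. coord (X n) i)" for i
  proof (rule metric_CauchyI)
    fix e :: real assume "e > 0"
    with C obtain M where M: "ALL m>=M. ALL n>=M. dist (X m) (X n) < e" by (auto simp: Cauchy_def)
    have "dist (coord (X m) i) (coord (X n) i) <= dist (X m) (X n)" for m n
      using norm_coord_le[of "X m - X n" i] by (simp add: dist_norm)
    with M show "EX M. ALL m>=M. ALL n>=M. dist (coord (X m) i) (coord (X n) i) < e"
      by (metis le_less_trans)
  qed
  then have "EX l. (%n. coord (X n) i) ----> l" for i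
    using Cauchy_convergent_iff convergent_def by blast
  then obtain f where f: "!!i. (%n. coord (X n) i) ----> f i" by metis
  \<comment> \<open>A Fatou argument: the Cauchy estimate passes to the coordinatewise limit inside
    a finite sum, where \<open>m\<close> may go to infinity.\<close>
  have *: "(SUM i:F. (norm (f i - coord (X n) i))\<^sup>2) <= e\<^sup>2"
    if M: "ALL m>=M. ALL n>=M. dist (X m) (X n) < e" and n: "n >= M" and F: "finite F" for e M n F
  proof (rule LIMSEQ_le_const2)
    show "(%m. SUM i:F. (norm (coord (X m) i - coord (X n) i))\<^sup>2) ----> (SUM i:F. (norm (f i - coord (X n) i))\<^sup>2)"
      by (intro tendsto_intros f)
    have "(SUM i:F. (norm (coord (X m) i - coord (X n) i))\<^sup>2) <= e\<^sup>2" if "m >= M" for m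
    proof -
      have "(SUM i:F. (norm (coord (X m) i - coord (X n) i))\<^sup>2) <= (norm (X m - X n))\<^sup>2"
        using sum_coord_le[OF F, of "X m - X n"] by simp
      also have "... <= e\<^sup>2" using M n that by (intro power_mono) (auto simp: dist_norm less_imp_le)
      finally show ?thesis .
    qed
    then show "EX N. ALL m>=N. (SUM i:F. (norm (coord (X m) i - coord (X n) i))\<^sup>2) <= e\<^sup>2" by blast
  qed
  have key: "EX M. ALL n>=M. EX y. norm y <= e & (ALL i. coord y i = f i - coord (X n) i)" if "e > 0" for e
  proof -
    from C that obtain M where M: "ALL m>=M. ALL n>=M. dist (X m) (X n) < e" by (auto simp: Cauchy_def)
    have "EX y. norm y <= e & (ALL i. coord y i = f i - coord (X n) i)" if "n >= M" for n
      using ell2I[of "%i. f i - coord (X n) i" e, OF *[OF M that]] \<open>e > 0\<close> by (meson less_imp_le)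
    then show ?thesis by blast
  qed
  from key[of 1] obtain M y where y: "!!i. coord y i = f i - coord (X M) i" by fastforce
  define L where "L = y + X M"
  have L: "coord L i = f i" for i by (simp add: L_def y)
  have "X ----> L"
  proof (rule metric_LIMSEQ_I)
    fix e :: real assume "e > 0"
    from key[of "e/2"] this obtain N where N: "ALL n>=N. EX y. norm y <= e/2 & (ALL i. coord y i = f i - coord (X n) i)"
      by auto
    have "dist (X n) L < e" if n: "n >= N" for n
    proof -
      obtain y where y: "norm y <= e/2" "ALL i. coord y i = f i - coord (X n) i" using N n by blast
      have "y = L - X n" by (rule ell2_eqI) (simp add: y L)
      then show ?thesis using y(1) \<open>e > 0\<close> by (simp add: dist_norm norm_minus_commute)
    qed
    then show "EX N. ALL n>=N. dist (X n) L < e" by blast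
  qed
  then show "convergent X" by (auto simp: convergent_def)
qed

definition cinn :: "'a ell2 => 'a ell2 => complex" where
  "cinn x y = Complex (x \<bullet> y) (mult_i x \<bullet> y)"

definition basis_vec :: "'a => 'a ell2" where
  "basis_vec i = Abs_ell2 (%j. if j = i then 1 else 0)"

lemma coord_basis_vec [simp]: "coord (basis_vec i) j = (if j = i then 1 else 0)"
proof -
  have "(SUM j:F. (norm (if j = i then 1 else 0 :: complex))\<^sup>2) <= 1\<^sup>2" if "finite F" for F
    using that by (simp add: if_distrib[of "%x. (norm x)\<^sup>2"] cong: if_cong)
  from ell2I(1)[OF this] show ?thesis by (simp add: basis_vec_def)
qed

lemma norm_basis_vec [simp]: "norm (basis_vec i) = 1"
proof -
  have "(norm (basis_vec i :: 'a ell2))\<^sup>2 = (\<Sum>\<^sub>\<infinity>j\<in>{i}. 1)"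
    unfolding norm_ell2_sq by (rule infsum_cong_neutral) auto
  then show ?thesis by (simp add: power2_eq_1_iff) (metis norm_ge_zero abs_of_nonneg abs_1 power2_eq_1_iff zero_le_one neg_0_le_iff_le norm_not_less_zero less_numeral_extra(1) neg_less_0_iff_less)
qed

subsection \<open>Weighted composition operators\<close>

text \<open>Matrix units, the unitaries implementing the actions and the cutting projections all
  have this form, so boundedness, linearity and adjoints are settled once for all of them.\<close>

definition wco :: "('a => complex) => ('a => 'a) => 'a ell2 \<Rightarrow>\<^sub>L 'a ell2" where
  "wco g \<eta> = Blinfun (%xi. Abs_ell2 (%\<gamma>. g \<gamma> * coord xi (\<eta> \<gamma>)))"

text \<open>Injectivity is asked only where \<open>g\<close> does not vanish: a partial isometry has
  a domain, and off it the value of \<eta> is a default.\<close>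

locale wco_data =
  fixes g :: "'a => complex" and \<eta> :: "'a => 'a" and B :: real
  assumes inj: "inj_on \<eta> {\<gamma>. g \<gamma> ~= 0}" and bd: "norm (g \<gamma>) <= B"
begin

lemma B_nonneg: "0 <= B" using bd norm_ge_zero order_trans by blast

lemma aux:
  fixes xi :: "'a ell2"
  shows "!!\<gamma>. coord (Abs_ell2 (%\<gamma>. g \<gamma> * coord xi (\<eta> \<gamma>))) \<gamma> = g \<gamma> * coord xi (\<eta> \<gamma>)"
    "norm (Abs_ell2 (%\<gamma>. g \<gamma> * coord xi (\<eta> \<gamma>))) <= B * norm xi"
proof -
  have *: "(SUM \<gamma>:F. (norm (g \<gamma> * coord xi (\<eta> \<gamma>)))\<^sup>2) <= (B * norm xi)\<^sup>2" if F: "finite F" for F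
  proof -
    let ?F = "F \<inter> {\<gamma>. g \<gamma> ~= 0}"
    have "(SUM \<gamma>:F. (norm (g \<gamma> * coord xi (\<eta> \<gamma>)))\<^sup>2) = (SUM \<gamma>:?F. (norm (g \<gamma> * coord xi (\<eta> \<gamma>)))\<^sup>2)"
      using F by (intro sum.mono_neutral_right) auto
    also have "... <= (SUM \<gamma>:?F. B\<^sup>2 * (norm (coord xi (\<eta> \<gamma>)))\<^sup>2)"
      by (intro sum_mono) (auto simp: norm_mult power_mult_distrib intro!: mult_right_mono power_mono bd)
    also have "... = B\<^sup>2 * (SUM i:\<eta> ` ?F. (norm (coord xi i))\<^sup>2)"
      using inj_on_subset[OF inj, of ?F] by (subst sum.reindex) (auto simp: sum_distrib_left)
    also have "... <= B\<^sup>2 * (norm xi)\<^sup>2"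
      using F by (intro mult_left_mono sum_coord_le) auto
    finally show ?thesis by (simp add: power_mult_distrib)
  qed
  have nn: "0 <= B * norm xi" using B_nonneg by simp
  show "coord (Abs_ell2 (%\<gamma>. g \<gamma> * coord xi (\<eta> \<gamma>))) \<gamma> = g \<gamma> * coord xi (\<eta> \<gamma>)" for \<gamma>
    by (rule ell2I(1)[OF * nn])
  show "norm (Abs_ell2 (%\<gamma>. g \<gamma> * coord xi (\<eta> \<gamma>))) <= B * norm xi"
    by (rule ell2I(2)[OF * nn])
qed

lemma bounded_linear_wco: "bounded_linear (%xi. Abs_ell2 (%\<gamma>. g \<gamma> * coord xi (\<eta> \<gamma>)))"
proof (rule bounded_linear_intro[where K = B], goal_cases)
  case (1 x y)
  show ?case by (rule ell2_eqI) (unfold aux, unfold coord_add aux, simp add: algebra_simps)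
next
  case (2 r x)
  show ?case by (rule ell2_eqI) (unfold aux, unfold coord_scaleR aux, simp)
next
  case (3 x)
  show ?case using aux(2) by (simp add: mult.commute)
qed

lemma coord_wco: "coord (wco g \<eta> xi) \<gamma> = g \<gamma> * coord xi (\<eta> \<gamma>)"
  by (simp add: wco_def bounded_linear_Blinfun_apply[OF bounded_linear_wco] aux)

lemma norm_wco: "norm (wco g \<eta>) <= B"
  by (rule norm_blinfun_bound[OF B_nonneg])
    (simp add: wco_def bounded_linear_Blinfun_apply[OF bounded_linear_wco] aux(2))

end

subsection \<open>Adjoints\<close>

text \<open>A relation rather than a value of \<open>hadj\<close>: an adjoint that has been
  exhibited is \<open>hadj\<close> by uniqueness, and no existence theorem is involved.\<close>

definition is_hadj :: "('a ell2 \<Rightarrow>\<^sub>L 'a ell2) => ('a ell2 \<Rightarrow>\<^sub>L 'a ell2) => bool" where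
  "is_hadj S T \<longleftrightarrow> (ALL x y. S x \<bullet> y = x \<bullet> T y)"

lemma is_hadj_hadj: "is_hadj S T ==> hadj S = T"
  unfolding is_hadj_def hadj_def by (subst adjoint_unique) (auto simp: blinfun_apply_inverse)

lemma is_hadj_sym: "is_hadj S T ==> is_hadj T S"
  unfolding is_hadj_def by (metis inner_commute)

lemma is_hadj_norm: assumes "is_hadj S T" shows "norm T = norm S"
proof -
  have *: "norm T <= norm S" if "is_hadj S T" for S T :: "'a ell2 \<Rightarrow>\<^sub>L 'a ell2"
  proof (rule norm_blinfun_bound)
    fix x
    have "norm (T x) * norm (T x) = T x \<bullet> T x" by (simp add: power2_norm_eq_inner[symmetric] power2_eq_square)
    also have "... = S (T x) \<bullet> x" using that by (simp add: is_hadj_def)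
    also have "... <= norm (S (T x)) * norm x" by (rule norm_cauchy_schwarz)
    also have "... <= (norm S * norm (T x)) * norm x" by (intro mult_right_mono norm_blinfun) auto
    finally have "norm (T x) * norm (T x) <= norm (T x) * (norm S * norm x)" by (simp add: mult_ac)
    then show "norm (T x) <= norm S * norm x" by (cases "T x = 0") auto
  qed simp
  show ?thesis using *[OF assms] *[OF is_hadj_sym[OF assms]] by simp
qed

lemma is_hadj_add: "is_hadj S T ==> is_hadj S' T' ==> is_hadj (S + S') (T + T')"
  by (simp add: is_hadj_def blinfun.add_left inner_add_left inner_add_right)

lemma is_hadj_diff: "is_hadj S T ==> is_hadj S' T' ==> is_hadj (S - S') (T - T')"
  by (simp add: is_hadj_def blinfun.diff_left inner_diff_left inner_diff_right)

lemma is_hadj_scaleR: "is_hadj S T ==> is_hadj (r *\<^sub>R S) (r *\<^sub>R T)"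
  by (simp add: is_hadj_def blinfun.scaleR_left)

lemma is_hadj_compose: "is_hadj S T ==> is_hadj S' T' ==> is_hadj (S oL S') (T' oL T)"
  by (simp add: is_hadj_def)

lemma is_hadj_0: "is_hadj 0 0" and is_hadj_id: "is_hadj id_blinfun id_blinfun"
  by (simp_all add: is_hadj_def)

lemma is_hadj_lim:
  assumes "!!n. is_hadj (S n) (T n)" "S ----> s" "T ----> t" shows "is_hadj s t"
  unfolding is_hadj_def
proof (intro allI)
  fix x y
  have "(%n. S n x \<bullet> y) ----> s x \<bullet> y"
    by (intro tendsto_inner tendsto_const blinfun.tendsto assms)
  moreover have "(%n. x \<bullet> T n y) ----> x \<bullet> t y"
    by (intro tendsto_inner tendsto_const blinfun.tendsto assms)
  ultimately show "s x \<bullet> y = x \<bullet> t y"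
    using assms(1) LIMSEQ_unique by (simp add: is_hadj_def)
qed

lemma mult_i_inner: "mult_i x \<bullet> y = - (x \<bullet> mult_i y)"
  unfolding inner_ell2_def by (simp add: inner_complex_def flip: infsum_uminus)

text \<open>Commuting with \<^const>\<open>mult_i\<close> is complex linearity.\<close>

definition clin :: "('a ell2 \<Rightarrow>\<^sub>L 'a ell2) => bool" where
  "clin T \<longleftrightarrow> (ALL x. T (mult_i x) = mult_i (T x))"

lemma clinI: "(!!x. blinfun_apply T (mult_i x) = mult_i (T x)) ==> clin T" by (simp add: clin_def)

lemma is_hadj_cscale:
  assumes "is_hadj S T" "clin S" shows "is_hadj (cscale c S) (cscale (cnj c) T)"
  unfolding is_hadj_def
proof (intro allI)
  fix x y
  have "mult_i (S x) \<bullet> y = - (x \<bullet> mult_i (T y))" by (metis assms(2) assms(1) clin_def is_hadj_def mult_i_inner)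
  moreover have "S x \<bullet> y = x \<bullet> T y" using assms(1) by (simp add: is_hadj_def)
  ultimately show "cscale c S x \<bullet> y = x \<bullet> cscale (cnj c) T y"
    unfolding cscale_def
    by (simp add: blinfun.add_left blinfun.scaleR_left inner_add_left
        blinfun.diff_left inner_diff_right)
qed

section \<open>Closed star-algebras of operators and their weights\<close>

text \<open>Operators of type \<open>blinfun\<close> are merely real-linear, and \<open>hadj\<close>
  is given by a description. On this set \<open>hadj\<close> is a genuine conjugate-linear
  involution, so it serves as the ambient algebra.\<close>

definition Adj :: "('a ell2 \<Rightarrow>\<^sub>L 'a ell2) set" where
  "Adj = {a. is_hadj a (hadj a) & clin a}"

lemma AdjI: "is_hadj a b ==> clin a ==> a : Adj"
  using is_hadj_hadj by (auto simp: Adj_def)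

lemma is_hadj_clin: assumes "is_hadj a b" "clin a" shows "clin b"
proof (rule clinI)
  fix x
  have "(b (mult_i x) - mult_i (b x)) \<bullet> y = 0" for y
    using is_hadj_sym[OF assms(1)] assms(2) by (auto simp: is_hadj_def mult_i_inner clin_def inner_diff_left)
  from this[of "b (mult_i x) - mult_i (b x)"] show "b (mult_i x) = mult_i (b x)" by simp
qed

lemma clin_add: "clin a ==> clin b ==> clin (a + b)"
  by (simp add: clin_def blinfun.add_left blinfun.add_right)
lemma clin_diff: "clin a ==> clin b ==> clin (a - b)"
  by (simp add: clin_def blinfun.diff_left blinfun.diff_right)
lemma clin_scaleR: "clin a ==> clin (r *\<^sub>R a)"
  by (simp add: clin_def blinfun.scaleR_left blinfun.scaleR_right)
lemma clin_compose: "clin a ==> clin b ==> clin (a oL b)"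
  by (simp add: clin_def)
lemma clin_cscale: "clin a ==> clin (cscale c a)"
  unfolding cscale_def by (simp add: clin_def blinfun.add_left blinfun.scaleR_left blinfun.scaleR_right blinfun.add_right)
lemma clin_id: "clin id_blinfun" and clin_0: "clin 0" by (simp_all add: clin_def)

lemma clin_lim:
  assumes "!!n. clin (a n)" "a ----> l" shows "clin l"
proof (rule clinI)
  fix x
  have "(%n. a n (mult_i x)) ----> l (mult_i x)" by (intro blinfun.tendsto tendsto_const assms)
  moreover have "(%n. mult_i (a n x)) ----> mult_i (l x)" by (intro blinfun.tendsto tendsto_const assms)
  ultimately show "l (mult_i x) = mult_i (l x)"
    using assms(1) LIMSEQ_unique by (simp add: clin_def)
qed

lemma comp_assoc: "(a oL b) oL c = a oL (b oL c)"
  by (rule blinfun_eqI) simp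
lemma comp_id [simp]: "a oL id_blinfun = a" "id_blinfun oL a = a" by (auto intro!: blinfun_eqI)
lemma comp_0 [simp]: "a oL 0 = 0" "0 oL a = 0" by auto
lemma comp_add: "a oL (b + c) = (a oL b) + (a oL c)" "(b + c) oL a = (b oL a) + (c oL a)"
  by (auto intro!: blinfun_eqI simp: blinfun.add_left blinfun.add_right)
lemma comp_diff: "a oL (b - c) = (a oL b) - (a oL c)" "(b - c) oL a = (b oL a) - (c oL a)"
  by (auto intro!: blinfun_eqI simp: blinfun.diff_left blinfun.diff_right)
lemma comp_scaleR: "a oL (r *\<^sub>R b) = r *\<^sub>R (a oL b)" "(r *\<^sub>R a) oL b = r *\<^sub>R (a oL b)"
  by (auto intro!: blinfun_eqI simp: blinfun.scaleR_left blinfun.scaleR_right)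
lemma comp_sum: "a oL sum f S = (SUM i:S. a oL f i)" "sum f S oL a = (SUM i:S. f i oL a)"
  by (induction S rule: infinite_finite_induct) (auto simp: comp_add)
lemma cscale_left: "cscale c a oL b = cscale c (a oL b)"
  by (auto intro!: blinfun_eqI ell2_eqI)
lemma cscale_right: "clin a ==> a oL cscale c b = cscale c (a oL b)"
  unfolding cscale_def clin_def
  by (auto intro!: blinfun_eqI simp: blinfun.add_left blinfun.scaleR_left blinfun.scaleR_right blinfun.add_right)
lemma cscale_of_real: "cscale (of_real r) a = r *\<^sub>R a"
  by (auto intro!: blinfun_eqI ell2_eqI simp: blinfun.scaleR_left scaleR_conv_of_real)

lemma AdjD: "a : Adj ==> is_hadj a (hadj a)" "a : Adj ==> clin a" by (auto simp: Adj_def)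

lemma hadj_in_Adj: "a : Adj ==> hadj a : Adj"
  using AdjI[OF is_hadj_sym is_hadj_clin] AdjD by blast
lemma hadj_hadj [simp]: "a : Adj ==> hadj (hadj a) = a"
  using is_hadj_hadj[OF is_hadj_sym] AdjD by blast
lemma norm_hadj [simp]: "a : Adj ==> norm (hadj a) = norm a"
  using is_hadj_norm AdjD by blast
lemma hadj_inner: "a : Adj ==> a x \<bullet> y = x \<bullet> hadj a y"
  using AdjD(1) by (auto simp: is_hadj_def)
lemma hadj_add: "a : Adj ==> b : Adj ==> hadj (a + b) = hadj a + hadj b"
  by (rule is_hadj_hadj) (intro is_hadj_add AdjD)
lemma hadj_diff: "a : Adj ==> b : Adj ==> hadj (a - b) = hadj a - hadj b"
  by (rule is_hadj_hadj) (intro is_hadj_diff AdjD)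
lemma hadj_comp: "a : Adj ==> b : Adj ==> hadj (a oL b) = hadj b oL hadj a"
  by (rule is_hadj_hadj) (intro is_hadj_compose AdjD)
lemma hadj_cscale: "a : Adj ==> hadj (cscale c a) = cscale (cnj c) (hadj a)"
  by (rule is_hadj_hadj) (intro is_hadj_cscale AdjD)
lemma hadj_scaleR: "a : Adj ==> hadj (r *\<^sub>R a) = r *\<^sub>R hadj a"
  by (rule is_hadj_hadj) (intro is_hadj_scaleR AdjD)
lemma hadj_0 [simp]: "hadj 0 = 0" by (rule is_hadj_hadj) (rule is_hadj_0)
lemma hadj_id [simp]: "hadj id_blinfun = id_blinfun" by (rule is_hadj_hadj) (rule is_hadj_id)

lemma Adj_add: "a : Adj ==> b : Adj ==> a + b : Adj"
  by (rule AdjI[OF is_hadj_add clin_add]) (auto intro: AdjD)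
lemma Adj_diff: "a : Adj ==> b : Adj ==> a - b : Adj"
  by (rule AdjI[OF is_hadj_diff clin_diff]) (auto intro: AdjD)
lemma Adj_comp: "a : Adj ==> b : Adj ==> a oL b : Adj"
  by (rule AdjI[OF is_hadj_compose clin_compose]) (auto intro: AdjD)
lemma Adj_cscale: "a : Adj ==> cscale c a : Adj"
  by (rule AdjI[OF is_hadj_cscale clin_cscale]) (auto intro: AdjD)
lemma Adj_scaleR: "a : Adj ==> r *\<^sub>R a : Adj"
  by (rule AdjI[OF is_hadj_scaleR clin_scaleR]) (auto intro: AdjD)
lemma Adj_id: "id_blinfun : Adj" and Adj_0: "0 : Adj"
  by (auto intro: AdjI is_hadj_id clin_id is_hadj_0 clin_0)

lemma norm_comp_le: "norm (a oL b) <= norm a * norm b" for a b :: "'a ell2 \<Rightarrow>\<^sub>L 'a ell2"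
  by (rule norm_blinfun_compose)

text \<open>Since \<open>hadj\<close> is isometric on \<open>Adj\<close>, the adjoints are Cauchy as
  well, and their limit is an adjoint of \<open>l\<close>.\<close>

lemma Adj_lim:
  assumes "!!n. a n : Adj" "a ----> l"
  shows "l : Adj" "(%n. hadj (a n)) ----> hadj l"
proof -
  have "Cauchy (%n. hadj (a n))"
    using assms(1) LIMSEQ_imp_Cauchy[OF assms(2)] by (auto simp: dist_norm Adj_diff Cauchy_def simp flip: hadj_diff)
  then obtain b where b: "(%n. hadj (a n)) ----> b"
    using Cauchy_convergent_iff convergent_def by blast
  have "is_hadj l b" using is_hadj_lim[OF _ assms(2) b] AdjD(1) assms(1) by blast
  moreover have "clin l" using clin_lim[OF _ assms(2)] AdjD(2) assms(1) by blast
  ultimately show "l : Adj" by (rule AdjI)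
  show "(%n. hadj (a n)) ----> hadj l" using b is_hadj_hadj[OF \<open>is_hadj l b\<close>] by simp
qed

lemma tendsto_comp:
  fixes f g :: "nat => 'a ell2 \<Rightarrow>\<^sub>L 'a ell2"
  shows "f ----> a ==> g ----> b ==> (%n. f n oL g n) ----> (a oL b)"
  by (rule bounded_bilinear.tendsto[OF bounded_bilinear_blinfun_compose])

subsection \<open>Square roots\<close>

text \<open>
  The iteration \<open>y \<mapsto> (b + y\<^sup>2) / 2\<close> started at 0 converges to \<open>1 - sqrt (1 - b)\<close>; it is
  dominated in norm by the scalar iteration with \<open>b = 1\<close>.
\<close>

fun sqit :: "('a ell2 \<Rightarrow>\<^sub>L 'a ell2) => nat => ('a ell2 \<Rightarrow>\<^sub>L 'a ell2)" where
  "sqit b 0 = 0"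
| "sqit b (Suc n) = (1/2) *\<^sub>R (b + (sqit b n oL sqit b n))"

fun sqit1 :: "nat => real" where
  "sqit1 0 = 0"
| "sqit1 (Suc n) = (1 + sqit1 n * sqit1 n) / 2"

lemma sqit1_bounds: "0 <= sqit1 n & sqit1 n <= 1 & sqit1 n <= sqit1 (Suc n)"
proof (induction n)
  case (Suc n)
  have "sqit1 n * sqit1 n <= 1 * 1" using Suc by (intro mult_mono) auto
  moreover have "sqit1 n * sqit1 n <= sqit1 (Suc n) * sqit1 (Suc n)"
    using Suc by (intro mult_mono) (auto simp del: sqit1.simps)
  moreover have "0 <= sqit1 n * sqit1 n" by simp
  ultimately show ?case
    by (simp only: sqit1.simps(2)) auto
qed simp

lemma sqit1_lim: "sqit1 ----> 1"
proof -
  have "incseq sqit1" by (rule incseq_SucI) (use sqit1_bounds in blast)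
  moreover have "bdd_above (range sqit1)" using sqit1_bounds by (auto intro!: bdd_aboveI)
  ultimately obtain l where l: "sqit1 ----> l" by (metis LIMSEQ_incseq_SUP)
  have "(%n. (1 + sqit1 n * sqit1 n) / 2) ----> (1 + l * l) / 2" by (intro tendsto_intros l) auto
  moreover have "(%n. (1 + sqit1 n * sqit1 n) / 2) ----> l" using LIMSEQ_Suc[OF l] by simp
  ultimately have "(1 + l * l) / 2 = l" using LIMSEQ_unique by blast
  then have "(l - 1)\<^sup>2 = 0" by (simp add: power2_eq_square algebra_simps)
  with l show ?thesis by simp
qed

lemma sqit_comm: "sqit b m oL b = b oL sqit b m"
  by (induction m) (auto simp: comp_add comp_scaleR, metis comp_assoc)

lemma sqit_comm2: "sqit b m oL sqit b n = sqit b n oL sqit b m"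
  by (induction n) (auto simp: comp_add comp_scaleR sqit_comm, metis comp_assoc)

lemma sqit_bounds:
  assumes "norm b <= 1"
  shows "norm (sqit b n) <= sqit1 n & norm (sqit b (Suc n) - sqit b n) <= sqit1 (Suc n) - sqit1 n"
proof (induction n)
  case 0 then show ?case using assms by simp
next
  case (Suc n)
  let ?q = "sqit b" and ?t = sqit1
  have 1: "norm (?q (Suc n)) <= ?t (Suc n)"
    using Suc norm_triangle_ineq[of "?q n" "?q (Suc n) - ?q n"] by (simp del: sqit.simps sqit1.simps)
  have "?q (Suc (Suc n)) - ?q (Suc n) = (1/2) *\<^sub>R ((?q (Suc n) oL ?q (Suc n)) - (?q n oL ?q n))"
    by (simp only: sqit.simps(2) sqit.simps(2)) (simp add: algebra_simps del: sqit.simps)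
  \<comment> \<open>The iterates are polynomials in \<open>b\<close> and commute, so the difference
    of squares factors as for numbers.\<close>
  also have "(?q (Suc n) oL ?q (Suc n)) - (?q n oL ?q n) = (?q (Suc n) - ?q n) oL (?q (Suc n) + ?q n)"
    using sqit_comm2 by (simp del: sqit.simps add: comp_add comp_diff)
  finally have "norm (?q (Suc (Suc n)) - ?q (Suc n)) <= (1/2) * (norm (?q (Suc n) - ?q n) * norm (?q (Suc n) + ?q n))"
    using norm_comp_le by simp
  also have "... <= (1/2) * ((?t (Suc n) - ?t n) * (?t (Suc n) + ?t n))"
    using Suc 1 norm_triangle_ineq[of "?q (Suc n)" "?q n"] sqit1_bounds
    by (intro mult_left_mono mult_mono) (auto simp del: sqit.simps sqit1.simps)
  also have "... = ?t (Suc (Suc n)) - ?t (Suc n)"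
    by (simp only: sqit1.simps(2) sqit1.simps(2)) (simp add: field_simps del: sqit1.simps)
  finally show ?case using 1 by simp
qed

lemma sqit_lim:
  assumes "norm b <= 1" obtains y where "sqit b ----> y" "y oL y = 2 *\<^sub>R y - b"
proof -
  have d: "norm (sqit b (n + k) - sqit b n) <= sqit1 (n + k) - sqit1 n" for n k
  proof (induction k)
    case (Suc k)
    show ?case using norm_triangle_ineq[of "sqit b (Suc (n + k)) - sqit b (n + k)" "sqit b (n + k) - sqit b n"] Suc sqit_bounds[OF assms, of "n + k"] by simp
  qed simp
  have "Cauchy (sqit b)"
  proof (rule CauchyI')
    fix e :: real assume "e > 0"
    then obtain M where M: "ALL m>=M. norm (sqit1 m - 1) < e" using LIMSEQ_D[OF sqit1_lim] by blast
    have "dist (sqit b m) (sqit b n) < e" if "m >= M" "n > m" for m n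
    proof -
      have "dist (sqit b m) (sqit b n) <= sqit1 n - sqit1 m"
        using d[of m "n - m"] that by (simp add: dist_norm norm_minus_commute)
      also have "... <= 1 - sqit1 m" using sqit1_bounds by simp
      also have "... < e" using M that by force
      finally show ?thesis .
    qed
    then show "EX M. ALL m>=M. ALL n>m. dist (sqit b m) (sqit b n) < e" by blast
  qed
  then obtain y where y: "sqit b ----> y" using Cauchy_convergent_iff convergent_def by blast
  have "(%n. (1/2) *\<^sub>R (b + (sqit b n oL sqit b n))) ----> (1/2) *\<^sub>R (b + (y oL y))"
    by (intro tendsto_intros tendsto_comp y)
  moreover have "(%n. (1/2) *\<^sub>R (b + (sqit b n oL sqit b n))) ----> y" using LIMSEQ_Suc[OF y] by simp
  ultimately have "(1/2) *\<^sub>R (b + (y oL y)) = y" using LIMSEQ_unique by blast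
  then have "2 *\<^sub>R ((1/2) *\<^sub>R (b + (y oL y))) = 2 *\<^sub>R y" by simp
  then have "y oL y = 2 *\<^sub>R y - b" by (simp add: algebra_simps)
  with y that show thesis by blast
qed

text \<open>Positivity at the vector \<open>x - b x\<close>, together with the upper bound at
  \<open>b x\<close>, gives that the square of \<open>norm (b x)\<close> is at most
  \<open>b x \<bullet> x\<close>; the upper bound at \<open>x\<close> finishes.\<close>

lemma norm_le_1_of_form:
  assumes "b : Adj" "hadj b = b" "!!x. 0 <= b x \<bullet> x" "!!x. b x \<bullet> x <= x \<bullet> x"
  shows "norm b <= 1"
proof (rule norm_blinfun_bound)
  fix x
  let ?y = "b x"
  have sym: "b u \<bullet> v = b v \<bullet> u" for u v using hadj_inner[OF assms(1)] assms(2) by (metis inner_commute)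
  define n where "n = ?y \<bullet> ?y"
  have "0 <= b (x - ?y) \<bullet> (x - ?y)" by (rule assms)
  also have "... = b x \<bullet> x - 2 * n + (b ?y \<bullet> ?y)"
    using sym by (simp add: n_def blinfun.diff_right inner_diff_left inner_diff_right)
  also have "... <= b x \<bullet> x - n" using assms(4) by (simp add: n_def)
  finally have "n <= b x \<bullet> x" by simp
  also have "... <= x \<bullet> x" by (rule assms)
  finally have "(norm ?y)\<^sup>2 <= (norm x)\<^sup>2" by (simp add: n_def power2_norm_eq_inner)
  then show "norm (b x) <= 1 * norm x" by (simp add: power2_le_iff_abs_le)
qed simp

section \<open>Positive elements of a closed star-algebra, possibly without unit\<close>

locale cstar =
  fixes A :: "('a ell2 \<Rightarrow>\<^sub>L 'a ell2) set"
  assumes A_Adj: "A \<subseteq> Adj" and A_0: "0 : A" and A_add: "a : A ==> b : A ==> a + b : A"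
    and A_cscale: "a : A ==> cscale c a : A" and A_comp: "a : A ==> b : A ==> a oL b : A"
    and A_hadj: "a : A ==> hadj a : A" and A_closed: "closed A"
begin

lemma A_scaleR: "a : A ==> r *\<^sub>R a : A"
  using A_cscale[of a "of_real r"] by (simp add: cscale_of_real)
lemma A_diff: "a : A ==> b : A ==> a - b : A"
  using A_add[of a "(-1) *\<^sub>R b"] A_scaleR[of b "-1"] by simp
lemma A_sum: "(!!i. i : S ==> f i : A) ==> sum f S : A"
  by (induction S rule: infinite_finite_induct) (auto intro: A_add A_0)
lemma A_lim: "(!!n. f n : A) ==> f ----> l ==> l : A"
  using A_closed closed_sequentially by blast
lemma AA: "a : A ==> a : Adj" using A_Adj by blast

text \<open>The unit may lie outside \<open>A\<close>, hence the two membership clauses. The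
  iterates are polynomials in \<open>b\<close> without constant term, so their limit
  \<open>id_blinfun - d\<close> stays in the closed algebra of \<open>b\<close>. In the other case
  \<open>sqit1 n *\<^sub>R id_blinfun - sqit b n\<close> is such a polynomial in
  \<open>id_blinfun - b\<close>, and \<open>sqit1 n\<close> tends to 1.\<close>

lemma sqrt_obtain:
  assumes b: "b : Adj" "hadj b = b" "norm b <= 1"
  obtains d where "d : Adj" "hadj d = d" "d oL d = id_blinfun - b"
    "b : A --> id_blinfun - d : A" "id_blinfun - b : A --> d : A"
proof -
  obtain y where y: "sqit b ----> y" "y oL y = 2 *\<^sub>R y - b" using sqit_lim[OF b(3)] .
  have q: "sqit b n : Adj & hadj (sqit b n) = sqit b n" for n
    by (induction n) (auto simp: Adj_0 hadj_add hadj_comp hadj_scaleR b Adj_add Adj_comp Adj_scaleR)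
  have yA: "y : Adj" using Adj_lim(1)[OF _ y(1)] q by blast
  have yh: "hadj y = y" using Adj_lim(2) q y(1) LIMSEQ_unique by (metis (no_types, lifting) ext)
  define d where "d = id_blinfun - y"
  have "d : Adj" "hadj d = d" using yA yh by (auto simp: d_def Adj_diff Adj_id hadj_diff)
  moreover have "d oL d = id_blinfun - b" by (simp add: d_def comp_diff y(2) scaleR_2)
  moreover have "id_blinfun - d : A" if "b : A"
  proof -
    have "sqit b n : A" for n by (induction n) (auto intro!: A_add A_comp A_scaleR A_0 that)
    then show ?thesis using A_lim[OF _ y(1)] by (simp add: d_def)
  qed
  moreover have "d : A" if s: "id_blinfun - b : A"
  proof -
    have half: "(c / 2) *\<^sub>R v + (c / 2) *\<^sub>R v = c *\<^sub>R v" for c and v :: "'a ell2 \<Rightarrow>\<^sub>L 'a ell2"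
      by (simp flip: scaleR_left_distrib)
    have r: "sqit1 n *\<^sub>R id_blinfun - sqit b n : A" for n
    proof (induction n)
      case (Suc n)
      let ?r = "sqit1 n *\<^sub>R id_blinfun - sqit b n"
      have "sqit1 (Suc n) *\<^sub>R id_blinfun - sqit b (Suc n)
        = (1/2) *\<^sub>R ((id_blinfun - b) + ((2 * sqit1 n) *\<^sub>R ?r - (?r oL ?r)))"
        by (simp add: comp_diff comp_scaleR algebra_simps add_divide_distrib)
          (simp add: half)
      then show ?case using Suc s by (auto intro!: A_add A_diff A_comp A_scaleR)
    qed (simp add: A_0)
    have "(%n. sqit1 n *\<^sub>R id_blinfun - sqit b n) ----> 1 *\<^sub>R id_blinfun - y"
      by (intro tendsto_intros sqit1_lim y)
    from A_lim[OF r this] show ?thesis by (simp add: d_def)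
  qed
  ultimately show thesis using that by blast
qed

lemma pos_coneI: "x : A ==> hadj x oL x : pos_cone A" by (auto simp: pos_cone_def)

lemma pos_coneE: assumes "a : pos_cone A" obtains x where "x : A" "a = hadj x oL x"
  using assms by (auto simp: pos_cone_def)

lemma pos_cone_A: "a : pos_cone A ==> a : A" by (auto simp: pos_cone_def intro: A_comp A_hadj)

lemma pos_cone_hadj: "a : pos_cone A ==> hadj a = a"
  by (auto simp: pos_cone_def hadj_comp AA hadj_in_Adj)

lemma pos_cone_form: "a : pos_cone A ==> 0 <= a x \<bullet> x"
  by (auto simp: pos_cone_def inner_commute hadj_inner[symmetric] AA)

lemma pos_sqrt:
  assumes s: "s : A" "hadj s = s" "!!x. 0 <= s x \<bullet> x"
  obtains d where "d : A" "hadj d = d" "d oL d = s"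
proof -
  \<comment> \<open>The added 1 keeps \<open>K\<close> positive for \<open>s = 0\<close>. As a form,
    \<open>s / K\<close> lies between 0 and the identity, so its complement \<open>b\<close> has
    norm at most 1.\<close>
  define K where "K = norm s + 1"
  have K: "K > 0" "norm s <= K" by (auto simp: K_def add_nonneg_pos)
  define b where "b = id_blinfun - (1/K) *\<^sub>R s"
  have bA: "b : Adj" using s AA by (auto simp: b_def intro!: Adj_diff Adj_id Adj_scaleR)
  have bh: "hadj b = b" using s AA by (simp add: b_def hadj_diff hadj_scaleR Adj_id Adj_scaleR)
  have form: "b x \<bullet> x = x \<bullet> x - (s x \<bullet> x) / K" for x
    by (simp add: b_def blinfun.diff_left blinfun.scaleR_left inner_diff_left)
  have "(s x \<bullet> x) / K <= x \<bullet> x" for x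
  proof -
    have "s x \<bullet> x <= norm (s x) * norm x" by (rule norm_cauchy_schwarz)
    also have "... <= (norm s * norm x) * norm x" by (intro mult_right_mono norm_blinfun) auto
    also have "... <= K * norm x * norm x" using K by (intro mult_right_mono) auto
    also have "... = K * (x \<bullet> x)" by (simp add: power2_norm_eq_inner[symmetric] power2_eq_square)
    finally show ?thesis using K by (simp add: field_simps)
  qed
  then have "norm b <= 1"
    using K s(3) by (intro norm_le_1_of_form bA bh) (auto simp: form)
  then obtain d where d: "hadj d = d" "d oL d = id_blinfun - b" "id_blinfun - b : A --> d : A"
    using sqrt_obtain[OF bA bh] by metis
  have dA: "d : A" using d(3) s by (simp add: b_def A_scaleR)
  have "sqrt K *\<^sub>R d oL sqrt K *\<^sub>R d = s"
    using K d by (simp add: comp_scaleR b_def)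
  then show ?thesis using that[OF A_scaleR[OF dA, of "sqrt K"]] by (simp add: hadj_scaleR AA[OF dA] d(1))
qed

text \<open>The root turns the form criterion into membership in the set of squares; closure of the
  cone under addition, invisible from its definition, follows.\<close>

lemma pos_cone_of_form:
  assumes "s : A" "hadj s = s" "!!x. 0 <= s x \<bullet> x" shows "s : pos_cone A"
  using pos_sqrt[OF assms] pos_coneI by metis

lemma pos_cone_add: assumes "a : pos_cone A" "b : pos_cone A" shows "a + b : pos_cone A"
  using assms by (intro pos_cone_of_form)
    (auto simp: pos_cone_A A_add hadj_add AA pos_cone_hadj blinfun.add_left inner_add_left pos_cone_form)

lemma pos_cone_scaleR: assumes "a : pos_cone A" "r >= 0" shows "r *\<^sub>R a : pos_cone A"
  using assms by (intro pos_cone_of_form)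
    (auto simp: pos_cone_A A_scaleR hadj_scaleR AA pos_cone_hadj blinfun.scaleR_left pos_cone_form)

lemma pos_cone_0: "0 : pos_cone A" using pos_coneI[OF A_0] by simp

lemma pos_cone_sum: "(!!i. i : S ==> f i : pos_cone A) ==> sum f S : pos_cone A"
  by (induction S rule: infinite_finite_induct) (auto intro: pos_cone_add pos_cone_0)

text \<open>\<open>d\<close> lies in the algebra with a unit adjoined, hence is a multiplier of \<open>A\<close>.\<close>

lemma norm_sq_minus:
  assumes a: "a : A"
  obtains d where "d : Adj" "hadj d oL d = (norm a)\<^sup>2 *\<^sub>R id_blinfun - (hadj a oL a)" "!!x. x : A ==> d oL x : A"
proof (cases "norm a = 0")
  case True
  then show ?thesis using that[of 0] by (auto simp: Adj_0 A_0)
next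
  case False
  define K where "K = (norm a)\<^sup>2"
  have K: "K > 0" using False by (simp add: K_def)
  define b where "b = (1/K) *\<^sub>R (hadj a oL a)"
  have bA: "b : A" using a by (auto simp: b_def intro!: A_scaleR A_comp A_hadj)
  have bh: "hadj b = b" using a
    by (simp add: b_def hadj_scaleR hadj_comp hadj_in_Adj Adj_comp AA)
  have "norm b <= 1" using norm_comp_le[of "hadj a" a] a K by (auto simp: K_def power2_eq_square AA b_def)
  then obtain d where d: "d : Adj" "hadj d = d" "d oL d = id_blinfun - b" "b : A --> id_blinfun - d : A"
    using sqrt_obtain[OF AA[OF bA] bh] by metis
  show ?thesis
  proof (rule that[of "sqrt K *\<^sub>R d"])
    show "sqrt K *\<^sub>R d : Adj" using d by (simp add: Adj_scaleR)
    show "hadj (sqrt K *\<^sub>R d) oL (sqrt K *\<^sub>R d) = (norm a)\<^sup>2 *\<^sub>R id_blinfun - (hadj a oL a)"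
      using d by (simp add: hadj_scaleR comp_scaleR b_def scaleR_diff_right) (simp add: K_def)
    fix x assume "x : A"
    then have "x - ((id_blinfun - d) oL x) : A" using d bA by (auto intro!: A_diff A_comp)
    then show "(sqrt K *\<^sub>R d) oL x : A" by (auto simp: comp_diff comp_scaleR A_scaleR)
  qed
qed

end

section \<open>Weights, their left ideal and their linear extension\<close>

locale cstar_weight = cstar +
  fixes \<psi> :: "('a ell2 \<Rightarrow>\<^sub>L 'a ell2) => ennreal"
  assumes weight: "weight_on A \<psi>"
begin

abbreviation "N \<equiv> weight_N A \<psi>"
abbreviation "L \<equiv> weight_ext A \<psi>"

definition wt :: "('a ell2 \<Rightarrow>\<^sub>L 'a ell2) => real" where "wt x = enn2real (\<psi> (hadj x oL x))"

lemma \<psi>_add: "a : pos_cone A ==> b : pos_cone A ==> \<psi> (a + b) = \<psi> a + \<psi> b"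
  and \<psi>_scaleR: "a : pos_cone A ==> r >= 0 ==> \<psi> (r *\<^sub>R a) = ennreal r * \<psi> a"
  using weight by (auto simp: weight_on_def)

lemma \<psi>_0: "\<psi> 0 = 0" using \<psi>_scaleR[OF pos_cone_0, of 0] by simp

lemma \<psi>_sum: "(!!i. i : S ==> f i : pos_cone A) ==> \<psi> (sum f S) = (SUM i:S. \<psi> (f i))"
  by (induction S rule: infinite_finite_induct) (auto simp: \<psi>_0 \<psi>_add pos_cone_sum)

lemma \<psi>_mono:
  assumes "a : pos_cone A" "b - a : pos_cone A" shows "\<psi> a <= \<psi> b"
proof -
  have "\<psi> b = \<psi> a + \<psi> (b - a)" using \<psi>_add[OF assms] by simp
  then show ?thesis by simp
qed

lemma N_A: "x : N ==> x : A" by (simp add: weight_N_def)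

lemma NI: "x : A ==> \<psi> (hadj x oL x) < \<infinity> ==> x : N" by (simp add: weight_N_def)

lemma N_fin: "x : N ==> \<psi> (hadj x oL x) = ennreal (wt x)"
  by (simp add: weight_N_def wt_def)

lemma wt_nonneg [simp]: "0 <= wt x" by (simp add: wt_def)

lemma N_0: "0 : N" by (auto intro!: NI simp: A_0 \<psi>_0)

text \<open>The cross terms of \<open>x + y\<close> and \<open>x - y\<close> cancel; this makes the
  elements of finite weight a vector space.\<close>

lemma parallelogram:
  assumes "x : A" "y : A"
  shows "\<psi> (hadj (x + y) oL (x + y)) <= 2 * \<psi> (hadj x oL x) + 2 * \<psi> (hadj y oL y)"
proof -
  let ?p = "hadj (x + y) oL (x + y)" and ?m = "hadj (x - y) oL (x - y)"
  have "?p + ?m = 2 *\<^sub>R (hadj x oL x) + 2 *\<^sub>R (hadj y oL y)"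
    using assms by (simp add: hadj_add hadj_diff AA comp_add comp_diff scaleR_2)
  moreover have "\<psi> (?p + ?m) = \<psi> ?p + \<psi> ?m"
    using assms by (intro \<psi>_add pos_coneI A_add A_diff)
  moreover have "\<psi> (2 *\<^sub>R (hadj x oL x) + 2 *\<^sub>R (hadj y oL y)) = 2 * \<psi> (hadj x oL x) + 2 * \<psi> (hadj y oL y)"
    using assms by (simp add: \<psi>_add pos_coneI pos_cone_scaleR \<psi>_scaleR)
  ultimately show ?thesis by (metis le_iff_add)
qed

lemma N_add: assumes "x : N" "y : N" shows "x + y : N"
proof (rule NI)
  show "x + y : A" using assms by (intro A_add N_A)
  show "\<psi> (hadj (x + y) oL (x + y)) < \<infinity>" using assms parallelogram[of x y] N_A le_less_trans by (force simp: N_fin ennreal_mult_less_top)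
qed

lemma N_cscale: assumes "x : N" shows "cscale c x : N" and "wt (cscale c x) = (norm c)\<^sup>2 * wt x"
proof -
  have x: "x : A" "x : Adj" using assms N_A AA by auto
  have "hadj (cscale c x) oL cscale c x = cscale (cnj c) (cscale c (hadj x oL x))"
    using x by (simp only: hadj_cscale cscale_left cscale_right[OF AdjD(2)[OF hadj_in_Adj[OF x(2)]]])
  also have "... = cscale (of_real ((norm c)\<^sup>2)) (hadj x oL x)"
    using complex_norm_square by (simp add: mult.commute)
  finally have "hadj (cscale c x) oL cscale c x = (norm c)\<^sup>2 *\<^sub>R (hadj x oL x)"
    by (simp only: cscale_of_real)
  then have e: "\<psi> (hadj (cscale c x) oL cscale c x) = ennreal ((norm c)\<^sup>2) * ennreal (wt x)"
    using assms by (simp only: \<psi>_scaleR[OF pos_coneI[OF x(1)]] N_fin zero_le_power2)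
  then show "cscale c x : N"
    by (intro NI A_cscale x) (simp only: ennreal_mult[symmetric] zero_le_power2 wt_nonneg, simp)
  show "wt (cscale c x) = (norm c)\<^sup>2 * wt x"
    unfolding wt_def[of "cscale c x"] e by (simp only: ennreal_mult[symmetric] zero_le_power2 wt_nonneg) simp
qed

lemma N_scaleR: "x : N ==> r *\<^sub>R x : N" using N_cscale(1)[of x "of_real r"] by (simp add: cscale_of_real)

lemma N_diff: "x : N ==> y : N ==> x - y : N"
  using N_add N_scaleR by (metis add_uminus_conv_diff scaleR_minus1_left)

text \<open>The gap between the two positive elements is itself a square: it is
  \<open>hadj (d oL x) oL (d oL x)\<close> with the multiplier \<open>d\<close> of
  \<open>norm_sq_minus\<close>. Hence \<open>N\<close> is a left ideal.\<close>

lemma \<psi>_comp_le: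
  assumes "a : A" "x : A"
  shows "\<psi> (hadj (a oL x) oL (a oL x)) <= ennreal ((norm a)\<^sup>2) * \<psi> (hadj x oL x)"
proof -
  obtain d where d: "d : Adj" "hadj d oL d = (norm a)\<^sup>2 *\<^sub>R id_blinfun - (hadj a oL a)" "d oL x : A"
    using norm_sq_minus[OF assms(1)] assms(2) by metis
  have "hadj (d oL x) oL (d oL x) = hadj x oL ((hadj d oL d) oL x)"
    using d(1) assms by (simp add: hadj_comp AA comp_assoc)
  also have "... = (norm a)\<^sup>2 *\<^sub>R (hadj x oL x) - (hadj (a oL x) oL (a oL x))"
    using assms by (simp add: d(2) hadj_comp AA comp_diff comp_scaleR comp_assoc)
  finally have "(norm a)\<^sup>2 *\<^sub>R (hadj x oL x) - (hadj (a oL x) oL (a oL x)) : pos_cone A"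
    using pos_coneI[OF d(3)] by simp
  then have "\<psi> (hadj (a oL x) oL (a oL x)) <= \<psi> ((norm a)\<^sup>2 *\<^sub>R (hadj x oL x))"
    using assms by (intro \<psi>_mono pos_coneI A_comp)
  then show ?thesis using assms by (simp add: \<psi>_scaleR pos_coneI)
qed

lemma N_left: assumes "a : A" "x : N" shows "a oL x : N" "wt (a oL x) <= (norm a)\<^sup>2 * wt x"
proof -
  have le: "\<psi> (hadj (a oL x) oL (a oL x)) <= ennreal ((norm a)\<^sup>2 * wt x)"
    using \<psi>_comp_le[OF assms(1) N_A[OF assms(2)]] N_fin[OF assms(2)] by (simp add: ennreal_mult)
  then show N: "a oL x : N"
    using assms by (intro NI A_comp) (auto simp: N_A elim: le_less_trans)
  show "wt (a oL x) <= (norm a)\<^sup>2 * wt x"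
    using le N_fin[OF N] by (simp add: ennreal_le_iff)
qed

subsection \<open>The linear extension\<close>

lemma sum_sign_split:
  fixes f :: "'b => 'c::comm_monoid_add" and s :: "'b => real"
  assumes "finite t"
  shows "(SUM b:t. f b) = (\<Sum>b | b : t & s b >= 0. f b) + (\<Sum>b | b : t & s b < 0. f b)"
  using assms by (subst sum.union_disjoint[symmetric]) (auto intro!: sum.cong)

lemma cop_linear_ex:
  fixes f :: "('a ell2 \<Rightarrow>\<^sub>L 'a ell2) => complex"
  assumes "~cop.dependent B"
  shows "EX g. Vector_Spaces.linear cscale (*) g & (ALL x:B. g x = f x)"
  using cop.vector_space_axioms vector_space_over_itself.vector_space_axioms vector_space_pair.linear_independent_extend assms by (force simp: vector_space_pair_def)

text \<open>The description in \<open>weight_ext\<close> is met: a maximal independent set of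
  positive elements of finite weight carries a linear functional with the right values, and
  additivity of the weight forces agreement on the rest of the cone.\<close>

lemma L_props:
  "Vector_Spaces.linear cscale (*) L & (ALL a : pos_cone A. \<psi> a < \<infinity> --> L a = of_real (enn2real (\<psi> a)))"
proof -
  define C where "C = {a : pos_cone A. \<psi> a < \<infinity>}"
  obtain B where B: "B \<subseteq> C" "~cop.dependent B" "C \<subseteq> cop.span B"
    using cop.maximal_independent_subset by metis
  obtain g where g: "Vector_Spaces.linear cscale (*) g" "!!x. x : B ==> g x = of_real (enn2real (\<psi> x))"
    using cop_linear_ex[OF B(2), of "%x. of_real (enn2real (\<psi> x))"] by blast
  interpret g: Vector_Spaces.linear cscale "(*)" g by fact
  have "g a = of_real (enn2real (\<psi> a))" if a: "a : pos_cone A" "\<psi> a < \<infinity>" for a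
  proof -
    obtain t r where t: "finite t" "t \<subseteq> B" "a = (SUM b:t. cscale (r b) b)" using B(3) a by (auto simp: C_def cop.span_explicit)
    have tC: "b : pos_cone A" "\<psi> b < \<infinity>" if "b : t" for b using that t(2) B(1) by (auto simp: C_def)
    have hs: "hadj (SUM b:S. cscale (r b) b) = (SUM b:S. cscale (cnj (r b)) b)" if "S \<subseteq> t" for S
      using finite_subset[OF that t(1)] that
    proof (induction S rule: finite_induct)
      case (insert x S)
      then have "x : pos_cone A" "!!b. b : S ==> b : pos_cone A" using tC by auto
      then show ?case using insert
        by (auto simp: hadj_add AA A_sum A_cscale pos_cone_A hadj_cscale pos_cone_hadj)
    qed simp
    \<comment> \<open>\<open>a\<close> and the basis elements are self-adjoint, so the conjugated
      coefficients represent \<open>a\<close> as well; independence makes them real.\<close>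
    have "(SUM b:t. cscale (r b - cnj (r b)) b) = 0" using hs t pos_cone_hadj[OF a(1)] by (auto simp: cop.scale_left_diff_distrib sum_subtractf)
    then have real: "r b = cnj (r b)" if "b : t" for b
      using cop.independentD[OF B(2) t(1,2) _ that] by force
    define s where "s b = Re (r b)" for b
    have rs: "r b = of_real (s b)" if "b : t" for b
      using real[OF that] by (simp add: s_def complex_eq_iff)
    let ?p = "{b : t. s b >= 0}" and ?n = "{b : t. s b < 0}"
    have neg: "(SUM b:?n. s b *\<^sub>R b) = - (SUM b:?n. \<bar>s b\<bar> *\<^sub>R b)"
      unfolding sum_negf[symmetric] by (intro sum.cong) auto
    have neg2: "(SUM b:?n. s b * w b) = - (SUM b:?n. \<bar>s b\<bar> * w b)" for w :: "_ => real"
      unfolding sum_negf[symmetric] by (intro sum.cong) auto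
    \<comment> \<open>With the negative coefficients moved to the left, both sides are non-negative
      combinations, to which additivity of the weight applies.\<close>
    have "a + (SUM b:?n. \<bar>s b\<bar> *\<^sub>R b) = (SUM b:?p. s b *\<^sub>R b)" using neg by (auto simp: t(3) rs cscale_of_real sum_sign_split[OF t(1), of "%b. s b *\<^sub>R b" s])
    moreover have "\<psi> (a + (SUM b:?n. \<bar>s b\<bar> *\<^sub>R b)) = \<psi> a + (SUM b:?n. ennreal \<bar>s b\<bar> * \<psi> b)"
    proof -
      have q: "\<bar>s b\<bar> *\<^sub>R b : pos_cone A" if "b : ?n" for b using tC that by (intro pos_cone_scaleR) auto
      have e0: "\<psi> (SUM b:?n. \<bar>s b\<bar> *\<^sub>R b) = (SUM b:?n. ennreal \<bar>s b\<bar> * \<psi> b)"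
        by (subst \<psi>_sum[OF q], assumption, rule sum.cong[OF refl], rule \<psi>_scaleR) (use tC in auto)
      have pc: "(SUM b:?n. \<bar>s b\<bar> *\<^sub>R b) : pos_cone A" by (rule pos_cone_sum) (rule q)
      show ?thesis unfolding \<psi>_add[OF a(1) pc] e0 ..
    qed
    moreover have "\<psi> (SUM b:?p. s b *\<^sub>R b) = (SUM b:?p. ennreal (s b) * \<psi> b)"
      using tC by (subst \<psi>_sum) (auto intro!: pos_cone_scaleR simp: \<psi>_scaleR)
    ultimately have e: "\<psi> a + (SUM b:?n. ennreal \<bar>s b\<bar> * \<psi> b) = (SUM b:?p. ennreal (s b) * \<psi> b)" by (simp only:)
    define w where "w b = enn2real (\<psi> b)" for b
    have w: "\<psi> b = ennreal (w b)" "0 <= w b" if "\<psi> b < \<infinity>" for b using that by (auto simp: w_def)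
    have enn: "(\<Sum>b | b : t & P b. ennreal \<bar>s b\<bar> * \<psi> b) = ennreal (\<Sum>b | b : t & P b. \<bar>s b\<bar> * w b)" for P
    proof -
      have "(\<Sum>b | b : t & P b. ennreal \<bar>s b\<bar> * \<psi> b) = (\<Sum>b | b : t & P b. ennreal (\<bar>s b\<bar> * w b))"
        by (rule sum.cong[OF refl], subst ennreal_mult) (use tC w in auto)
      also have "... = ennreal (\<Sum>b | b : t & P b. \<bar>s b\<bar> * w b)"
        by (rule sum_ennreal) (use tC w in auto)
      finally show ?thesis .
    qed
    have nn: "0 <= (\<Sum>b | b : t & P b. \<bar>s b\<bar> * w b)" for P
      using w tC by (auto intro!: sum_nonneg)
    have pp: "(SUM b:?p. ennreal (s b) * \<psi> b) = ennreal (SUM b:?p. \<bar>s b\<bar> * w b)"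
      unfolding enn[symmetric] by (intro sum.cong) auto
    have "ennreal (w a + (SUM b:?n. \<bar>s b\<bar> * w b)) = ennreal (SUM b:?p. \<bar>s b\<bar> * w b)"
      using e w[OF a(2)] nn enn pp by (simp only: ennreal_plus)
    then have "w a + (SUM b:?n. \<bar>s b\<bar> * w b) = (SUM b:?p. \<bar>s b\<bar> * w b)"
      using w[OF a(2)] nn by (subst (asm) ennreal_inj) (simp_all only: add_nonneg_nonneg)
    also have "... = (SUM b:?p. s b * w b)" by (intro sum.cong) auto
    finally have "w a + (SUM b:?n. \<bar>s b\<bar> * w b) = (SUM b:?p. s b * w b)" .
    then have "w a = (SUM b:t. s b * w b)" unfolding sum_sign_split[OF t(1), of "%b. s b * w b" s] neg2 by simp
    moreover have "g a = (SUM b:t. of_real (s b * w b))"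
      unfolding t(3) g.sum using t(2) by (intro sum.cong) (auto simp: g.scale rs g(2) w_def)
    ultimately show ?thesis by (simp add: w_def)
  qed
  then have "EX g. Vector_Spaces.linear cscale (*) g & (ALL a : pos_cone A. \<psi> a < \<infinity> --> g a = of_real (enn2real (\<psi> a)))"
    using g(1) by blast
  then show ?thesis unfolding weight_ext_def by (rule someI_ex)
qed

lemma L_linear: "Vector_Spaces.linear cscale (*) L" using L_props by blast

lemma L_add: "L (a + b) = L a + L b" and L_diff: "L (a - b) = L a - L b" and L_cscale: "L (cscale c a) = c * L a"
  and L_0: "L 0 = 0" and L_sum: "L (sum f S) = (SUM i:S. L (f i))"
proof -
  interpret g: Vector_Spaces.linear cscale "(*)" L by (rule L_linear)
  show "L (a + b) = L a + L b" "L (a - b) = L a - L b" "L (cscale c a) = c * L a" "L 0 = 0"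
    "L (sum f S) = (SUM i:S. L (f i))"
    by (rule g.add g.diff g.scale g.zero g.sum)+
qed

lemma L_scaleR: "L (r *\<^sub>R a) = of_real r * L a"
  using L_cscale[of "of_real r" a] by (simp add: cscale_of_real)

lemma L_pos: "a : pos_cone A ==> \<psi> a < \<infinity> ==> L a = of_real (enn2real (\<psi> a))"
  using L_props by blast

lemma L_sq: "x : N ==> L (hadj x oL x) = of_real (wt x)"
  unfolding wt_def by (rule L_pos) (auto simp: weight_N_def intro: pos_coneI)

lemma sq_expand:
  assumes "x : N" "y : N"
  shows "of_real (wt (x + cscale c y)) = of_real (wt x) + c * L (hadj x oL y) + cnj c * L (hadj y oL x)
    + of_real ((norm c)\<^sup>2 * wt y)"
proof -
  have xy: "x : Adj" "y : Adj" using assms by (auto simp: N_A AA)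
  have "of_real (wt (x + cscale c y)) = L (hadj (x + cscale c y) oL (x + cscale c y))"
    using assms by (intro L_sq[symmetric] N_add N_cscale)
  also have "hadj (x + cscale c y) oL (x + cscale c y)
     = (hadj x oL x) + cscale c (hadj x oL y) + cscale (cnj c) (hadj y oL x) + (hadj (cscale c y) oL cscale c y)"
    using xy by (simp add: hadj_add Adj_cscale comp_add hadj_cscale cscale_left cscale_right AdjD(2) hadj_in_Adj)
  also have "L ... = of_real (wt x) + c * L (hadj x oL y) + cnj c * L (hadj y oL x) + of_real (wt (cscale c y))"
    by (simp only: L_add L_cscale L_sq assms N_cscale)
  finally show ?thesis using assms by (simp add: N_cscale)
qed

text \<open>The left side of \<open>sq_expand\<close> is real; its imaginary parts at
  \<open>c = 1\<close> and \<open>c = \<i>\<close> give the two components.\<close>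

lemma L_herm: assumes "x : N" "y : N" shows "L (hadj y oL x) = cnj (L (hadj x oL y))"
  using arg_cong[OF sq_expand[OF assms, of 1], of Im] arg_cong[OF sq_expand[OF assms, of \<i>], of Im] by (auto simp: complex_eq_iff)

lemma L_CS: assumes "x : N" "y : N" shows "(norm (L (hadj x oL y)))\<^sup>2 <= wt x * wt y"
proof -
  let ?a = "L (hadj x oL y)"
  define n where "n = norm ?a"
  have key: "0 <= wt x + 2 * t * n\<^sup>2 + t\<^sup>2 * n\<^sup>2 * wt y" for t :: real
  proof -
    \<comment> \<open>This scalar makes both cross terms equal to \<open>t * n\<^sup>2\<close> and
      leaves a real quadratic in \<open>t\<close>.\<close>
    let ?c = "of_real t * cnj ?a"
    have a: "?a * cnj ?a = of_real (n\<^sup>2)" unfolding n_def by (rule complex_norm_square[symmetric])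
    have c: "(norm ?c)\<^sup>2 = t\<^sup>2 * n\<^sup>2" by (simp add: norm_mult n_def power_mult_distrib)
    have "of_real (wt (x + cscale ?c y)) = of_real (wt x) + ?c * ?a + cnj ?c * cnj ?a + of_real (t\<^sup>2 * n\<^sup>2 * wt y)"
      using sq_expand[OF assms, of ?c] unfolding L_herm[OF assms] c .
    also have "?c * ?a = of_real (t * n\<^sup>2)" unfolding of_real_mult a[symmetric] by (simp only: mult_ac)
    also have "cnj ?c * cnj ?a = of_real (t * n\<^sup>2)" unfolding of_real_mult a[symmetric] by simp
    finally have "of_real (wt (x + cscale ?c y)) = complex_of_real (wt x + t * n\<^sup>2 + t * n\<^sup>2 + t\<^sup>2 * n\<^sup>2 * wt y)"
      by (simp only: of_real_add)
    then have "wt (x + cscale ?c y) = wt x + t * n\<^sup>2 + t * n\<^sup>2 + t\<^sup>2 * n\<^sup>2 * wt y"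
      by (simp only: of_real_eq_iff)
    then show ?thesis using wt_nonneg[of "x + cscale (of_real t * cnj ?a) y"]
      by (simp add: algebra_simps)
  qed
  show ?thesis
  proof (cases "wt y = 0")
    case True
    have "n\<^sup>2 <= 0"
    proof (rule ccontr)
      assume "~n\<^sup>2 <= 0"
      then have "n\<^sup>2 > 0" by simp
      \<comment> \<open>For \<open>wt y = 0\<close> the quadratic is affine in \<open>t\<close>, and
        this choice makes it negative.\<close>
      define t where "t = - (wt x + 1) / n\<^sup>2"
      have t: "t * n\<^sup>2 = - (wt x + 1)" using \<open>n\<^sup>2 > 0\<close> by (simp add: t_def)
      show False using key[of t] t True wt_nonneg[of x] by simp
    qed
    then show ?thesis by (simp add: n_def)
  next
    case False
    then have "wt y > 0" using wt_nonneg[of y] by linarith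
    moreover have "0 <= wt x + 2 * (- 1 / wt y) * n\<^sup>2 + (1 / (wt y * wt y)) * n\<^sup>2 * wt y"
      using key[of "- 1 / wt y"] by (simp add: power2_eq_square)
    ultimately show ?thesis by (simp add: n_def field_simps)
  qed
qed

lemma L_CS': assumes "x : N" "y : N" shows "norm (L (hadj x oL y)) <= sqrt (wt x) * sqrt (wt y)"
  using real_sqrt_le_mono[OF L_CS[OF assms]] by (simp add: real_sqrt_mult)

end

section \<open>Paths in a graph\<close>

definition pre :: "nat => (nat => 'e) => 'e list" where "pre n x = map x [0..<n]"

definition cat :: "'e list => (nat => 'e) => nat => 'e" where
  "cat mu x = (%i. if i < length mu then mu ! i else x (i - length mu))"

lemma shift_funpow: "(shift ^^ n) x = (%i. x (i + n))"
  by (induction n arbitrary: x) (auto simp: shift_def)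

lemma length_pre [simp]: "length (pre n x) = n" by (simp add: pre_def)
lemma nth_pre [simp]: "i < n ==> pre n x ! i = x i" by (simp add: pre_def)
lemma pre_0 [simp]: "pre 0 x = []" by (simp add: pre_def)
lemma pre_eq_Nil [simp]: "pre n x = [] \<longleftrightarrow> n = 0" by (simp add: pre_def)
lemma pre_eq_iff: "pre n x = pre n y \<longleftrightarrow> (ALL i<n. x i = y i)" by (auto simp: pre_def)
lemma pre_eq_iff': "pre n x = mu \<longleftrightarrow> n = length mu & (ALL i<n. x i = mu ! i)"
  by (auto simp: list_eq_iff_nth_eq)
lemma pre_Suc: "pre (Suc n) x = pre n x @ [x n]" by (simp add: pre_def)
lemma pre_add: "pre (m + n) x = pre m x @ pre n ((shift ^^ m) x)"
  by (rule nth_equalityI) (auto simp: nth_append shift_funpow)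
lemma take_pre: "m <= n ==> take m (pre n x) = pre m x" by (rule nth_equalityI) auto

lemma cat_Nil [simp]: "cat [] x = x" by (simp add: cat_def)
lemma cat_append: "cat (mu @ nu) x = cat mu (cat nu x)" by (auto simp: cat_def nth_append fun_eq_iff)
lemma cat_Cons: "cat (e # nu) x = cat [e] (cat nu x)" using cat_append[of "[e]"] by simp
lemma shift_cat [simp]: "(shift ^^ length mu) (cat mu x) = x" by (simp add: shift_funpow cat_def)
lemma shift_cat_Cons [simp]: "shift (cat [e] x) = x" using shift_cat[of "[e]"] by simp
lemma pre_cat [simp]: "pre (length mu) (cat mu x) = mu" by (rule nth_equalityI) (auto simp: cat_def)
lemma pre_cat': "length mu = n ==> pre n (cat mu x) = mu" by auto
lemma cat_pre [simp]: "cat (pre n x) ((shift ^^ n) x) = x" by (auto simp: cat_def shift_funpow)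
lemma cat_inj: "cat mu x = cat mu y \<longleftrightarrow> x = y" by (metis shift_cat)
lemma cat_eq_iff: "length mu = length nu ==> cat mu x = cat nu y \<longleftrightarrow> mu = nu & x = y" by (metis shift_cat pre_cat)
lemma cat_0: "mu ~= [] ==> cat mu x 0 = hd mu" by (simp add: cat_def hd_conv_nth)
lemma shift_shift: "(shift ^^ m) ((shift ^^ n) x) = (shift ^^ (n + m)) x" by (simp add: shift_funpow add_ac)

lemma birkhoff_Suc: "birkhoff_sum u (Suc n) x = u x + birkhoff_sum u n (shift x)"
  unfolding birkhoff_sum_def shift_funpow by (subst sum.lessThan_Suc_shift) (simp add: shift_def)
lemma birkhoff_0 [simp]: "birkhoff_sum u 0 x = 0" by (simp add: birkhoff_sum_def)
lemma birkhoff_add: "birkhoff_sum u (n + m) x = birkhoff_sum u n x + birkhoff_sum u m ((shift ^^ n) x)"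
  unfolding birkhoff_sum_def shift_funpow by (induction m) (simp_all add: add.assoc add.commute[of n])
lemma birkhoff_append: "birkhoff_sum u (length mu + n) (cat mu x) = birkhoff_sum u (length mu) (cat mu x) + birkhoff_sum u n x"
  by (simp add: birkhoff_add)

text \<open>Cofinality is added in \<open>cpot\<close>, where transfer sums and conformal functions
  on different cylinders are compared.\<close>

locale pgraph =
  fixes G :: "('v, 'e) pre_digraph"
  assumes wf: "wf_digraph G" and cnt: "countable (arcs G)"
    and fin_out: "v : verts G ==> finite (out_arcs G v)" and ex_out: "v : verts G ==> out_arcs G v ~= {}"
begin

abbreviation "X \<equiv> inf_paths G"
abbreviation "cyl \<equiv> cylinder G"

lemma tail_verts: "e : arcs G ==> tail G e : verts G" and head_verts: "e : arcs G ==> head G e : verts G"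
  using wf by (auto simp: wf_digraph_def)

lemma XD: "x : X ==> x i : arcs G" "x : X ==> head G (x i) = tail G (x (Suc i))" by (auto simp: inf_paths_def)

lemma X_shift: "x : X ==> (shift ^^ n) x : X" by (auto simp: inf_paths_def shift_funpow)
lemma X_shift1: "x : X ==> shift x : X" using X_shift[of x 1] by simp

lemma cat1_X: "cat [e] x : X \<longleftrightarrow> e : arcs G & head G e = tail G (x 0) & x : X"
proof
  assume a: "cat [e] x : X"
  have "x : X" using X_shift1[OF a] by simp
  then show "e : arcs G & head G e = tail G (x 0) & x : X"
    using XD[OF a, of 0] by (simp add: cat_def)
next
  assume a: "e : arcs G & head G e = tail G (x 0) & x : X"
  show "cat [e] x : X" using a by (auto simp: cat_def inf_paths_def)
qed

lemma cat_X_tail: "cat mu x : X ==> x : X" using X_shift[of "cat mu x" "length mu"] by simp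

lemma cat_X_cong: "cat mu x : X ==> y : X ==> tail G (y 0) = tail G (x 0) ==> cat mu y : X"
proof (induction mu)
  case (Cons e mu)
  then show ?case
    by (cases "mu = []") (simp_all add: cat_Cons[of e mu] cat1_X cat_0)
qed simp

lemma mem_cyl: "x : cyl mu \<longleftrightarrow> x : X & pre (length mu) x = mu"
  by (auto simp: cylinder_def pre_eq_iff')

lemma cylE: assumes "x : cyl mu" obtains w where "x = cat mu w" "w : X" "cat mu w : X" by (metis assms cat_pre mem_cyl X_shift)

lemma cat_in_cyl [simp]: "cat mu w : cyl mu \<longleftrightarrow> cat mu w : X" by (simp add: mem_cyl)
lemma cat_in_cyl_append [simp]: "cat mu w : cyl (mu @ nu) \<longleftrightarrow> cat mu w : X & w : cyl nu"
  using cat_X_tail by (auto simp: mem_cyl pre_add)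
lemma cat1_in_cyl [simp]: "cat [e] w : cyl (e # nu) \<longleftrightarrow> cat [e] w : X & w : cyl nu"
  using cat_in_cyl_append[of "[e]" w nu] by simp
lemma cyl_pre: "x : X ==> x : cyl (pre n x)" by (simp add: mem_cyl)
lemma cyl_X: "x : cyl mu ==> x : X" by (simp add: mem_cyl)
lemma cyl_Nil [simp]: "cyl [] = X" by (auto simp: mem_cyl)

lemma cyl_append_subset: "cyl (mu @ nu) \<subseteq> cyl mu"
  by (auto simp: mem_cyl pre_add)

lemma cyl_nth: "x : cyl mu ==> i < length mu ==> x i = mu ! i" by (auto simp: cylinder_def)

lemma cyl_cat_append: "cyl (mu @ nu) = cat mu ` {w : cyl nu. cat mu w : X}"
proof
  show "cyl (mu @ nu) \<subseteq> cat mu ` {w : cyl nu. cat mu w : X}"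
  proof
    fix x assume x: "x : cyl (mu @ nu)"
    then obtain w where w: "x = cat mu w" using cyl_append_subset cylE by (metis subsetD)
    then show "x : cat mu ` {w : cyl nu. cat mu w : X}" using x by auto
  qed
qed auto

lemma ex_path: assumes "v : verts G" shows "EX x:X. tail G (x 0) = v"
proof -
  define nx where "nx v = (SOME e. e : out_arcs G v)" for v
  have nx: "nx v : arcs G" "tail G (nx v) = v" if "v : verts G" for v
    using ex_out[OF that] unfolding nx_def some_in_eq[symmetric] by auto
  define y where "y = rec_nat v (%_ w. head G (nx w))"
  have y: "y 0 = v" "y (Suc n) = head G (nx (y n))" for n by (auto simp: y_def)
  have yv: "y n : verts G" for n by (induction n) (auto simp: y assms nx head_verts)
  have "nx (y i) : arcs G & head G (nx (y i)) = tail G (nx (y (Suc i)))" for i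
    using nx[OF yv[of i]] nx[OF yv[of "Suc i"]] y(2) by simp
  then have "(%i. nx (y i)) : X" by (auto simp: inf_paths_def)
  moreover have "tail G (nx (y 0)) = v" using nx(2)[OF yv[of 0]] y(1) by simp
  ultimately show ?thesis by (intro bexI[of _ "%i. nx (y i)"])
qed

lemma ex_cat: "e : arcs G ==> EX x. cat [e] x : X"
  using ex_path[OF head_verts] cat1_X by metis

lemma cyl_arc_ne: "e : arcs G ==> cyl [e] ~= {}"
  using ex_cat cat_in_cyl by blast

text \<open>Admissible extensions are recognised by a non-empty cylinder instead of adjacency of
  edges. For \<open>mu = []\<close> the set may be infinite, as there can be infinitely many edges;
  hence the recurring assumption \<open>mu ~= []\<close>.\<close>

definition E :: "nat => 'e list => 'e list set" where
  "E n mu = {rho. length rho = n & cyl (mu @ rho) ~= {}}"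

lemma E_len: "rho : E n mu ==> length rho = n" by (simp add: E_def)

lemma E_0: "E 0 mu = (if cyl mu = {} then {} else {[]})" by (auto simp: E_def)

lemma cyl_E: "cyl mu = (UN rho:E n mu. cyl (mu @ rho))" by (force simp: mem_cyl pre_add E_def)

lemma cyl_disj: "length mu = length nu ==> mu ~= nu ==> cyl mu \<inter> cyl nu = {}" by (auto simp: mem_cyl)

lemma E_add: "E (n + k) mu = (UN rho:E n mu. (%tau. rho @ tau) ` E k (mu @ rho))"
proof
  show "E (n + k) mu \<subseteq> (UN rho:E n mu. (%tau. rho @ tau) ` E k (mu @ rho))"
  proof
    fix rho assume r: "rho : E (n + k) mu"
    have "take n rho : E n mu" "drop n rho : E k (mu @ take n rho)" using cyl_append_subset[of "mu @ take n rho" "drop n rho"] r by (auto simp: E_def)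
    then show "rho : (UN rho:E n mu. (%tau. rho @ tau) ` E k (mu @ rho))"
      by (intro UN_I[of "take n rho"] image_eqI[of _ _ "drop n rho"]) auto
  qed
qed (auto simp: E_def)

text \<open>Here the cylinder description of extensions meets the graph; through this identity
  row-finiteness makes \<open>E\<close> finite.\<close>

lemma E_step: assumes "mu ~= []" "cyl mu ~= {}" shows "E 1 mu = (%e. [e]) ` out_arcs G (head G (last mu))"
proof -
  obtain w where w: "cat mu w : X" using assms(2) cylE by (metis all_not_in_conv)
  have l: "head G (last mu) = tail G (w 0)"
    using XD(2)[OF w, of "length mu - 1"] assms(1) by (simp add: cat_def last_conv_nth)
  show ?thesis
  proof (intro set_eqI iffI)
    fix rho assume "rho : E 1 mu"
    then obtain e where e: "rho = [e]" "cyl (mu @ [e]) ~= {}" by (auto simp: E_def length_Suc_conv)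
    then obtain x where x: "x : cyl (mu @ [e])" by blast
    then show "rho : (%e. [e]) ` out_arcs G (head G (last mu))" using cyl_nth[OF x, of "length mu - 1"] cyl_nth[OF x, of "length mu"] assms(1) XD[OF cyl_X[OF x], of "length mu - 1"] XD(1)[OF cyl_X[OF x], of "length mu"] e by (auto simp: nth_append last_conv_nth)
  next
    fix rho assume "rho : (%e. [e]) ` out_arcs G (head G (last mu))"
    then obtain e where e: "rho = [e]" "e : arcs G" "tail G e = head G (last mu)" by auto
    obtain y where y: "cat [e] y : X" using ex_cat[OF e(2)] by blast
    have "cyl (mu @ [e]) ~= {}" using e l cat_X_cong[OF w y] cat_in_cyl[of "mu @ [e]" y] by (force simp: cat_0 cat_append)
    then show "rho : E 1 mu" using e(1) by (simp add: E_def)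
  qed
qed

lemma E_empty: "cyl mu = {} ==> E n mu = {}" using cyl_append_subset by (fastforce simp: E_def)

lemma last_arc: assumes "mu ~= []" "cyl mu ~= {}" shows "set mu \<subseteq> arcs G"
proof -
  obtain x where x: "x : cyl mu" using assms by blast
  show ?thesis using cyl_nth[OF x] XD(1)[OF cyl_X[OF x]] by (metis in_set_conv_nth subsetI)
qed

lemma finite_E1: "mu ~= [] ==> finite (E 1 mu)"
  using E_empty E_step fin_out[OF head_verts, of "last mu"] last_arc[of mu] last_in_set[of mu]
  by (cases "cyl mu = {}") (auto simp del: One_nat_def last_in_set)

lemma finite_E: "mu ~= [] ==> finite (E n mu)"
proof (induction n)
  case (Suc n)
  then show ?case unfolding Suc_eq_plus1 E_add by (intro finite_UN_I finite_imageI finite_E1) auto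
qed (simp add: E_0)

lemma sum_E_add: assumes "mu ~= []"
  shows "(SUM rho:E (n + k) mu. f rho) = (SUM rho:E n mu. SUM tau:E k (mu @ rho). f (rho @ tau))"
proof -
  have "(SUM rho:E (n + k) mu. f rho) = (SUM rho:E n mu. SUM \<sigma>:(%tau. rho @ tau) ` E k (mu @ rho). f \<sigma>)"
    unfolding E_add using assms by (intro sum.UNION_disjoint) (auto simp: finite_E dest!: E_len)
  also have "... = (SUM rho:E n mu. SUM tau:E k (mu @ rho). f (rho @ tau))"
    by (rule sum.cong[OF refl]) (simp add: sum.reindex inj_on_def)
  finally show ?thesis .
qed

lemma E_cat: assumes "cyl (mu @ nu) ~= {}" "nu ~= []" shows "E n (mu @ nu) = E n nu"
proof -
  obtain w where w: "cat mu w : X" "w : cyl nu" using assms(1) unfolding cyl_cat_append by blast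
  have "cyl (mu @ nu @ rho) ~= {} \<longleftrightarrow> cyl (nu @ rho) ~= {}" for rho
  proof -
    have "cat mu y : X" if "y : cyl (nu @ rho)" for y
    proof -
      have "y 0 = w 0" using that w(2) assms(2) cyl_nth[of y "nu @ rho" 0] cyl_nth by (simp add: nth_append)
      then show ?thesis using cat_X_cong[OF w(1), of y] cyl_X[OF that] by simp
    qed
    then show ?thesis unfolding cyl_cat_append by auto
  qed
  then show ?thesis by (auto simp: E_def)
qed

text \<open>Koenig's lemma, as an induction principle on the compact set \<open>cyl mu\<close>.\<close>

lemma bar_induct:
  assumes "mu ~= []"
    and step: "!!nu. nu ~= [] ==> (!!rho. rho : E 1 nu ==> Q (nu @ rho)) ==> Q nu"
    and bar: "!!x. x : cyl mu ==> EX n>=length mu. Q (pre n x)"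
  shows "Q mu"
proof (rule ccontr)
  assume nQ: "~Q mu"
  \<comment> \<open>Every word violating \<open>Q\<close> has a one-edge extension violating it;
    iterating the choice spells out an infinite path in \<open>cyl mu\<close> that avoids the
    bar.\<close>
  define nx where "nx nu = (SOME rho. rho : E 1 nu & ~Q (nu @ rho))" for nu
  have nx: "nx nu : E 1 nu" "~Q (nu @ nx nu)" if "nu ~= []" "~Q nu" for nu
  proof -
    have "EX rho. rho : E 1 nu & ~Q (nu @ rho)" using step[OF that(1)] that(2) by blast
    then have "nx nu : E 1 nu & ~Q (nu @ nx nu)" unfolding nx_def by (rule someI_ex)
    then show "nx nu : E 1 nu" "~Q (nu @ nx nu)" by blast+
  qed
  define s where "s = rec_nat mu (%_ nu. nu @ nx nu)"
  have s: "s 0 = mu" "s (Suc n) = s n @ nx (s n)" for n by (auto simp: s_def)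
  have sQ: "s n ~= [] & ~Q (s n)" for n by (induction n) (auto simp: s nQ assms(1) nx)
  have sl: "length (s n) = length mu + n" for n
    using sQ nx(1)[THEN E_len] by (induction n) (auto simp: s)
  have ne: "cyl (s (Suc n)) ~= {}" for n using nx(1) sQ by (auto simp: E_def s)
  have st: "take (length (s n)) (s (n + k)) = s n" for n k
    by (induction k) (auto simp: s sl)
  define x where "x i = s (Suc i) ! i" for i
  have xs: "s n ! i = x i" if "i < length mu + n" for n i
  proof (cases "n <= Suc i")
    case True
    then show ?thesis using st that sl unfolding x_def
      by (metis le_add_diff_inverse nth_take)
  next
    case False
    then show ?thesis using st sl unfolding x_def
      by (metis add_leD2 le_add_diff_inverse less_or_eq_imp_le linorder_not_le not_less_eq nth_take trans_less_add2)
  qed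
  have "x i : arcs G & head G (x i) = tail G (x (Suc i))" for i
  proof -
    obtain y where y: "y : cyl (s (Suc (Suc i)))" using ne by blast
    show ?thesis using cyl_nth[OF y] xs sl XD[OF cyl_X[OF y], of i] by simp
  qed
  then have xX: "x : X" by (auto simp: inf_paths_def)
  have px: "pre (length mu + n) x = s n" for n
    by (rule nth_equalityI) (auto simp: sl xs)
  then have "x : cyl mu" using px[of 0] xX by (simp add: mem_cyl s)
  from bar[OF this] obtain n where "n >= length mu" "Q (pre n x)" by blast
  then show False using px[of "n - length mu"] sQ by simp
qed

subsection \<open>The topology of the path space\<close>

lemma fin_path_cat:
  assumes "fin_path G u mu v" "x : X" "tail G (x 0) = v"
  shows "cat mu x : X & tail G (cat mu x 0) = u"
proof -
  have "set mu \<subseteq> arcs G ==> pre_digraph.cas G u mu v ==> cat mu x : X & tail G (cat mu x 0) = u"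
  proof (induction mu arbitrary: u)
    case Nil
    then show ?case using assms by (simp add: pre_digraph.cas.simps)
  next
    case (Cons e mu)
    then have "cat mu x : X & tail G (cat mu x 0) = head G e" using Cons.IH[of "head G e"] by (simp add: pre_digraph.cas.simps)
    then show ?case using Cons.prems unfolding cat_Cons[of e mu] cat1_X
      by (simp add: pre_digraph.cas.simps cat_0)
  qed
  then show ?thesis using assms(1) by (auto simp: fin_path_def pre_digraph.awalk_def)
qed

lemma pre_fin_path: assumes "x : X" "n > 0" shows "fin_path G (tail G (x 0)) (pre n x) (tail G (x n))"
proof -
  have "pre_digraph.cas G (tail G (x 0)) (pre n x) (tail G (x n))" for n
    using assms(1)
  proof (induction n arbitrary: x)
    case (Suc n)
    show ?case using pre_add[of 1 n x] Suc.IH[OF X_shift1[OF Suc.prems]] XD(2)[OF Suc.prems, of 0] by (auto simp: pre_Suc pre_digraph.cas.simps shift_def)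
  qed (simp add: pre_digraph.cas.simps)
  moreover have "set (pre n x) \<subseteq> arcs G" using XD(1)[OF assms(1)] by (auto simp: pre_def)
  ultimately show ?thesis
    using assms XD(1) tail_verts by (auto simp: fin_path_def pre_digraph.awalk_def)
qed

lemma openin_path_iff:
  "openin (path_topology G) U \<longleftrightarrow> U \<subseteq> X & (ALL x:U. EX n. cyl (pre n x) \<subseteq> U)"
proof
  assume "openin (path_topology G) U"
  then have "generate_topology_on {cyl mu |u mu v. fin_path G u mu v} U"
    by (simp add: path_topology_def openin_topology_generated_by_iff)
  then show "U \<subseteq> X & (ALL x:U. EX n. cyl (pre n x) \<subseteq> U)"
  proof (induction rule: generate_topology_on.induct)
    case (Int a b)
    show ?case
    proof (intro conjI ballI)
      fix x assume x: "x : a \<inter> b"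
      then obtain n m where nm: "cyl (pre n x) \<subseteq> a" "cyl (pre m x) \<subseteq> b" using Int by blast
      have "cyl (pre (n + m) x) \<subseteq> cyl (pre n x)" "cyl (pre (m + n) x) \<subseteq> cyl (pre m x)"
        using cyl_append_subset unfolding pre_add by auto
      then show "EX n. cyl (pre n x) \<subseteq> a \<inter> b" using nm by (auto simp: add.commute intro!: exI)
    qed (use Int in blast)
  next
    case (UN K)
    then show ?case by (meson Union_iff Union_least Union_upper subset_trans)
  next
    case (Basis s)
    then obtain mu where m: "s = cyl mu" by blast
    have "cyl (pre (length mu) x) \<subseteq> s" if "x : s" for x using that unfolding m by (simp add: mem_cyl)
    then show ?case unfolding m using cyl_X by blast
  qed simp
next
  assume U: "U \<subseteq> X & (ALL x:U. EX n. cyl (pre n x) \<subseteq> U)"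
  have "EX mu u v. fin_path G u mu v & x : cyl mu & cyl mu \<subseteq> U" if "x : U" for x
  proof -
    have "EX n. cyl (pre n x) \<subseteq> U" using conjunct2[OF U] \<open>x : U\<close> by (rule bspec)
    then obtain n where n: "cyl (pre n x) \<subseteq> U" ..
    \<comment> \<open>Generating cylinders belong to paths with at least one edge, so the prefix is
      lengthened by one in case \<open>n = 0\<close>.\<close>
    have "cyl (pre (Suc n) x) \<subseteq> cyl (pre n x)" unfolding pre_Suc by (rule cyl_append_subset)
    then show ?thesis using n subsetD[OF conjunct1[OF U] that] cyl_pre pre_fin_path by blast
  qed
  note * = this
  have "U \<subseteq> \<Union>{cyl mu |u mu v. fin_path G u mu v & cyl mu \<subseteq> U}"
  proof
    fix x assume "x : U"
    from *[OF this] obtain mu u v where "fin_path G u mu v" "x : cyl mu" "cyl mu \<subseteq> U" by blast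
    then show "x : \<Union>{cyl mu |u mu v. fin_path G u mu v & cyl mu \<subseteq> U}" by (intro UnionI CollectI exI conjI) auto
  qed
  then have "U = \<Union>{cyl mu |u mu v. fin_path G u mu v & cyl mu \<subseteq> U}" by (intro equalityI) auto
  moreover have "openin (path_topology G) (\<Union>{cyl mu |u mu v. fin_path G u mu v & cyl mu \<subseteq> U})"
    unfolding path_topology_def by (intro openin_Union) (auto intro!: topology_generated_by_Basis)
  ultimately show "openin (path_topology G) U" by simp
qed

lemma topspace_path [simp]: "topspace (path_topology G) = X"
proof
  show "topspace (path_topology G) \<subseteq> X" using openin_path_iff by blast
  have "openin (path_topology G) X" by (auto simp: openin_path_iff mem_cyl)
  then show "X \<subseteq> topspace (path_topology G)" by (rule openin_subset)
qed

lemma openin_cyl: "openin (path_topology G) (cyl mu)"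
proof -
  have "cyl (pre (length mu) x) \<subseteq> cyl mu" if "x : cyl mu" for x using that by (simp add: mem_cyl)
  then show ?thesis unfolding openin_path_iff using cyl_X by blast
qed

text \<open>Bar induction on the property of having a finite subcover.\<close>

lemma compactin_cyl: assumes "mu ~= []" shows "compactin (path_topology G) (cyl mu)"
  unfolding compactin_def
proof (intro conjI allI impI)
  fix \<U> assume U: "Ball \<U> (openin (path_topology G)) & cyl mu \<subseteq> \<Union>\<U>"
  show "EX \<F>. finite \<F> & \<F> \<subseteq> \<U> & cyl mu \<subseteq> \<Union>\<F>"
  proof (rule bar_induct[OF assms, of "%nu. EX \<F>. finite \<F> & \<F> \<subseteq> \<U> & cyl nu \<subseteq> \<Union>\<F>"])
    fix nu :: "'e list" assume nu: "nu ~= []" "!!rho. rho : E 1 nu ==> EX \<F>. finite \<F> & \<F> \<subseteq> \<U> & cyl (nu @ rho) \<subseteq> \<Union>\<F>"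
    then obtain F where F: "!!rho. rho : E 1 nu ==> finite (F rho) & F rho \<subseteq> \<U> & cyl (nu @ rho) \<subseteq> \<Union>(F rho)" by metis
    show "EX \<F>. finite \<F> & \<F> \<subseteq> \<U> & cyl nu \<subseteq> \<Union>\<F>"
    proof (intro exI[of _ "UN rho:E 1 nu. F rho"] conjI)
      show "cyl nu \<subseteq> \<Union>(UN rho:E 1 nu. F rho)"
      proof
        fix x assume "x : cyl nu"
        then obtain rho where "rho : E 1 nu" "x : cyl (nu @ rho)" unfolding cyl_E[of nu 1] by (rule UN_E)
        then show "x : \<Union>(UN rho:E 1 nu. F rho)" using F by (meson UN_I Union_iff subsetD)
      qed
    qed (use F finite_E1[OF nu(1)] in auto)
  next
    fix x assume x: "x : cyl mu"
    then obtain V where V: "V : \<U>" "x : V" using U by blast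
    then obtain n where n: "cyl (pre n x) \<subseteq> V" using U openin_path_iff[of V] by (metis)
    have "cyl (pre (n + length mu) x) \<subseteq> V" using n cyl_append_subset unfolding pre_add by blast
    then show "EX n>=length mu. EX \<F>. finite \<F> & \<F> \<subseteq> \<U> & cyl (pre n x) \<subseteq> \<Union>\<F>"
      using V by (intro exI[of _ "n + length mu"] conjI exI[of _ "{V}"]) simp_all
  qed
qed (simp add: mem_cyl subset_iff)

lemma compactin_path_cover:
  assumes "compactin (path_topology G) K" shows "EX F. finite F & F \<subseteq> arcs G & K \<subseteq> (UN e:F. cyl [e])"
proof -
  have "K \<subseteq> \<Union>((%e. cyl [e]) ` arcs G)" using compactin_subset_topspace[OF assms] XD(1) by (auto simp: mem_cyl pre_Suc)
  then obtain \<F> where \<F>: "finite \<F>" "\<F> \<subseteq> (%e. cyl [e]) ` arcs G" "K \<subseteq> \<Union>\<F>"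
    using compactinD[OF assms, of "(%e. cyl [e]) ` arcs G"] openin_cyl by blast
  then obtain F where "F \<subseteq> arcs G" "finite F" "\<F> = (%e. cyl [e]) ` F" by (meson finite_subset_image)
  then show ?thesis using \<F> by blast
qed

text \<open>Heine-Cantor on a compact cylinder. In the induction the property is strengthened to all
  depths beyond \<open>n\<close>, so that the depths found for the finitely many one-edge extensions
  can be merged into their sum.\<close>

lemma cyl_uniform:
  assumes "mu ~= []" and c: "!!x e. x : cyl mu ==> e > 0 ==> EX n. ALL y:cyl (pre n x). dist (f x) (f y) < e" and "e > 0"
  shows "EX n. ALL rho:E n mu. ALL x:cyl (mu @ rho). ALL y:cyl (mu @ rho). dist (f x) (f y) < (e :: real)"
proof -
  let ?Q = "%nu. EX n. ALL m>=n. ALL rho:E m nu. ALL x:cyl (nu @ rho). ALL y:cyl (nu @ rho). dist (f x) (f y) < e"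
  have "?Q mu"
  proof (rule bar_induct[OF assms(1)])
    fix nu :: "'e list" assume nu: "nu ~= []" "!!rho. rho : E 1 nu ==> ?Q (nu @ rho)"
    then obtain n where n: "!!rho m tau x y. rho : E 1 nu ==> m >= n rho ==> tau : E m (nu @ rho) ==> x : cyl ((nu @ rho) @ tau)
       ==> y : cyl ((nu @ rho) @ tau) ==> dist (f x) (f y) < e" by metis
    define k where "k = (SUM rho:E 1 nu. n rho)"
    have k: "n rho <= k" if "rho : E 1 nu" for rho
      unfolding k_def using that finite_E1[OF nu(1)] by (intro member_le_sum) auto
    show "?Q nu"
    proof (intro exI[of _ "1 + k"] allI impI ballI)
      fix m rho x y assume a: "m >= 1 + k" "rho : E m nu" "x : cyl (nu @ rho)" "y : cyl (nu @ rho)"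
      then have "rho : E (1 + (m - 1)) nu" by simp
      then obtain rho' tau where "rho' : E 1 nu" "tau : E (m - 1) (nu @ rho')" "rho = rho' @ tau" unfolding E_add by blast
      then show "dist (f x) (f y) < e" using a k[of rho'] by (intro n[of rho' "m - 1" tau]) auto
    qed
  next
    fix x assume x: "x : cyl mu"
    obtain n where n: "ALL y:cyl (pre n x). dist (f x) (f y) < e / 2" using c[OF x, of "e/2"] \<open>e > 0\<close> by auto
    have *: "cyl (pre (n + length mu) x) \<subseteq> cyl (pre n x)" using cyl_append_subset unfolding pre_add by blast
    have "dist (f y) (f z) < e" if "y : cyl (pre n x)" "z : cyl (pre n x)" for y z
      using n that dist_triangle_half_r by blast
    then have "?Q (pre (n + length mu) x)" using * cyl_append_subset by (intro exI[of _ 0]) blast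
    then show "EX n>=length mu. ?Q (pre n x)" by (intro exI[of _ "n + length mu"]) simp
  qed
  then show ?thesis by blast
qed

end

section \<open>Transfer sums and conformal functions\<close>

text \<open>Used with \<phi>, whose cocycle defines the action, and with
  \<open>- \<beta> * \<phi>\<close>, which governs transfer sums and conformality.\<close>

locale pot = pgraph G for G :: "('v, 'e) pre_digraph" +
  fixes u :: "(nat => 'e) => real"
  assumes vr: "e > 0 ==> EX k. ALL x:X. ALL y:X. pre k x = pre k y --> \<bar>u x - u y\<bar> <= e"
begin

abbreviation "bs \<equiv> birkhoff_sum u"

lemma u_bd: assumes "mu ~= []" shows "EX b. ALL x:cyl mu. \<bar>u x\<bar> <= b"
proof -
  have c: "EX n. ALL y:cyl (pre n x). dist (u x) (u y) < e" if x: "x : cyl mu" and e: "e > 0" for x and e :: real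
  proof -
    obtain k where "ALL x:X. ALL y:X. pre k x = pre k y --> \<bar>u x - u y\<bar> <= e / 2" using vr[of "e/2"] e by auto
    then have "ALL y:cyl (pre k x). dist (u x) (u y) < e"
      using e cyl_X[OF x] by (force simp: mem_cyl dist_real_def)
    then show ?thesis ..
  qed
  obtain n where n: "!!rho x y. rho : E n mu ==> x : cyl (mu @ rho) ==> y : cyl (mu @ rho) ==> dist (u x) (u y) < 1" using cyl_uniform[OF assms, of u 1] c zero_less_one by blast
  define p where "p rho = (SOME x. x : cyl (mu @ rho))" for rho
  have p: "p rho : cyl (mu @ rho)" if "rho : E n mu" for rho
  proof -
    have "EX x. x : cyl (mu @ rho)" using that by (auto simp: E_def)
    then show ?thesis unfolding p_def by (rule someI_ex)
  qed
  have "\<bar>u x\<bar> <= 1 + (SUM rho:E n mu. \<bar>u (p rho)\<bar>)" if x: "x : cyl mu" for x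
  proof -
    obtain rho where r: "rho : E n mu" "x : cyl (mu @ rho)" using x unfolding cyl_E[of mu n] by (rule UN_E)
    have "\<bar>u x\<bar> <= 1 + \<bar>u (p rho)\<bar>" using n[OF r p[OF r(1)]] by (simp add: dist_real_def)
    also have "\<bar>u (p rho)\<bar> <= (SUM rho:E n mu. \<bar>u (p rho)\<bar>)"
      using r(1) finite_E[OF assms] by (intro member_le_sum) auto
    finally show ?thesis by simp
  qed
  then show ?thesis by blast
qed

lemma cyl_shift: "x : cyl (\<sigma> @ rho) ==> (shift ^^ length \<sigma>) x : cyl rho"
  by (auto simp: mem_cyl X_shift pre_add)

lemma bs_bd: "n <= length \<sigma> ==> EX b. ALL x:cyl \<sigma>. \<bar>bs n x\<bar> <= b"
proof (induction n arbitrary: \<sigma>)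
  case (Suc n)
  then obtain e rho where s: "\<sigma> = e # rho" "n <= length rho" by (cases \<sigma>) auto
  obtain b where b: "ALL x:cyl rho. \<bar>bs n x\<bar> <= b" using Suc.IH[OF s(2)] ..
  obtain c where c: "ALL x:cyl \<sigma>. \<bar>u x\<bar> <= c" using u_bd s by auto
  have "\<bar>bs (Suc n) x\<bar> <= c + b" if "x : cyl \<sigma>" for x
  proof -
    have "shift x : cyl rho" using cyl_shift[of x "[e]" rho] that s by simp
    then have "\<bar>bs n (shift x)\<bar> <= b" "\<bar>u x\<bar> <= c" using b c that by auto
    then show ?thesis by (simp add: birkhoff_Suc)
  qed
  then show ?case by blast
qed auto

text \<open>The two points still agree on \<open>rho\<close> after \<open>tau\<close>, so each of
  the \<open>length tau\<close> summands differs by at most \<open>e\<close>. The depth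
  \<open>k\<close> does not depend on \<open>tau\<close>; only the error grows with it.\<close>

lemma osc:
  fixes e :: real
  assumes "e > 0"
  shows "EX k>=1. ALL tau rho x y. k <= length rho --> x : cyl (tau @ rho) --> y : cyl (tau @ rho) -->
     \<bar>bs (length tau) x - bs (length tau) y\<bar> <= length tau * e"
proof -
  obtain k where k: "ALL x:X. ALL y:X. pre k x = pre k y --> \<bar>u x - u y\<bar> <= e" using vr[OF assms] ..
  have "\<bar>bs (length tau) x - bs (length tau) y\<bar> <= length tau * e"
    if "Suc k <= length rho" "x : cyl (tau @ rho)" "y : cyl (tau @ rho)" for tau rho x y
    using that(2,3)
  proof (induction tau arbitrary: x y)
    case (Cons a tau)
    have "pre k x = take k (pre (length (a # tau @ rho)) x)" "pre k y = take k (pre (length (a # tau @ rho)) y)"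
      using that(1) by (simp_all add: take_pre)
    then have 1: "\<bar>u x - u y\<bar> <= e" using Cons.prems k by (auto simp: mem_cyl)
    have "shift x : cyl (tau @ rho)" "shift y : cyl (tau @ rho)"
      using cyl_shift[of x "[a]" "tau @ rho"] cyl_shift[of y "[a]" "tau @ rho"] Cons.prems by auto
    from Cons.IH[OF this] 1 show ?case by (simp add: birkhoff_Suc algebra_simps)
  qed simp
  then show ?thesis by (intro exI[of _ "Suc k"]) auto
qed

definition S :: "'e list => nat => (nat => 'e) => 'e list set" where
  "S mu n x = {tau. length tau = n & cat tau x : cyl mu}"

text \<open>The \<open>n\<close>-th iterate of the transfer operator on the indicator of
  \<open>cyl mu\<close>, evaluated at \<open>x\<close>; preimages of \<open>x\<close> are indexed by
  the words glued in front of it.\<close>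

definition Y :: "nat => 'e list => (nat => 'e) => real" where
  "Y n mu x = (SUM tau:S mu n x. exp (bs n (cat tau x)))"

lemma finite_S: assumes "mu ~= []" shows "finite (S mu n x)"
proof (cases n)
  case 0
  have "S mu 0 x \<subseteq> {[]}" by (auto simp: S_def)
  then show ?thesis using 0 finite_subset by auto
next
  case (Suc m)
  have "S mu n x \<subseteq> (%rho. hd mu # rho) ` E m [hd mu]"
  proof
    fix tau assume t: "tau : S mu n x"
    then obtain a rho where a: "tau = a # rho" "length rho = m" using Suc by (auto simp: S_def length_Suc_conv)
    have c: "cat tau x : cyl mu" using t by (simp add: S_def)
    have "a = hd mu" using cyl_nth[OF c, of 0] assms a by (simp add: cat_0 hd_conv_nth)
    moreover have "cat tau x : cyl ([a] @ rho)" using cyl_X[OF c] a by simp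
    ultimately have "cyl ([hd mu] @ rho) ~= {}" by blast
    then have "rho : E m [hd mu]" using a by (simp add: E_def)
    then show "tau : (%rho. hd mu # rho) ` E m [hd mu]" using a \<open>a = hd mu\<close> by auto
  qed
  then show ?thesis using finite_subset finite_imageI[OF finite_E[of "[hd mu]"]] by blast
qed

lemma Y_nonneg: "0 <= Y n mu x" by (simp add: Y_def sum_nonneg)

lemma Y_split: assumes "mu ~= []" shows "Y n mu x = (SUM rho:E k mu. Y n (mu @ rho) x)"
proof -
  have "S mu n x = (UN rho:E k mu. S (mu @ rho) n x)"
    unfolding S_def using cyl_E[of mu k] by auto
  moreover have "ALL rho:E k mu. ALL rho':E k mu. rho ~= rho' --> S (mu @ rho) n x \<inter> S (mu @ rho') n x = {}"
  proof (intro ballI impI)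
    fix rho rho' assume "rho : E k mu" "rho' : E k mu" "rho ~= rho'"
    then have "cyl (mu @ rho) \<inter> cyl (mu @ rho') = {}" by (intro cyl_disj) (auto dest: E_len)
    then show "S (mu @ rho) n x \<inter> S (mu @ rho') n x = {}" unfolding S_def by blast
  qed
  ultimately show ?thesis unfolding Y_def
    by (simp only:) (rule sum.UNION_disjoint, use assms in \<open>auto simp: finite_E finite_S\<close>)
qed

lemma Y_mono: assumes "mu ~= []" shows "Y n (mu @ nu) x <= Y n mu x"
  unfolding Y_def using cyl_append_subset by (intro sum_mono2 finite_S assms) (auto simp: S_def)

lemma cat_cyl_prefix:
  assumes "cyl (\<sigma> @ nu) ~= {}" "nu ~= []" "y : cyl nu" shows "cat \<sigma> y : cyl (\<sigma> @ nu)"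
proof -
  obtain w where w: "cat \<sigma> w : X" "w : cyl nu" using assms(1) unfolding cyl_cat_append by blast
  have "y 0 = w 0" using cyl_nth[OF w(2), of 0] cyl_nth[OF assms(3), of 0] assms(2) by simp
  then show ?thesis using cat_X_cong[OF w(1) cyl_X[OF assms(3)]] assms(3) by simp
qed

lemma Y_append:
  assumes "cyl (\<sigma> @ nu) ~= {}" "nu ~= []"
  shows "Y (length \<sigma> + n) (\<sigma> @ nu) x = (SUM tau:S nu n x. exp (bs (length \<sigma>) (cat \<sigma> (cat tau x))) * exp (bs n (cat tau x)))"
proof -
  have "S (\<sigma> @ nu) (length \<sigma> + n) x = (%tau. \<sigma> @ tau) ` S nu n x"
  proof (intro set_eqI iffI)
    fix tau assume t: "tau : S (\<sigma> @ nu) (length \<sigma> + n) x"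
    then have c: "cat tau x : cyl (\<sigma> @ nu)" and l: "length tau = length \<sigma> + n" by (auto simp: S_def)
    have "take (length \<sigma>) (pre (length tau) (cat tau x)) = pre (length \<sigma>) (cat tau x)" using l by (simp add: take_pre del: pre_cat)
    also have "... = \<sigma>" using cyl_append_subset c by (metis mem_cyl subsetD)
    finally have e: "tau = \<sigma> @ drop (length \<sigma>) tau" by (metis append_take_drop_id pre_cat)
    then have "cat \<sigma> (cat (drop (length \<sigma>) tau) x) : cyl (\<sigma> @ nu)" using c by (metis cat_append)
    then show "tau : (%tau. \<sigma> @ tau) ` S nu n x" using l e by (auto simp: S_def)
  next
    fix tau assume "tau : (%tau. \<sigma> @ tau) ` S nu n x"
    then show "tau : S (\<sigma> @ nu) (length \<sigma> + n) x"
      using cat_cyl_prefix[OF assms] by (auto simp: S_def cat_append)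
  qed
  then show ?thesis by (auto simp: Y_def sum.reindex inj_on_def cat_append birkhoff_append exp_add)
qed

lemma Y_append_bounds:
  assumes "cyl (\<sigma> @ nu) ~= {}" "nu ~= []" "!!x. x : cyl (\<sigma> @ nu) ==> lo <= exp (bs (length \<sigma>) x) & exp (bs (length \<sigma>) x) <= hi"
  shows "lo * Y n nu x <= Y (length \<sigma> + n) (\<sigma> @ nu) x" "Y (length \<sigma> + n) (\<sigma> @ nu) x <= hi * Y n nu x"
proof -
  have *: "cat \<sigma> (cat tau x) : cyl (\<sigma> @ nu)" if "tau : S nu n x" for tau
    using cat_cyl_prefix[OF assms(1,2)] that by (auto simp: S_def)
  show "lo * Y n nu x <= Y (length \<sigma> + n) (\<sigma> @ nu) x" "Y (length \<sigma> + n) (\<sigma> @ nu) x <= hi * Y n nu x"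
    unfolding Y_append[OF assms(1,2)] unfolding Y_def sum_distrib_left
    using assms(3)[OF *] by (auto intro!: sum_mono)
qed

text \<open>The cylinder values of a conformal measure. The last clause stands for the integral
  formula for \<open>m (e # nu)\<close>: bounds with arbitrary \<open>lo\<close> and
  \<open>hi\<close> avoid integration, and applied to fine subdivisions of \<open>nu\<close> they
  determine the integral.\<close>

definition conf :: "('e list => real) => bool" where
  "conf m \<longleftrightarrow> (ALL mu. 0 <= m mu) & (ALL mu. mu ~= [] --> m mu = (SUM rho:E 1 mu. m (mu @ rho))) &
     (ALL e nu lo hi. nu ~= [] --> cyl (e # nu) ~= {} --> (ALL x:cyl (e # nu). lo <= exp (u x) & exp (u x) <= hi) -->
        lo * m nu <= m (e # nu) & m (e # nu) <= hi * m nu)"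

lemma conf_nonneg: "conf m ==> 0 <= m mu" by (simp add: conf_def)
lemma conf_split1: "conf m ==> mu ~= [] ==> m mu = (SUM rho:E 1 mu. m (mu @ rho))" by (simp add: conf_def)
lemma conf_step: "conf m ==> nu ~= [] ==> cyl (e # nu) ~= {} ==> (!!x. x : cyl (e # nu) ==> lo <= exp (u x) & exp (u x) <= hi)
   ==> lo * m nu <= m (e # nu) & m (e # nu) <= hi * m nu" unfolding conf_def by blast

lemma conf_empty: "conf m ==> mu ~= [] ==> cyl mu = {} ==> m mu = 0"
  using conf_split1[of m mu] by (simp add: E_empty)

lemma conf_split: assumes "conf m" "mu ~= []" shows "m mu = (SUM rho:E n mu. m (mu @ rho))"
proof (induction n)
  case 0
  then show ?case using conf_empty[OF assms] by (simp add: E_0)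
next
  case (Suc n)
  have "(SUM rho:E n mu. m (mu @ rho)) = (SUM rho:E n mu. SUM tau:E 1 (mu @ rho). m (mu @ rho @ tau))"
    using conf_split1[OF assms(1)] assms(2) by (intro sum.cong) simp_all
  also have "... = (SUM rho:E (n + 1) mu. m (mu @ rho))" by (rule sum_E_add[OF assms(2), symmetric])
  finally show ?case using Suc by simp
qed

lemma conf_mono: assumes "conf m" "mu ~= []" shows "m (mu @ nu) <= m mu"
proof (cases "cyl (mu @ nu) = {}")
  case True then show ?thesis using conf_empty[OF assms(1), of "mu @ nu"] conf_nonneg[OF assms(1)] assms(2) by simp
next
  case False
  then have "nu : E (length nu) mu" by (simp add: E_def)
  then show ?thesis unfolding conf_split[OF assms, of "length nu"]
    using finite_E[OF assms(2)] conf_nonneg[OF assms(1)] by (intro member_le_sum) auto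
qed

text \<open>The one-edge clause is iterated: at every edge of \<open>tau\<close> at least
  \<open>k\<close> edges still follow, so \<open>exp (u x)\<close> is known up to a factor
  \<open>exp e\<close>.\<close>

lemma conf_approx:
  fixes e :: real
  assumes m: "conf m" and e: "e > 0"
  shows "EX k>=1. ALL tau rho x. k <= length rho --> x : cyl (tau @ rho) -->
     exp (bs (length tau) x - length tau * e) * m rho <= m (tau @ rho) & m (tau @ rho) <= exp (bs (length tau) x + length tau * e) * m rho"
proof -
  obtain k where k: "k >= 1" "!!tau rho x y. k <= length rho ==> x : cyl (tau @ rho) ==> y : cyl (tau @ rho) ==>
     \<bar>bs (length tau) x - bs (length tau) y\<bar> <= length tau * e" using osc[OF e] by metis
  have "exp (bs (length tau) x - length tau * e) * m rho <= m (tau @ rho) & m (tau @ rho) <= exp (bs (length tau) x + length tau * e) * m rho"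
    if "k <= length rho" "x : cyl (tau @ rho)" for tau rho x
    using that(2)
  proof (induction tau arbitrary: x)
    case (Cons a tau)
    let ?n = "length tau"
    have sx: "shift x : cyl (tau @ rho)" using cyl_shift[of x "[a]"] Cons.prems by simp
    note IH = Cons.IH[OF sx]
    have ne: "tau @ rho ~= []" "cyl (a # tau @ rho) ~= {}" using that(1) k(1) Cons.prems by auto
    have b: "exp (u x - e) <= exp (u y) & exp (u y) <= exp (u x + e)" if "y : cyl (a # tau @ rho)" for y
      using k(2)[of "tau @ rho" x "[a]" y] that Cons.prems \<open>k <= length rho\<close> by (auto simp: birkhoff_sum_def)
    have s: "exp (u x - e) * m (tau @ rho) <= m (a # tau @ rho)" "m (a # tau @ rho) <= exp (u x + e) * m (tau @ rho)"
      using conf_step[OF m ne b] by auto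
    have "exp (bs (Suc ?n) x - real (Suc ?n) * e) * m rho = exp (u x - e) * (exp (bs ?n (shift x) - ?n * e) * m rho)"
      by (simp add: birkhoff_Suc algebra_simps flip: exp_add)
    also have "... <= exp (u x - e) * m (tau @ rho)" using IH by simp
    finally have 1: "exp (bs (Suc ?n) x - real (Suc ?n) * e) * m rho <= m (a # tau @ rho)" using s by simp
    have "m (a # tau @ rho) <= exp (u x + e) * (exp (bs ?n (shift x) + ?n * e) * m rho)"
      using s(2) IH by (meson exp_ge_zero mult_left_mono order_trans)
    also have "... = exp (bs (Suc ?n) x + real (Suc ?n) * e) * m rho"
      by (simp add: birkhoff_Suc algebra_simps flip: exp_add)
    finally show ?case using 1 by simp
  qed simp
  then show ?thesis using k(1) by blast
qed

text \<open>Subdividing \<open>rho\<close> by \<open>k\<close> edges makes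
  \<open>conf_approx\<close> available on each piece. The error factor depends on \<open>e\<close>
  and the fixed length of \<open>tau\<close> only, so it disappears as \<open>e\<close> tends to
  0.\<close>

lemma conf_bounds:
  assumes m: "conf m" and r: "rho ~= []" "cyl (tau @ rho) ~= {}"
    and lh: "!!x. x : cyl (tau @ rho) ==> lo <= bs (length tau) x & bs (length tau) x <= hi"
  shows "exp lo * m rho <= m (tau @ rho) & m (tau @ rho) <= exp hi * m rho"
proof -
  let ?n = "length tau"
  have *: "exp (lo - ?n * e) * m rho <= m (tau @ rho) & m (tau @ rho) <= exp (hi + ?n * e) * m rho" if e: "e > 0" for e :: real
  proof -
    obtain k where k: "!!tau rho x. k <= length rho ==> x : cyl (tau @ rho) ==>
     exp (bs (length tau) x - length tau * e) * m rho <= m (tau @ rho) & m (tau @ rho) <= exp (bs (length tau) x + length tau * e) * m rho"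
      using conf_approx[OF m e] by blast
    have t: "exp (lo - ?n * e) * m (rho @ \<sigma>) <= m (tau @ rho @ \<sigma>) & m (tau @ rho @ \<sigma>) <= exp (hi + ?n * e) * m (rho @ \<sigma>)"
      if s: "\<sigma> : E k rho" for \<sigma>
    proof -
      obtain x where x: "x : cyl (tau @ rho @ \<sigma>)" using s E_cat[OF r(2,1)] by (auto simp: E_def)
      have "x : cyl (tau @ rho)" using x cyl_append_subset[of "tau @ rho" \<sigma>] by auto
      note l = lh[OF this]
      have "k <= length (rho @ \<sigma>)" using E_len[OF s] by simp
      note kk = k[OF this x]
      have "exp (lo - ?n * e) * m (rho @ \<sigma>) <= exp (bs ?n x - ?n * e) * m (rho @ \<sigma>)"
        using l conf_nonneg[OF m] by (intro mult_right_mono) auto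
      moreover have "exp (bs ?n x + ?n * e) * m (rho @ \<sigma>) <= exp (hi + ?n * e) * m (rho @ \<sigma>)"
        using l conf_nonneg[OF m] by (intro mult_right_mono) auto
      ultimately show ?thesis using kk by linarith
    qed
    have "m (tau @ rho) = (SUM \<sigma>:E k rho. m (tau @ rho @ \<sigma>))"
      using conf_split[OF m, of "tau @ rho" k] E_cat r by simp
    then show ?thesis unfolding conf_split[OF m r(1), of k] sum_distrib_left using t by (simp add: sum_mono)
  qed
  have l1: "((%e::real. exp (lo - ?n * e) * m rho) \<longlongrightarrow> exp (lo - ?n * (0::real)) * m rho) (at_right 0)"
    and l2: "((%e::real. exp (hi + ?n * e) * m rho) \<longlongrightarrow> exp (hi + ?n * (0::real)) * m rho) (at_right 0)"
    by (intro tendsto_intros)+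
  have ev: "eventually (%e::real. e > 0) (at_right 0)" by (rule eventually_at_right_less)
  have "exp (lo - ?n * (0::real)) * m rho <= m (tau @ rho)"
    by (rule tendsto_upperbound[OF l1 eventually_mono[OF ev]]) (use * in simp_all)
  moreover have "m (tau @ rho) <= exp (hi + ?n * (0::real)) * m rho"
    by (rule tendsto_lowerbound[OF l2 eventually_mono[OF ev]]) (use * in simp_all)
  ultimately show ?thesis by simp
qed

end

locale cpot = pot G u for G :: "('v, 'e) pre_digraph" and u +
  assumes cof: "v : verts G ==> x : X ==> EX mu i. fin_path G v mu (tail G (x i))"
begin

lemma reach:
  assumes "\<kappa> ~= []" "cyl \<kappa> ~= {}" "x : X"
  shows "EX i>=n. EX \<sigma>. cat (\<kappa> @ \<sigma>) ((shift ^^ i) x) : X"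
proof -
  obtain w where w: "cat \<kappa> w : X" using assms(2) cylE by (metis all_not_in_conv)
  have h: "head G (last \<kappa>) = tail G (w 0)"
    using XD(2)[OF w, of "length \<kappa> - 1"] assms(1) by (simp add: cat_def last_conv_nth)
  have "last \<kappa> : arcs G" using last_arc[OF assms(1,2)] assms(1) by auto
  then obtain mu i where m: "fin_path G (head G (last \<kappa>)) mu (tail G ((shift ^^ n) x i))"
    using cof[OF head_verts X_shift[OF assms(3)]] by blast
  have "cat mu ((shift ^^ (n + i)) x) : X & tail G (cat mu ((shift ^^ (n + i)) x) 0) = head G (last \<kappa>)"
    by (rule fin_path_cat[OF m]) (use assms(3) in \<open>auto simp: X_shift, simp add: shift_funpow add.commute\<close>)
  then show ?thesis using cat_X_cong[OF w] h exI[of _ "n + i"] exI[of _ mu] by (auto simp: cat_append)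
qed

text \<open>Cofinality in usable form: an extension of \<kappa> and a prefix of \<open>x\<close> can
  be followed by the same edge \<open>x i\<close>, so quantities at \<kappa> and along
  \<open>x\<close> are both comparable with those at \<open>[x i]\<close>.\<close>

lemma meet:
  assumes "\<kappa> ~= []" "cyl \<kappa> ~= {}" "x : cyl nu"
  obtains i \<sigma> where "i >= length nu" "cyl ((\<kappa> @ \<sigma>) @ [x i]) ~= {}" "cyl (pre i x @ [x i]) ~= {}" "x i : arcs G"
proof -
  have x: "x : X" using assms(3) by (rule cyl_X)
  obtain i \<sigma> where i: "i >= length nu" "cat (\<kappa> @ \<sigma>) ((shift ^^ i) x) : X" using reach[OF assms(1,2) x] by blast
  have "(shift ^^ i) x : cyl [x i]" using X_shift[OF x] by (simp add: mem_cyl pre_Suc shift_funpow)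
  then have "cat (\<kappa> @ \<sigma>) ((shift ^^ i) x) : cyl ((\<kappa> @ \<sigma>) @ [x i])" using i(2) by (simp only: cat_in_cyl_append)
  moreover have "x : cyl (pre i x @ [x i])" using cyl_pre[OF x, of "Suc i"] by (simp add: pre_Suc)
  ultimately show thesis using that i XD(1)[OF x] by blast
qed

text \<open>By \<open>meet\<close>, every path of \<open>cyl nu\<close> has a prefix comparable with
  \<kappa> through a common edge; bar induction merges the constants. The same \<open>C\<close>
  serves all \<open>m\<close>, as the comparison of two conformal functions later requires.\<close>

lemma conf_dom:
  assumes "\<kappa> ~= []" "cyl \<kappa> ~= {}" "nu ~= []"
  shows "EX C>=0. ALL m. conf m --> m nu <= C * m \<kappa>"
proof (rule bar_induct[OF assms(3)])
  fix nu :: "'e list" assume nu: "nu ~= []" "!!rho. rho : E 1 nu ==> EX C>=0. ALL m. conf m --> m (nu @ rho) <= C * m \<kappa>"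
  then obtain C where C: "!!rho m. rho : E 1 nu ==> C rho >= 0 & (conf m --> m (nu @ rho) <= C rho * m \<kappa>)" by metis
  show "EX C>=0. ALL m. conf m --> m nu <= C * m \<kappa>"
  proof (intro exI[of _ "SUM rho:E 1 nu. C rho"] conjI allI impI)
    fix m assume m: "conf m"
    show "m nu <= (SUM rho:E 1 nu. C rho) * m \<kappa>"
      unfolding conf_split1[OF m nu(1)] sum_distrib_right using C m by (intro sum_mono) auto
  qed (use C in \<open>auto intro: sum_nonneg\<close>)
next
  fix x assume "x : cyl nu"
  then obtain i \<sigma> where i: "i >= length nu" "cyl ((\<kappa> @ \<sigma>) @ [x i]) ~= {}" "cyl (pre i x @ [x i]) ~= {}"
    by (rule meet[OF assms(1,2)])
  obtain b where b: "ALL y:cyl (pre i x @ [x i]). \<bar>bs (length (pre i x)) y\<bar> <= b"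
    using bs_bd[of "length (pre i x)" "pre i x @ [x i]"] by auto
  obtain c where c: "ALL y:cyl ((\<kappa> @ \<sigma>) @ [x i]). \<bar>bs (length (\<kappa> @ \<sigma>)) y\<bar> <= c"
    using bs_bd[of "length (\<kappa> @ \<sigma>)" "(\<kappa> @ \<sigma>) @ [x i]"] by auto
  have "m (pre (Suc i) x) <= exp (b + c) * m \<kappa>" if m: "conf m" for m
  proof -
    have b': "- b <= bs (length (pre i x)) y & bs (length (pre i x)) y <= b" if "y : cyl (pre i x @ [x i])" for y
      using b that by auto
    have c': "- c <= bs (length (\<kappa> @ \<sigma>)) y & bs (length (\<kappa> @ \<sigma>)) y <= c" if "y : cyl ((\<kappa> @ \<sigma>) @ [x i])" for y
      using c that by auto
    have "m (pre (Suc i) x) <= exp b * m [x i]"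
      using conf_bounds[OF m _ i(3) b'] by (simp add: pre_Suc)
    moreover have "exp (- c) * m [x i] <= m \<kappa>"
      using conf_bounds[OF m _ i(2) c'] conf_mono[OF m assms(1), of "\<sigma> @ [x i]"] by simp
    then have "m [x i] <= exp c * m \<kappa>" by (simp add: exp_minus field_simps)
    ultimately have "m (pre (Suc i) x) <= exp b * (exp c * m \<kappa>)" by (meson exp_ge_zero mult_left_mono order_trans)
    then show ?thesis by (simp add: exp_add)
  qed
  then show "EX n>=length nu. EX C>=0. ALL m. conf m --> m (pre n x) <= C * m \<kappa>"
    using i(1) by (intro exI[of _ "Suc i"] conjI exI[of _ "exp (b + c)"]) auto
qed

lemma conf_pos:
  assumes "conf m" "nu ~= []" "m nu ~= 0" "\<kappa> ~= []" "cyl \<kappa> ~= {}" shows "m \<kappa> > 0"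
  using conf_dom[OF assms(4,5,2)] assms(4,5,2) assms(1) assms(3) conf_nonneg[OF assms(1), of nu] conf_nonneg[OF assms(1), of \<kappa>] by auto

text \<open>The analogue of \<open>conf_dom\<close> for transfer sums. Exchanging a prefix for
  \<open>\<kappa> @ \<sigma>\<close> changes the number of iterations, so a single index
  \<open>n\<close> turns into a window around it.\<close>

lemma Y_dom:
  assumes "\<kappa> ~= []" "cyl \<kappa> ~= {}" "nu ~= []"
  shows "EX C>=0. EX K J. ALL n>=K. ALL x. Y n nu x <= C * (SUM i:{n-K..n+J}. Y i \<kappa> x)"
proof (rule bar_induct[OF assms(3)])
  fix nu :: "'e list" assume nu: "nu ~= []"
    "!!rho. rho : E 1 nu ==> EX C>=0. EX K J. ALL n>=K. ALL x. Y n (nu @ rho) x <= C * (SUM i:{n-K..n+J}. Y i \<kappa> x)"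
  have "ALL rho:E 1 nu. EX t. 0 <= (fst t :: real) &
    (ALL n>=fst (snd t). ALL x. Y n (nu @ rho) x <= fst t * (SUM i:{n-fst (snd t)..n+snd (snd t)}. Y i \<kappa> x))"
  proof
    fix rho assume "rho : E 1 nu"
    from nu(2)[OF this] obtain C K J where "C >= 0" "ALL n>=K. ALL x. Y n (nu @ rho) x <= C * (SUM i:{n-K..n+J}. Y i \<kappa> x)"
      by blast
    then show "EX t. 0 <= (fst t :: real) &
      (ALL n>=fst (snd t). ALL x. Y n (nu @ rho) x <= fst t * (SUM i:{n-fst (snd t)..n+snd (snd t)}. Y i \<kappa> x))"
      by (intro exI[of _ "(C, K, J)"]) simp
  qed
  from bchoice[OF this] obtain t where t: "ALL rho:E 1 nu. 0 <= (fst (t rho) :: real) &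
    (ALL n>=fst (snd (t rho)). ALL x. Y n (nu @ rho) x <= fst (t rho) * (SUM i:{n-fst (snd (t rho))..n+snd (snd (t rho))}. Y i \<kappa> x))" ..
  define C where "C rho = fst (t rho)" for rho
  define K where "K rho = fst (snd (t rho))" for rho
  define J where "J rho = snd (snd (t rho))" for rho
  have C: "C rho >= (0::real)" "n >= K rho ==> Y n (nu @ rho) x <= C rho * (SUM i:{n-K rho..n+J rho}. Y i \<kappa> x)"
    if "rho : E 1 nu" for rho n x
    using bspec[OF t that] by (simp_all add: C_def K_def J_def)
  define k where "k = (SUM rho:E 1 nu. K rho)" define j where "j = (SUM rho:E 1 nu. J rho)"
  have kj: "K rho <= k" "J rho <= j" if "rho : E 1 nu" for rho
    unfolding k_def j_def using that finite_E1[OF nu(1)] by (auto intro!: member_le_sum)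
  show "EX C>=0. EX K J. ALL n>=K. ALL x. Y n nu x <= C * (SUM i:{n-K..n+J}. Y i \<kappa> x)"
  proof (rule exI[of _ "SUM rho:E 1 nu. C rho"], rule conjI, rule sum_nonneg, rule C(1), assumption,
      rule exI[of _ k], rule exI[of _ j], intro allI impI)
    fix n x assume n: "k <= n"
    show "Y n nu x <= (SUM rho:E 1 nu. C rho) * (SUM i:{n-k..n+j}. Y i \<kappa> x)"
      unfolding Y_split[OF nu(1), of n x 1] sum_distrib_right[of C]
    proof (rule sum_mono)
      fix rho assume r: "rho : E 1 nu"
      have "Y n (nu @ rho) x <= C rho * (SUM i:{n-K rho..n+J rho}. Y i \<kappa> x)" using kj(1)[OF r] n by (intro C(2)[OF r]) simp
      also have "... <= C rho * (SUM i:{n-k..n+j}. Y i \<kappa> x)"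
        using kj[OF r] C(1)[OF r] by (intro mult_left_mono sum_mono2) (auto simp: Y_nonneg)
      finally show "Y n (nu @ rho) x <= C rho * (SUM i:{n-k..n+j}. Y i \<kappa> x)" .
    qed
  qed
next
  fix x assume "x : cyl nu"
  then obtain i \<sigma> where i: "i >= length nu" "cyl ((\<kappa> @ \<sigma>) @ [x i]) ~= {}" "cyl (pre i x @ [x i]) ~= {}"
    by (rule meet[OF assms(1,2)])
  obtain b where b: "ALL y:cyl (pre i x @ [x i]). \<bar>bs (length (pre i x)) y\<bar> <= b"
    using bs_bd[of "length (pre i x)" "pre i x @ [x i]"] by auto
  obtain c where c: "ALL y:cyl ((\<kappa> @ \<sigma>) @ [x i]). \<bar>bs (length (\<kappa> @ \<sigma>)) y\<bar> <= c"
    using bs_bd[of "length (\<kappa> @ \<sigma>)" "(\<kappa> @ \<sigma>) @ [x i]"] by auto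
  let ?l = "length (\<kappa> @ \<sigma>)"
  have "Y n (pre (Suc i) x) y <= exp (b + c) * (SUM q:{n-i..n+?l}. Y q \<kappa> y)" if n: "n >= i" for n y
  proof -
    have b': "exp (- b) <= exp (bs (length (pre i x)) y) & exp (bs (length (pre i x)) y) <= exp b" if "y : cyl (pre i x @ [x i])" for y
      using b that by auto
    have c': "exp (- c) <= exp (bs ?l y) & exp (bs ?l y) <= exp c" if "y : cyl ((\<kappa> @ \<sigma>) @ [x i])" for y
      using c that by auto
    have "Y (length (pre i x) + (n - i)) (pre i x @ [x i]) y <= exp b * Y (n - i) [x i] y"
      by (rule Y_append_bounds(2)[OF i(3) _ b']) auto
    then have 1: "Y n (pre (Suc i) x) y <= exp b * Y (n - i) [x i] y" using n by (simp add: pre_Suc)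
    have "exp (- c) * Y (n - i) [x i] y <= Y (?l + (n - i)) ((\<kappa> @ \<sigma>) @ [x i]) y"
      by (rule Y_append_bounds(1)[OF i(2) _ c']) auto
    also have "... <= Y (?l + (n - i)) \<kappa> y" using Y_mono[OF assms(1), of _ "\<sigma> @ [x i]"] by simp
    also have "... <= (SUM q:{n-i..n+?l}. Y q \<kappa> y)" by (intro member_le_sum) (auto simp: Y_nonneg)
    finally have "Y (n - i) [x i] y <= exp c * (SUM q:{n-i..n+?l}. Y q \<kappa> y)" by (simp add: exp_minus field_simps)
    then have "exp b * Y (n - i) [x i] y <= exp b * (exp c * (SUM q:{n-i..n+?l}. Y q \<kappa> y))" by simp
    from order_trans[OF 1 this] show ?thesis by (simp only: exp_add)
  qed
  then show "EX n>=length nu. EX C>=0. EX K J. ALL p>=K. ALL y. Y p (pre n x) y <= C * (SUM i:{p-K..p+J}. Y i \<kappa> y)"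
    by (rule_tac exI[of _ "Suc i"], rule_tac conjI, use i(1) in simp, rule_tac exI[of _ "exp (b + c)"],
      rule_tac conjI, simp, rule_tac exI[of _ i], rule_tac exI[of _ ?l]) blast
qed

end

section \<open>Existence of conformal functions\<close>

context cpot
begin

text \<open>
  Conformal functions as limits of normalised sums \<open>\<Sum>\<^sub>n \<lambda>\<^sup>n L\<^sup>n\<close> at points whose mass escapes.
\<close>

lemma exist_conf:
  fixes lam :: "nat => real" and x :: "nat => nat => 'e"
  assumes k: "\<kappa> ~= []" "cyl \<kappa> ~= {}" and lam: "!!j. 0 < lam j" "!!j. lam j <= 1" "lam ----> 1"
    and sm: "!!j mu. mu ~= [] ==> summable (%n. lam j ^ n * Y n mu (x j))"
    and pos: "!!j. 0 < (\<Sum>n. lam j ^ n * Y n \<kappa> (x j))"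
    and esc: "!!e. (%j. indicator (cyl [e]) (x j) / (\<Sum>n. lam j ^ n * Y n \<kappa> (x j))) ----> 0"
  shows "EX m. conf m & m \<kappa> = 1"
proof -
  define N where "N j = (\<Sum>n. lam j ^ n * Y n \<kappa> (x j))" for j
  define M where "M j mu = (\<Sum>n. lam j ^ n * Y n mu (x j)) / N j" for j mu
  \<comment> \<open>A bound for the normalised term \<open>n = 0\<close>, the only defect of
    conformality in \<open>M j\<close>.\<close>
  define d where "d e = (%j. indicator (cyl [e]) (x j) / N j)" for e
  have N: "N j > 0" for j using pos by (simp add: N_def)
  have d0: "d e ----> 0" for e using esc by (simp add: d_def N_def)
  have d1: "EX D>=0. ALL j. d e j <= D" for e
    using Bseq_def convergentI[OF d0[of e], THEN convergent_imp_Bseq] by (metis abs_ge_self less_imp_le order_trans real_norm_def)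
  \<comment> \<open>A positive sequence tending to 1 is bounded away from 0; the lower estimates
    need this uniformly in \<open>j\<close>.\<close>
  obtain K where K: "K > 0" "!!j. \<bar>inverse (lam j)\<bar> <= K" using tendsto_inverse[OF lam(3)] convergent_imp_Bseq by (force simp: convergent_def Bseq_def)
  have lam2: "1 / K <= lam j" for j using K(2)[of j] K(1) lam(1)[of j] by (simp add: field_simps)
  have tn: "0 <= lam j ^ n * Y n mu (x j)" for j n mu using lam(1)[of j] Y_nonneg by simp
  have M0: "0 <= M j mu" if "mu ~= []" for j mu
    unfolding M_def using N[of j] suminf_nonneg[OF sm[OF that] tn] by simp
  have Mk: "M j \<kappa> = 1" for j using N[of j] by (simp add: M_def N_def)
  have Msplit: "M j mu = (SUM rho:E 1 mu. M j (mu @ rho))" if "mu ~= []" for j mu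
  proof -
    have "(\<Sum>n. lam j ^ n * Y n mu (x j)) = (\<Sum>n. SUM rho:E 1 mu. lam j ^ n * Y n (mu @ rho) (x j))"
      unfolding Y_split[OF that, of _ _ 1] sum_distrib_left ..
    also have "... = (SUM rho:E 1 mu. \<Sum>n. lam j ^ n * Y n (mu @ rho) (x j))"
      by (rule suminf_sum) (use that in \<open>auto intro: sm\<close>)
    finally show ?thesis unfolding M_def by (simp add: sum_divide_distrib)
  qed
  have Mmono: "M j (mu @ nu) <= M j mu" if "mu ~= []" for j mu nu
    unfolding M_def using N[of j] lam(1)[of j] that
    by (intro divide_right_mono suminf_le mult_left_mono Y_mono sm) auto
  \<comment> \<open>Term \<open>n\<close> for \<open>nu\<close> is compared with term
    \<open>Suc n\<close> for \<open>e # nu\<close>: the index shift produces the factor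
    \<open>lam j\<close>, and the term 0 for \<open>e # nu\<close> remains over.\<close>
  have Mstep: "lo * (lam j * M j nu) <= M j (e # nu) & M j (e # nu) <= d e j + hi * (lam j * M j nu)"
    if n: "nu ~= []" "cyl (e # nu) ~= {}" and b: "!!y. y : cyl (e # nu) ==> lo <= exp (u y) & exp (u y) <= hi" for j nu e lo hi
  proof -
    let ?f = "%n. lam j ^ n * Y n (e # nu) (x j)" and ?g = "%n. lam j ^ n * Y n nu (x j)"
    have b': "lo <= exp (bs (length [e]) y) & exp (bs (length [e]) y) <= hi" if "y : cyl ([e] @ nu)" for y
      using b that by (simp add: birkhoff_sum_def)
    have st: "lo * Y n nu (x j) <= Y (Suc n) (e # nu) (x j)" "Y (Suc n) (e # nu) (x j) <= hi * Y n nu (x j)" for n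
      using Y_append_bounds[OF _ n(1) b', of n "x j"] n(2) by simp_all
    have sf: "summable ?f" "summable ?g" "summable (%n. ?f (Suc n))" using sm n(1) summable_Suc_iff[of ?f] by auto
    have h: "suminf ?f = ?f 0 + (\<Sum>n. ?f (Suc n))" using suminf_split_head[OF sf(1)] by simp
    have "lo * lam j * suminf ?g = (\<Sum>n. lo * lam j * ?g n)" by (rule suminf_mult[OF sf(2), symmetric])
    also have "... <= (\<Sum>n. ?f (Suc n))"
    proof (rule suminf_le)
      show "lo * lam j * ?g n <= ?f (Suc n)" for n
        using mult_left_mono[OF st(1)[of n], of "lam j ^ Suc n"] lam(1)[of j] by (simp add: mult_ac)
    qed (use sf summable_mult in auto)
    finally have l: "lo * lam j * suminf ?g <= (\<Sum>n. ?f (Suc n))" .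
    have "(\<Sum>n. ?f (Suc n)) <= (\<Sum>n. hi * lam j * ?g n)"
    proof (rule suminf_le)
      show "?f (Suc n) <= hi * lam j * ?g n" for n
        using mult_left_mono[OF st(2)[of n], of "lam j ^ Suc n"] lam(1)[of j] by (simp add: mult_ac)
    qed (use sf summable_mult in auto)
    also have "... = hi * lam j * suminf ?g" by (rule suminf_mult[OF sf(2)])
    finally have r: "(\<Sum>n. ?f (Suc n)) <= hi * lam j * suminf ?g" .
    have S0: "S (e # nu) 0 (x j) \<subseteq> (if x j : cyl [e] then {[]} else {})"
      using cyl_append_subset[of "[e]" nu] by (auto simp: S_def)
    have f0: "0 <= ?f 0" "?f 0 <= indicator (cyl [e]) (x j)"
      using S0 sum_mono2[OF _ S0, of "%tau. exp (bs 0 (cat tau (x j)))"]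
      by (auto simp: Y_def split: if_splits)
    have "lo * lam j * suminf ?g / N j <= suminf ?f / N j" using l h f0(1) N[of j] by (intro divide_right_mono) auto
    moreover have "suminf ?f / N j <= (indicator (cyl [e]) (x j) + hi * lam j * suminf ?g) / N j"
      using r h f0(2) N[of j] by (intro divide_right_mono) auto
    ultimately show ?thesis by (simp add: M_def d_def add_divide_distrib)
  qed
  have Mempty: "M j mu = 0" if "mu ~= []" "cyl mu = {}" for j mu using Msplit[OF that(1)] E_empty[OF that(2)] by simp
  have ubd: "EX b. ALL y:cyl (e # nu). exp (- b) <= exp (u y) & exp (u y) <= exp b" for e nu
  proof -
    obtain b where "ALL y:cyl (e # nu). \<bar>u y\<bar> <= b" using u_bd by blast
    then show ?thesis by (intro exI[of _ b]) auto
  qed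
  have up: "EX C1>=0. EX C2>=0. ALL j. M j (\<sigma> @ [f]) <= C1 + C2 * M j [f]" if "cyl (\<sigma> @ [f]) ~= {}" for \<sigma> f
    using that
  proof (induction \<sigma>)
    case Nil
    then show ?case by (intro exI[of _ 0] conjI exI[of _ 1]) auto
  next
    case (Cons e \<sigma>)
    have "cyl (\<sigma> @ [f]) ~= {}" using Cons.prems cyl_shift[of _ "[e]" "\<sigma> @ [f]"] by fastforce
    from Cons.IH[OF this] obtain C1 C2 where C: "C1 >= 0" "C2 >= 0" "ALL j. M j (\<sigma> @ [f]) <= C1 + C2 * M j [f]" by blast
    obtain b where b: "ALL y:cyl (e # \<sigma> @ [f]). exp (- b) <= exp (u y) & exp (u y) <= exp b" using ubd by blast
    obtain D where D: "D >= 0" "ALL j. d e j <= D" using d1 by blast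
    have "M j ((e # \<sigma>) @ [f]) <= (D + exp b * C1) + exp b * C2 * M j [f]" for j
    proof -
      have "M j (e # \<sigma> @ [f]) <= d e j + exp b * (lam j * M j (\<sigma> @ [f]))"
        using Mstep[of "\<sigma> @ [f]" e "exp (- b)" "exp b" j] b Cons.prems by simp
      also have "... <= D + exp b * (1 * (C1 + C2 * M j [f]))"
        using D C lam(2) lam(1) M0
        by (intro add_mono mult_left_mono mult_mono) auto
      finally show ?thesis by (simp add: algebra_simps)
    qed
    moreover have "0 <= D + exp b * C1" "0 <= exp b * C2" using C D by auto
    ultimately show ?case by blast
  qed
  have low: "EX c>0. ALL j. c * M j [f] <= M j (\<sigma> @ [f])" if "cyl (\<sigma> @ [f]) ~= {}" for \<sigma> f
    using that
  proof (induction \<sigma>)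
    case Nil
    then show ?case by (intro exI[of _ 1]) auto
  next
    case (Cons e \<sigma>)
    have "cyl (\<sigma> @ [f]) ~= {}" using Cons.prems cyl_shift[of _ "[e]" "\<sigma> @ [f]"] by fastforce
    from Cons.IH[OF this] obtain c where c: "c > 0" "ALL j. c * M j [f] <= M j (\<sigma> @ [f])" by blast
    obtain b where b: "ALL y:cyl (e # \<sigma> @ [f]). exp (- b) <= exp (u y) & exp (u y) <= exp b" using ubd by blast
    have "exp (- b) * (1 / K * c) * M j [f] <= M j ((e # \<sigma>) @ [f])" for j
    proof -
      have "exp (- b) * (1 / K * (c * M j [f])) <= exp (- b) * (lam j * M j (\<sigma> @ [f]))"
        using lam2 c M0 lam(1)[of j] by (intro mult_left_mono mult_mono) auto
      also have "... <= M j (e # \<sigma> @ [f])"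
        using Mstep[of "\<sigma> @ [f]" e "exp (- b)" "exp b" j] b Cons.prems by simp
      finally show ?thesis by (simp add: mult.assoc)
    qed
    moreover have "0 < exp (- b) * (1 / K * c)" using c K(1) by simp
    ultimately show ?case by blast
  qed
  \<comment> \<open>From a prefix of \<open>y\<close> down to the edge \<open>y i\<close> by
    \<open>up\<close>, and from there to \<kappa> by \<open>low\<close>, where
    \<open>M j \<kappa> = 1\<close> for all \<open>j\<close>.\<close>
  have bdd: "EX C. ALL j. M j nu <= C" if "nu ~= []" for nu
  proof (rule bar_induct[OF that])
    fix nu :: "'e list" assume nu: "nu ~= []" "!!rho. rho : E 1 nu ==> EX C. ALL j. M j (nu @ rho) <= C"
    then obtain C where "!!rho j. rho : E 1 nu ==> M j (nu @ rho) <= C rho" by metis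
    then show "EX C. ALL j. M j nu <= C"
      unfolding Msplit[OF nu(1)] by (intro exI[of _ "SUM rho:E 1 nu. C rho"] allI sum_mono)
  next
    fix y assume "y : cyl nu"
    then obtain i \<sigma> where i: "i >= length nu" "cyl ((\<kappa> @ \<sigma>) @ [y i]) ~= {}" "cyl (pre i y @ [y i]) ~= {}"
      by (rule meet[OF k])
    obtain C1 C2 where C: "C2 >= 0" "!!j. M j (pre i y @ [y i]) <= C1 + C2 * M j [y i]" using up[OF i(3)] by blast
    obtain c where c: "c > 0" "!!j. c * M j [y i] <= M j ((\<kappa> @ \<sigma>) @ [y i])" using low[OF i(2)] by blast
    have "M j (pre (Suc i) y) <= C1 + C2 * (1 / c)" for j
    proof -
      have "M j [y i] <= 1 / c" using c(2)[of j] Mmono[OF k(1), of j "\<sigma> @ [y i]"] Mk c(1) by (auto simp: field_simps)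
      then have "C2 * M j [y i] <= C2 * (1 / c)" using C(1) by (rule mult_left_mono)
      then show ?thesis using C(2)[of j] unfolding pre_Suc by linarith
    qed
    then show "EX n>=length nu. EX C. ALL j. M j (pre n y) <= C" using i(1) le_SucI by blast
  qed
  then obtain C where C: "!!mu j. mu ~= [] ==> M j mu <= C mu" by metis
  \<comment> \<open>The diagonal extraction wants a countable family bounded by 1: words over
    \<open>arcs G\<close>, divided by \<open>1 + C mu\<close>. On all other non-empty words
    \<open>M j\<close> vanishes.\<close>
  define T where "T = lists (arcs G) - {[]}"
  have "norm (M j mu / (1 + C mu)) <= 1" if "mu : T" for j mu
    using C[of mu j] M0[of mu j] that by (auto simp: T_def)
  moreover have "countable T" using cnt by (simp add: T_def)
  ultimately obtain r where r: "strict_mono r" "!!mu. mu : T ==> EX l. (%j. M (r j) mu / (1 + C mu)) ----> l"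
    using function_convergent_subsequence[of T "%j mu. M j mu / (1 + C mu)" 1] by blast
  have conv: "EX l. (%j. M (r j) mu) ----> l" if m: "mu ~= []" for mu
  proof (cases "mu : T")
    case True
    from r(2)[OF this] obtain l where "(%j. M (r j) mu / (1 + C mu)) ----> l" ..
    then have "(%j. (1 + C mu) * (M (r j) mu / (1 + C mu))) ----> (1 + C mu) * l" by (intro tendsto_intros)
    moreover have "1 + C mu ~= 0" using C[OF m, of 0] M0[OF m, of 0] by linarith
    ultimately show ?thesis by auto
  next
    case False
    then show ?thesis using last_arc m Mempty by (force simp: T_def)
  qed
  \<comment> \<open>For the empty word \<open>conf\<close> asks only for a non-negative value; 0 is
    the default.\<close>
  define m where "m mu = (if mu = [] then 0 else lim (%j. M (r j) mu))" for mu
  have m: "(%j. M (r j) mu) ----> m mu" if "mu ~= []" for mu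
    using conv[OF that] that by (auto simp: m_def limI)
  have lamr: "(%j. lam (r j)) ----> 1" using LIMSEQ_subseq_LIMSEQ[OF lam(3) r(1)] by (simp add: o_def)
  have dr: "(%j. d e (r j)) ----> 0" for e using LIMSEQ_subseq_LIMSEQ[OF d0 r(1)] by (simp add: o_def)
  have "conf m" unfolding conf_def
  proof (intro conjI allI impI)
    show "0 <= m mu" for mu
    proof (cases "mu = []")
      case False then show ?thesis using M0 by (intro LIMSEQ_le_const[OF m[OF False]]) simp
    qed (simp add: m_def)
    fix mu :: "'e list" assume n: "mu ~= []"
    have "(%j. SUM rho:E 1 mu. M (r j) (mu @ rho)) ----> (SUM rho:E 1 mu. m (mu @ rho))"
      using n by (intro tendsto_sum m) auto
    then have "(%j. M (r j) mu) ----> (SUM rho:E 1 mu. m (mu @ rho))" unfolding Msplit[OF n, symmetric] .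
    then show "m mu = (SUM rho:E 1 mu. m (mu @ rho))" by (rule LIMSEQ_unique[OF m[OF n]])
  next
    fix e nu lo hi assume a: "nu ~= []" "cyl (e # nu) ~= {}" "ALL x:cyl (e # nu). lo <= exp (u x) & exp (u x) <= hi"
    have st: "lo * (lam j * M j nu) <= M j (e # nu)" "M j (e # nu) <= d e j + hi * (lam j * M j nu)" for j using Mstep[OF a(1,2) bspec[OF a(3)]] by auto
    have L: "(%j. lo * (lam (r j) * M (r j) nu)) ----> lo * (1 * m nu)" by (intro tendsto_intros lamr m a)
    have U: "(%j. d e (r j) + hi * (lam (r j) * M (r j) nu)) ----> 0 + hi * (1 * m nu)" by (intro tendsto_intros lamr m a dr)
    have e: "(%j. M (r j) (e # nu)) ----> m (e # nu)" by (rule m) simp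
    show "lo * m nu <= m (e # nu)" using LIMSEQ_le[OF L e] st(1) by simp
    show "m (e # nu) <= hi * m nu" using LIMSEQ_le[OF e U] st(2) by simp
  qed
  moreover have "m \<kappa> = 1" using m[OF k(1)] unfolding Mk LIMSEQ_const_iff by simp
  ultimately show ?thesis by blast
qed

end

subsection \<open>Pressure and the growth of transfer sums\<close>

lemma limsup_root_le:
  fixes a :: "nat => real"
  assumes "!!n. a n <= C * s ^ n" "s > 0"
  shows "limsup (%n. ereal (root n (a n))) <= ereal s"
proof -
  \<comment> \<open>A positive constant, so that \<open>root n D\<close> tends to 1.\<close>
  define D where "D = max C 1"
  have D: "D > 0" "a n <= D * s ^ n" for n
  proof -
    show "D > 0" by (simp add: D_def)
    have "C * s ^ n <= D * s ^ n" using assms(2) by (intro mult_right_mono) (auto simp: D_def)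
    then show "a n <= D * s ^ n" using assms(1)[of n] by simp
  qed
  have "(%n. root n D * s) ----> 1 * s" by (intro tendsto_intros LIMSEQ_root_const D)
  then have l: "(%n. ereal (root n D * s)) ----> ereal s" by simp
  have "eventually (%n. ereal (root n (a n)) <= ereal (root n D * s)) sequentially"
  proof (rule eventually_sequentiallyI[of 1])
    fix n :: nat assume n: "1 <= n"
    have "root n (a n) <= root n (D * s ^ n)" using n D(2) by (intro real_root_le_mono) auto
    also have "... = root n D * s" using n assms(2) by (simp add: real_root_mult real_root_power_cancel)
    finally show "ereal (root n (a n)) <= ereal (root n D * s)" by simp
  qed
  then have "limsup (%n. ereal (root n (a n))) <= limsup (%n. ereal (root n D * s))" by (rule Limsup_mono)
  also have "... = ereal s" using l by (intro lim_imp_Limsup) auto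
  finally show ?thesis .
qed

lemma limsup_root_less:
  fixes a :: "nat => real"
  assumes "limsup (%n. ereal (root n (a n))) < ereal s" "s > 0" "!!n. 0 <= a n"
  shows "EX C. ALL n. a n <= C * s ^ n"
proof -
  have "eventually (%n. ereal (root n (a n)) < ereal s) sequentially" using assms(1) by (rule Limsup_lessD)
  then obtain n0 where n0: "!!n. n >= n0 ==> root n (a n) < s" unfolding eventually_sequentially by auto
  let ?C = "1 + (SUM i<=n0. a i / s ^ i)"
  have q: "0 <= a i / s ^ i" for i using assms(2,3) by simp
  have "a n <= ?C * s ^ n" for n
  proof (cases "n <= n0")
    case True
    have "a n / s ^ n <= (SUM i<=n0. a i / s ^ i)" using True q by (intro member_le_sum) auto
    then have "a n / s ^ n <= ?C" by simp
    then show ?thesis using assms(2) by (simp add: field_simps)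
  next
    case False
    then have "root n (a n) ^ n <= s ^ n" using n0[of n] assms(3) by (intro power_mono) auto
    then have "a n <= s ^ n" using False assms(3) by (simp add: real_root_pow_pos2)
    also have "... <= ?C * s ^ n" using q assms(2) by (auto simp: sum_nonneg)
    finally show ?thesis .
  qed
  then show ?thesis by blast
qed

lemma elog_le: assumes "a <= ereal s" "s > 0" shows "elog a <= ereal (ln s)"
  using assms by (cases a) (auto simp: elog_def)

lemma elog_less: assumes "elog a < ereal (ln s)" "s > 0" shows "a < ereal s"
proof (cases "a <= 0")
  case True
  then show ?thesis using assms(2) by (meson ereal_less(2) le_less_trans)
next
  case False
  then obtain r where r: "a = ereal r" "r > 0" using assms by (cases a) (auto simp: elog_def)
  then show ?thesis using assms by (auto simp: elog_def)
qed

context pot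
begin

definition SF :: "'e set => nat => (nat => 'e) => 'e list set" where
  "SF F n x = (UN e:F. S [e] n x)"

lemma finite_SF: "finite F ==> finite (SF F n x)" by (auto simp: SF_def finite_S)

lemma SF_Suc: "{tau : SF F (Suc n) x. cat [last tau] x = y} = (%tau. tau @ [y 0]) ` SF F n y"
  if "y = cat [a] x" for y
proof (intro set_eqI iffI)
  fix tau assume t: "tau : {tau : SF F (Suc n) x. cat [last tau] x = y}"
  then have l: "length tau = Suc n" by (auto simp: SF_def S_def)
  then obtain \<sigma> b where s: "tau = \<sigma> @ [b]" by (metis append_butlast_last_id length_0_conv nat.distinct(1))
  show "tau : (%tau. tau @ [y 0]) ` SF F n y" using t s by (auto simp: cat_0 SF_def S_def cat_append)
next
  fix tau assume "tau : (%tau. tau @ [y 0]) ` SF F n y"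
  then obtain \<sigma> where s: "tau = \<sigma> @ [y 0]" "\<sigma> : SF F n y" by blast
  have "y = cat [y 0] x" using that by (simp add: cat_0)
  then show "tau : {tau : SF F (Suc n) x. cat [last tau] x = y}" using s by (auto simp: SF_def S_def cat_append)
qed

text \<open>Of the preimages of \<open>x\<close> only the finite set \<open>T\<close> contributes,
  namely those through which a word leads into the support of \<open>f\<close>. The words of length
  \<open>Suc n\<close> are grouped by their last edge, the one glued to \<open>x\<close>.\<close>

lemma transfer_formula:
  assumes F: "finite F" and f: "!!x. x ~: (UN e:F. cyl [e]) ==> f x = 0" and x: "x : X"
  shows "(transfer_op G u ^^ n) f x = (SUM tau:SF F n x. exp (bs n (cat tau x)) * f (cat tau x))"
  using x
proof (induction n arbitrary: x)
  case 0
  have "SF F 0 x = (if x : (UN e:F. cyl [e]) then {[]} else {})" by (auto simp: SF_def S_def)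
  then show ?case using f by auto
next
  case (Suc n)
  define H where "H y = exp (u y) * (SUM tau:SF F n y. exp (bs n (cat tau y)) * f (cat tau y))" for y
  define T where "T = (%tau. cat [last tau] x) ` SF F (Suc n) x"
  have fT: "finite T" using finite_SF[OF F] by (simp add: T_def)
  have y: "y = cat [y 0] x" if "shift y = x" for y
    using cat_pre[of 1 y] that by (simp add: pre_Suc)
  have TX: "T \<subseteq> {y : X. shift y = x}"
  proof
    fix y assume "y : T"
    then obtain tau where t: "tau : SF F (Suc n) x" "y = cat [last tau] x" by (auto simp: T_def)
    then have "length tau = Suc n" by (auto simp: SF_def S_def)
    then have "tau = butlast tau @ [last tau]" by (intro append_butlast_last_id[symmetric]) auto
    moreover have "cat tau x : X" using t(1) cyl_X by (auto simp: SF_def S_def)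
    ultimately have "cat [last tau] x : X" by (metis cat_X_tail cat_append)
    then show "y : {y : X. shift y = x}" using t by simp
  qed
  have "(transfer_op G u ^^ Suc n) f x = (\<Sum>\<^sub>\<infinity>y\<in>{y : X. shift y = x}. H y)"
    unfolding funpow.simps comp_apply transfer_op_def[of G u "(transfer_op G u ^^ n) f"]
    by (rule infsum_cong) (simp add: Suc.IH H_def)
  also have "... = (\<Sum>\<^sub>\<infinity>y\<in>T. H y)"
  proof (rule infsum_cong_neutral)
    fix z assume z: "z : {y : X. shift y = x} - T"
    have "SF F n z = {}"
    proof (rule ccontr)
      assume "SF F n z ~= {}"
      then have "{tau : SF F (Suc n) x. cat [last tau] x = z} ~= {}" using SF_Suc[of z "z 0" x F n] y z by auto
      then show False using z by (auto simp: T_def)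
    qed
    then show "H z = 0" by (simp add: H_def)
  qed (use TX in auto)
  also have "... = (SUM y:T. H y)" using fT by simp
  also have "... = (SUM y:T. \<Sum>tau | tau : SF F (Suc n) x & cat [last tau] x = y. exp (bs (Suc n) (cat tau x)) * f (cat tau x))"
  proof (rule sum.cong[OF refl])
    fix z assume z: "z : T"
    then have yz: "z = cat [z 0] x" using TX y by blast
    have st: "bs (Suc n) (cat tau z) = bs n (cat tau z) + u z" if "tau : SF F n z" for tau
    proof -
      have "length tau = n" using that by (auto simp: SF_def S_def)
      then show ?thesis using birkhoff_append[of u tau 1 z] by (simp add: birkhoff_sum_def)
    qed
    have "(\<Sum>tau | tau : SF F (Suc n) x & cat [last tau] x = z. exp (bs (Suc n) (cat tau x)) * f (cat tau x))
      = (SUM tau:SF F n z. exp (bs (Suc n) (cat tau z)) * f (cat tau z))"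
      unfolding SF_Suc[OF yz, of F n] by (subst sum.reindex) (auto simp: inj_on_def cat_append yz[symmetric])
    also have "... = H z" unfolding H_def sum_distrib_left by (intro sum.cong) (auto simp: st exp_add)
    finally show "H z = (\<Sum>tau | tau : SF F (Suc n) x & cat [last tau] x = z. exp (bs (Suc n) (cat tau x)) * f (cat tau x))" ..
  qed
  also have "... = (SUM tau:SF F (Suc n) x. exp (bs (Suc n) (cat tau x)) * f (cat tau x))"
    using sum.group[OF finite_SF[OF F, of "Suc n" x] fT, of "%tau. cat [last tau] x"] by (simp add: T_def)
  finally show ?case .
qed

text \<open>A test function is at most a constant on finitely many edge cylinders and exceeds half
  of some positive value on a small cylinder. The growth of its iterates is thus enclosed between
  that of transfer sums.\<close>

lemma test_bounds:
  assumes f: "f : Cc (path_topology G)" "!!x. 0 <= (f x :: real)" "EX x. f x ~= 0"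
  obtains F B mu \<epsilon> where "finite F" "F \<subseteq> arcs G" "B >= 0"
      "!!n x. x : X ==> (transfer_op G u ^^ n) f x <= B * (SUM e:F. Y n [e] x)"
      "!!n x. x : X ==> 0 <= (transfer_op G u ^^ n) f x"
      "mu ~= []" "cyl mu ~= {}" "\<epsilon> > 0" "!!n x. x : X ==> \<epsilon> * Y n mu x <= (transfer_op G u ^^ n) f x"
proof -
  obtain K where K: "compactin (path_topology G) K" "!!x. x ~: K ==> f x = 0" and c: "continuous_map (path_topology G) euclidean f"
    using f(1) by (auto simp: Cc_def)
  obtain F where F: "finite F" "F \<subseteq> arcs G" "K \<subseteq> (UN e:F. cyl [e])" using compactin_path_cover[OF K(1)] by blast
  have f0: "f x = 0" if "x ~: (UN e:F. cyl [e])" for x using K(2) F(3) that by blast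
  obtain B where B: "!!y. y : f ` K ==> norm y <= B" using image_compactin[OF K(1) c] compact_imp_bounded[of "f ` K"] by (auto simp: bounded_iff)
  define B' where "B' = max B 0"
  have B': "f x <= B'" for x using B[of "f x"] K(2) by (cases "x : K") (auto simp: B'_def)
  have tf: "(transfer_op G u ^^ n) f x = (SUM tau:SF F n x. exp (bs n (cat tau x)) * f (cat tau x))" if "x : X" for n x
    by (rule transfer_formula[OF F(1) _ that]) (rule f0)
  have U1: "(transfer_op G u ^^ n) f x <= B' * (SUM e:F. Y n [e] x)" if "x : X" for n x
  proof -
    have "(transfer_op G u ^^ n) f x <= (SUM tau:SF F n x. B' * exp (bs n (cat tau x)))"
      unfolding tf[OF that] using B' by (intro sum_mono) (simp add: mult.commute)
    also have "... = B' * (SUM tau:SF F n x. exp (bs n (cat tau x)))" by (simp add: sum_distrib_left)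
    also have "... <= B' * (SUM e:F. Y n [e] x)"
    proof (rule mult_left_mono)
      show "(SUM tau:SF F n x. exp (bs n (cat tau x))) <= (SUM e:F. Y n [e] x)"
        unfolding SF_def Y_def using F(1) cyl_disj[of "[_]" "[_]"]
        by (subst sum.UNION_disjoint) (auto simp: finite_S, auto simp: S_def)
    qed (simp add: B'_def)
    finally show ?thesis .
  qed
  obtain x0 where x0: "f x0 ~= 0" using f(3) by blast
  then have fx0: "f x0 > 0" using f(2)[of x0] by simp
  have x0X: "x0 : X" using f0 x0 cyl_X by blast
  have "openin (path_topology G) {x : topspace (path_topology G). f x : {f x0 / 2 <..}}"
    by (rule openin_continuous_map_preimage[OF c]) simp
  then obtain k where k: "cyl (pre k x0) \<subseteq> {x : X. f x : {f x0 / 2 <..}}"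
    unfolding openin_path_iff using x0X fx0 by force
  define mu where "mu = pre (Suc k) x0"
  have "cyl mu \<subseteq> cyl (pre k x0)" unfolding mu_def pre_Suc by (rule cyl_append_subset)
  then have mf: "f x0 / 2 < f x" if "x : cyl mu" for x using k that by auto
  have L1: "(f x0 / 2) * Y n mu x <= (transfer_op G u ^^ n) f x" if "x : X" for n x
  proof -
    have sub: "S mu n x \<subseteq> SF F n x"
    proof
      fix tau assume t: "tau : S mu n x"
      then show "tau : SF F n x" using mf fx0 f0 by (force simp: S_def SF_def)
    qed
    have "(f x0 / 2) * Y n mu x <= (SUM tau:S mu n x. exp (bs n (cat tau x)) * f (cat tau x))"
      unfolding Y_def sum_distrib_left
    proof (rule sum_mono)
      fix tau assume "tau : S mu n x"
      then show "f x0 / 2 * exp (bs n (cat tau x)) <= exp (bs n (cat tau x)) * f (cat tau x)" using mf[of "cat tau x"] by (auto simp: S_def)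
    qed
    also have "... <= (SUM tau:SF F n x. exp (bs n (cat tau x)) * f (cat tau x))"
      using sub f(2) by (intro sum_mono2 finite_SF F) auto
    finally show ?thesis unfolding tf[OF that] .
  qed
  have P: "0 <= (transfer_op G u ^^ n) f x" if "x : X" for n x
    unfolding tf[OF that] using f(2) by (intro sum_nonneg) auto
  show thesis
    by (rule that[OF F(1,2) _ U1 P _ _ _ L1]) (use fx0 x0X cyl_pre[of x0 "Suc k"] in \<open>auto simp: B'_def mu_def\<close>)
qed

lemma indicator_Cc: assumes "mu ~= []" shows "(indicator (cyl mu) :: _ => real) : Cc (path_topology G)"
proof -
  have "openin (path_topology G) (X - cyl mu)"
  proof -
    have "cyl (pre (length mu) x) \<subseteq> X - cyl mu" if "x : X - cyl mu" for x
      using that by (auto simp: mem_cyl)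
    then show ?thesis unfolding openin_path_iff by blast
  qed
  moreover have "openin (path_topology G) (cyl mu)" by (rule openin_cyl)
  moreover have "openin (path_topology G) X" using openin_topspace[of "path_topology G"] by simp
  ultimately have "openin (path_topology G) {x : X. indicator (cyl mu) x : U}" for U :: "real set"
  proof -
    have "{x : X. (indicator (cyl mu) x :: real) : U} =
       (if 1 : U then (if 0 : U then X else cyl mu) else (if 0 : U then X - cyl mu else {}))"
      using cyl_X by (auto simp: indicator_def split: if_splits)
    then show ?thesis using \<open>openin (path_topology G) X\<close> \<open>openin (path_topology G) (cyl mu)\<close>
      \<open>openin (path_topology G) (X - cyl mu)\<close> by simp
  qed
  then show ?thesis using compactin_cyl[OF assms] by (auto simp: continuous_map Cc_def)
qed

text \<open>Stands for pressure at most \<open>ln s\<close>: it implies this inequality and is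
  implied by the strict one. The constant may depend on the point and on the edge.\<close>

definition gr :: "real => bool" where
  "gr s \<longleftrightarrow> (ALL x:X. ALL e:arcs G. EX C. ALL n. Y n [e] x <= C * s ^ n)"

text \<open>The very choice made inside \<open>pressure\<close>, given a name.\<close>

definition test :: "(nat => 'e) => real" where
  "test = (SOME f. f : Cc (path_topology G) & (ALL x. 0 <= f x) & (EX x. f x ~= 0))"

lemma test: assumes "verts G ~= {}"
  shows "test : Cc (path_topology G)" "0 <= test x" "EX x. test x ~= 0"
    "pressure G u = (SUP x\<in>X. pressure_at G u test x)"
proof -
  obtain v where "v : verts G" using assms by blast
  then obtain x where x: "x : X" using ex_path by blast
  have "EX f. f : Cc (path_topology G) & (ALL x. 0 <= f x) & (EX x. f x ~= (0::real))"
  proof (intro exI[of _ "indicator (cyl [x 0])"] conjI exI[of _ x])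
    show "indicator (cyl [x 0]) x ~= (0::real)" using cyl_pre[OF x, of 1] by (simp add: pre_Suc)
  qed (auto intro: indicator_Cc)
  from someI_ex[OF this] show "test : Cc (path_topology G)" "0 <= test x" "EX x. test x ~= 0" for x
    unfolding test_def by blast+
  show "pressure G u = (SUP x\<in>X. pressure_at G u test x)" by (simp add: pressure_def test_def)
qed

lemma pressure_le: assumes "verts G ~= {}" "gr s" "s > 0" shows "pressure G u <= ereal (ln s)"
proof -
  obtain F B where F: "finite F" "F \<subseteq> arcs G" "B >= 0"
      "!!n x. x : X ==> (transfer_op G u ^^ n) test x <= B * (SUM e:F. Y n [e] x)"
    using test_bounds[OF test(1-3)[OF assms(1)]] by metis
  have "pressure_at G u test x <= ereal (ln s)" if x: "x : X" for x
  proof -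
    have "ALL e:F. EX C. ALL n. Y n [e] x <= C * s ^ n" using assms(2) x F(2) by (auto simp: gr_def)
    from bchoice[OF this] obtain C where C: "ALL e:F. ALL n. Y n [e] x <= C e * s ^ n" ..
    have "(transfer_op G u ^^ n) test x <= B * (SUM e:F. C e) * s ^ n" for n
    proof -
      have "(SUM e:F. Y n [e] x) <= (SUM e:F. C e * s ^ n)" using C by (intro sum_mono) auto
      then have "B * (SUM e:F. Y n [e] x) <= B * ((SUM e:F. C e) * s ^ n)"
        using F(3) by (intro mult_left_mono) (auto simp: sum_distrib_right)
      then show ?thesis using F(4)[OF x, of n] by (simp add: mult.assoc)
    qed
    from limsup_root_le[OF this assms(3)] show ?thesis unfolding pressure_at_def by (rule elog_le) fact
  qed
  then show ?thesis unfolding test(4)[OF assms(1)] by (rule SUP_least)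
qed

end

context cpot
begin

text \<open>By \<open>Y_dom\<close> the growth on one cylinder controls that on every other, at the
  cost of a window of indices of fixed size; the finitely many \<open>n\<close> below
  \<open>K\<close> are absorbed into the constant.\<close>

lemma gr_of_one:
  assumes "\<kappa> ~= []" "cyl \<kappa> ~= {}" "s > 0" "!!n. Y n \<kappa> x <= C * s ^ n" "nu ~= []"
  shows "EX D. ALL n. Y n nu x <= D * s ^ n"
proof -
  obtain A K J where A: "A >= 0" "!!n. n >= K ==> Y n nu x <= A * (SUM i:{n-K..n+J}. Y i \<kappa> x)"
    using Y_dom[OF assms(1,2,5)] by blast
  \<comment> \<open>Bounds the effect of moving the exponent of \<open>s\<close> by one in either
    direction, whether \<open>s\<close> lies above or below 1.\<close>
  define q where "q = max s (1 / s)"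
  have q: "q >= 1" using assms(3) by (cases "s >= 1") (auto simp: q_def le_max_iff_disj)
  have C: "0 <= C" using order_trans[OF Y_nonneg assms(4)[of 0]] by simp
  have st: "s ^ i <= s ^ n * q ^ (K + J)" if "i : {n-K..n+J}" "n >= K" for i n
  proof (cases "i >= n")
    case True
    then have "s ^ i = s ^ n * s ^ (i - n)" by (simp flip: power_add)
    also have "s ^ (i - n) <= q ^ (i - n)" using assms(3) by (intro power_mono) (auto simp: q_def)
    also have "q ^ (i - n) <= q ^ (K + J)" using that q by (intro power_increasing) auto
    finally show ?thesis using assms(3) by simp
  next
    case False
    have "s ^ i = s ^ n * (1 / s) ^ (n - i)" using False assms(3) by (simp add: power_diff power_one_over)
    also have "(1 / s) ^ (n - i) <= q ^ (n - i)" using assms(3) by (intro power_mono) (auto simp: q_def)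
    also have "q ^ (n - i) <= q ^ (K + J)" using that q by (intro power_increasing) auto
    finally show ?thesis using assms(3) by simp
  qed
  define D where "D = A * (real (K + J + 1) * (C * q ^ (K + J)))"
  define D' where "D' = D + (\<Sum>i<K. Y i nu x / s ^ i)"
  have D: "0 <= D" using A C q by (auto simp: D_def)
  have r: "0 <= Y i nu x / s ^ i" for i using Y_nonneg assms(3) by simp
  have "Y n nu x <= D' * s ^ n" for n
  proof (cases "n >= K")
    case True
    have "(SUM i:{n-K..n+J}. Y i \<kappa> x) <= (SUM i:{n-K..n+J}. C * (s ^ n * q ^ (K + J)))"
    proof (rule sum_mono)
      fix i assume "i : {n-K..n+J}"
      then show "Y i \<kappa> x <= C * (s ^ n * q ^ (K + J))"
        using order_trans[OF assms(4)[of i] mult_left_mono[OF st[OF _ True] C]] by blast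
    qed
    also have "... = real (K + J + 1) * (C * q ^ (K + J)) * s ^ n" using True by (simp add: algebra_simps)
    finally have "A * (SUM i:{n-K..n+J}. Y i \<kappa> x) <= A * (real (K + J + 1) * (C * q ^ (K + J)) * s ^ n)"
      using A(1) by (intro mult_left_mono) auto
    then have "Y n nu x <= D * s ^ n" using A(2)[OF True] by (simp add: D_def)
    also have "... <= D' * s ^ n" using r assms(3) by (intro mult_right_mono) (auto simp: D'_def sum_nonneg)
    finally show ?thesis .
  next
    case False
    have "Y n nu x / s ^ n <= (\<Sum>i<K. Y i nu x / s ^ i)" using False r by (intro member_le_sum) auto
    then have "Y n nu x / s ^ n <= D'" using D by (simp add: D'_def)
    then show ?thesis using assms(3) by (simp add: field_simps)
  qed
  then show ?thesis by blast
qed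

lemma pressure_less: assumes "verts G ~= {}" "pressure G u < ereal (ln s)" "s > 0" shows "gr s"
  unfolding gr_def
proof (intro ballI)
  fix x e assume x: "x : X" and e: "e : arcs G"
  obtain mu \<epsilon> where F: "!!n x. x : X ==> 0 <= (transfer_op G u ^^ n) test x"
    and M: "mu ~= []" "cyl mu ~= {}" "\<epsilon> > 0" "!!n x. x : X ==> \<epsilon> * Y n mu x <= (transfer_op G u ^^ n) test x"
    using test_bounds[OF test(1-3)[OF assms(1)]] by metis
  have "pressure_at G u test x <= pressure G u" unfolding test(4)[OF assms(1)] using x by (rule SUP_upper)
  then have "elog (limsup (%n. ereal (root n ((transfer_op G u ^^ n) test x)))) < ereal (ln s)"
    using assms(2) unfolding pressure_at_def by (rule le_less_trans)
  from limsup_root_less[OF elog_less[OF this assms(3)] assms(3)] obtain C where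
    C: "!!n. (transfer_op G u ^^ n) test x <= C * s ^ n" using F[OF x] by blast
  have "Y n mu x <= (C / \<epsilon>) * s ^ n" for n using M(4)[OF x, of n] C[of n] M(3) by (auto simp: field_simps)
  from gr_of_one[OF M(1,2) assms(3) this] show "EX C. ALL n. Y n [e] x <= C * s ^ n" by blast
qed

lemma pressure_le_0_iff: assumes "verts G ~= {}" shows "pressure G u <= 0 \<longleftrightarrow> (ALL s>1. gr s)"
proof
  assume P: "pressure G u <= 0"
  show "ALL s>1. gr s" using le_less_trans[OF P] pressure_less[OF assms] by simp
next
  assume g: "ALL s>1. gr s"
  show "pressure G u <= 0"
  proof (rule ccontr)
    assume "~pressure G u <= 0"
    then obtain e where e: "0 < ereal e" "ereal e < pressure G u" using ereal_dense2[of 0 "pressure G u"] by (auto simp: not_le)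
    then have "gr (exp e)" using g by simp
    from pressure_le[OF assms this] e show False by simp
  qed
qed

text \<open>The words \<open>tau\<close> of \<open>S [e] (Suc n) x\<close>, each followed by a fixed
  prefix \<open>rho\<close> of \<open>x\<close>, give disjoint pieces of \<open>cyl [e]\<close> of
  total mass at most \<open>m [e]\<close>. Each has mass at least
  \<open>exp (bs (Suc n) (cat tau x)) * m rho\<close>, up to an error which for
  \<open>\<epsilon> = ln s\<close> is exactly \<open>s ^ Suc n\<close>.\<close>

lemma conf_gr: assumes m: "conf m" "m nu ~= 0" "nu ~= []" and s: "s > 1" shows "gr s"
  unfolding gr_def
proof (intro ballI)
  fix x e assume x: "x : X" and e: "e : arcs G"
  define \<epsilon> where "\<epsilon> = ln s"
  have ep: "\<epsilon> > 0" using s by (simp add: \<epsilon>_def)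
  obtain k where k: "k >= 1" "!!tau rho x. k <= length rho ==> x : cyl (tau @ rho) ==>
     exp (bs (length tau) x - length tau * \<epsilon>) * m rho <= m (tau @ rho)" using conf_approx[OF m(1) ep] by metis
  define rho where "rho = pre k x"
  have r: "rho ~= []" "cyl rho ~= {}" "x : cyl rho" using k(1) cyl_pre[OF x, of k] by (auto simp: rho_def)
  have mr: "m rho > 0" using conf_pos[OF m(1,3,2) r(1,2)] .
  have "Y (Suc n) [e] x <= (m [e] / m rho) * s ^ Suc n" for n
  proof -
    have "Y (Suc n) [e] x * m rho = (SUM tau:S [e] (Suc n) x. exp (bs (Suc n) (cat tau x)) * m rho)"
      by (simp add: Y_def sum_distrib_right)
    also have "... <= (SUM tau:S [e] (Suc n) x. s ^ Suc n * m (tau @ rho))"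
    proof (rule sum_mono)
      fix tau assume t: "tau : S [e] (Suc n) x"
      then have l: "length tau = Suc n" "cat tau x : cyl (tau @ rho)" using r(3) cyl_X by (auto simp: S_def)
      have "exp (real (Suc n) * \<epsilon>) = s ^ Suc n" using s by (simp only: exp_of_nat_mult \<epsilon>_def) simp
      moreover have "exp (bs (Suc n) (cat tau x)) * m rho = exp (real (Suc n) * \<epsilon>) * (exp (bs (Suc n) (cat tau x) - real (Suc n) * \<epsilon>) * m rho)"
        by (simp flip: exp_add)
      moreover have "exp (bs (Suc n) (cat tau x) - real (Suc n) * \<epsilon>) * m rho <= m (tau @ rho)"
        using k(2)[OF _ l(2)] l(1) by (simp add: rho_def)
      ultimately show "exp (bs (Suc n) (cat tau x)) * m rho <= s ^ Suc n * m (tau @ rho)"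
        using s
        by (simp only:) simp
    qed
    also have "... = s ^ Suc n * (SUM tau:S [e] (Suc n) x. m (tau @ rho))" by (simp add: sum_distrib_left)
    also have "... <= s ^ Suc n * m [e]"
    proof (rule mult_left_mono)
      have "(SUM tau:S [e] (Suc n) x. m (tau @ rho)) = (SUM \<sigma>:(%tau. tl tau @ rho) ` S [e] (Suc n) x. m ([e] @ \<sigma>))"
      proof -
        have h: "tau = e # tl tau" if "tau : S [e] (Suc n) x" for tau
          using that cyl_nth[of "cat tau x" "[e]" 0] by (cases tau) (auto simp: S_def cat_0)
        have "inj_on (%tau. tl tau @ rho) (S [e] (Suc n) x)"
        proof (rule inj_onI)
          fix a b assume ab: "a : S [e] (Suc n) x" "b : S [e] (Suc n) x" "tl a @ rho = tl b @ rho"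
          then show "a = b" using h[OF ab(1)] h by simp
        qed
        then show ?thesis using h by (subst sum.reindex) (auto intro!: sum.cong, metis append_Cons)
      qed
      also have "... <= (SUM \<sigma>:E (n + k) [e]. m ([e] @ \<sigma>))"
      proof (rule sum_mono2)
        show "(%tau. tl tau @ rho) ` S [e] (Suc n) x \<subseteq> E (n + k) [e]"
        proof
          fix \<sigma> assume "\<sigma> : (%tau. tl tau @ rho) ` S [e] (Suc n) x"
          then obtain tau where t: "tau : S [e] (Suc n) x" "\<sigma> = tl tau @ rho" by blast
          have h: "tau = e # tl tau" using t(1) cyl_nth[of "cat tau x" "[e]" 0] by (cases tau) (auto simp: S_def cat_0)
          have c: "cat tau x : X" "length tau = Suc n" using t(1) cyl_X by (auto simp: S_def)
          then have "cat tau x : cyl (tau @ rho)" using r(3) by simp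
          moreover have "[e] @ \<sigma> = tau @ rho" using h t(2) by (metis append_Cons append_Nil)
          ultimately have "cyl ([e] @ \<sigma>) ~= {}" by (metis empty_iff)
          then show "\<sigma> : E (n + k) [e]" using c(2) t(2) by (simp add: E_def rho_def)
        qed
      qed (use finite_E conf_nonneg[OF m(1)] in auto)
      also have "... = m [e]" using conf_split[OF m(1), of "[e]" "n + k"] by simp
      finally show "(SUM tau:S [e] (Suc n) x. m (tau @ rho)) <= m [e]" .
    qed (use s in simp)
    finally show ?thesis using mr by (simp add: field_simps)
  qed
  then have "Y n [e] x <= (m [e] / m rho + Y 0 [e] x) * s ^ n" for n
  proof (cases n)
    case 0
    then show ?thesis using conf_nonneg[OF m(1)] by simp
  next
    case (Suc k)
    have "(m [e] / m rho) * s ^ n <= (m [e] / m rho + Y 0 [e] x) * s ^ n" using s Y_nonneg by (intro mult_right_mono) auto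
    then show ?thesis using \<open>!!n. Y (Suc n) [e] x <= (m [e] / m rho) * s ^ Suc n\<close>[of k] Suc by simp
  qed
  then show "EX C. ALL n. Y n [e] x <= C * s ^ n" by blast
qed

lemma conf_pressure: "verts G ~= {} ==> conf m ==> m nu ~= 0 ==> nu ~= [] ==> pressure G u <= 0"
  using pressure_le_0_iff conf_gr by blast

end

subsection \<open>Non-wandering vertices\<close>

context pgraph
begin

text \<open>Reachability is phrased through infinite paths, to which \<open>shift\<close>,
  \<open>cat\<close> and \<open>pre\<close> apply directly; every finite path extends to one because
  no vertex is a sink.\<close>

definition R :: "'v => 'v => bool" where
  "R v w \<longleftrightarrow> (EX x:X. EX n>0. tail G (x 0) = v & tail G (x n) = w)"

lemma R_I: "x : X ==> i < n ==> R (tail G (x i)) (tail G (x n))"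
  unfolding R_def using X_shift
  by (intro bexI[of _ "(shift ^^ i) x"] exI[of _ "n - i"]) (auto simp: shift_funpow)

lemma fin_path_R: assumes "fin_path G v mu w" "w : verts G" shows "R v w"
proof -
  obtain y where y: "y : X" "tail G (y 0) = w" using ex_path[OF assms(2)] by blast
  have "cat mu y : X & tail G (cat mu y 0) = v" by (rule fin_path_cat[OF assms(1) y])
  moreover have "cat mu y (length mu) = y 0" by (simp add: cat_def)
  moreover have "length mu > 0" using assms(1) by (simp add: fin_path_def)
  ultimately show ?thesis using y unfolding R_def by (metis)
qed

lemma R_trans: assumes "R v w" "R w z" shows "R v z"
proof -
  obtain x n where x: "x : X" "n > 0" "tail G (x 0) = v" "tail G (x n) = w" using assms(1) by (auto simp: R_def)
  obtain y m where y: "y : X" "m > 0" "tail G (y 0) = w" "tail G (y m) = z" using assms(2) by (auto simp: R_def)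
  have "cat (pre n x) ((shift ^^ n) x) : X" using x by simp
  then have "cat (pre n x) y : X" by (rule cat_X_cong) (use x y in \<open>auto simp: shift_funpow\<close>)
  moreover have "cat (pre n x) y 0 = x 0" "cat (pre n x) y (n + m) = y m" using x(2) by (auto simp: cat_def)
  ultimately show ?thesis using x y unfolding R_def by (metis add_gr_0)
qed

lemma R_verts: "R v w ==> v : verts G & w : verts G"
  unfolding R_def using XD(1) tail_verts by metis

lemma NW_iff: "v : NW G \<longleftrightarrow> R v v"
proof
  assume "v : NW G"
  then show "R v v" using fin_path_R by (auto simp: NW_def)
next
  assume r: "R v v"
  then obtain x n where x: "x : X" "n > 0" "tail G (x 0) = v" "tail G (x n) = v" by (auto simp: R_def)
  then show "v : NW G" using pre_fin_path[OF x(1,2)] R_verts[OF r] by (auto simp: NW_def)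
qed

lemma periodic_path: assumes "R v v" obtains p n where "p : X" "n > 0" "!!i. tail G (p (i * n)) = v"
proof -
  obtain x n where x: "x : X" "n > 0" "tail G (x 0) = v" "tail G (x n) = v" using assms by (auto simp: R_def)
  define p where "p i = x (i mod n)" for i
  have "p : X" using mod_Suc x(1) x(3,4) by (auto simp: p_def inf_paths_def)
  then show thesis using that x by (simp add: p_def)
qed

end

context cpot
begin

lemma R_cof: assumes "v : verts G" "x : X" shows "EX i. R v (tail G (x i))"
  using cof[OF assms] fin_path_R XD(1)[OF assms(2)] tail_verts by blast

text \<open>Cofinality is applied to the periodic path around the loop at \<open>w\<close>: every
  tail of it returns to \<open>w\<close>.\<close>

lemma NW_reach: assumes "v : verts G" "R w w" shows "R v w"
proof -
  obtain p n where p: "p : X" "n > 0" "!!i. tail G (p (i * n)) = w" using periodic_path[OF assms(2)] by metis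
  obtain i where i: "R v (tail G (p i))" using R_cof[OF assms(1) p(1)] ..
  have "i < (i + 1) * n" using p(2) by (cases n) auto
  from R_I[OF p(1) this] show ?thesis by (metis p(3) R_trans i)
qed

text \<open>\<open>w\<close> reaches \<open>v\<close> by \<open>NW_reach\<close>, which closes a
  loop at \<open>w\<close>.\<close>

lemma NW_her: assumes "R v v" "R v w" shows "R w w"
  using NW_reach[OF _ assms(1), of w] R_verts assms(2) R_trans by blast

lemma NW_her_path: assumes "x : X" "R (tail G (x 0)) (tail G (x 0))" shows "R (tail G (x i)) (tail G (x i))"
  using NW_her[OF assms(2) R_I[OF assms(1), of 0 i]] assms(2) by auto

lemma NW_enter: assumes "R v v" "x : X" shows "EX i. R (tail G (x i)) (tail G (x i))"
  using R_cof[OF _ assms(2), of v] R_verts[OF assms(1)] NW_her[OF assms(1)] by blast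

lemma connect: assumes "e : arcs G" "x : X" "R (head G e) (tail G (x 0))"
  shows "EX \<sigma>. cat (e # \<sigma>) x : X"
proof -
  obtain y n where y: "y : X" "n > 0" "tail G (y 0) = head G e" "tail G (y n) = tail G (x 0)"
    using assms(3) by (auto simp: R_def)
  have "cat (pre n y) ((shift ^^ n) y) : X" using y by simp
  then have c: "cat (pre n y) x : X" by (rule cat_X_cong) (use assms y in \<open>auto simp: shift_funpow\<close>)
  have "cat [e] (cat (pre n y) x) : X"
    unfolding cat1_X using c assms(1) y(2,3) by (simp add: cat_def)
  then show ?thesis using cat_Cons by metis
qed

lemma connect_Y: assumes "cat (e # \<sigma>) x : X" shows "Y (length (e # \<sigma>)) [e] x > 0"
proof -
  have "e # \<sigma> : S [e] (length (e # \<sigma>)) x"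
    using assms cat_Cons[of e \<sigma> x]
    by (simp add: S_def)
  then show ?thesis unfolding Y_def using finite_S by (intro sum_pos2[of _ "e # \<sigma>"]) auto
qed

lemma summable_lam:
  assumes g: "gr s" and s: "s > 0" "0 < l" "l * s < 1" and x: "x : X" and m: "mu ~= []"
  shows "summable (%n. l ^ n * Y n mu x)"
proof (cases "cyl mu = {}")
  case True
  then show ?thesis by (simp add: Y_def S_def)
next
  case False
  then obtain C where C: "!!n. Y n [hd mu] x <= C * s ^ n" using last_arc[OF m] m g x by (force simp: gr_def)
  have "summable (%n. C * (l * s) ^ n)" using s by (intro summable_mult summable_geometric) auto
  then show ?thesis
  proof (rule summable_comparison_test'[where N = 0])
    fix n
    show "norm (l ^ n * Y n mu x) <= C * (l * s) ^ n" using Y_mono[of "[hd mu]" n "tl mu" x] m C[of n] s Y_nonneg by (auto simp: power_mult_distrib)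
  qed
qed

lemma summable_gr1:
  assumes "ALL s>1. gr s" "0 < l" "l < 1" "x : X" "mu ~= []" shows "summable (%n. l ^ n * Y n mu x)"
proof -
  obtain s where s: "1 < s" "s < 1 / l" using dense[of 1 "1 / l"] assms(2,3) by auto
  show ?thesis by (rule summable_lam[of s]) (use assms s in \<open>auto simp: field_simps\<close>)
qed

text \<open>The offset 2 makes the value at \<open>j = 0\<close> equal to 1/2, so all values lie
  strictly between 0 and 1.\<close>

abbreviation "lamseq j \<equiv> 1 - 1 / (real j + 2)"

lemma lamseq: "0 < lamseq j" "lamseq j < 1" "(%j. lamseq j) ----> 1"
proof -
  show "0 < lamseq j" "lamseq j < 1" by auto
  have "(%j. 1 / (real j + 2)) ----> 0"
    using LIMSEQ_ignore_initial_segment[OF LIMSEQ_inverse_real_of_nat, of 1] by (simp add: inverse_eq_divide add.commute)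
  from tendsto_diff[OF tendsto_const this, of 1] show "(%j. lamseq j) ----> 1" by simp
qed

lemma suminf_Y_pos:
  assumes "summable (%n. l ^ n * Y n [e] x)" "l > 0" "cat (e # \<sigma>) x : X"
  shows "0 < (\<Sum>n. l ^ n * Y n [e] x)"
  using connect_Y[OF assms(3)] assms(2) Y_nonneg
  by (intro suminf_pos2[OF assms(1), of "length (e # \<sigma>)"]) auto

text \<open>Paths starting at infinitely many distinct vertices of \<open>NW\<close> leave every
  edge cylinder. Each of these vertices is reached from \<open>e0\<close>, so the normalising sums
  are positive; the growth hypothesis makes them converge for every factor below 1.\<close>

lemma exists_conf_infinite:
  assumes inf: "infinite (NW G)" and g: "ALL s>1. gr s"
  shows "EX m. conf m & (EX mu. mu ~= [] & m mu ~= 0)"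
proof -
  obtain w :: "nat => 'v" where w: "inj w" "range w \<subseteq> NW G" using infinite_countable_subset[OF inf] by blast
  have wR: "R (w j) (w j)" for j using w(2) by (auto simp flip: NW_iff)
  have "ALL j. EX x. x : X & tail G (x 0) = w j" using ex_path R_verts[OF wR] by blast
  then obtain x where x: "!!j. x j : X" "!!j. tail G (x j 0) = w j" by metis
  define e0 where "e0 = x 0 0"
  have e0: "e0 : arcs G" using XD(1)[OF x(1)] by (simp add: e0_def)
  have "EX m. conf m & m [e0] = 1"
  proof (rule exist_conf)
    show "cyl [e0] ~= {}" by (rule cyl_arc_ne[OF e0])
    show "summable (%n. lamseq j ^ n * Y n mu (x j))" if "mu ~= []" for j mu
      by (rule summable_gr1[OF g lamseq(1,2) x(1) that])
    show "0 < (\<Sum>n. lamseq j ^ n * Y n [e0] (x j))" for j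
      using NW_reach[OF head_verts[OF e0] wR] connect[OF e0 x(1)] suminf_Y_pos summable_gr1[OF g lamseq(1,2) x(1)] lamseq by (force simp: x(2))
    show "(%j. indicator (cyl [e]) (x j) / (\<Sum>n. lamseq j ^ n * Y n [e0] (x j))) ----> 0" for e
    proof (cases "EX j. x j : cyl [e]")
      case True
      then obtain j0 where j0: "x j0 : cyl [e]" ..
      have "indicator (cyl [e]) (x j) = (0::real)" if "j > j0" for j
      proof -
        have "x j ~: cyl [e]"
        proof
          assume "x j : cyl [e]"
          then have "x j 0 = x j0 0" using j0 cyl_nth[of "x j" "[e]" 0] cyl_nth[of "x j0" "[e]" 0] by simp
          then show False using x(2)[of j] x(2) w(1) that by (auto simp: inj_def)
        qed
        then show ?thesis by simp
      qed
      then have "eventually (%j. indicator (cyl [e]) (x j) / (\<Sum>n. lamseq j ^ n * Y n [e0] (x j)) = 0) sequentially"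
        by (intro eventually_sequentiallyI[of "Suc j0"]) simp
      then show ?thesis by (rule tendsto_eventually)
    next
      case False
      then show ?thesis by simp
    qed
    show "lamseq j <= 1" for j by simp
  qed (use lamseq in auto)
  then show ?thesis by (metis list.discI zero_neq_one)
qed

lemma exists_conf_wandering:
  assumes nw: "NW G = {}" and ne: "verts G ~= {}"
  shows "EX m. conf m & (EX mu. mu ~= [] & m mu ~= 0)"
proof -
  have nR: "~R v v" for v using nw NW_iff by blast
  obtain p where p: "p : X" using ne ex_path by blast
  \<comment> \<open>At least one edge is removed, so the word leading from \<open>e0\<close> to
    \<open>x j\<close> is non-empty.\<close>
  define x where "x j = (shift ^^ Suc j) p" for j
  have x: "x j : X" for j by (simp only: x_def X_shift[OF p])
  have fin: "EX n0. ALL n>=n0. S nu n y = {}" if n: "nu ~= []" and y: "y : X" for nu y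
  proof (rule bar_induct[OF n])
    fix nu :: "'e list" assume nu: "nu ~= []" "!!rho. rho : E 1 nu ==> EX n0. ALL n>=n0. S (nu @ rho) n y = {}"
    then have "ALL rho:E 1 nu. EX n0. ALL n>=n0. S (nu @ rho) n y = {}" by blast
    from bchoice[OF this] obtain t where t: "ALL rho:E 1 nu. ALL n>=t rho. S (nu @ rho) n y = {}" ..
    have "S nu n y = {}" if n: "n >= (SUM rho:E 1 nu. t rho)" for n
    proof -
      have "S (nu @ rho) n y = {}" if "rho : E 1 nu" for rho
      proof -
        have "t rho <= (SUM rho:E 1 nu. t rho)" using that finite_E1[OF nu(1)] by (intro member_le_sum) auto
        then show ?thesis using bspec[OF t that] n by auto
      qed
      moreover have "S nu n y = (UN rho:E 1 nu. S (nu @ rho) n y)" unfolding S_def using cyl_E[of nu 1] by auto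
      ultimately show ?thesis by simp
    qed
    then show "EX n0. ALL n>=n0. S nu n y = {}" by blast
  next
    fix z assume z: "z : cyl nu"
    \<comment> \<open>\<open>y\<close> reaches \<open>z\<close> at some index; a longer word from a
      cylinder around \<open>z\<close> back to \<open>y\<close> would close a loop.\<close>
    then obtain i where i: "R (tail G (y 0)) (tail G ((shift ^^ length nu) z i))" using cyl_X R_cof tail_verts[OF XD(1)[OF y]] X_shift by blast
    let ?k = "i + length nu"
    have ik: "R (tail G (y 0)) (tail G (z ?k))" using i by (simp add: shift_funpow)
    have "S (pre (Suc ?k) z) n y = {}" if "n > ?k" for n
    proof (rule ccontr)
      assume "S (pre (Suc ?k) z) n y ~= {}"
      then obtain tau where t: "length tau = n" "cat tau y : cyl (pre (Suc ?k) z)" by (auto simp: S_def)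
      have "cat tau y ?k = z ?k" using cyl_nth[OF t(2), of ?k] by simp
      moreover have "cat tau y n = y 0" using t(1) by (simp add: cat_def)
      moreover have "R (tail G (cat tau y ?k)) (tail G (cat tau y n))" by (rule R_I[OF cyl_X[OF t(2)] that])
      ultimately have "R (tail G (z ?k)) (tail G (y 0))" by simp
      then show False using R_trans[OF ik] nR by blast
    qed
    then show "EX k>=length nu. EX n0. ALL n>=n0. S (pre k z) n y = {}" using exI[of _ "Suc ?k"] by simp
  qed
  have sm: "summable (%n. l ^ n * Y n mu y)" if m: "mu ~= []" and y: "y : X" for l :: real and mu y
  proof -
    obtain n0 where "ALL n>=n0. S mu n y = {}" using fin[OF m y] ..
    then show ?thesis by (intro summable_finite[of "{..<n0}"]) (auto simp: Y_def)
  qed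
  define e0 where "e0 = p 0"
  have e0: "e0 : arcs G" using XD(1)[OF p] by (simp add: e0_def)
  have "EX m. conf m & m [e0] = 1"
  proof (rule exist_conf[of _ "%j. lamseq j" x])
    show "cyl [e0] ~= {}" by (rule cyl_arc_ne[OF e0])
    show "summable (%n. lamseq j ^ n * Y n mu (x j))" if "mu ~= []" for j mu by (rule sm[OF that x])
    show "0 < (\<Sum>n. lamseq j ^ n * Y n [e0] (x j))" for j
    proof -
      have "pre (Suc j) p = e0 # tl (pre (Suc j) p)" by (simp add: pre_def e0_def upt_conv_Cons del: upt_Suc)
      then have "cat (e0 # tl (pre (Suc j) p)) (x j) : X" using p cat_pre unfolding x_def by metis
      then show ?thesis by (intro suminf_Y_pos sm x lamseq) auto
    qed
    show "(%j. indicator (cyl [e]) (x j) / (\<Sum>n. lamseq j ^ n * Y n [e0] (x j))) ----> 0" for e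
    proof (cases "EX j. x j : cyl [e]")
      case True
      then obtain j0 where j0: "x j0 : cyl [e]" ..
      have "indicator (cyl [e]) (x j) = (0::real)" if "j > j0" for j
      proof -
        have "x j ~: cyl [e]"
        proof
          assume "x j : cyl [e]"
          then have "x j 0 = x j0 0" using j0 cyl_nth[of "x j" "[e]" 0] cyl_nth[of "x j0" "[e]" 0] by simp
          then have "p (Suc j) = p (Suc j0)" by (simp add: x_def shift_funpow del: funpow.simps)
          then show False using R_I[OF p, of "Suc j0" "Suc j"] that nR by simp
        qed
        then show ?thesis by simp
      qed
      then have "eventually (%j. indicator (cyl [e]) (x j) / (\<Sum>n. lamseq j ^ n * Y n [e0] (x j)) = 0) sequentially"
        by (intro eventually_sequentiallyI[of "Suc j0"]) simp
      then show ?thesis by (rule tendsto_eventually)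
    next
      case False
      then show ?thesis by simp
    qed
    show "lamseq j <= 1" for j by simp
  qed (use lamseq in auto)
  then show ?thesis by (metis list.discI zero_neq_one)
qed

end

subsection \<open>Finitely many non-wandering vertices\<close>

lemma sum_UNION_le:
  fixes f :: "'b => real"
  assumes "finite I" "!!i. i : I ==> finite (A i)" "!!x. 0 <= f x"
  shows "sum f (UN i:I. A i) <= (SUM i:I. sum f (A i))"
  using assms(1,2)
proof (induction I rule: finite_induct)
  case (insert i I)
  have "sum f (A i \<union> (UN i:I. A i)) <= sum f (A i) + sum f (UN i:I. A i)"
    using insert assms(3) by (subst sum_Un) (auto intro!: sum_nonneg)
  then show ?case using insert by simp
qed simp

context cpot
begin

lemma conf_scale: assumes "conf m" "a >= 0" shows "conf (%mu. a * m mu)"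
  unfolding conf_def
proof (intro conjI allI impI)
  show "0 <= a * m mu" for mu using conf_nonneg[OF assms(1)] assms(2) by simp
  show "a * m mu = (SUM rho:E 1 mu. a * m (mu @ rho))" if "mu ~= []" for mu
    using conf_split1[OF assms(1) that] by (simp add: sum_distrib_left)
  fix e nu lo hi assume h: "nu ~= []" "cyl (e # nu) ~= {}" "ALL x:cyl (e # nu). lo <= exp (u x) & exp (u x) <= hi"
  have "lo * m nu <= m (e # nu) & m (e # nu) <= hi * m nu" using conf_step[OF assms(1) h(1,2) bspec[OF h(3)]] .
  then show "lo * (a * m nu) <= a * m (e # nu)" "a * m (e # nu) <= hi * (a * m nu)"
    using mult_left_mono[OF _ assms(2)] by (metis mult.left_commute)+
qed

definition NWA :: "'e set" where "NWA = {e : arcs G. tail G e : NW G}"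

lemma NWA_her: "x : X ==> x i : NWA ==> i <= j ==> x j : NWA"
  using NW_her_path[OF X_shift[of x i], of "j - i"] XD(1) by (simp add: NWA_def NW_iff shift_funpow)

lemma finite_NWA: "finite (NW G) ==> finite NWA"
proof -
  assume f: "finite (NW G)"
  have "NWA \<subseteq> (UN v:NW G. out_arcs G v)" by (auto simp: NWA_def)
  moreover have "finite (UN v:NW G. out_arcs G v)" using f fin_out by (auto simp: NW_def)
  ultimately show "finite NWA" by (rule finite_subset)
qed

lemma NWA_arcs: "e : NWA ==> e : arcs G" by (simp add: NWA_def)

lemma NWA_ne: "NW G ~= {} ==> NWA ~= {}"
proof -
  assume "NW G ~= {}"
  then obtain v where v: "v : NW G" by blast
  then obtain e where "e : out_arcs G v" using ex_out unfolding NW_def by blast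
  then show "NWA ~= {}" using v by (auto simp: NWA_def)
qed

lemma NWA_enter: assumes "e : NWA" "x : X" shows "EX i. x i : NWA"
  using NW_enter assms XD(1) by (auto simp: NWA_def NW_iff)

lemma NWA_connect: assumes "e : arcs G" "x : X" "x 0 : NWA" shows "EX \<sigma>. cat (e # \<sigma>) x : X"
  by (rule connect[OF assms(1,2)]) (use assms NW_reach[OF head_verts[OF assms(1)]] in \<open>auto simp: NWA_def NW_iff\<close>)

text \<open>Since \<open>NW\<close> is finite and hereditary, \<open>cyl [e0]\<close> is covered by
  words of length \<open>n\<close> followed by one of the finitely many words \<open>rho\<close> in
  \<open>P\<close>. If the pressure were below \<open>c < 0\<close>, the sums over these words would
  decay like \<open>exp (c * n)\<close>. With \<open>\<epsilon> = - c / 2\<close> the conformal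
  error spoils only half of this rate, so \<open>m [e0]\<close> would vanish.\<close>

lemma pressure_ge_0:
  assumes fin: "finite (NW G)" and e0: "e0 : NWA" and m: "conf m" "m nu ~= 0" "nu ~= []"
  shows "0 <= pressure G u"
proof (rule ccontr)
  have ne: "verts G ~= {}" using e0 NWA_arcs tail_verts by blast
  assume "~0 <= pressure G u"
  then obtain c where c: "pressure G u < ereal c" "c < 0"
    using ereal_dense2[of "pressure G u" 0] by (auto simp: not_le)
  define s where "s = exp c"
  have s: "0 < s" "s < 1" using c(2) by (auto simp: s_def)
  have g: "gr s" by (rule pressure_less[OF ne]) (use c(1) in \<open>simp_all add: s_def\<close>)
  define \<epsilon> where "\<epsilon> = - c / 2"
  have ep: "\<epsilon> > 0" using c(2) by (simp add: \<epsilon>_def)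
  obtain k where k: "k >= 1" "!!tau rho x. k <= length rho ==> x : cyl (tau @ rho) ==>
     m (tau @ rho) <= exp (bs (length tau) x + length tau * \<epsilon>) * m rho" using conf_approx[OF m(1) ep] by metis
  define P where "P = (UN f:NWA. (%rho. f # rho) ` E (k - 1) [f])"
  have P: "finite P" unfolding P_def using finite_NWA[OF fin] by (intro finite_UN_I finite_imageI finite_E) auto
  have Pl: "length rho = k & cyl rho ~= {}" if "rho : P" for rho using that k(1) by (auto simp: P_def E_def)
  define p where "p rho = (SOME x. x : cyl rho)" for rho
  have p: "p rho : cyl rho" if "rho : P" for rho using Pl[OF that] unfolding p_def by (simp add: some_in_eq)
  have "ALL rho:P. EX C. ALL n. Y n [e0] (p rho) <= C * s ^ n"
    using g NWA_arcs[OF e0] cyl_X[OF p] unfolding gr_def by blast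
  from bchoice[OF this] obtain C where C: "ALL rho:P. ALL n. Y n [e0] (p rho) <= C rho * s ^ n" ..
  define D where "D = (SUM rho:P. C rho * m rho)"
  have main: "m [e0] <= D * exp (c / 2) ^ n" if n: "n >= 1" for n
  proof -
    let ?q = "n - 1 + k"
    have "m [e0] = (SUM \<sigma>:E ?q [e0]. m (e0 # \<sigma>))" using conf_split[OF m(1), of "[e0]" ?q] by simp
    also have "... <= (SUM \<sigma>:(UN rho:P. (%tau. tl tau @ rho) ` S [e0] n (p rho)). m (e0 # \<sigma>))"
    proof (rule sum_mono2)
      show "finite (UN rho:P. (%tau. tl tau @ rho) ` S [e0] n (p rho))" using P finite_S by auto
      show "E ?q [e0] \<subseteq> (UN rho:P. (%tau. tl tau @ rho) ` S [e0] n (p rho))"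
      proof
        fix \<sigma> assume s: "\<sigma> : E ?q [e0]"
        then have l: "length \<sigma> = ?q" and "cyl ([e0] @ \<sigma>) ~= {}" by (auto simp: E_def)
        then obtain y where y: "y : cyl (e0 # \<sigma>)" by auto
        define tau where "tau = take n (e0 # \<sigma>)"
        define rho where "rho = drop n (e0 # \<sigma>)"
        have tr: "tau @ rho = e0 # \<sigma>" by (simp add: tau_def rho_def)
        have ll: "length tau = n" "length rho = k" using l n by (auto simp: tau_def rho_def)
        have rne: "rho ~= []" using ll(2) k(1) by auto
        have yn: "y n : NWA" using cyl_nth[OF y, of 0] e0 NWA_her cyl_X[OF y] by auto
        have sy: "(shift ^^ n) y : cyl rho" using cyl_shift[of y tau rho] y tr ll by simp
        have "hd rho = y n" using cyl_nth[OF sy, of 0] rne by (simp add: shift_funpow hd_conv_nth)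
        then have hd: "rho = y n # tl rho" using rne by (cases rho) auto
        have rP: "rho : P" using sy hd ll yn by (force simp: E_def P_def)
        have "cat tau (p rho) : cyl (tau @ rho)" using cat_cyl_prefix[of tau rho "p rho"] y tr rne p[OF rP] by auto
        moreover have "tau = e0 # tl tau" using n by (cases n) (auto simp: tau_def)
        ultimately have "cat tau (p rho) : cyl [e0]" using cyl_append_subset by (metis append_Cons append_Nil subsetD)
        then have "tau : S [e0] n (p rho)" using ll by (simp add: S_def)
        moreover have "\<sigma> = tl tau @ rho" using tr \<open>tau = e0 # tl tau\<close> by (metis append_Cons list.inject)
        ultimately show "\<sigma> : (UN rho:P. (%tau. tl tau @ rho) ` S [e0] n (p rho))" using rP by blast
      qed
    qed (rule conf_nonneg[OF m(1)])
    also have "... <= (SUM rho:P. SUM \<sigma>:(%tau. tl tau @ rho) ` S [e0] n (p rho). m (e0 # \<sigma>))"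
      using P conf_nonneg[OF m(1)] by (intro sum_UNION_le) (auto simp: finite_S)
    also have "... <= (SUM rho:P. SUM tau:S [e0] n (p rho). m (e0 # tl tau @ rho))"
    proof (rule sum_mono)
      fix rho
      show "(SUM \<sigma>:(%tau. tl tau @ rho) ` S [e0] n (p rho). m (e0 # \<sigma>)) <= (SUM tau:S [e0] n (p rho). m (e0 # tl tau @ rho))"
        using sum_image_le[of "S [e0] n (p rho)" "%\<sigma>. m (e0 # \<sigma>)" "%tau. tl tau @ rho"] conf_nonneg[OF m(1)]
        by (simp add: finite_S)
    qed
    also have "... <= (SUM rho:P. SUM tau:S [e0] n (p rho). exp (bs n (cat tau (p rho)) + n * \<epsilon>) * m rho)"
    proof (intro sum_mono)
      fix rho tau assume r: "rho : P" and t: "tau : S [e0] n (p rho)"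
      have l: "length tau = n" "cat tau (p rho) : cyl [e0]" using t by (auto simp: S_def)
      have h: "tau = e0 # tl tau" using cyl_nth[OF l(2), of 0] l(1) n by (cases tau) (auto simp: cat_0)
      have "cat tau (p rho) : cyl (tau @ rho)" using cyl_X[OF l(2)] p[OF r] by simp
      from k(2)[OF _ this] Pl[OF r] l h show "m (e0 # tl tau @ rho) <= exp (bs n (cat tau (p rho)) + n * \<epsilon>) * m rho"
        by (metis append_Cons order_refl)
    qed
    also have "... = (SUM rho:P. exp \<epsilon> ^ n * (Y n [e0] (p rho) * m rho))"
      by (intro sum.cong refl) (simp add: Y_def sum_distrib_left exp_add mult_ac flip: exp_of_nat_mult)
    also have "... <= (SUM rho:P. exp \<epsilon> ^ n * ((C rho * s ^ n) * m rho))"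
      using C conf_nonneg[OF m(1)] by (intro sum_mono mult_left_mono mult_right_mono) auto
    also have "... = D * (exp \<epsilon> * s) ^ n" by (simp add: D_def sum_distrib_left power_mult_distrib mult_ac)
    also have "exp \<epsilon> * s = exp (c / 2)" by (simp add: s_def \<epsilon>_def flip: exp_add)
    finally show ?thesis .
  qed
  have "(%n. exp (c / 2) ^ n) ----> 0" by (rule LIMSEQ_realpow_zero) (use c(2) in auto)
  then have "m [e0] <= D * 0" using tendsto_mult[OF tendsto_const] LIMSEQ_le_const main by blast
  then have "m [e0] <= 0" by simp
  moreover have "m [e0] > 0" using conf_pos[OF m(1,3,2), of "[e0]"] cyl_arc_ne[OF NWA_arcs[OF e0]] by simp
  ultimately show False by simp
qed

end

text \<open>A path starting with an edge of \<open>NWA\<close> stays in \<open>NW\<close>, so the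
  condition \<open>x 0 : NWA\<close> replaces membership in the path space of the subgraph.\<close>

locale bowen_pot = cpot G u for G :: "('v, 'e) pre_digraph" and u +
  fixes C0 :: real
  assumes bw: "x : X ==> y : X ==> x 0 : NWA ==> pre n x = pre n y ==> n >= 1 ==> \<bar>bs n x - bs n y\<bar> <= C0"
    and finNW: "finite (NW G)" and neNW: "NW G ~= {}"
begin

lemma C0_nonneg: "C0 >= 0"
proof -
  obtain e where e: "e : NWA" using NWA_ne[OF neNW] by blast
  then obtain x where "x : cyl [e]" using cyl_arc_ne NWA_arcs by blast
  then show ?thesis using bw[of x x 1] cyl_nth cyl_X e by fastforce
qed

text \<open>The same words can be put before \<open>x\<close> and \<open>y\<close>; the extended
  paths agree on \<open>n\<close> edges and stay in \<open>NW\<close>, so Bowen's bound compares the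
  sums term by term.\<close>

lemma Y_bowen:
  assumes "e : NWA" "x : X" "y : X" "x 0 = y 0" "n >= 1"
  shows "Y n [e] x <= exp C0 * Y n [e] y"
proof -
  have xy: "cat tau x : cyl [e] \<longleftrightarrow> cat tau y : cyl [e]" if "length tau = n" for tau
    using assms(5) cat_X_cong assms(2-4) by (auto simp: cat_def mem_cyl pre_Suc)
  then have S: "S [e] n x = S [e] n y" by (auto simp: S_def)
  have "exp (bs n (cat tau x)) <= exp C0 * exp (bs n (cat tau y))" if "tau : S [e] n y" for tau
  proof -
    have l: "length tau = n" "cat tau y : cyl [e]" using that by (auto simp: S_def)
    then have c: "cat tau x : cyl [e]" using xy by simp
    have "\<bar>bs n (cat tau x) - bs n (cat tau y)\<bar> <= C0"
      using cyl_nth[OF c, of 0] assms(1,5) l by (intro bw cyl_X[OF c] cyl_X[OF l(2)]) (simp_all add: pre_cat')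
    then show ?thesis by (simp flip: exp_add)
  qed
  then show ?thesis unfolding Y_def S sum_distrib_left by (intro sum_mono)
qed

text \<open>The \<open>n\<close>-th iterate of the transfer operator on the indicator of the paths
  starting in \<open>NW\<close>.\<close>

definition Tn :: "nat => (nat => 'e) => real" where "Tn n x = (SUM e:NWA. Y n [e] x)"

lemma Tn_nonneg: "0 <= Tn n x" by (simp add: Tn_def sum_nonneg Y_nonneg)

lemma Tn_SF: "Tn n x = (SUM tau:SF NWA n x. exp (bs n (cat tau x)))"
  unfolding SF_def Tn_def Y_def using finite_NWA[OF finNW] cyl_disj[of "[_]" "[_]"]
  by (subst sum.UNION_disjoint) (auto simp: finite_S, auto simp: S_def)

text \<open>A word of length \<open>n + k\<close> is cut after \<open>n\<close> edges; by heredity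
  the path after the cut still starts in \<open>NW\<close>, where the uniform bound \<open>a\<close>
  applies.\<close>

lemma Tn_submult:
  assumes a: "!!y. y : X ==> y 0 : NWA ==> Tn n y <= a" and x: "x : X"
  shows "Tn (n + k) x <= a * Tn k x"
proof -
  have sub: "SF NWA (n + k) x \<subseteq> (UN tau:SF NWA k x. (%\<sigma>. \<sigma> @ tau) ` SF NWA n (cat tau x))"
  proof
    fix \<upsilon> assume "\<upsilon> : SF NWA (n + k) x"
    then obtain e where e: "e : NWA" "length \<upsilon> = n + k" "cat \<upsilon> x : cyl [e]" by (auto simp: SF_def S_def)
    define \<sigma> where "\<sigma> = take n \<upsilon>"
    define tau where "tau = drop n \<upsilon>"
    have st: "\<upsilon> = \<sigma> @ tau" "length \<sigma> = n" "length tau = k" using e(2) by (auto simp: \<sigma>_def tau_def)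
    have cX: "cat \<sigma> (cat tau x) : X" using cyl_X[OF e(3)] st by (simp add: cat_append)
    then have tX: "cat tau x : X" by (rule cat_X_tail)
    have "cat \<upsilon> x 0 : NWA" using cyl_nth[OF e(3), of 0] e(1) by simp
    moreover have "cat \<upsilon> x n = cat tau x 0" using st by (simp add: cat_def nth_append)
    ultimately have "cat tau x 0 : NWA" using NWA_her[OF cyl_X[OF e(3)], of 0 n] by simp
    moreover have "cat tau x : cyl [cat tau x 0]" using cyl_pre[OF tX, of 1] by (simp add: pre_Suc)
    ultimately have "tau : SF NWA k x" using st by (auto simp: SF_def S_def)
    moreover have "\<sigma> : SF NWA n (cat tau x)" using e st by (auto simp: SF_def S_def cat_append)
    ultimately show "\<upsilon> : (UN tau:SF NWA k x. (%\<sigma>. \<sigma> @ tau) ` SF NWA n (cat tau x))" using st(1) by blast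
  qed
  note fS = finite_SF[OF finite_NWA[OF finNW]]
  have "Tn (n + k) x <= (SUM \<upsilon>:(UN tau:SF NWA k x. (%\<sigma>. \<sigma> @ tau) ` SF NWA n (cat tau x)). exp (bs (n + k) (cat \<upsilon> x)))"
    unfolding Tn_SF using sub by (intro sum_mono2) (auto simp: fS)
  also have "... <= (SUM tau:SF NWA k x. SUM \<upsilon>:(%\<sigma>. \<sigma> @ tau) ` SF NWA n (cat tau x). exp (bs (n + k) (cat \<upsilon> x)))"
    by (intro sum_UNION_le) (auto simp: fS)
  also have "... = (SUM tau:SF NWA k x. SUM \<sigma>:SF NWA n (cat tau x). exp (bs (n + k) (cat (\<sigma> @ tau) x)))"
    by (rule sum.cong[OF refl], subst sum.reindex) (auto simp: inj_on_def)
  also have "... = (SUM tau:SF NWA k x. exp (bs k (cat tau x)) * Tn n (cat tau x))"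
    unfolding Tn_SF sum_distrib_left
  proof (intro sum.cong refl)
    fix tau \<sigma> assume "\<sigma> : SF NWA n (cat tau x)"
    then show "exp (bs (n + k) (cat (\<sigma> @ tau) x)) = exp (bs k (cat tau x)) * exp (bs n (cat \<sigma> (cat tau x)))" using birkhoff_append[of u \<sigma> k "cat tau x"] by (auto simp: SF_def S_def cat_append simp flip: exp_add)
  qed
  also have "... <= (SUM tau:SF NWA k x. exp (bs k (cat tau x)) * a)"
  proof (intro sum_mono mult_left_mono)
    fix tau assume "tau : SF NWA k x"
    then obtain e where e: "e : NWA" "cat tau x : cyl [e]" by (auto simp: SF_def S_def)
    then show "Tn n (cat tau x) <= a" using cyl_nth[OF e(2), of 0] by (intro a cyl_X[OF e(2)]) simp
  qed simp
  also have "... = a * Tn k x" by (simp add: Tn_SF sum_distrib_left mult.commute)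
  finally show ?thesis .
qed

lemma pressure_neg:
  assumes n0: "n0 >= 1" and half: "!!y. y : X ==> y 0 : NWA ==> Tn n0 y <= 1/2"
  shows "pressure G u < 0"
proof -
  have ne: "verts G ~= {}" using neNW by (auto simp: NW_def)
  obtain e0 where e0: "e0 : NWA" using NWA_ne[OF neNW] by blast
  \<comment> \<open>One halving every \<open>n0\<close> steps amounts to geometric decay at this
    rate, hence pressure at most \<open>ln s < 0\<close>.\<close>
  define s where "s = root n0 (1/2)"
  have s: "0 < s" "s < 1" "s ^ n0 = 1/2" using n0 by (auto simp: s_def)
  have it: "Tn (q * n0 + r) x <= (1/2) ^ q * Tn r x" if "x : X" for q r x
  proof (induction q)
    case (Suc q)
    have "Tn (n0 + (q * n0 + r)) x <= 1/2 * Tn (q * n0 + r) x" by (rule Tn_submult[OF half that])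
    then show ?case using Suc by (simp add: add.assoc)
  qed simp
  have "gr s" unfolding gr_def
  proof (intro ballI)
    fix x e assume x: "x : X" and e: "e : arcs G"
    define D where "D = 2 * (\<Sum>r<n0. Tn r x)"
    have "Y n [e0] x <= D * s ^ n" for n
    proof -
      let ?q = "n div n0" and ?r = "n mod n0"
      have "Y n [e0] x <= Tn n x" unfolding Tn_def
        using e0 finite_NWA[OF finNW] by (intro member_le_sum) (auto simp: Y_nonneg)
      also have "... <= (1/2) ^ ?q * Tn ?r x" using it[OF x, of ?q ?r] by simp
      also have "... = s ^ (?q * n0) * Tn ?r x" by (simp add: s(3) power_mult mult.commute)
      also have "... <= (2 * s ^ n) * (\<Sum>r<n0. Tn r x)"
      proof (rule mult_mono)
        have "s ^ n0 * s ^ (?q * n0) <= s ^ n"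
          by (metis n0 add.commute div_mult_mod_eq less_imp_le mod_less_divisor nat_add_left_cancel_le zero_less_one order_less_le_trans s power_add power_decreasing)
        then show "s ^ (?q * n0) <= 2 * s ^ n" using s(3) by simp
        show "Tn ?r x <= (\<Sum>r<n0. Tn r x)" using n0 by (intro member_le_sum) (auto simp: Tn_nonneg)
      qed (use s Tn_nonneg in auto)
      finally show ?thesis by (simp add: D_def mult_ac)
    qed
    then show "EX C. ALL n. Y n [e] x <= C * s ^ n"
      by (intro gr_of_one[of "[e0]"]) (use s cyl_arc_ne[OF NWA_arcs[OF e0]] in auto)
  qed
  from pressure_le[OF ne this s(1)] have "pressure G u <= ereal (ln s)" .
  also have "ereal (ln s) < 0" using s by simp
  finally show ?thesis .
qed

end

context bowen_pot
begin

text \<open>At pressure 0 the series with factor 1 diverges at \<open>x0\<close>: otherwise, by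
  Bowen's condition, \<open>Tn n0\<close> would be at most 1/2 on all of \<open>NW\<close> for some
  \<open>n0\<close>, and the pressure would be negative. Divergence sends the normalising sums to
  infinity, so a constant sequence of points suffices.\<close>

lemma exists_conf_finite:
  assumes P: "pressure G u = 0"
  shows "EX m. conf m & (EX mu. mu ~= [] & m mu ~= 0)"
proof -
  have g: "ALL s>1. gr s" using neNW pressure_le_0_iff P by (auto simp: NW_def)
  obtain e0 where e0: "e0 : NWA" using NWA_ne[OF neNW] by blast
  have e0a: "e0 : arcs G" "cyl [e0] ~= {}" using NWA_arcs[OF e0] cyl_arc_ne by auto
  then obtain x0 where x0c: "x0 : cyl [e0]" by blast
  have x0: "x0 : X" "x0 0 : NWA" using cyl_X[OF x0c] cyl_nth[OF x0c, of 0] e0 by auto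
  have ns: "~summable (%n. Y n [e0] x0)"
  proof
    assume sm: "summable (%n. Y n [e0] x0)"
    \<comment> \<open>By \<open>Y_dom\<close> the terms for \<open>e\<close> are dominated by
      finitely many shifted copies of a convergent series.\<close>
    have sm1: "summable (%n. Y n [e] x0)" for e
    proof -
      obtain A K J where A: "A >= 0" "!!n. n >= K ==> Y n [e] x0 <= A * (SUM i:{n-K..n+J}. Y i [e0] x0)"
        using Y_dom[OF _ e0a(2), of "[e]"] by blast
      have "summable (%n. A * (SUM i<=K+J. Y (n + i) [e0] x0))"
        by (intro summable_mult summable_sum) (simp add: summable_iff_shift[of "%n. Y n [e0] x0"] sm)
      moreover have "norm (Y (n + K) [e] x0) <= A * (SUM i<=K+J. Y (n + i) [e0] x0)" for n
        using sum.shift_bounds_cl_nat_ivl[of "%i. Y i [e0] x0" 0 n "K + J"] A(2)[of "n + K"] Y_nonneg by (auto simp: atMost_atLeast0 add_ac)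
      ultimately have "summable (%n. Y (n + K) [e] x0)" by (rule summable_comparison_test'[where N = 0])
      then show ?thesis by (rule summable_iff_shift[THEN iffD1])
    qed
    \<comment> \<open>Prepending a word from \<open>f\<close> to \<open>x0\<close> carries
      convergence to one point of each \<open>cyl [f]\<close>; through Bowen's condition these
      finitely many points represent all of \<open>NW\<close>.\<close>
    have "ALL f:NWA. EX y. y : cyl [f] & (ALL e. summable (%n. Y n [e] y))"
    proof
      fix f assume f: "f : NWA"
      obtain \<sigma> where c: "cat (f # \<sigma>) x0 : X" using NWA_connect[OF NWA_arcs[OF f] x0] by blast
      define y where "y = cat (f # \<sigma>) x0"
      let ?l = "length (f # \<sigma>)"
      have y: "y : cyl [f]" using c by (simp add: y_def mem_cyl pre_Suc cat_0)
      obtain b where b: "ALL z:cyl (f # \<sigma>). \<bar>bs ?l z\<bar> <= b" using bs_bd[of ?l "f # \<sigma>"] by auto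
      have "\<bar>bs ?l y\<bar> <= b" using c b by (auto simp: y_def)
      then have yb: "- b <= bs ?l y" by linarith
      have "summable (%n. Y n [e] y)" for e
      proof (rule summable_comparison_test'[where N = 0])
        show "summable (%n. exp b * Y (n + ?l) [e] x0)"
          by (rule summable_mult, rule summable_iff_shift[THEN iffD2], rule sm1)
        fix n
        have "exp (- b) * Y n [e] y <= (SUM tau:S [e] n y. exp (bs (n + ?l) (cat (tau @ f # \<sigma>) x0)))"
          unfolding Y_def sum_distrib_left
        proof (rule sum_mono)
          fix tau assume "tau : S [e] n y"
          then have l: "length tau = n" by (simp add: S_def)
          show "exp (- b) * exp (bs n (cat tau y)) <= exp (bs (n + ?l) (cat (tau @ f # \<sigma>) x0))" using birkhoff_append[of u tau ?l y] l yb by (auto simp: cat_append y_def simp flip: exp_add)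
        qed
        also have "... = (SUM \<upsilon>:(%tau. tau @ f # \<sigma>) ` S [e] n y. exp (bs (n + ?l) (cat \<upsilon> x0)))"
          by (subst sum.reindex) (auto simp: inj_on_def)
        also have "... <= Y (n + ?l) [e] x0"
          unfolding Y_def by (intro sum_mono2 finite_S) (auto simp: S_def cat_append y_def)
        finally have "exp (- b) * Y n [e] y <= Y (n + ?l) [e] x0" .
        then show "norm (Y n [e] y) <= exp b * Y (n + ?l) [e] x0"
          using Y_nonneg by (simp add: exp_minus field_simps)
      qed
      then show "EX y. y : cyl [f] & (ALL e. summable (%n. Y n [e] y))" using y by blast
    qed
    from bchoice[OF this] obtain y where y: "ALL f:NWA. y f : cyl [f] & (ALL e. summable (%n. Y n [e] (y f)))" ..
    define A where "A n = (SUM f:NWA. exp C0 * Tn n (y f))" for n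
    have "summable A" unfolding A_def Tn_def using y by (intro summable_sum summable_mult) auto
    then have "A ----> 0" by (rule summable_LIMSEQ_zero)
    then have "eventually (%n. A n < 1/2) sequentially" by (rule order_tendstoD(2)) simp
    then obtain n1 where n1: "ALL n>=n1. A n < 1/2" unfolding eventually_sequentially ..
    define n0 where "n0 = Suc n1"
    have "Tn n0 z <= 1/2" if z: "z : X" "z 0 : NWA" for z
    proof -
      have yz: "y (z 0) : cyl [z 0]" using y z by blast
      have "Tn n0 z <= exp C0 * Tn n0 (y (z 0))"
        unfolding Tn_def sum_distrib_left
        using cyl_nth[OF yz, of 0] by (intro sum_mono Y_bowen z cyl_X[OF yz]) (auto simp: n0_def)
      also have "... <= A n0" unfolding A_def
        using z finite_NWA[OF finNW] Tn_nonneg by (intro member_le_sum) auto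
      also have "A n0 <= 1/2" using n1 by (simp add: n0_def less_imp_le)
      finally show ?thesis .
    qed
    then show False using pressure_neg P by (auto simp: n0_def)
  qed
  define N where "N j = (\<Sum>n. lamseq j ^ n * Y n [e0] x0)" for j
  have sml: "summable (%n. lamseq j ^ n * Y n mu x0)" if "mu ~= []" for j mu
    by (rule summable_gr1[OF g lamseq(1,2) x0(1) that])
  have Npos: "0 < N j" for j using NWA_connect[OF e0a(1) x0] suminf_Y_pos sml by (auto simp: N_def)
  \<comment> \<open>A large partial sum with factor 1 is the limit of the same partial sums with
    factor \<open>lamseq j\<close>.\<close>
  have Ninf: "filterlim N at_top sequentially"
    unfolding filterlim_at_top
  proof
    fix B :: real
    obtain n0 where n0: "B + 1 < (\<Sum>n<n0. Y n [e0] x0)" by (metis ccontr summableI_nonneg_bounded Y_nonneg ns not_less)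
    have "(%j. \<Sum>n<n0. lamseq j ^ n * Y n [e0] x0) ----> (\<Sum>n<n0. 1 ^ n * Y n [e0] x0)"
      by (intro tendsto_sum tendsto_mult tendsto_power lamseq(3) tendsto_const)
    then have "eventually (%j. B < (\<Sum>n<n0. lamseq j ^ n * Y n [e0] x0)) sequentially"
      by (rule order_tendstoD(1)) (use n0 in simp)
    then show "eventually (%j. B <= N j) sequentially"
    proof (rule eventually_mono)
      fix j assume "B < (\<Sum>n<n0. lamseq j ^ n * Y n [e0] x0)"
      also have "... <= N j" unfolding N_def
        using Y_nonneg by (intro sum_le_suminf sml) auto
      finally show "B <= N j" by simp
    qed
  qed
  have "EX m. conf m & m [e0] = 1"
  proof (rule exist_conf[of _ "%j. lamseq j" "%_. x0"])
    show "(%j. indicator (cyl [e]) x0 / (\<Sum>n. lamseq j ^ n * Y n [e0] x0)) ----> 0" for e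
      using tendsto_divide_0[OF tendsto_const filterlim_at_top_imp_at_infinity[OF Ninf], of "indicator (cyl [e]) x0"]
      by (simp add: N_def)
    show "0 < (\<Sum>n. lamseq j ^ n * Y n [e0] x0)" for j using Npos by (simp add: N_def)
    show "lamseq j <= 1" for j by simp
  qed (use e0a(2) lamseq sml in simp_all)
  then show ?thesis by (metis list.discI zero_neq_one)
qed

text \<open>Every path enters \<open>NW\<close>, so along each path some prefix ends in an edge of
  \<open>NWA\<close>, where the hypothesis holds. Prepending the earlier edges multiplies both
  functions by the same factor, up to an error \<open>exp (i * \<epsilon>)\<close> from each; then
  \<epsilon> tends to 0.\<close>

lemma conf_ext:
  assumes m: "conf m" "conf m'" and c: "c >= 0" and le: "!!mu. mu ~= [] ==> hd mu : NWA ==> c * m' mu <= m mu" and n: "nu ~= []"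
  shows "c * m' nu <= m nu"
proof (rule bar_induct[OF n])
  fix nu :: "'e list" assume nu: "nu ~= []" "!!rho. rho : E 1 nu ==> c * m' (nu @ rho) <= m (nu @ rho)"
  show "c * m' nu <= m nu"
    unfolding conf_split1[OF m(1) nu(1)] conf_split1[OF m(2) nu(1)] sum_distrib_left by (intro sum_mono nu(2))
next
  fix x assume xc: "x : cyl nu"
  then have x: "x : X" by (rule cyl_X)
  obtain e where "e : NWA" using NWA_ne[OF neNW] by blast
  then obtain i0 where "x i0 : NWA" using NWA_enter x by blast
  define i where "i = i0 + length nu"
  have i: "x i : NWA" using NWA_her[OF x \<open>x i0 : NWA\<close>, of i] by (simp add: i_def)
  let ?t = "pre i x" and ?f = "[x i]"
  have ne: "cyl (?t @ ?f) ~= {}" using cyl_pre[OF x, of "Suc i"] by (auto simp: pre_Suc)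
  have *: "c * m' (?t @ ?f) <= exp (2 * real i * \<epsilon>) * m (?t @ ?f)" if e: "\<epsilon> > 0" for \<epsilon>
  proof -
    obtain k1 where k1: "k1 >= 1" "!!tau rho x. k1 <= length rho ==> x : cyl (tau @ rho) ==>
     exp (bs (length tau) x - length tau * \<epsilon>) * m rho <= m (tau @ rho)" using conf_approx[OF m(1) e] by metis
    obtain k2 where k2: "k2 >= 1" "!!tau rho x. k2 <= length rho ==> x : cyl (tau @ rho) ==>
     m' (tau @ rho) <= exp (bs (length tau) x + length tau * \<epsilon>) * m' rho" using conf_approx[OF m(2) e] by metis
    define k where "k = k1 + k2"
    have "c * m' (?t @ ?f @ \<sigma>) <= exp (2 * real i * \<epsilon>) * m (?t @ ?f @ \<sigma>)" if s: "\<sigma> : E k (?t @ ?f)" for \<sigma>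
    proof -
      obtain y where y: "y : cyl (?t @ ?f @ \<sigma>)" using s by (auto simp: E_def)
      have l: "k1 <= length (?f @ \<sigma>)" "k2 <= length (?f @ \<sigma>)" using E_len[OF s] by (auto simp: k_def)
      have "c * m' (?t @ ?f @ \<sigma>) <= c * (exp (bs i y + i * \<epsilon>) * m' (?f @ \<sigma>))"
        using k2(2)[OF l(2) y] c by (intro mult_left_mono) auto
      also have "... = exp (bs i y + i * \<epsilon>) * (c * m' (?f @ \<sigma>))" by simp
      also have "... <= exp (bs i y + i * \<epsilon>) * m (?f @ \<sigma>)" using le i by (intro mult_left_mono) auto
      also have "... = exp (2 * real i * \<epsilon>) * (exp (bs i y - i * \<epsilon>) * m (?f @ \<sigma>))" by (simp add: algebra_simps flip: exp_add)
      also have "... <= exp (2 * real i * \<epsilon>) * m (?t @ ?f @ \<sigma>)" using k1(2)[OF l(1) y] by (intro mult_left_mono) auto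
      finally show ?thesis .
    qed
    then show ?thesis unfolding conf_split[OF m(1), of "?t @ ?f" k, simplified] conf_split[OF m(2), of "?t @ ?f" k, simplified] sum_distrib_left
      by (intro sum_mono) simp
  qed
  have "((%\<epsilon>::real. exp (2 * real i * \<epsilon>) * m (?t @ ?f)) \<longlongrightarrow> exp (2 * real i * 0) * m (?t @ ?f)) (at_right 0)"
    by (intro tendsto_intros)
  then have "c * m' (?t @ ?f) <= exp (2 * real i * 0) * m (?t @ ?f)"
    by (rule tendsto_lowerbound[OF _ eventually_mono[OF eventually_at_right_less]]) (use * in simp_all)
  then show "EX n>=length nu. c * m' (pre n x) <= m (pre n x)"
    by (intro exI[of _ "Suc i"]) (simp add: pre_Suc i_def)
qed

text \<open>The two-sided bounds of \<open>conf\<close> cannot be subtracted directly. On fine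
  pieces both functions are multiplied by nearly the same number \<open>w\<close>, which can be
  factored out of the difference; the remaining error vanishes in the limit.\<close>

lemma conf_diff:
  assumes m: "conf m" "conf m'" and c: "c >= 0" and le: "!!mu. mu ~= [] ==> c * m' mu <= m mu"
  shows "conf (%mu. if mu = [] then 0 else m mu - c * m' mu)" (is "conf ?d")
  unfolding conf_def
proof (intro conjI allI impI)
  show d0: "0 <= ?d mu" for mu using le by auto
  show sp: "?d mu = (SUM rho:E 1 mu. ?d (mu @ rho))" if "mu ~= []" for mu
    using conf_split1[OF m(1) that] conf_split1[OF m(2) that] that by (simp add: sum_subtractf sum_distrib_left)
  fix e nu lo hi assume h: "nu ~= []" "cyl (e # nu) ~= {}" "ALL x:cyl (e # nu). lo <= exp (u x) & exp (u x) <= hi"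
  have hi: "hi >= 0" using h(2,3) by (metis all_not_in_conv exp_ge_zero order_trans)
  \<comment> \<open>Collects the mismatch that arises when the upper factor of one function meets
    the lower factor of the other.\<close>
  define err where "err \<epsilon> = (exp \<epsilon> - exp (- \<epsilon>)) * (hi * (c * m' nu))" for \<epsilon> :: real
  have *: "exp (- \<epsilon>) * (lo * ?d nu) - err \<epsilon> <= ?d (e # nu) & ?d (e # nu) <= exp \<epsilon> * (hi * ?d nu) + err \<epsilon>" if ep: "\<epsilon> > 0" for \<epsilon>
  proof -
    obtain k1 where k1: "k1 >= 1" "!!tau rho x. k1 <= length rho ==> x : cyl (tau @ rho) ==>
     exp (bs (length tau) x - length tau * \<epsilon>) * m rho <= m (tau @ rho) & m (tau @ rho) <= exp (bs (length tau) x + length tau * \<epsilon>) * m rho"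
      using conf_approx[OF m(1) ep] by metis
    obtain k2 where k2: "k2 >= 1" "!!tau rho x. k2 <= length rho ==> x : cyl (tau @ rho) ==>
     exp (bs (length tau) x - length tau * \<epsilon>) * m' rho <= m' (tau @ rho) & m' (tau @ rho) <= exp (bs (length tau) x + length tau * \<epsilon>) * m' rho"
      using conf_approx[OF m(2) ep] by metis
    define k where "k = k1 + k2"
    have EE: "E k ([e] @ nu) = E k nu" by (rule E_cat) (use h in auto)
    let ?er = "%\<sigma>. (exp \<epsilon> - exp (- \<epsilon>)) * (hi * (c * m' (nu @ \<sigma>)))"
    have t: "exp (- \<epsilon>) * (lo * (m (nu @ \<sigma>) - c * m' (nu @ \<sigma>))) - ?er \<sigma> <= m (e # nu @ \<sigma>) - c * m' (e # nu @ \<sigma>) &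
       m (e # nu @ \<sigma>) - c * m' (e # nu @ \<sigma>) <= exp \<epsilon> * (hi * (m (nu @ \<sigma>) - c * m' (nu @ \<sigma>))) + ?er \<sigma>" if s: "\<sigma> : E k nu" for \<sigma>
    proof -
      have "cyl ([e] @ nu @ \<sigma>) ~= {}" using s unfolding EE[symmetric] by (simp add: E_def)
      then obtain y where y: "y : cyl ([e] @ nu @ \<sigma>)" by blast
      have yc: "y : cyl (e # nu)" using y cyl_append_subset[of "e # nu" \<sigma>] by auto
      have l: "k1 <= length (nu @ \<sigma>)" "k2 <= length (nu @ \<sigma>)" using E_len[OF s] by (auto simp: k_def)
      define w where "w = exp (u y)"
      have w: "lo <= w" "w <= hi" "0 < w" using h(3) yc by (auto simp: w_def)
      define a where "a = m (nu @ \<sigma>)" define b where "b = c * m' (nu @ \<sigma>)"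
      have ab: "0 <= a - b" "0 <= b" using le h(1) c conf_nonneg[OF m(2)] by (auto simp: a_def b_def)
      have bs1: "bs (length [e]) y = u y" by (simp add: birkhoff_sum_def)
      have A: "w * exp (- \<epsilon>) * a <= m (e # nu @ \<sigma>)" "m (e # nu @ \<sigma>) <= w * exp \<epsilon> * a"
        using k1(2)[OF l(1) y] unfolding bs1 by (simp_all add: w_def a_def exp_diff exp_add exp_minus field_simps)
      have "exp (u y - \<epsilon>) * m' (nu @ \<sigma>) <= m' (e # nu @ \<sigma>)" "m' (e # nu @ \<sigma>) <= exp (u y + \<epsilon>) * m' (nu @ \<sigma>)"
        using k2(2)[OF l(2) y] unfolding bs1 by simp_all
      from this[THEN mult_left_mono, OF c] have B: "w * exp (- \<epsilon>) * b <= c * m' (e # nu @ \<sigma>)" "c * m' (e # nu @ \<sigma>) <= w * exp \<epsilon> * b"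
        by (simp_all add: w_def b_def exp_diff exp_add exp_minus field_simps)
      have wb: "(exp \<epsilon> - exp (- \<epsilon>)) * (w * b) <= (exp \<epsilon> - exp (- \<epsilon>)) * (hi * b)" using ep w ab mult_right_mono by simp
      have "exp (- \<epsilon>) * (lo * (a - b)) <= exp (- \<epsilon>) * (w * (a - b))" using w ab by (intro mult_left_mono mult_right_mono) auto
      moreover have "exp \<epsilon> * (w * (a - b)) <= exp \<epsilon> * (hi * (a - b))" using w ab by (intro mult_left_mono mult_right_mono) auto
      ultimately show ?thesis using A B wb unfolding a_def b_def by (simp add: algebra_simps)
    qed
    have S: "?d nu = (SUM \<sigma>:E k nu. m (nu @ \<sigma>) - c * m' (nu @ \<sigma>))"
      using conf_split[OF m(1) h(1), of k] conf_split[OF m(2) h(1), of k] h(1) by (simp add: sum_subtractf sum_distrib_left)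
    have S2: "?d (e # nu) = (SUM \<sigma>:E k nu. m (e # nu @ \<sigma>) - c * m' (e # nu @ \<sigma>))"
      using conf_split[OF m(1), of "e # nu" k] conf_split[OF m(2), of "e # nu" k] EE by (simp add: sum_subtractf sum_distrib_left)
    have Er: "err \<epsilon> = (SUM \<sigma>:E k nu. ?er \<sigma>)"
      unfolding err_def conf_split[OF m(2) h(1), of k] by (simp add: sum_distrib_left)
    show ?thesis
      unfolding S S2 Er unfolding sum_distrib_left sum_subtractf[symmetric] sum.distrib[symmetric]
      using t by (intro conjI sum_mono) auto
  qed
  have ev: "eventually (%e::real. e > 0) (at_right 0)" by (rule eventually_at_right_less)
  have "((%\<epsilon>. exp (- \<epsilon>) * (lo * ?d nu) - err \<epsilon>) \<longlongrightarrow> exp (- 0) * (lo * ?d nu) - (exp 0 - exp (- 0)) * (hi * (c * m' nu))) (at_right 0)"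
    unfolding err_def by (intro tendsto_intros)
  from tendsto_upperbound[OF this eventually_mono[OF ev]] * show "lo * ?d nu <= ?d (e # nu)" by simp
  have "((%\<epsilon>. exp \<epsilon> * (hi * ?d nu) + err \<epsilon>) \<longlongrightarrow> exp 0 * (hi * ?d nu) + (exp 0 - exp (- 0)) * (hi * (c * m' nu))) (at_right 0)"
    unfolding err_def by (intro tendsto_intros)
  from tendsto_lowerbound[OF this eventually_mono[OF ev]] * show "?d (e # nu) <= hi * ?d nu" by simp
qed

text \<open>\<open>conf_dom\<close> compares the finitely many edges of \<open>NWA\<close>. For a
  word ending in the edge \<open>f\<close>, Bowen's condition confines the Birkhoff sums to an
  interval of length \<open>2 * C0\<close>, so both functions are nearly the same multiple of their
  values at \<open>[f]\<close>. It matters that \<open>K\<close> is independent of the two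
  functions.\<close>

lemma conf_comparable:
  assumes e0: "e0 : NWA"
  shows "EX K>0. ALL m m' mu. conf m --> conf m' --> m [e0] = 1 --> m' [e0] = 1 --> mu ~= [] --> hd mu : NWA --> m' mu <= K * m mu"
proof -
  have ce0: "cyl [e0] ~= {}" by (rule cyl_arc_ne[OF NWA_arcs[OF e0]])
  have "ALL f:NWA. EX C. 0 <= C & (ALL m m'. conf m --> conf m' --> m [e0] = 1 --> m' [e0] = 1 --> m' [f] <= C * m [f])"
  proof
    fix f assume f: "f : NWA"
    obtain C1 where C1: "C1 >= 0" "!!m. conf m ==> m [f] <= C1 * m [e0]" using conf_dom[OF _ ce0, of "[f]"] by auto
    obtain C2 where C2: "C2 >= 0" "!!m. conf m ==> m [e0] <= C2 * m [f]"
      using conf_dom[OF _ cyl_arc_ne[OF NWA_arcs[OF f]], of "[e0]"] by auto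
    have "m' [f] <= C1 * C2 * m [f]" if "conf m" "conf m'" "m [e0] = 1" "m' [e0] = 1" for m m'
    proof -
      have "m' [f] <= C1 * 1" using C1(2)[OF that(2)] that by simp
      also have "... <= C1 * (C2 * m [f])" using C2(2)[OF that(1)] that C1(1) by (intro mult_left_mono) auto
      finally show ?thesis by simp
    qed
    then show "EX C. 0 <= C & (ALL m m'. conf m --> conf m' --> m [e0] = 1 --> m' [e0] = 1 --> m' [f] <= C * m [f])"
      using C1(1) C2(1) by (intro exI[of _ "C1 * C2"]) auto
  qed
  from bchoice[OF this] obtain C where C: "ALL f:NWA. 0 <= C f & (ALL m m'. conf m --> conf m' --> m [e0] = 1 --> m' [e0] = 1 --> m' [f] <= C f * m [f])" ..
  define K0 where "K0 = 1 + (SUM f:NWA. C f)"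
  have K0: "C f <= K0" if "f : NWA" for f
  proof -
    have "C f <= (SUM f:NWA. C f)" using that C finite_NWA[OF finNW] by (intro member_le_sum) auto
    then show ?thesis by (simp add: K0_def)
  qed
  have K0p: "K0 > 0" using C by (auto simp: K0_def intro!: add_pos_nonneg sum_nonneg)
  have "m' mu <= (exp (2 * C0) * K0) * m mu"
    if h: "conf m" "conf m'" "m [e0] = 1" "m' [e0] = 1" "mu ~= []" "hd mu : NWA" for m m' mu
  proof (cases "cyl mu = {}")
    case True
    then show ?thesis using conf_empty[OF h(1,5)] conf_empty[OF h(2,5)] by simp
  next
    case False
    then obtain x where x: "x : cyl mu" by blast
    define tau where "tau = butlast mu" define f where "f = last mu"
    have tf: "mu = tau @ [f]" using h(5) by (simp add: tau_def f_def)
    have x0: "x 0 : NWA" using cyl_nth[OF x, of 0] h(5,6) by (simp add: hd_conv_nth)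
    have f: "f : NWA" using cyl_nth[OF x, of "length tau"] tf NWA_her[OF cyl_X[OF x] x0] by auto
    have lh: "bs (length tau) x - C0 <= bs (length tau) y & bs (length tau) y <= bs (length tau) x + C0" if y: "y : cyl (tau @ [f])" for y
    proof (cases "length tau = 0")
      case True then show ?thesis using C0_nonneg by simp
    next
      case False
      have "pre (length tau) x = pre (length tau) y"
        using y x tf cyl_append_subset by (metis mem_cyl subsetD)
      then show ?thesis using bw[OF cyl_X[OF x] cyl_X[OF y] x0, of "length tau"] False by auto
    qed
    have ne: "cyl (tau @ [f]) ~= {}" using False tf by simp
    have "m' mu <= exp (bs (length tau) x + C0) * m' [f]" unfolding tf using conf_bounds[OF h(2) _ ne lh] by simp
    also have "... <= exp (bs (length tau) x + C0) * (K0 * m [f])"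
    proof (rule mult_left_mono)
      have "m' [f] <= C f * m [f]" using C f h by blast
      also have "... <= K0 * m [f]" using K0[OF f] conf_nonneg[OF h(1)] by (intro mult_right_mono) auto
      finally show "m' [f] <= K0 * m [f]" .
    qed simp
    also have "... = exp (2 * C0) * K0 * (exp (bs (length tau) x - C0) * m [f])" by (simp add: algebra_simps flip: exp_add)
    also have "... <= exp (2 * C0) * K0 * m mu"
      unfolding tf using conf_bounds[OF h(1) _ ne lh] K0p by (intro mult_left_mono) auto
    finally show ?thesis .
  qed
  then show ?thesis using K0p by (intro exI[of _ "exp (2 * C0) * K0"]) auto
qed

text \<open>Let \<open>c\<close> be the largest constant with \<open>c * m' <= m\<close> on
  \<open>NW\<close>. If \<open>c < 1\<close>, the difference divided by \<open>1 - c\<close> is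
  again conformal and normalised, hence at least \<open>m' / K\<close>; so \<open>c\<close> could be
  raised by \<open>(1 - c) / K\<close>.\<close>

lemma conf_le_normalised:
  assumes e0: "e0 : NWA" and m: "conf m" "conf m'" "m [e0] = 1" "m' [e0] = 1" and n: "nu ~= []"
  shows "m' nu <= m nu"
proof -
  obtain K where K: "K > 0" "!!m m' mu. conf m ==> conf m' ==> m [e0] = 1 ==> m' [e0] = 1 ==> mu ~= [] ==> hd mu : NWA ==> m' mu <= K * m mu"
    using conf_comparable[OF e0] by blast
  define Z where "Z = {c. 0 <= c & (ALL mu. mu ~= [] --> hd mu : NWA --> c * m' mu <= m mu)}"
  have Z1: "c <= 1" if "c : Z" for c using that e0 m(3,4) by (force simp: Z_def dest: spec[of _ "[e0]"])
  have Z0: "0 : Z" using conf_nonneg[OF m(1)] by (simp add: Z_def)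
  have bdd: "bdd_above Z" using Z1 by (intro bdd_aboveI[of _ 1])
  define c where "c = Sup Z"
  have c01: "0 <= c" "c <= 1" unfolding c_def using Z0 Z1 bdd by (auto intro: cSup_upper cSup_least)
  have le: "c * m' mu <= m mu" if "mu ~= []" "hd mu : NWA" for mu
  proof (cases "m' mu = 0")
    case False
    then have p: "m' mu > 0" using conf_nonneg[OF m(2), of mu] by simp
    have "c <= m mu / m' mu" unfolding c_def
    proof (rule cSup_least)
      show "Z ~= {}" using Z0 by blast
      fix z assume "z : Z"
      then have "z * m' mu <= m mu" using that by (simp add: Z_def)
      then show "z <= m mu / m' mu" using p by (simp add: field_simps)
    qed
    then show ?thesis using p by (simp add: field_simps)
  qed (use conf_nonneg[OF m(1)] in simp)
  have le': "c * m' mu <= m mu" if "mu ~= []" for mu by (rule conf_ext[OF m(1,2) c01(1) le that])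
  have "c = 1"
  proof (rule ccontr)
    assume "c ~= 1"
    then have c1: "c < 1" using c01 by simp
    let ?d = "%mu. if mu = [] then 0 else m mu - c * m' mu"
    let ?d1 = "%mu. 1 / (1 - c) * ?d mu"
    have d1: "conf ?d1" by (rule conf_scale[OF conf_diff[OF m(1,2) c01(1) le']]) (use c1 in auto)
    have "?d1 [e0] = 1" using m(3,4) c1 by simp
    note kk = K(2)[OF d1 m(2) this m(4)]
    have "c + (1 - c) / K : Z" unfolding Z_def
    proof (intro CollectI conjI allI impI)
      show "0 <= c + (1 - c) / K" using c01 K(1) by simp
      fix mu :: "'e list" assume u: "mu ~= []" "hd mu : NWA"
      have "(1 - c) / K * m' mu <= m mu - c * m' mu" using kk u c1 K(1) by (auto simp: field_simps)
      then show "(c + (1 - c) / K) * m' mu <= m mu" by (simp add: algebra_simps)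
    qed
    then have "c + (1 - c) / K <= c" unfolding c_def using bdd by (intro cSup_upper)
    then show False using c1 K(1) by (simp add: field_simps)
  qed
  then show ?thesis using le'[OF n] by simp
qed

lemma conf_unique:
  assumes m: "conf m" "conf m'" "m \<kappa> ~= 0" "\<kappa> ~= []" "m' \<kappa>' ~= 0" "\<kappa>' ~= []"
  shows "EX c>0. ALL mu. mu ~= [] --> m' mu = c * m mu"
proof -
  obtain e0 where e0: "e0 : NWA" using NWA_ne[OF neNW] by blast
  have p: "m [e0] > 0" "m' [e0] > 0" using cyl_arc_ne[OF NWA_arcs[OF e0]] conf_pos m(1,4,3) m(2,6,5) by auto
  let ?a = "%mu. 1 / m [e0] * m mu" and ?b = "%mu. 1 / m' [e0] * m' mu"
  have a: "conf ?a" by (rule conf_scale[OF m(1)]) (use p in simp)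
  have b: "conf ?b" by (rule conf_scale[OF m(2)]) (use p in simp)
  have ab: "?a [e0] = 1" "?b [e0] = 1" using p by simp_all
  have *: "m' mu = m' [e0] / m [e0] * m mu" if "mu ~= []" for mu using conf_le_normalised[OF e0 a b ab that] conf_le_normalised[OF e0 b a ab(2,1) that] p by (auto simp: field_simps)
  show ?thesis
  proof (rule exI[of _ "m' [e0] / m [e0]"], intro conjI allI impI)
    show "0 < m' [e0] / m [e0]" using p by simp
  qed (rule *)
qed

end

section \<open>The algebra of the path groupoid\<close>

lemma (in wco_data) clin_wco: "clin (wco g \<eta>)"
  by (rule clinI, rule ell2_eqI) (simp add: coord_wco)

text \<open>\<eta> maps the support of \<open>g\<close> bijectively onto that of \<open>g'\<close>,
  and the inner product is reindexed along it.\<close>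

lemma is_hadj_wco:
  assumes d: "wco_data g \<eta> B" "wco_data g' \<eta>' B'"
    and b: "!!\<gamma>. g \<gamma> ~= 0 ==> \<eta>' (\<eta> \<gamma>) = \<gamma> & g' (\<eta> \<gamma>) = cnj (g \<gamma>)"
    and b': "!!\<gamma>. g' \<gamma> ~= 0 ==> \<eta> (\<eta>' \<gamma>) = \<gamma> & g (\<eta>' \<gamma>) ~= 0"
  shows "is_hadj (wco g \<eta>) (wco g' \<eta>')"
  unfolding is_hadj_def
proof (intro allI)
  fix x y
  interpret p: wco_data g \<eta> B by fact
  interpret q: wco_data g' \<eta>' B' by fact
  let ?S = "{\<gamma>. g \<gamma> ~= 0}" and ?S' = "{\<gamma>. g' \<gamma> ~= 0}"
  have bij: "bij_betw \<eta> ?S ?S'"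
    by (rule bij_betw_byWitness[of _ \<eta>']) (use b b' in \<open>force+\<close>)
  have "wco g \<eta> x \<bullet> y = (\<Sum>\<^sub>\<infinity>\<gamma>\<in>?S. (g \<gamma> * coord x (\<eta> \<gamma>)) \<bullet> coord y \<gamma>)"
    unfolding inner_ell2_def p.coord_wco by (rule infsum_cong_neutral) auto
  also have "... = (\<Sum>\<^sub>\<infinity>\<gamma>\<in>?S. coord x (\<eta> \<gamma>) \<bullet> (g' (\<eta> \<gamma>) * coord y (\<eta>' (\<eta> \<gamma>))))"
    by (rule infsum_cong) (use b in \<open>auto simp: inner_complex_def algebra_simps\<close>)
  also have "... = (\<Sum>\<^sub>\<infinity>\<gamma>\<in>?S'. coord x \<gamma> \<bullet> (g' \<gamma> * coord y (\<eta>' \<gamma>)))"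
    by (rule infsum_reindex_bij_betw[OF bij])
  also have "... = x \<bullet> wco g' \<eta>' y"
    unfolding inner_ell2_def q.coord_wco by (rule infsum_cong_neutral) auto
  finally show "wco g \<eta> x \<bullet> y = x \<bullet> wco g' \<eta>' y" .
qed

context pgraph
begin

abbreviation "Gam \<equiv> path_groupoid G"

lemma GamI: "x : X ==> y : X ==> (shift ^^ n) x = (shift ^^ m) y ==> k = int n - int m ==> (x, k, y) : Gam"
  unfolding path_groupoid_def by blast

lemma GamE: assumes "(x, k, y) : Gam"
  obtains n m where "x : X" "y : X" "k = int n - int m" "(shift ^^ n) x = (shift ^^ m) y"
  using assms unfolding path_groupoid_def by blast

lemma Gam_mult: assumes "(x, k, z) : Gam" "(z, l, y) : Gam" shows "(x, k + l, y) : Gam"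
proof -
  obtain a b where 1: "x : X" "k = int a - int b" "(shift ^^ a) x = (shift ^^ b) z" using assms(1) by (rule GamE)
  obtain c d where 2: "y : X" "l = int c - int d" "(shift ^^ c) z = (shift ^^ d) y" using assms(2) by (rule GamE)
  have "(shift ^^ (a + c)) x = (shift ^^ c) ((shift ^^ b) z)" unfolding 1(3)[symmetric] shift_shift ..
  also have "... = (shift ^^ b) ((shift ^^ d) y)" unfolding 2(3)[symmetric] shift_shift by (simp add: add.commute)
  finally have "(shift ^^ (a + c)) x = (shift ^^ (d + b)) y" unfolding shift_shift .
  then show ?thesis by (rule GamI[OF 1(1) 2(1)]) (simp add: 1(2) 2(2))
qed

lemma Gam_inv: "(x, k, y) : Gam ==> (y, - k, x) : Gam"
proof -
  assume "(x, k, y) : Gam"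
  then obtain n m where "x : X" "y : X" "k = int n - int m" "(shift ^^ n) x = (shift ^^ m) y" by (rule GamE)
  then show ?thesis by (intro GamI[of y x m n]) auto
qed

lemma Gam_unit: "x : X ==> (x, 0, x) : Gam" by (rule GamI[of x x 0 0]) auto
lemma Gam_X: "(x, k, y) : Gam ==> x : X & y : X" by (auto elim: GamE)

definition sw :: "'e list => 'e list => (nat => 'e) => nat => 'e" where
  "sw mu nu x = cat nu ((shift ^^ length mu) x)"

definition dg :: "'e list => 'e list => int" where "dg mu nu = int (length mu) - int (length nu)"

definition dm :: "'e list => 'e list => (nat => 'e) set" where "dm mu nu = {x : cyl mu. sw mu nu x : X}"

text \<open>The basic open bisection that exchanges the prefix \<open>mu\<close> for
  \<open>nu\<close>, parametrised by its range points.\<close>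

definition D :: "'e list => 'e list => 'e gpd set" where
  "D mu nu = {(x, k, y). x : dm mu nu & k = dg mu nu & y = sw mu nu x}"

lemma sw_cat [simp]: "sw mu nu (cat mu w) = cat nu w" by (simp add: sw_def)

lemma dm_cat: "cat mu w : dm mu nu \<longleftrightarrow> cat mu w : X & cat nu w : X" by (simp add: dm_def)

lemma dmE: assumes "x : dm mu nu" obtains w where "x = cat mu w" "cat mu w : X" "cat nu w : X" "w : X"
  using assms cylE unfolding dm_def by (metis (no_types, lifting) mem_Collect_eq sw_cat)

lemma dm_sw: "x : dm mu nu ==> sw mu nu x : dm nu mu" and sw_sw: "x : dm mu nu ==> sw nu mu (sw mu nu x) = x"
  by (auto elim!: dmE simp: dm_cat)

lemma sw_inj: "x : cyl mu ==> y : cyl mu ==> sw mu nu x = sw mu nu y ==> x = y"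
  by (auto elim!: cylE simp: cat_inj)

lemma D_Gam: "D mu nu \<subseteq> Gam"
  by (auto simp: D_def dg_def elim!: dmE intro!: GamI)

lemma dm_Gam: "x : dm mu nu ==> (x, dg mu nu, sw mu nu x) : Gam" using D_Gam by (force simp: D_def)

lemma sw_append: assumes "x : cyl (mu @ rho)" shows "sw (mu @ rho) (nu @ rho) x = sw mu nu x"
  by (metis assms cylE sw_cat cat_append)

lemma dm_append: "dm (mu @ rho) (nu @ rho) = dm mu nu \<inter> cyl (mu @ rho)"
  using cyl_append_subset sw_append by (auto simp: dm_def)

lemma dg_append: "dg (mu @ rho) (nu @ rho) = dg mu nu" by (simp add: dg_def)

text \<open>Whether \<open>nu\<close> can precede a tail depends only on the first vertex of the
  tail, and all tails following \<open>mu\<close> share it. So the domain is empty or the whole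
  cylinder.\<close>

lemma dm_full: assumes "dm mu nu ~= {}" "mu ~= []" "nu ~= []" shows "dm mu nu = cyl mu"
proof
  obtain w where w: "cat mu w : X" "cat nu w : X" using assms(1) by (auto elim!: dmE)
  have l: "head G (last \<sigma>) = tail G (z 0)" if "cat \<sigma> z : X" "\<sigma> ~= []" for \<sigma> z
    using XD(2)[OF that(1), of "length \<sigma> - 1"] that(2) by (simp add: cat_def last_conv_nth)
  show "cyl mu \<subseteq> dm mu nu"
  proof
    fix x assume "x : cyl mu"
    then obtain z where z: "x = cat mu z" "z : X" "cat mu z : X" by (rule cylE)
    show "x : dm mu nu" using l[OF z(3) assms(2)] l[OF w(1) assms(2)] cat_X_cong[OF w(2) z(2)] z by (auto simp: dm_cat)
  qed
qed (auto simp: dm_def)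

definition op_wt :: "('e gpd => complex) => 'e list => 'e list => 'e gpd => complex" where
  "op_wt f mu nu = (%(x, k, y). if (x, k, y) : Gam & x : dm mu nu then f (x, dg mu nu, sw mu nu x) else 0)"

definition op_map :: "'e list => 'e list => 'e gpd => 'e gpd" where
  "op_map mu nu = (%(x, k, y). (sw mu nu x, k - dg mu nu, y))"

text \<open>Left convolution by \<open>f\<close> restricted to \<open>D mu nu\<close>: over a range
  point in \<open>dm mu nu\<close> the bisection has exactly one element, so the convolution sum
  collapses to one term.\<close>

definition op :: "('e gpd => complex) => 'e list => 'e list => 'e gpd ell2 \<Rightarrow>\<^sub>L 'e gpd ell2" where
  "op f mu nu = wco (op_wt f mu nu) (op_map mu nu)"

definition bdd_on :: "('e gpd => complex) => 'e list => 'e list => real => bool" where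
  "bdd_on f mu nu B \<longleftrightarrow> 0 <= B & (ALL \<gamma>:D mu nu. norm (f \<gamma>) <= B)"

lemma op_data: assumes "bdd_on f mu nu B" shows "wco_data (op_wt f mu nu) (op_map mu nu) B"
proof
  have sub: "{\<gamma>. op_wt f mu nu \<gamma> ~= 0} \<subseteq> {(x, k, y). x : cyl mu}" by (auto simp: op_wt_def dm_def split: if_splits)
  have "inj_on (op_map mu nu) {(x, k, y). x : cyl mu}" by (auto simp: inj_on_def op_map_def dest: sw_inj)
  then show "inj_on (op_map mu nu) {\<gamma>. op_wt f mu nu \<gamma> ~= 0}" using sub inj_on_subset by blast
  show "norm (op_wt f mu nu \<gamma>) <= B" for \<gamma>
    using assms by (cases \<gamma>) (auto simp: op_wt_def bdd_on_def D_def)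
qed

lemma coord_op: assumes "bdd_on f mu nu B"
  shows "coord (op f mu nu xi) (x, k, y) =
    (if (x, k, y) : Gam & x : dm mu nu then f (x, dg mu nu, sw mu nu x) * coord xi (sw mu nu x, k - dg mu nu, y) else 0)"
  unfolding op_def wco_data.coord_wco[OF op_data[OF assms]] by (simp add: op_wt_def op_map_def)

lemma norm_op: "bdd_on f mu nu B ==> norm (op f mu nu) <= B"
  unfolding op_def by (rule wco_data.norm_wco[OF op_data])

lemma op_cong: assumes "!!\<gamma>. \<gamma> : D mu nu ==> f \<gamma> = g \<gamma>" shows "op f mu nu = op g mu nu"
proof -
  have "op_wt f mu nu = op_wt g mu nu" using assms by (auto simp: op_wt_def D_def)
  then show ?thesis by (simp add: op_def)
qed

lemma op_dm_empty: "dm mu nu = {} ==> op f mu nu = 0"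
proof -
  assume e: "dm mu nu = {}"
  then have b: "bdd_on f mu nu 0" by (auto simp: bdd_on_def D_def)
  show ?thesis by (rule blinfun_eqI, rule ell2_eqI) (use e in \<open>auto simp: coord_op[OF b]\<close>)
qed

lemma op_diff: assumes "bdd_on f mu nu B" "bdd_on g mu nu C" shows "op (%\<gamma>. f \<gamma> - g \<gamma>) mu nu = op f mu nu - op g mu nu"
proof -
  have b: "bdd_on (%\<gamma>. f \<gamma> - g \<gamma>) mu nu (B + C)"
    using assms by (auto simp: bdd_on_def intro!: order_trans[OF norm_triangle_ineq4] add_mono)
  show ?thesis
    by (rule blinfun_eqI, rule ell2_eqI)
      (auto simp: blinfun.diff_left coord_op[OF b] coord_op[OF assms(1)] coord_op[OF assms(2)] algebra_simps)
qed

lemma op_cmult: assumes "bdd_on f mu nu B" shows "op (%\<gamma>. c * f \<gamma>) mu nu = cscale c (op f mu nu)"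
proof -
  have b: "bdd_on (%\<gamma>. c * f \<gamma>) mu nu (norm c * B)"
    using assms by (auto simp: bdd_on_def norm_mult intro!: mult_left_mono)
  show ?thesis
    by (rule blinfun_eqI, rule ell2_eqI) (auto simp: coord_op[OF b] coord_op[OF assms])
qed

text \<open>Convolution by the indicator of \<open>D mu nu\<close>, usually written as the partial
  isometry of \<open>mu\<close> times the adjoint of that of \<open>nu\<close>.\<close>

definition T :: "'e list => 'e list => 'e gpd ell2 \<Rightarrow>\<^sub>L 'e gpd ell2" where "T mu nu = op (%_. 1) mu nu"

lemma bdd_1: "bdd_on (%_. 1) mu nu 1" by (simp add: bdd_on_def)

lemma coord_T: "coord (T mu nu xi) (x, k, y) =
    (if (x, k, y) : Gam & x : dm mu nu then coord xi (sw mu nu x, k - dg mu nu, y) else 0)"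
  unfolding T_def coord_op[OF bdd_1] by simp

lemma norm_T: "norm (T mu nu) <= 1" unfolding T_def by (rule norm_op[OF bdd_1])

lemma Gam_op: assumes "(x, k, y) : Gam" "x : dm mu nu" shows "(sw mu nu x, k - dg mu nu, y) : Gam"
  using Gam_mult[OF Gam_inv[OF dm_Gam[OF assms(2)]] assms(1)] by (simp add: algebra_simps)

lemma dg_swap: "dg nu mu = - dg mu nu" by (simp add: dg_def)

lemma T_hadj: "is_hadj (T mu nu) (T nu mu)"
proof -
  have 1: "op_map nu mu (op_map mu nu \<gamma>) = \<gamma> & op_wt (%_. 1) nu mu (op_map mu nu \<gamma>) = 1"
    if "op_wt (%_. 1) mu nu \<gamma> ~= 0" for mu nu \<gamma>
    using that Gam_op dm_sw sw_sw dg_swap[of nu mu]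
    by (cases \<gamma>) (auto simp: op_wt_def op_map_def split: if_splits)
  have c: "cnj (op_wt (%_. 1) mu nu \<gamma>) = 1" if "op_wt (%_. 1) mu nu \<gamma> ~= 0" for \<gamma>
    using that by (cases \<gamma>) (auto simp: op_wt_def split: if_splits)
  show ?thesis unfolding T_def op_def
    by (rule is_hadj_wco[OF op_data[OF bdd_1] op_data[OF bdd_1]]) (use 1 c in \<open>simp_all\<close>)
qed

lemma T_Adj: "T mu nu : Adj"
  by (rule AdjI[OF T_hadj]) (unfold T_def op_def, rule wco_data.clin_wco[OF op_data[OF bdd_1]])

lemma hadj_T: "hadj (T mu nu) = T nu mu" by (rule is_hadj_hadj[OF T_hadj])

lemma T_empty: "dm mu nu = {} ==> T mu nu = 0" unfolding T_def by (rule op_dm_empty)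

lemma coord_TT: "coord (T mu nu (T mu' nu' xi)) (x, k, y) =
   (if (x, k, y) : Gam & x : dm mu nu & sw mu nu x : dm mu' nu'
    then coord xi (sw mu' nu' (sw mu nu x), k - dg mu nu - dg mu' nu', y) else 0)"
  using Gam_op by (simp add: coord_T)

text \<open>With \<open>T_mult_left\<close> and \<open>T_mult_zero\<close> these are the
  Cuntz-Krieger product rules: a product is non-zero only if one of the two inner words extends the
  other.\<close>

lemma T_mult_right:
  assumes "dm mu nu ~= {}" "mu ~= []" "nu ~= []"
  shows "T mu nu oL T (nu @ tau) nu' = T (mu @ tau) nu'"
proof (rule blinfun_eqI, rule ell2_eqI)
  fix xi and \<gamma> :: "'e gpd"
  obtain x k y where g: "\<gamma> = (x, k, y)" by (cases \<gamma>)
  have f: "dm mu nu = cyl mu" by (rule dm_full[OF assms])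
  have A: "x : dm mu nu & sw mu nu x : dm (nu @ tau) nu' \<longleftrightarrow> x : dm (mu @ tau) nu'" (is "?l \<longleftrightarrow> ?r")
  proof
    assume l: ?l
    then obtain w where w: "x = cat mu w" "cat mu w : X" "cat nu w : X" by (auto elim: dmE)
    then obtain z where z: "cat nu w = cat (nu @ tau) z" "cat nu' z : X" using l by (auto elim: dmE)
    then show ?r by (metis w z cat_append cat_inj dm_cat)
  next
    assume ?r
    then obtain z where z: "x = cat (mu @ tau) z" "cat (mu @ tau) z : X" "cat nu' z : X" by (auto elim: dmE)
    then show ?l using dm_sw[of x mu nu] dm_cat[of "nu @ tau" z nu'] by (auto simp: f cat_append dm_cat)
  qed
  have B: "sw (nu @ tau) nu' (sw mu nu x) = sw (mu @ tau) nu' x" if a: "x : dm (mu @ tau) nu'"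
  proof -
    obtain z where z: "x = cat (mu @ tau) z" by (rule dmE[OF a])
    have "sw mu nu x = cat (nu @ tau) z" unfolding z cat_append by simp
    then show ?thesis using z by simp
  qed
  have d: "k - dg mu nu - dg (nu @ tau) nu' = k - dg (mu @ tau) nu'" by (simp add: dg_def)
  show "coord ((T mu nu oL T (nu @ tau) nu') xi) \<gamma> = coord (T (mu @ tau) nu' xi) \<gamma>"
    unfolding g blinfun_apply_blinfun_compose coord_TT unfolding d coord_T using A B by auto
qed

lemma T_mult_left:
  assumes "dm mu' nu' ~= {}" "mu' ~= []" "nu' ~= []"
  shows "T mu (mu' @ tau) oL T mu' nu' = T mu (nu' @ tau)"
proof -
  have "T nu' mu' oL T (mu' @ tau) mu = T (nu' @ tau) mu" using assms(1) dm_sw T_mult_right[OF _ assms(3,2)] by blast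
  from arg_cong[OF this, of hadj] show ?thesis by (simp add: hadj_comp T_Adj hadj_T)
qed

lemma T_mult_zero:
  assumes "!!tau. mu' ~= nu @ tau" "!!tau. nu ~= mu' @ tau" shows "T mu nu oL T mu' nu' = 0"
proof (rule blinfun_eqI, rule ell2_eqI)
  fix xi and \<gamma> :: "'e gpd"
  obtain x k y where g: "\<gamma> = (x, k, y)" by (cases \<gamma>)
  have "~(x : dm mu nu & sw mu nu x : dm mu' nu')"
  proof
    assume a: "x : dm mu nu & sw mu nu x : dm mu' nu'"
    then have p: "pre (length nu) (sw mu nu x) = nu" "pre (length mu') (sw mu nu x) = mu'" using dm_sw by (auto simp: dm_def mem_cyl)
    show False
    proof (cases "length nu <= length mu'")
      case True
      then show False using pre_add[of "length nu" "length mu' - length nu" "sw mu nu x"] p assms(1) by simp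
    next
      case False
      then show False using pre_add[of "length mu'" "length nu - length mu'" "sw mu nu x"] p assms(2) by simp
    qed
  qed
  then show "coord ((T mu nu oL T mu' nu') xi) \<gamma> = coord (blinfun_apply 0 xi) \<gamma>"
    unfolding g blinfun_apply_blinfun_compose coord_TT by auto
qed

text \<open>Empty words are excluded: \<open>D [] []\<close> is the whole unit space, which need not
  be compact.\<close>

definition T0 :: "('e gpd ell2 \<Rightarrow>\<^sub>L 'e gpd ell2) set" where "T0 = {T mu nu | mu nu. mu ~= [] & nu ~= []}"

definition A0 :: "('e gpd ell2 \<Rightarrow>\<^sub>L 'e gpd ell2) set" where "A0 = cop.span T0"

lemma T_A0: "mu ~= [] ==> nu ~= [] ==> T mu nu : A0" unfolding A0_def T0_def by (rule cop.span_base) blast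

lemma A0_add: "a : A0 ==> b : A0 ==> a + b : A0" and A0_cscale: "a : A0 ==> cscale c a : A0" and A0_0: "0 : A0"
  unfolding A0_def by (rule cop.span_add cop.span_scale cop.span_zero; assumption)+

lemma A0_sum: "(!!i. i : I ==> f i : A0) ==> sum f I : A0"
  unfolding A0_def by (rule cop.span_sum)

lemma A0_induct [consumes 1, case_names zero add]:
  assumes "a : A0" "P 0" "!!c mu nu b. mu ~= [] ==> nu ~= [] ==> b : A0 ==> P b ==> P (cscale c (T mu nu) + b)"
  shows "P a"
proof -
  have "a : A0 & P a" using assms(1) unfolding A0_def
  proof (induction rule: cop.span_induct_alt)
    case base then show ?case using assms(2) by (simp add: cop.span_zero)
  next
    case (step c x y)
    then obtain mu nu where x: "x = T mu nu" "mu ~= []" "nu ~= []" by (auto simp: T0_def)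
    have "P (cscale c x + y)" unfolding x(1) by (rule assms(3)) (use x step in \<open>auto simp: A0_def\<close>)
    moreover have "cscale c x + y : cop.span T0"
      using cop.span_add[OF cop.span_scale[OF cop.span_base[OF step(1)]]] step(2) by blast
    ultimately show ?case by blast
  qed
  then show ?thesis ..
qed

lemma A0_Adj: "A0 \<subseteq> Adj"
proof
  fix a assume "a : A0" then show "a : Adj"
    by (induction rule: A0_induct) (auto simp: Adj_0 intro: Adj_add Adj_cscale T_Adj)
qed

lemma A0_hadj: "a : A0 ==> hadj a : A0"
proof (induction rule: A0_induct)
  case (add c mu nu b)
  have "hadj (cscale c (T mu nu) + b) = cscale (cnj c) (T nu mu) + hadj b"
    using add A0_Adj by (subst hadj_add) (auto simp: hadj_cscale T_Adj hadj_T intro: Adj_cscale)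
  then show ?case using add by (simp add: A0_add A0_cscale T_A0)
qed (simp add: A0_0)

lemma TT_A0: assumes n: "mu ~= []" "nu ~= []" "mu' ~= []" "nu' ~= []" shows "T mu nu oL T mu' nu' : A0"
proof (cases "dm mu nu = {} \<or> dm mu' nu' = {}")
  case True then show ?thesis using T_empty A0_0 by auto
next
  case False
  consider tau where "mu' = nu @ tau" | tau where "nu = mu' @ tau" | "!!tau. mu' ~= nu @ tau" "!!tau. nu ~= mu' @ tau" by blast
  then show ?thesis
  proof cases
    case 1
    then show ?thesis using T_mult_right False n by (simp add: T_A0)
  next
    case 2
    then show ?thesis using T_mult_left False n by (simp add: T_A0)
  next
    case 3
    then show ?thesis using T_mult_zero by (simp add: A0_0)
  qed
qed

lemma A0_comp: assumes "a : A0" "b : A0" shows "a oL b : A0"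
proof -
  have 1: "T mu nu oL b : A0" if n: "mu ~= []" "nu ~= []" for mu nu
    using assms(2)
  proof (induction rule: A0_induct)
    case (add c mu' nu' b)
    then show ?case using n
      by (auto simp: comp_add cscale_right[OF AdjD(2)[OF T_Adj]] intro!: A0_add A0_cscale TT_A0)
  qed (simp add: A0_0)
  from assms(1) show ?thesis
    by (induction rule: A0_induct) (auto simp: comp_add cscale_left A0_0 intro!: A0_add A0_cscale 1)
qed

lemma cstar_closure: "cstar (closure A0)"
proof
  have seq: "EX f. (ALL n. f n : A0) & f ----> a" if "a : closure A0" for a using that by (simp add: closure_sequential)
  show "closure A0 \<subseteq> Adj" using seq Adj_lim(1) A0_Adj by blast
  show "0 : closure A0" using A0_0 closure_subset by blast
  show "a + b : closure A0" if ab: "a : closure A0" "b : closure A0" for a b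
  proof -
    obtain f g where "ALL n. f n : A0" "f ----> a" "ALL n. g n : A0" "g ----> b" using seq[OF ab(1)] seq[OF ab(2)] by blast
    then show ?thesis unfolding closure_sequential
      by (intro exI[of _ "%n. f n + g n"]) (auto intro: A0_add tendsto_add)
  qed
  show "a oL b : closure A0" if ab: "a : closure A0" "b : closure A0" for a b
  proof -
    obtain f g where "ALL n. f n : A0" "f ----> a" "ALL n. g n : A0" "g ----> b" using seq[OF ab(1)] seq[OF ab(2)] by blast
    then show ?thesis unfolding closure_sequential
      by (intro exI[of _ "%n. f n oL g n"]) (auto intro: A0_comp tendsto_comp)
  qed
  show "cscale c a : closure A0" if ab: "a : closure A0" for c a
  proof -
    obtain f where f: "ALL n. f n : A0" "f ----> a" using seq[OF ab] by blast
    have "(%n. cscale c (f n)) ----> cscale c a"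
      unfolding cscale_def by (intro tendsto_intros f(2) tendsto_comp)
    then show ?thesis unfolding closure_sequential using f(1)
      by (intro exI[of _ "%n. cscale c (f n)"] conjI allI A0_cscale) simp
  qed
  show "hadj a : closure A0" if ab: "a : closure A0" for a
  proof -
    obtain f where f: "ALL n. f n : A0" "f ----> a" using seq[OF ab] by blast
    show ?thesis using Adj_lim(2)[OF _ f(2)] f(1) A0_Adj exI[of _ "%n. hadj (f n)"] A0_hadj by (force simp: closure_sequential)
  qed
qed simp

end

section \<open>Topology of the path groupoid\<close>

context pgraph
begin

abbreviation "Gtop \<equiv> groupoid_topology G"

text \<open>A common point makes \<open>mu'\<close> and \<open>nu'\<close> extensions of
  \<open>mu\<close> and \<open>nu\<close>; the equal degrees force both extensions to be by the same
  word. So bisections with sufficiently long words are contained in a given one or disjoint from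
  it.\<close>

lemma D_nest:
  assumes "length mu <= length mu'" "length nu <= length nu'" "D mu nu \<inter> D mu' nu' ~= {}"
  shows "D mu' nu' \<subseteq> D mu nu"
proof -
  obtain x where x: "x : dm mu nu" "x : dm mu' nu'" "sw mu nu x = sw mu' nu' x" "dg mu nu = dg mu' nu'"
    using assms(3) by (auto simp: D_def)
  obtain w where w: "x = cat mu w" by (rule dmE[OF x(1)])
  obtain w' where w': "x = cat mu' w'" by (rule dmE[OF x(2)])
  have c: "cat mu w = cat mu' w'" "cat nu w = cat nu' w'" using x(3) w w' by (simp_all, metis sw_cat)
  obtain rho where r: "mu' = mu @ rho"
    using take_pre[OF assms(1), of "cat mu w"] c(1) by (metis append_take_drop_id pre_cat)
  obtain rho' where r': "nu' = nu @ rho'"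
    using take_pre[OF assms(2), of "cat nu w"] c(2) by (metis append_take_drop_id pre_cat)
  have "w = cat rho w'" "w = cat rho' w'" using c by (simp_all add: r r' cat_append cat_inj)
  moreover have "length rho = length rho'" using x(4) by (simp add: r r' dg_def)
  ultimately have e: "rho' = rho" using cat_eq_iff by metis
  show ?thesis
    unfolding r r' e D_def dm_append dg_append by (auto simp: sw_append)
qed

lemma D_open: "openin Gtop (D mu nu)"
proof -
  have inj: "inj_on (shift ^^ length \<sigma>) (cyl \<sigma>)" for \<sigma>
    by (auto simp: inj_on_def elim!: cylE)
  have e: "D mu nu = {(x, int (length mu) - int (length nu), y) | x y. x : cyl mu & y : cyl nu &
      (shift ^^ length mu) x = (shift ^^ length nu) y}"
    by (auto simp: D_def dg_def elim!: dmE cylE) (auto simp: dm_cat)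
  show ?thesis unfolding groupoid_topology_def
    by (rule topology_generated_by_Basis, unfold e) (use inj openin_cyl in blast)
qed

text \<open>The two exponents witnessing membership may be increased simultaneously, so bisections
  with long, in particular non-empty, words cover the groupoid.\<close>

lemma Gam_D: assumes "(x, k, y) : Gam"
  shows "EX n>=N. EX m>=M. (x, k, y) : D (pre n x) (pre m y)"
proof -
  obtain n m where g: "x : X" "y : X" "k = int n - int m" "(shift ^^ n) x = (shift ^^ m) y" using assms by (rule GamE)
  let ?n = "n + (N + M)" and ?m = "m + (N + M)"
  have s: "(shift ^^ ?n) x = (shift ^^ ?m) y" using g(4) by (metis shift_shift)
  have "(x, k, y) : D (pre ?n x) (pre ?m y)" using g by (auto simp: sw_def s D_def dm_def cyl_pre dg_def)
  then show ?thesis by (meson le_add1 le_add2 le_trans)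
qed

lemma topspace_GT: "topspace Gtop = Gam"
proof
  show "topspace Gtop \<subseteq> Gam" unfolding groupoid_topology_def
    by (auto intro!: GamI dest!: openin_subset)
  show "Gam \<subseteq> topspace Gtop"
  proof
    fix \<gamma> assume a: "\<gamma> : Gam"
    obtain x k y where g: "\<gamma> = (x, k, y)" by (cases \<gamma>)
    obtain n m where "\<gamma> : D (pre n x) (pre m y)" using Gam_D a g by blast
    then show "\<gamma> : topspace Gtop" using openin_subset[OF D_open] by blast
  qed
qed

lemma D_closed: "closedin Gtop (D mu nu)"
proof -
  have "openin Gtop (Gam - D mu nu)"
  proof (subst openin_subopen, intro ballI)
    fix \<gamma> assume a: "\<gamma> : Gam - D mu nu"
    obtain x k y where g: "\<gamma> = (x, k, y)" by (cases \<gamma>)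
    obtain n m where n: "length mu <= n" "length nu <= m" "\<gamma> : D (pre n x) (pre m y)"
      using Gam_D a g by blast
    have "D (pre n x) (pre m y) \<subseteq> Gam - D mu nu" using D_nest[of mu "pre n x" nu "pre m y"] n a D_Gam by auto
    then show "EX T. openin Gtop T & \<gamma> : T & T \<subseteq> Gam - D mu nu" using n(3) D_open by blast
  qed
  then show ?thesis using D_Gam by (simp add: closedin_def topspace_GT)
qed

lemma sw_cyl: assumes "x : dm mu nu" "y : cyl (pre (length mu + n) x)"
  shows "y : dm mu nu \<or> n = 0" "sw mu nu y : X ==> sw mu nu y : cyl (pre n (sw mu nu x))"
proof -
  have px: "pre (length mu) x = mu" using assms(1) by (simp add: dm_def mem_cyl)
  obtain w where w: "x = cat mu w" "cat nu w : X" by (rule dmE[OF assms(1)])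
  have y: "y : cyl (mu @ pre n w)" using assms(2) by (simp add: pre_add w)
  then obtain z where z: "y = cat mu z" using cyl_append_subset by (metis cylE subsetD)
  have zw: "z : cyl (pre n w)" using y z by simp
  show "y : dm mu nu \<or> n = 0" using zw cat_X_cong[OF w(2), of z] z y by (auto simp: mem_cyl pre_eq_iff dm_cat)
  show "sw mu nu y : X ==> sw mu nu y : cyl (pre n (sw mu nu x))"
    using zw unfolding z w by (simp add: mem_cyl pre_eq_iff) (simp add: cat_def)
qed

text \<open>Parametrises a bisection by a compact cylinder, which transports compactness and uniform
  continuity to the groupoid.\<close>

lemma emb_cont:
  assumes f: "dm mu nu = cyl mu"
  shows "continuous_map (subtopology (path_topology G) (cyl mu)) Gtop (%x. (x, dg mu nu, sw mu nu x))" (is "continuous_map ?P _ ?j")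
  unfolding groupoid_topology_def continuous_on_generated_topo_iff
proof (intro conjI allI impI)
  have tp: "topspace ?P = cyl mu" using cyl_X by auto
  show "?j ` topspace ?P \<subseteq> \<Union> {{(x, int n - int m, y) | x y. x : U & y : V & (shift ^^ n) x = (shift ^^ m) y} | U V n m.
        openin (path_topology G) U & openin (path_topology G) V &
        inj_on (shift ^^ n) U & inj_on (shift ^^ m) V}"
    using topspace_GT[unfolded groupoid_topology_def topology_generated_by_topspace] dm_Gam f by auto
  fix B assume "B : {{(x, int n - int m, y) | x y. x : U & y : V & (shift ^^ n) x = (shift ^^ m) y} | U V n m.
        openin (path_topology G) U & openin (path_topology G) V &
        inj_on (shift ^^ n) U & inj_on (shift ^^ m) V}"
  then obtain U V n m where B: "B = {(x, int n - int m, y) | x y. x : U & y : V & (shift ^^ n) x = (shift ^^ m) y}"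
    and U: "openin (path_topology G) U" and V: "openin (path_topology G) V" by blast
  \<comment> \<open>With equal degrees, corresponding coordinates are read either both from the
    words or both from the same place of the tail; so the condition depends on \<open>mu\<close> and
    \<open>nu\<close> only.\<close>
  have const: "(shift ^^ n) x' = (shift ^^ m) (sw mu nu x')"
    if a: "x : cyl mu" "x' : cyl mu" "dg mu nu = int n - int m" "(shift ^^ n) x = (shift ^^ m) (sw mu nu x)" for x x'
  proof -
    obtain w where w: "x = cat mu w" using a(1) by (rule cylE)
    obtain w' where w': "x' = cat mu w'" using a(2) by (rule cylE)
    show ?thesis
    proof
      fix i
      have "cat mu w (i + n) = cat nu w (i + m)" using fun_cong[OF a(4), of i] by (simp add: w shift_funpow)
      moreover have "i + n < length mu \<longleftrightarrow> i + m < length nu" "i + n - length mu = i + m - length nu"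
        using a(3) by (auto simp: dg_def)
      ultimately show "(shift ^^ n) x' i = (shift ^^ m) (sw mu nu x') i"
        unfolding w' sw_cat by (auto simp: shift_funpow cat_def)
    qed
  qed
  have "openin (path_topology G) (?j -` B \<inter> cyl mu)"
    unfolding openin_path_iff
  proof (intro conjI ballI)
    show "?j -` B \<inter> cyl mu \<subseteq> X" using cyl_X by auto
    fix x assume x: "x : ?j -` B \<inter> cyl mu"
    then have xm: "x : cyl mu" and xB: "dg mu nu = int n - int m" "x : U" "sw mu nu x : V" "(shift ^^ n) x = (shift ^^ m) (sw mu nu x)"
      unfolding B by auto
    obtain p where p: "cyl (pre p x) \<subseteq> U" using U xB(2) unfolding openin_path_iff by blast
    obtain q where q: "cyl (pre q (sw mu nu x)) \<subseteq> V" using V xB(3) unfolding openin_path_iff by blast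
    have "cyl (pre (length mu + (p + q)) x) \<subseteq> ?j -` B \<inter> cyl mu"
    proof
      fix y assume y: "y : cyl (pre (length mu + (p + q)) x)"
      have ym: "y : cyl mu" using xm y by (auto simp: mem_cyl pre_add)
      have yU: "y : U" using pre_add[of p "length mu + q" x] p y cyl_append_subset by (auto simp: add_ac)
      have "sw mu nu y : cyl (pre (p + q) (sw mu nu x))"
        using sw_cyl(2)[OF _ y, of nu] xm ym f by (auto simp: dm_def)
      moreover have "pre (p + q) (sw mu nu x) = pre q (sw mu nu x) @ pre p ((shift ^^ q) (sw mu nu x))"
        using pre_add[of q p] by (simp add: add.commute)
      ultimately have "sw mu nu y : V" using cyl_append_subset q by (metis subsetD)
      then show "y : ?j -` B \<inter> cyl mu" using ym yU const[OF xm ym xB(1,4)] xB(1) unfolding B by auto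
    qed
    then show "EX n. cyl (pre n x) \<subseteq> ?j -` B \<inter> cyl mu" by blast
  qed
  then show "openin ?P (?j -` B \<inter> topspace ?P)" unfolding tp
    by (simp add: openin_subtopology) blast
qed

lemma D_image: "dm mu nu = cyl mu ==> D mu nu = (%x. (x, dg mu nu, sw mu nu x)) ` cyl mu"
  by (auto simp: D_def)

lemma D_compact: assumes "mu ~= []" "nu ~= []" shows "compactin Gtop (D mu nu)"
proof (cases "dm mu nu = {}")
  case True then have "D mu nu = {}" by (auto simp: D_def)
  then show ?thesis by simp
next
  case False
  have f: "dm mu nu = cyl mu" by (rule dm_full[OF False assms])
  have "compactin (subtopology (path_topology G) (cyl mu)) (cyl mu)"
    using compactin_cyl[OF assms(1)] by (simp add: compactin_subtopology)
  from image_compactin[OF this emb_cont[OF f]] show ?thesis unfolding D_image[OF f] .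
qed

end

lemma coord_sum: "coord (sum f S) i = (SUM s:S. coord (f s) i)" for f :: "'b => 'a ell2"
  by (induction S rule: infinite_finite_induct) auto

section \<open>The graph algebra as the closed span of the matrix units\<close>

context pgraph
begin

abbreviation Fac :: "(nat => 'e) => int => (nat => 'e) => ((nat => 'e) \<times> int \<times> int) set" where
  "Fac x k y \<equiv> {(z, n, m). n + m = k & (x, n, z) : Gam & (z, m, y) : Gam}"

text \<open>Stated with \<open>has_sum\<close>, so that convergence of every convolution sum is part
  of the relation; by \<open>rep_lreg\<close> it then determines \<open>lreg G f\<close>.\<close>

definition rep :: "('e gpd => complex) => ('e gpd ell2 \<Rightarrow>\<^sub>L 'e gpd ell2) => bool" where
  "rep f a \<longleftrightarrow> (ALL xi x k y. ((%(z, n, m). f (x, n, z) * coord xi (z, m, y)) has_sum coord (blinfun_apply a xi) (x, k, y)) (Fac x k y))"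

lemma rep_lreg: assumes "rep f a" shows "lreg G f = a"
proof -
  have "convolution G f (coord xi) = coord (a xi)" for xi
  proof
    fix \<gamma> :: "'e gpd"
    obtain x k y where g: "\<gamma> = (x, k, y)" by (cases \<gamma>)
    show "convolution G f (coord xi) \<gamma> = coord (a xi) \<gamma>"
      unfolding g convolution_def prod.case using assms[unfolded rep_def] infsumI by blast
  qed
  then show ?thesis by (simp add: lreg_def coord_inverse blinfun_apply_inverse)
qed

lemma rep_0: "rep (%_. 0) 0" by (auto simp: rep_def intro!: has_sum_0)

lemma rep_add: assumes "rep f a" "rep g b" shows "rep (%\<gamma>. f \<gamma> + g \<gamma>) (a + b)"
  unfolding rep_def
proof (intro allI)
  fix xi :: "'e gpd ell2" and x k y
  from has_sum_add[OF assms(1)[unfolded rep_def, rule_format, of x xi y k] assms(2)[unfolded rep_def, rule_format, of x xi y k]]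
  show "((%(z, n, m). (f (x, n, z) + g (x, n, z)) * coord xi (z, m, y)) has_sum coord (blinfun_apply (a + b) xi) (x, k, y)) (Fac x k y)"
    by (simp add: blinfun.add_left case_prod_unfold algebra_simps)
qed

lemma rep_cscale: assumes "rep f a" shows "rep (%\<gamma>. c * f \<gamma>) (cscale c a)"
  unfolding rep_def
proof (intro allI)
  fix xi :: "'e gpd ell2" and x k y
  from has_sum_cmult_right[OF assms(1)[unfolded rep_def, rule_format, of x xi y k], of c]
  show "((%(z, n, m). (c * f (x, n, z)) * coord xi (z, m, y)) has_sum coord (blinfun_apply (cscale c a) xi) (x, k, y)) (Fac x k y)"
    by (simp add: case_prod_unfold algebra_simps)
qed

lemma rep_op: assumes b: "bdd_on f mu nu B" and z: "!!\<gamma>. \<gamma> ~: D mu nu ==> f \<gamma> = 0"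
  shows "rep f (op f mu nu)"
  unfolding rep_def
proof (intro allI)
  fix xi :: "'e gpd ell2" and x k y
  let ?t = "%(z, n, m). f (x, n, z) * coord xi (z, m, y)"
  have nz: "x : dm mu nu & n = dg mu nu & z = sw mu nu x" if "f (x, n, z) ~= 0" for n z
    using z that by (auto simp: D_def)
  show "(?t has_sum coord (op f mu nu xi) (x, k, y)) (Fac x k y)"
  proof (cases "(x, k, y) : Gam & x : dm mu nu")
    case True
    let ?p = "(sw mu nu x, dg mu nu, k - dg mu nu)"
    have p: "?p : Fac x k y" using Gam_op dm_Gam True by simp
    have "(?t has_sum ?t ?p) {?p}" using has_sum_finite[of "{?p}" ?t] by simp
    also have "?this \<longleftrightarrow> (?t has_sum ?t ?p) (Fac x k y)"
      by (rule has_sum_cong_neutral) (use p nz in \<open>force+\<close>)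
    finally show ?thesis using True by (simp add: coord_op[OF b])
  next
    case False
    have "?t p = 0" if "p : Fac x k y" for p
      using that False nz Gam_mult by (cases p) fastforce
    then have "(?t has_sum 0) (Fac x k y)" by (rule has_sum_0)
    moreover have "coord (op f mu nu xi) (x, k, y) = 0" unfolding coord_op[OF b] using False by argo
    ultimately show ?thesis by simp
  qed
qed

text \<open>\<open>f\<close> is replaced by a function \<open>g\<close> constant on each
  \<open>D (mu @ rho) (nu @ rho)\<close>. The operator of \<open>g\<close> is a finite combination
  of matrix units, and the operator norm of the difference is at most the uniform distance.\<close>

lemma op_closure:
  assumes n: "mu ~= []" "nu ~= []" and b: "bdd_on f mu nu B"
    and osc: "!!e. e > 0 ==> EX n. ALL rho:E n mu. ALL \<gamma>:D (mu @ rho) (nu @ rho). ALL \<gamma>':D (mu @ rho) (nu @ rho). dist (f \<gamma>) (f \<gamma>') < e"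
  shows "op f mu nu : closure A0"
proof (cases "dm mu nu = {}")
  case True
  then show ?thesis using op_dm_empty[OF True] A0_0 closure_subset by auto
next
  case False
  have fu: "dm mu nu = cyl mu" by (rule dm_full[OF False n])
  show ?thesis unfolding closure_approachable
  proof (intro allI impI)
    fix e :: real assume e: "e > 0"
    obtain n where n1: "!!rho \<gamma> \<gamma>'. rho : E n mu ==> \<gamma> : D (mu @ rho) (nu @ rho) ==> \<gamma>' : D (mu @ rho) (nu @ rho) ==> dist (f \<gamma>) (f \<gamma>') < e / 2"
      using osc[of "e/2"] e by auto
    define pt where "pt rho = (SOME \<gamma>. \<gamma> : D (mu @ rho) (nu @ rho))" for rho
    define g where "g \<gamma> = f (pt (drop (length mu) (pre (length mu + n) (fst \<gamma>))))" for \<gamma> :: "'e gpd"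
    have gx: "g (x, k, y) = f (pt rho)" if "rho : E n mu" "x : cyl (mu @ rho)" for x k y rho
      using that E_len by (simp add: g_def mem_cyl)
    have ex: "EX rho:E n mu. x : cyl (mu @ rho)" if "x : dm mu nu" for x using that unfolding fu cyl_E[of mu n] by blast
    have fg: "norm (f \<gamma> - g \<gamma>) <= e / 2" "norm (g \<gamma>) <= B" if g: "\<gamma> : D mu nu" for \<gamma>
    proof -
      obtain x where x: "x : dm mu nu" "\<gamma> = (x, dg mu nu, sw mu nu x)" using g by (auto simp: D_def)
      obtain rho where r: "rho : E n mu" "x : cyl (mu @ rho)" using ex[OF x(1)] by blast
      have gD: "\<gamma> : D (mu @ rho) (nu @ rho)" using x r by (simp add: D_def dm_append dg_append sw_append)
      then have pD: "pt rho : D (mu @ rho) (nu @ rho)" unfolding pt_def by (rule someI)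
      have ge: "g \<gamma> = f (pt rho)" using gx[OF r] x(2) by simp
      show "norm (f \<gamma> - g \<gamma>) <= e / 2" using n1[OF r(1) gD pD] ge by (simp add: dist_norm)
      show "norm (g \<gamma>) <= B" using pD b ge by (auto simp: D_def dm_append dg_append sw_append bdd_on_def)
    qed
    have bg: "bdd_on g mu nu B" using fg(2) b by (simp add: bdd_on_def)
    have bfg: "bdd_on (%\<gamma>. f \<gamma> - g \<gamma>) mu nu (e / 2)" using fg(1) e by (simp add: bdd_on_def)
    have "op g mu nu = (SUM rho:E n mu. cscale (f (pt rho)) (T (mu @ rho) (nu @ rho)))"
    proof (rule blinfun_eqI, rule ell2_eqI)
      fix xi and \<gamma> :: "'e gpd"
      obtain x k y where g: "\<gamma> = (x, k, y)" by (cases \<gamma>)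
      have R: "coord (blinfun_apply (SUM rho:E n mu. cscale (f (pt rho)) (T (mu @ rho) (nu @ rho))) xi) \<gamma> =
         (SUM rho:E n mu. f (pt rho) * (if (x, k, y) : Gam & x : dm mu nu \<inter> cyl (mu @ rho) then coord xi (sw (mu @ rho) (nu @ rho) x, k - dg mu nu, y) else 0))"
        unfolding blinfun.sum_left coord_sum coord_cscale g coord_T dm_append dg_append ..
      show "coord (op g mu nu xi) \<gamma> = coord (blinfun_apply (SUM rho:E n mu. cscale (f (pt rho)) (T (mu @ rho) (nu @ rho))) xi) \<gamma>"
      proof (cases "(x, k, y) : Gam & x : dm mu nu")
        case True
        then obtain rho where r: "rho : E n mu" "x : cyl (mu @ rho)" using ex by blast
        have ot: "x ~: cyl (mu @ \<sigma>)" if "\<sigma> : E n mu" "\<sigma> ~= rho" for \<sigma>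
          using r that E_len by (force simp: mem_cyl)
        show ?thesis unfolding R
          by (subst sum.remove[OF finite_E[OF n(1)] r(1)], subst sum.neutral)
            (use True r ot in \<open>auto simp: g coord_op[OF bg] sw_append gx\<close>)
      qed (auto simp: R[unfolded g] g coord_op[OF bg])
    qed
    also have "... : A0" by (intro A0_sum A0_cscale T_A0) (simp_all add: n)
    finally have "op g mu nu : A0" .
    moreover have "dist (op g mu nu) (op f mu nu) < e"
      using norm_op[OF bfg] e unfolding op_diff[OF b bg] by (simp add: dist_norm norm_minus_commute)
    ultimately show "EX y:A0. dist y (op f mu nu) < e" by blast
  qed
qed

lemma cont_cases:
  fixes f g :: "'e gpd => complex"
  assumes "continuous_map Gtop euclidean f" "continuous_map Gtop euclidean g"
  shows "continuous_map Gtop euclidean (%\<gamma>. if \<gamma> : D mu nu then f \<gamma> else g \<gamma>)"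
proof (rule continuous_map_cases)
  have "Gtop frontier_of (D mu nu) = {}"
    using D_closed D_open frontier_of_eq_empty closedin_subset by metis
  then show "f x = g x" if "x : Gtop frontier_of {x. x : D mu nu}" for x using that by simp
qed (use assms in \<open>auto intro: continuous_map_from_subtopology\<close>)

lemma cont_osc:
  fixes f :: "'e gpd => complex"
  assumes c: "continuous_map Gtop euclidean f" and f: "dm mu nu = cyl mu" and n: "mu ~= []" and e: "e > 0"
  shows "EX n. ALL rho:E n mu. ALL \<gamma>:D (mu @ rho) (nu @ rho). ALL \<gamma>':D (mu @ rho) (nu @ rho). dist (f \<gamma>) (f \<gamma>') < e"
proof -
  define h where "h = f \<circ> (%x. (x, dg mu nu, sw mu nu x))"
  have h: "continuous_map (subtopology (path_topology G) (cyl mu)) euclidean h"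
    unfolding h_def by (rule continuous_map_compose[OF emb_cont[OF f] c])
  have "EX n. ALL rho:E n mu. ALL x:cyl (mu @ rho). ALL y:cyl (mu @ rho). dist (h x) (h y) < e"
  proof (rule cyl_uniform[OF n _ e])
    fix x and e :: real assume x: "x : cyl mu" and e: "e > 0"
    have "openin (path_topology G) {y : topspace (subtopology (path_topology G) (cyl mu)). h y : ball (h x) e}" using openin_continuous_map_preimage[OF h] openin_open_subtopology[OF openin_cyl] by force
    moreover have "x : {y : topspace (subtopology (path_topology G) (cyl mu)). h y : ball (h x) e}"
      using x e cyl_X by auto
    ultimately obtain n where "cyl (pre n x) \<subseteq> {y : topspace (subtopology (path_topology G) (cyl mu)). h y : ball (h x) e}"
      unfolding openin_path_iff by blast
    then show "EX n. ALL y:cyl (pre n x). dist (h x) (h y) < e" by (intro exI[of _ n]) auto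
  qed
  then obtain n where n: "ALL rho:E n mu. ALL x:cyl (mu @ rho). ALL y:cyl (mu @ rho). dist (h x) (h y) < e" ..
  show ?thesis
    by (rule exI[of _ n]) (use n in \<open>auto simp: D_def dm_append dg_append sw_append h_def\<close>)
qed

lemma cont_bdd: fixes f :: "'e gpd => complex"
  assumes "continuous_map Gtop euclidean f" "mu ~= []" "nu ~= []" shows "EX B. bdd_on f mu nu B"
proof -
  have "compact (f ` D mu nu)" using image_compactin[OF D_compact[OF assms(2,3)] assms(1)] by simp
  then obtain B where "!!z. z : f ` D mu nu ==> norm z <= B" using compact_imp_bounded bounded_iff by metis
  then have "bdd_on f mu nu (max B 0)" by (fastforce simp: bdd_on_def)
  then show ?thesis ..
qed

lemma op_cont_closure: fixes f :: "'e gpd => complex"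
  assumes c: "continuous_map Gtop euclidean f" and n: "mu ~= []" "nu ~= []" shows "op f mu nu : closure A0"
proof (cases "dm mu nu = {}")
  case True
  then show ?thesis using op_dm_empty[OF True] A0_0 closure_subset by auto
next
  case False
  obtain B where B: "bdd_on f mu nu B" using cont_bdd[OF assms] ..
  show ?thesis by (rule op_closure[OF n B cont_osc[OF c dm_full[OF False n] n(1)]])
qed

text \<open>The bisections are clopen, so a continuous function splits along each of them into
  continuous pieces; induction on the number of covering bisections.\<close>

lemma cover_rep:
  fixes f :: "'e gpd => complex"
  assumes "finite F" "ALL (mu, nu):F. mu ~= [] & nu ~= []" "continuous_map Gtop euclidean f"
    "!!\<gamma>. \<gamma> ~: (UN (mu, nu):F. D mu nu) ==> f \<gamma> = 0"
  shows "EX a:closure A0. rep f a"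
  using assms
proof (induction F arbitrary: f)
  case empty
  then have "f = (%_. 0)" by auto
  then show ?case using rep_0 A0_0 closure_subset by auto
next
  case (insert p F)
  obtain mu nu where p: "p = (mu, nu)" by (cases p)
  have n: "mu ~= []" "nu ~= []" using insert.prems(1) p by auto
  define f1 where "f1 \<gamma> = (if \<gamma> : D mu nu then f \<gamma> else 0)" for \<gamma>
  define f2 where "f2 \<gamma> = (if \<gamma> : D mu nu then 0 else f \<gamma>)" for \<gamma>
  have c: "continuous_map Gtop euclidean f1" "continuous_map Gtop euclidean f2"
    unfolding f1_def f2_def by (rule cont_cases; use insert.prems(2) in simp)+
  obtain B where B: "bdd_on f1 mu nu B" using cont_bdd[OF c(1) n] ..
  have r1: "rep f1 (op f1 mu nu)" by (rule rep_op[OF B]) (simp add: f1_def)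
  obtain a where a: "a : closure A0" "rep f2 a"
  proof -
    have "EX a:closure A0. rep f2 a"
    proof (rule insert.IH[OF _ c(2)])
      show "ALL (mu, nu):F. mu ~= [] & nu ~= []" using insert.prems(1) by blast
      show "f2 \<gamma> = 0" if "\<gamma> ~: (UN (mu, nu):F. D mu nu)" for \<gamma>
        using insert.prems(3) that by (simp add: f2_def p)
    qed
    then show ?thesis using that by blast
  qed
  have "f = (%\<gamma>. f1 \<gamma> + f2 \<gamma>)" by (auto simp: f1_def f2_def)
  then have "rep f (op f1 mu nu + a)" using rep_add[OF r1 a(2)] by simp
  then show ?case using cstar.A_add[OF cstar_closure op_cont_closure[OF c(1) n] a(1)] by blast
qed

lemma Cc_rep: assumes "f : Cc Gtop" shows "EX a:closure A0. rep f a"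
proof -
  obtain K where K: "continuous_map Gtop euclidean f" "compactin Gtop K" "!!x. x ~: K ==> f x = 0"
    using assms by (auto simp: Cc_def)
  let ?U = "(%(mu, nu). D mu nu) ` {(mu, nu). mu ~= [] & nu ~= []}"
  have "K \<subseteq> \<Union>?U"
  proof
    fix \<gamma> assume "\<gamma> : K"
    then have a: "\<gamma> : Gam" using compactin_subset_topspace[OF K(2)] topspace_GT by blast
    obtain x k y where g: "\<gamma> = (x, k, y)" by (cases \<gamma>)
    obtain n m where n: "n >= 1" "m >= 1" "\<gamma> : D (pre n x) (pre m y)" using Gam_D a g by blast
    have "D (pre n x) (pre m y) : ?U" using n by auto
    then show "\<gamma> : \<Union>?U" using n(3) by (rule UnionI)
  qed
  moreover have "!!S. S : ?U ==> openin Gtop S" using D_open by auto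
  ultimately obtain V where V: "finite V" "V \<subseteq> ?U" "K \<subseteq> \<Union>V"
    using K(2) unfolding compactin_def by meson
  obtain F where F: "F \<subseteq> {(mu, nu). mu ~= [] & nu ~= []}" "finite F" "V = (%(mu, nu). D mu nu) ` F"
    using finite_subset_image[OF V(1,2)] by metis
  show ?thesis using cover_rep[OF F(2) _ K(1)] F(1) K(3) V(3) F(3) by blast
qed

lemma A0_rep: assumes "a : A0" shows "EX f:Cc Gtop. rep f a"
  using assms
proof (induction rule: A0_induct)
  case zero
  show ?case using rep_0 by (auto simp: Cc_def intro!: exI)
next
  case (add c mu nu b)
  then obtain g where g: "g : Cc Gtop" "rep g b" by blast
  then obtain K where K: "continuous_map Gtop euclidean g" "compactin Gtop K" "!!x. x ~: K ==> g x = 0"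
    by (auto simp: Cc_def)
  define h where "h \<gamma> = (if \<gamma> : D mu nu then 1 else 0 :: complex)" for \<gamma>
  have "rep h (op h mu nu)" by (rule rep_op[of _ _ _ 1]) (auto simp: h_def bdd_on_def)
  moreover have "op h mu nu = T mu nu" unfolding T_def by (rule op_cong) (simp add: h_def)
  ultimately have r: "rep (%\<gamma>. c * h \<gamma> + g \<gamma>) (cscale c (T mu nu) + b)" using rep_add[OF rep_cscale g(2)] by metis
  have "continuous_map Gtop euclidean (%\<gamma>. c * h \<gamma> + g \<gamma>)"
  proof (rule continuous_map_add[OF _ K(1)])
    have "(%\<gamma>. c * h \<gamma>) = (%\<gamma>. if \<gamma> : D mu nu then c else 0)" by (auto simp: h_def)
    then show "continuous_map Gtop euclidean (%\<gamma>. c * h \<gamma>)" using cont_cases by simp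
  qed
  moreover have "compactin Gtop (D mu nu \<union> K)" using compactin_Un[OF D_compact K(2)] add by blast
  moreover have "c * h x + g x = 0" if "x ~: D mu nu \<union> K" for x using that K(3) by (simp add: h_def)
  ultimately have "(%\<gamma>. c * h \<gamma> + g \<gamma>) : Cc Gtop" unfolding Cc_def by blast
  then show ?case using r by blast
qed

abbreviation "AG \<equiv> graph_algebra G"

text \<open>From here on, statements that are continuous in norm and linear need be checked on
  \<open>T mu nu\<close> only.\<close>

lemma graph_algebra_eq: "AG = closure A0"
proof
  have "lreg G ` Cc Gtop \<subseteq> closure A0" using Cc_rep rep_lreg by force
  then show "AG \<subseteq> closure A0" unfolding graph_algebra_def by (rule closure_minimal) simp
  have "A0 \<subseteq> lreg G ` Cc Gtop" using A0_rep rep_lreg by force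
  then show "closure A0 \<subseteq> AG" unfolding graph_algebra_def by (rule closure_mono)
qed

lemma A0_AG: "A0 \<subseteq> AG" unfolding graph_algebra_eq by (rule closure_subset)

sublocale cstar AG unfolding graph_algebra_eq by (rule cstar_closure)

end

lemma norm_cis_diff: "norm (cis a - cis b) <= \<bar>a - b\<bar>"
proof -
  have "cis a - cis b = cis b * (exp (\<i> * of_real (a - b)) - 1)"
    by (simp add: cis_conv_exp algebra_simps flip: exp_add)
  then have "norm (cis a - cis b) = 2 * \<bar>sin ((a - b) / 2)\<bar>" by (metis norm_mult norm_cis mult_1 dist_exp_i_1)
  also have "... <= \<bar>a - b\<bar>" using abs_sin_x_le_abs_x[of "(a - b) / 2"] by simp
  finally show ?thesis .
qed

lemma blinfun_sandwich_norm:
  fixes p q a :: "'a ell2 \<Rightarrow>\<^sub>L 'a ell2"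
  assumes "norm p <= 1" "norm q <= 1" shows "norm (p oL a oL q) <= norm a"
proof -
  have "norm (p oL a oL q) <= norm p * norm a * norm q"
    by (rule order_trans[OF norm_comp_le], rule mult_right_mono[OF norm_comp_le]) simp
  also have "... <= 1 * norm a * 1" by (intro mult_mono assms) auto
  finally show ?thesis by simp
qed

section \<open>The cocycle of a potential and the unitaries implementing its action\<close>

context pgraph
begin

text \<open>The limit behind \<open>act_Cc\<close>, taken before exponentiation.\<close>

definition coc :: "((nat => 'e) => real) => 'e gpd => real" where
  "coc \<phi> = (%(x, k, y). lim (%n. birkhoff_sum \<phi> (nat (k + int n)) x - birkhoff_sum \<phi> n y))"

lemma coc_ev:
  assumes "(shift ^^ n) x = (shift ^^ m) y" "k = int n - int m" "j >= m"
  shows "birkhoff_sum \<phi> (nat (k + int j)) x - birkhoff_sum \<phi> j y = birkhoff_sum \<phi> n x - birkhoff_sum \<phi> m y"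
proof -
  have e: "nat (k + int j) = n + (j - m)" "j = m + (j - m)" using assms by auto
  have "birkhoff_sum \<phi> j y = birkhoff_sum \<phi> m y + birkhoff_sum \<phi> (j - m) ((shift ^^ m) y)"
    by (subst e(2), rule birkhoff_add)
  then show ?thesis unfolding e(1) birkhoff_add assms(1) by simp
qed

lemma coc_eq:
  assumes "(shift ^^ n) x = (shift ^^ m) y" "k = int n - int m"
  shows "coc \<phi> (x, k, y) = birkhoff_sum \<phi> n x - birkhoff_sum \<phi> m y"
  unfolding coc_def prod.case
  by (rule limI, rule tendsto_eventually) (use coc_ev[OF assms] in \<open>auto simp: eventually_sequentially\<close>)

lemma coc_mult: assumes "(x, k, z) : Gam" "(z, l, y) : Gam"
  shows "coc \<phi> (x, k + l, y) = coc \<phi> (x, k, z) + coc \<phi> (z, l, y)"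
proof -
  let ?b = "birkhoff_sum \<phi>"
  obtain a b where 1: "x : X" "k = int a - int b" "(shift ^^ a) x = (shift ^^ b) z" using assms(1) by (rule GamE)
  obtain c d where 2: "y : X" "l = int c - int d" "(shift ^^ c) z = (shift ^^ d) y" using assms(2) by (rule GamE)
  have "(shift ^^ (a + c)) x = (shift ^^ c) ((shift ^^ b) z)" unfolding 1(3)[symmetric] shift_shift ..
  also have "... = (shift ^^ b) ((shift ^^ d) y)" unfolding 2(3)[symmetric] shift_shift by (simp add: add.commute)
  finally have e: "(shift ^^ (a + c)) x = (shift ^^ (d + b)) y" unfolding shift_shift .
  have "coc \<phi> (x, k + l, y) = ?b (a + c) x - ?b (d + b) y" by (rule coc_eq[OF e]) (simp add: 1 2)
  also have "... = ?b a x + ?b c ((shift ^^ b) z) - (?b d y + ?b b ((shift ^^ c) z))"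
    unfolding birkhoff_add 1(3) 2(3) ..
  also have "... = (?b a x - ?b b z) + (?b c z - ?b d y)"
    using birkhoff_add[of \<phi> b c z] birkhoff_add[of \<phi> c b z] by (simp add: add.commute)
  finally show ?thesis unfolding coc_eq[OF 1(3,2)] coc_eq[OF 2(3,2)] .
qed

lemma coc_unit [simp]: "coc \<phi> (x, 0, x) = 0" using coc_eq[of 0 x 0 x 0] by simp

lemma coc_D: "x : dm mu nu ==> coc \<phi> (x, dg mu nu, sw mu nu x) =
    birkhoff_sum \<phi> (length mu) x - birkhoff_sum \<phi> (length nu) (sw mu nu x)"
  by (rule coc_eq) (auto simp: dg_def elim!: dmE)

lemma coc_gauge: "(x, k, y) : Gam ==> coc (%_. 1) (x, k, y) = of_int k"
  by (erule GamE) (simp add: coc_eq birkhoff_sum_def)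

definition Uw :: "((nat => 'e) => real) => real => 'e gpd => complex" where
  "Uw \<phi> t \<gamma> = (if \<gamma> : Gam then cis (t * coc \<phi> \<gamma>) else 1)"

text \<open>By additivity of the cocycle, conjugation with this unitary multiplies a convolution
  kernel by \<open>cis (t * coc \<phi> \<gamma>)\<close>. Off the groupoid the factor is 1, which
  keeps the operator unitary.\<close>

definition Ut :: "((nat => 'e) => real) => real => 'e gpd ell2 \<Rightarrow>\<^sub>L 'e gpd ell2" where
  "Ut \<phi> t = wco (Uw \<phi> t) id"

lemma Ut_data: "wco_data (Uw \<phi> t) id 1" by standard (auto simp: Uw_def)

lemma coord_Ut: "coord (Ut \<phi> t xi) \<gamma> = Uw \<phi> t \<gamma> * coord xi \<gamma>"
  unfolding Ut_def wco_data.coord_wco[OF Ut_data] by simp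

lemma norm_Ut: "norm (Ut \<phi> t) <= 1" unfolding Ut_def by (rule wco_data.norm_wco[OF Ut_data])

lemma Uw_add: "Uw \<phi> s \<gamma> * Uw \<phi> t \<gamma> = Uw \<phi> (s + t) \<gamma>" by (simp add: Uw_def cis_mult algebra_simps)
lemma Uw_0: "Uw \<phi> 0 \<gamma> = 1" by (simp add: Uw_def)

lemma Ut_add: "Ut \<phi> s oL Ut \<phi> t = Ut \<phi> (s + t)"
  by (rule blinfun_eqI, rule ell2_eqI) (simp add: coord_Ut Uw_add)

lemma Ut_0: "Ut \<phi> 0 = id_blinfun"
  by (rule blinfun_eqI, rule ell2_eqI) (simp add: coord_Ut Uw_0)

lemma Ut_hadj: "is_hadj (Ut \<phi> t) (Ut \<phi> (- t))"
  unfolding Ut_def by (rule is_hadj_wco[OF Ut_data Ut_data]) (auto simp: Uw_def cis_cnj)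

lemma Ut_Adj: "Ut \<phi> t : Adj"
  by (rule AdjI[OF Ut_hadj]) (unfold Ut_def, rule wco_data.clin_wco[OF Ut_data])

lemma hadj_Ut: "hadj (Ut \<phi> t) = Ut \<phi> (- t)" by (rule is_hadj_hadj[OF Ut_hadj])

definition al :: "((nat => 'e) => real) => real => ('e gpd ell2 \<Rightarrow>\<^sub>L 'e gpd ell2) => ('e gpd ell2 \<Rightarrow>\<^sub>L 'e gpd ell2)" where
  "al \<phi> t a = Ut \<phi> t oL a oL Ut \<phi> (- t)"

lemma al_comp: "al \<phi> t (a oL b) = al \<phi> t a oL al \<phi> t b"
proof -
  have "Ut \<phi> (- t) oL (Ut \<phi> t oL c) = c" for c :: "'e gpd ell2 \<Rightarrow>\<^sub>L 'e gpd ell2" by (simp add: comp_assoc[symmetric] Ut_add Ut_0)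
  then show ?thesis by (simp add: al_def comp_assoc)
qed

lemma al_add: "al \<phi> t (a + b) = al \<phi> t a + al \<phi> t b" and al_diff: "al \<phi> t (a - b) = al \<phi> t a - al \<phi> t b"
  and al_scaleR: "al \<phi> t (r *\<^sub>R a) = r *\<^sub>R al \<phi> t a" and al_zero [simp]: "al \<phi> t 0 = 0"
  by (simp_all add: al_def comp_add comp_diff comp_scaleR)

lemma al_cscale: "al \<phi> t (cscale c a) = cscale c (al \<phi> t a)"
  by (simp add: al_def cscale_right[OF AdjD(2)[OF Ut_Adj]] cscale_left)

lemma al_hadj: "a : Adj ==> hadj (al \<phi> t a) = al \<phi> t (hadj a)"
  by (simp add: al_def hadj_comp Adj_comp Ut_Adj hadj_Ut comp_assoc)

lemma norm_al: "norm (al \<phi> t a) <= norm a"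
  unfolding al_def by (rule blinfun_sandwich_norm[OF norm_Ut norm_Ut])

lemma al_al: "al \<phi> s (al \<phi> t a) = al \<phi> (s + t) a"
  by (simp add: al_def comp_assoc Ut_add add.commute) (simp add: comp_assoc[symmetric] Ut_add)

lemma al_0 [simp]: "al \<phi> 0 a = a" by (simp add: al_def Ut_0)

lemma al_tendsto: "f ----> a ==> (%n. al \<phi> t (f n)) ----> al \<phi> t a"
  unfolding al_def by (intro tendsto_comp tendsto_const)

lemma coord_al: "coord (al \<phi> t a xi) \<gamma> = Uw \<phi> t \<gamma> * coord (a (Ut \<phi> (- t) xi)) \<gamma>"
  by (simp add: al_def coord_Ut)

lemma act_Cc_eq: assumes "(x, k, y) : Gam"
  shows "act_Cc \<phi> t f (x, k, y) = Uw \<phi> t (x, k, y) * f (x, k, y)"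
proof -
  obtain n m where g: "x : X" "y : X" "k = int n - int m" "(shift ^^ n) x = (shift ^^ m) y"
    using assms by (rule GamE)
  show ?thesis unfolding act_Cc_def prod.case
    by (rule limI, rule tendsto_eventually, unfold eventually_sequentially, rule exI[of _ m])
      (simp add: coc_ev[OF g(4,3)] Uw_def assms coc_eq[OF g(4,3)] cis_conv_exp)
qed

lemma rep_act: assumes "rep f a" shows "rep (act_Cc \<phi> t f) (al \<phi> t a)"
  unfolding rep_def
proof (intro allI)
  fix xi :: "'e gpd ell2" and x k y
  have "((%p. Uw \<phi> t (x, k, y) * (%(z, n, m). f (x, n, z) * coord (Ut \<phi> (- t) xi) (z, m, y)) p) has_sum coord (al \<phi> t a xi) (x, k, y)) (Fac x k y)"
    unfolding coord_al using assms[unfolded rep_def] by (intro has_sum_cmult_right) blast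
  also have "?this \<longleftrightarrow> ((%(z, n, m). act_Cc \<phi> t f (x, n, z) * coord xi (z, m, y)) has_sum coord (al \<phi> t a xi) (x, k, y)) (Fac x k y)"
  proof (rule has_sum_cong)
    fix p assume "p : Fac x k y"
    then obtain z n m where p: "p = (z, n, m)" "k = n + m" "(x, n, z) : Gam" "(z, m, y) : Gam" by auto
    show "Uw \<phi> t (x, k, y) * (%(z, n, m). f (x, n, z) * coord (Ut \<phi> (- t) xi) (z, m, y)) p =
       (%(z, n, m). act_Cc \<phi> t f (x, n, z) * coord xi (z, m, y)) p" using Gam_mult p(3,4) coc_mult coord_Ut by (auto simp: p(2) Uw_def cis_mult distrib_left p(1) act_Cc_eq)
  qed
  finally show "((%(z, n, m). act_Cc \<phi> t f (x, n, z) * coord xi (z, m, y)) has_sum coord (al \<phi> t a xi) (x, k, y)) (Fac x k y)" .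
qed

text \<open>Conjugation is norm-continuous and gives the right kernel on the dense image, so it
  meets the description in \<open>act\<close>; one approximating sequence yields uniqueness.\<close>

lemma act_eq: assumes "a : AG" shows "act G \<phi> t a = al \<phi> t a"
proof -
  have L: "lreg G (act_Cc \<phi> t f) = al \<phi> t (lreg G f)" if "f : Cc Gtop" for f
    using Cc_rep[OF that] rep_lreg rep_act by metis
  show ?thesis unfolding act_def
  proof (rule the_equality, intro allI impI)
    fix f assume f: "(ALL j. f j : Cc Gtop) & (%j. lreg G (f j)) ----> a"
    then show "(%j. lreg G (act_Cc \<phi> t (f j))) ----> al \<phi> t a"
      using al_tendsto L by simp
  next
    fix b assume b: "ALL f. (ALL j. f j : Cc Gtop) & (%j. lreg G (f j)) ----> a --> (%j. lreg G (act_Cc \<phi> t (f j))) ----> b"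
    obtain h where h: "!!j. h j : lreg G ` Cc Gtop" "h ----> a"
      using assms unfolding graph_algebra_def closure_sequential by blast
    have "ALL j. EX f. f : Cc Gtop & lreg G f = h j" using h(1) unfolding image_iff by metis
    then obtain f where f: "!!j. f j : Cc Gtop" "!!j. lreg G (f j) = h j" by metis
    have "(%j. lreg G (act_Cc \<phi> t (f j))) ----> b" using b f h(2) by simp
    moreover have "(%j. lreg G (act_Cc \<phi> t (f j))) ----> al \<phi> t a" using L f al_tendsto[OF h(2)] by simp
    ultimately show "b = al \<phi> t a" by (rule LIMSEQ_unique)
  qed
qed

lemma cis_coc_bdd: "bdd_on (%\<gamma>. cis (t * coc \<phi> \<gamma>)) mu nu 1" by (simp add: bdd_on_def)

lemma al_T: "al \<phi> t (T mu nu) = op (%\<gamma>. cis (t * coc \<phi> \<gamma>)) mu nu"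
proof (rule blinfun_eqI, rule ell2_eqI)
  fix xi and \<gamma> :: "'e gpd"
  obtain x k y where g: "\<gamma> = (x, k, y)" by (cases \<gamma>)
  have "Uw \<phi> t (x, k, y) * Uw \<phi> (- t) (sw mu nu x, k - dg mu nu, y) = cis (t * coc \<phi> (x, dg mu nu, sw mu nu x))"
    if "(x, k, y) : Gam" "x : dm mu nu"
    using coc_mult[OF dm_Gam[OF that(2)] Gam_op[OF that], of \<phi>] Gam_op that
    by (simp add: Uw_def cis_mult algebra_simps)
  then show "coord (al \<phi> t (T mu nu) xi) \<gamma> = coord (op (%\<gamma>. cis (t * coc \<phi> \<gamma>)) mu nu xi) \<gamma>"
    unfolding g coord_al coord_T coord_op[OF cis_coc_bdd] by (simp add: coord_Ut)
qed

end

context pot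
begin

lemma coc_osc: assumes "e > 0"
  shows "EX n. ALL rho. n <= length rho --> (ALL \<gamma>:D (mu @ rho) (nu @ rho). ALL \<gamma>':D (mu @ rho) (nu @ rho). \<bar>coc u \<gamma> - coc u \<gamma>'\<bar> < e)"
proof -
  \<comment> \<open>The added 1 makes the final estimate strict and \<open>l\<close>
    positive.\<close>
  define l where "l = length mu + length nu + 1"
  have "0 < e / l" using assms by (simp add: l_def)
  from osc[OF this] obtain k where k: "ALL tau rho x y. k <= length rho --> x : cyl (tau @ rho) --> y : cyl (tau @ rho) -->
     \<bar>bs (length tau) x - bs (length tau) y\<bar> <= length tau * (e / l)" by blast
  have *: "\<bar>coc u \<gamma> - coc u \<gamma>'\<bar> < e"
    if r: "k <= length rho" and g: "\<gamma> : D (mu @ rho) (nu @ rho)" "\<gamma>' : D (mu @ rho) (nu @ rho)" for rho \<gamma> \<gamma>'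
  proof -
    obtain x where x: "x : dm (mu @ rho) (nu @ rho)" "\<gamma> = (x, dg mu nu, sw mu nu x)"
      using g(1) by (auto simp: D_def dg_append dm_append sw_append)
    obtain y where y: "y : dm (mu @ rho) (nu @ rho)" "\<gamma>' = (y, dg mu nu, sw mu nu y)"
      using g(2) by (auto simp: D_def dg_append dm_append sw_append)
    have c: "x : cyl (mu @ rho)" "y : cyl (mu @ rho)" "x : dm mu nu" "y : dm mu nu" using x(1) y(1) by (auto simp: dm_append)
    have s: "sw mu nu x : cyl (nu @ rho)" "sw mu nu y : cyl (nu @ rho)"
      using dm_sw[OF x(1)] dm_sw[OF y(1)] c by (auto simp: sw_append dm_def)
    have "\<bar>coc u \<gamma> - coc u \<gamma>'\<bar> <= \<bar>bs (length mu) x - bs (length mu) y\<bar> + \<bar>bs (length nu) (sw mu nu x) - bs (length nu) (sw mu nu y)\<bar>"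
      unfolding x(2) y(2) coc_D[OF c(3)] coc_D[OF c(4)] by linarith
    also have "... <= length mu * (e / l) + length nu * (e / l)"
      using r by (intro add_mono k[rule_format, OF _ c(1,2)] k[rule_format, OF _ s]) simp_all
    also have "... = (real l - 1) * (e / l)" by (simp add: l_def distrib_right add_divide_distrib)
    also have "... < l * (e / l)" using \<open>0 < e / l\<close> by (intro mult_strict_right_mono) auto
    also have "... = e" by (simp add: l_def)
    finally show ?thesis .
  qed
  then show ?thesis by blast
qed

lemma coc_bd: assumes n: "mu ~= []" "nu ~= []" shows "EX b. ALL \<gamma>:D mu nu. \<bar>coc u \<gamma>\<bar> <= b"
proof -
  obtain b where b: "!!x. x : cyl mu ==> \<bar>bs (length mu) x\<bar> <= b" using bs_bd by blast
  obtain c where c: "!!x. x : cyl nu ==> \<bar>bs (length nu) x\<bar> <= c" using bs_bd by blast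
  have "\<bar>coc u (x, dg mu nu, sw mu nu x)\<bar> <= b + c" if "x : dm mu nu" for x
    using b[of x] c[of "sw mu nu x"] dm_sw that unfolding coc_D[OF that] by (auto simp: dm_def)
  then show ?thesis by (intro exI[of _ "b + c"]) (auto simp: D_def)
qed

lemma al_T_AG: assumes n: "mu ~= []" "nu ~= []" shows "al u t (T mu nu) : AG"
  unfolding al_T graph_algebra_eq
proof (rule op_closure[OF n cis_coc_bdd])
  fix e :: real assume e: "e > 0"
  then have "0 < e / (\<bar>t\<bar> + 1)" by auto
  from coc_osc[OF this, of mu nu] obtain k where k: "ALL rho. k <= length rho --> (ALL \<gamma>:D (mu @ rho) (nu @ rho). ALL \<gamma>':D (mu @ rho) (nu @ rho). \<bar>coc u \<gamma> - coc u \<gamma>'\<bar> < e / (\<bar>t\<bar> + 1))" ..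
  have "dist (cis (t * c)) (cis (t * d)) < e" if "\<bar>c - d\<bar> < e / (\<bar>t\<bar> + 1)" for c d
  proof -
    have "dist (cis (t * c)) (cis (t * d)) <= \<bar>t\<bar> * \<bar>c - d\<bar>"
      using norm_cis_diff[of "t * c" "t * d"] by (simp add: dist_norm abs_mult flip: right_diff_distrib)
    also have "... <= \<bar>t\<bar> * (e / (\<bar>t\<bar> + 1))" using that by (intro mult_left_mono) auto
    also have "... < e" using e by (simp add: field_simps)
    finally show ?thesis .
  qed
  then show "EX n. ALL rho:E n mu. ALL \<gamma>:D (mu @ rho) (nu @ rho). ALL \<gamma>':D (mu @ rho) (nu @ rho).
      dist (cis (t * coc u \<gamma>)) (cis (t * coc u \<gamma>')) < e" using k E_len by (metis order_refl)
qed

lemma al_AG: assumes "a : AG" shows "al u t a : AG"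
proof -
  have 0: "al u t a : AG" if "a : A0" for a
    using that by (induction rule: A0_induct) (auto simp: A_0 al_add al_cscale intro!: A_add A_cscale al_T_AG)
  obtain f where "!!n. f n : A0" "f ----> a" using assms unfolding graph_algebra_eq closure_sequential by blast
  then show ?thesis using A_lim[OF 0 al_tendsto] by blast
qed

end

section \<open>Functions on a strip\<close>

lemma strip_convex: "convex (strip \<beta>)"
proof -
  have "strip \<beta> = Im -` {min 0 \<beta>..max 0 \<beta>}" by (auto simp: strip_def)
  then show ?thesis by (simp add: convex_linear_vimage bounded_linear.linear bounded_linear_Im)
qed

lemma strip_real: "of_real t : strip \<beta>" and strip_top: "of_real t + \<i> * of_real \<beta> : strip \<beta>"
  by (simp_all add: strip_def)

text \<open>Multiplication by \<open>exp (- e z\<^sup>2)\<close> reduces this to the maximum principle on a rectangle.\<close>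

lemma strip_max:
  assumes cont: "continuous_on (strip \<beta>) F" and holo: "F holomorphic_on interior (strip \<beta>)"
    and M: "!!z. z : strip \<beta> ==> norm (F z) <= M"
    and C: "!!t. norm (F (of_real t)) <= C" "!!t. norm (F (of_real t + \<i> * of_real \<beta>)) <= C"
    and w: "w : strip \<beta>"
  shows "norm (F w) <= C"
proof -
  have C0: "0 <= C" using C(1) norm_ge_zero order_trans by blast
  have M0: "0 <= M" using M[OF w] norm_ge_zero order_trans by blast
  have key: "norm (F w) * exp (- e * Re (w\<^sup>2)) <= exp (e * \<beta>\<^sup>2) * C + d" if e: "e > 0" and d: "d > 0" for e d :: real
  proof -
    \<comment> \<open>On the short sides of a long rectangle the Gaussian factor beats the global
      bound \<open>M\<close>; on the long sides it costs at most
      \<open>exp (e * \<beta>\<^sup>2)\<close>.\<close>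
    have "((%R::nat. exp (e * \<beta>\<^sup>2 - e * (real R)\<^sup>2) * M) \<longlongrightarrow> 0 * M) sequentially"
      by (intro tendsto_intros) (use e in real_asymp)
    then have "\<forall>\<^sub>F R in sequentially. exp (e * \<beta>\<^sup>2 - e * (real R)\<^sup>2) * M < d" by (rule order_tendstoD) (use d in simp)
    then have "\<forall>\<^sub>F R in sequentially. exp (e * \<beta>\<^sup>2 - e * (real R)\<^sup>2) * M < d & \<bar>Re w\<bar> <= real R"
      by (rule eventually_conj) (use eventually_ge_at_top[of "nat \<lceil>\<bar>Re w\<bar>\<rceil>"] in eventually_elim, linarith)
    then obtain R :: nat where R: "exp (e * \<beta>\<^sup>2 - e * (real R)\<^sup>2) * M < d" "\<bar>Re w\<bar> <= real R" by (auto simp: eventually_sequentially)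
    define S where "S = cbox (Complex (- real R) (min 0 \<beta>)) (Complex (real R) (max 0 \<beta>))"
    have S: "z : S \<longleftrightarrow> \<bar>Re z\<bar> <= R & z : strip \<beta>" for z by (auto simp: S_def in_cbox_complex_iff strip_def)
    have ns: "norm (F z * exp (- of_real e * z\<^sup>2)) = norm (F z) * exp (e * (Im z)\<^sup>2 - e * (Re z)\<^sup>2)" for z
      by (simp add: norm_mult power2_eq_square algebra_simps)
    have im: "e * (Im z)\<^sup>2 <= e * \<beta>\<^sup>2" if "z : strip \<beta>" for z
      using that e by (intro mult_left_mono iffD1[OF abs_le_square_iff]) (auto simp: strip_def)
    have "norm (F w * exp (- of_real e * w\<^sup>2)) <= exp (e * \<beta>\<^sup>2) * C + d"
    proof (rule maximum_modulus_frontier[of "%z. F z * exp (- of_real e * z\<^sup>2)" S])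
      have "interior S \<subseteq> interior (strip \<beta>)" using S by (intro interior_mono) blast
      then show "(%z. F z * exp (- of_real e * z\<^sup>2)) holomorphic_on interior S"
        by (intro holomorphic_intros holomorphic_on_subset[OF holo])
      show "continuous_on (closure S) (%z. F z * exp (- of_real e * z\<^sup>2))"
        using S by (intro continuous_intros continuous_on_subset[OF cont]) (auto simp: S_def)
      show "bounded S" by (simp add: S_def)
      show "w : S" using S w R(2) by simp
      fix z assume z: "z : frontier S"
      have zS: "z : S" using z frontier_subset_closed by (auto simp: S_def)
      have "z ~: box (Complex (- real R) (min 0 \<beta>)) (Complex (real R) (max 0 \<beta>))"
        using z by (simp add: S_def frontier_def)
      then have "\<bar>Re z\<bar> = R \<or> Im z = 0 \<or> Im z = \<beta>" using zS by (auto simp: S_def in_box_complex_iff in_cbox_complex_iff)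
      then consider "\<bar>Re z\<bar> = R" | "norm (F z) <= C"
      proof (elim disjE)
        assume "Im z = 0" then have "z = of_real (Re z)" by (simp add: complex_eq_iff)
        then have "norm (F z) <= C" using C(1) by metis
        then show ?thesis using that by blast
      next
        assume "Im z = \<beta>" then have "z = of_real (Re z) + \<i> * of_real \<beta>" by (simp add: complex_eq_iff)
        then have "norm (F z) <= C" using C(2) by metis
        then show ?thesis using that by blast
      qed (use that in blast)
      then show "norm (F z * exp (- of_real e * z\<^sup>2)) <= exp (e * \<beta>\<^sup>2) * C + d"
      proof cases
        case 1
        then have r2: "(Re z)\<^sup>2 = (real R)\<^sup>2" by (metis power2_abs)
        have "norm (F z) * exp (e * (Im z)\<^sup>2 - e * (Re z)\<^sup>2) <= M * exp (e * \<beta>\<^sup>2 - e * (real R)\<^sup>2)"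
          using M im zS S M0 unfolding r2 by (intro mult_mono) auto
        also have "... = exp (e * \<beta>\<^sup>2 - e * (real R)\<^sup>2) * M" by simp
        moreover have "0 <= exp (e * \<beta>\<^sup>2) * C" using C0 by simp
        ultimately show ?thesis unfolding ns using R(1) by linarith
      next
        case 2
        have "0 <= e * (Re z)\<^sup>2" using e by simp
        then have "e * (Im z)\<^sup>2 - e * (Re z)\<^sup>2 <= e * \<beta>\<^sup>2" using im[of z] zS S by auto
        then have "norm (F z) * exp (e * (Im z)\<^sup>2 - e * (Re z)\<^sup>2) <= C * exp (e * \<beta>\<^sup>2)"
          using C0 2 by (intro mult_mono) simp_all
        then show ?thesis unfolding ns using d by (simp add: mult.commute)
      qed
    qed
    then show ?thesis unfolding ns by (simp add: power2_eq_square algebra_simps)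
  qed
  have key': "norm (F w) * exp (- e * Re (w\<^sup>2)) <= exp (e * \<beta>\<^sup>2) * C" if "e > 0" for e
    by (rule field_le_epsilon) (rule key[OF that])
  have l: "((%e. norm (F w) * exp (- e * Re (w\<^sup>2))) \<longlongrightarrow> norm (F w) * exp (- 0 * Re (w\<^sup>2))) (at_right 0)"
    "((%e. exp (e * \<beta>\<^sup>2) * C) \<longlongrightarrow> exp (0 * \<beta>\<^sup>2) * C) (at_right 0)" by (intro tendsto_intros)+
  have "norm (F w) * exp (- 0 * Re (w\<^sup>2)) <= exp (0 * \<beta>\<^sup>2) * C"
    by (rule tendsto_le[OF _ l(2,1)], simp, rule eventually_mono[OF eventually_at_right_less], rule key')
  then show ?thesis by simp
qed

text \<open>
  The sums are Riemann sums of an average over a long segment of the upper line. By Cauchy's theorem this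
  is an average over the real line, where \<open>F\<close> is bounded by \<open>C\<close>, up to the contributions of
  the two short sides; so the bound does not involve the values of \<open>F\<close> off the real line.
\<close>

lemma strip_smoothing:
  fixes F :: "complex => complex"
  assumes cont: "continuous_on (strip \<beta>) F" and holo: "F holomorphic_on interior (strip \<beta>)"
    and M: "!!z. z : strip \<beta> ==> norm (F z) <= M" and C: "!!t. norm (F (of_real t)) <= C"
  shows "EX (J :: nat) t c. (ALL j<J. 0 <= c j) & (\<Sum>j<J. c j) = 1 &
     (ALL k<J. norm (\<Sum>j<J. of_real (c j) * F (of_real (t j - t k) + \<i> * of_real \<beta>)) <= C + 1)"
proof -
  have M0: "0 <= M" using M[OF strip_real] norm_ge_zero order_trans by blast
  obtain P where P: "!!z. z : strip \<beta> ==> (P has_field_derivative F z) (at z within strip \<beta>)"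
    using holomorphic_convex_primitive[OF strip_convex finite.emptyI cont] holomorphic_on_imp_differentiable_at[OF holo open_interior]
    by (metis Diff_empty)
  have seg: "norm (P w - P z - c * (w - z)) <= B * norm (w - z)"
    if "z : strip \<beta>" "w : strip \<beta>" and B: "!!x. x : closed_segment z w ==> norm (F x - c) <= B" for z w c B
  proof -
    have sub: "closed_segment z w \<subseteq> strip \<beta>" using that(1,2) strip_convex by (simp add: closed_segment_subset)
    have "norm ((P w - c * w) - (P z - c * z)) <= B * norm (w - z)"
    proof (rule field_differentiable_bound[where f' = "%x. F x - c"])
      fix x assume "x : closed_segment z w"
      then show "((%w. P w - c * w) has_field_derivative F x - c) (at x within closed_segment z w)"
        using sub by (auto intro!: derivative_eq_intros DERIV_subset[OF P])
    qed (use B in auto)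
    then show ?thesis by (simp add: algebra_simps)
  qed
  define Top where "Top x = of_real x + \<i> * of_real \<beta>" for x
  have Top: "Top x : strip \<beta>" for x by (simp add: Top_def strip_def)
  \<comment> \<open>Long enough for the two short sides, of total size at most
    \<open>2 * (M * \<bar>\<beta>\<bar>)\<close>, to contribute no more than
    \<open>R / 2\<close>.\<close>
  define R where "R = 4 * \<bar>\<beta>\<bar> * M + 1"
  have R: "R > 0" "2 * (M * \<bar>\<beta>\<bar>) <= R / 2" using M0 by (auto simp: R_def add_nonneg_pos)
  have long: "norm (P (Top b) - P (Top a)) <= C * R + R / 2" if "b - a = R" for a b
  proof -
    have side: "norm (P (Top x) - P (of_real x)) <= M * \<bar>\<beta>\<bar>" for x
      using seg[OF strip_real Top, of x x 0 M] M closed_segment_subset[OF strip_real Top strip_convex]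
      by (auto simp: Top_def norm_mult)
    have "norm (F x) <= C" if "x : closed_segment (of_real a) (of_real b)" for x
      using that C by (auto simp: closed_segment_of_real)
    then have bottom: "norm (P (of_real b) - P (of_real a)) <= C * R"
      using seg[OF strip_real strip_real, of a b 0 C] \<open>b - a = R\<close> R by (simp flip: of_real_diff)
    have "P (Top b) - P (Top a) = (P (Top b) - P (of_real b)) - (P (Top a) - P (of_real a)) + (P (of_real b) - P (of_real a))" by simp
    also have "norm ... <= (M * \<bar>\<beta>\<bar> + M * \<bar>\<beta>\<bar>) + C * R"
      by (intro norm_triangle_mono order_trans[OF norm_triangle_ineq4] add_mono side bottom)
    finally show ?thesis using R by simp
  qed
  have "continuous_on {- R..R} Top" unfolding Top_def by (intro continuous_intros)
  \<comment> \<open>All differences of two sample points below lie in this interval.\<close>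
  then have uc: "uniformly_continuous_on {- R..R} (%x. F (Top x))"
    using Top by (intro compact_uniformly_continuous continuous_on_compose2[OF cont] compact_Icc) auto
  have half: "0 < 1 / (2 :: real)" by simp
  obtain d where d: "d > 0" "!!x y. x : {- R..R} ==> y : {- R..R} ==> dist y x < d ==> dist (F (Top y)) (F (Top x)) < 1 / 2"
    by (rule uniformly_continuous_onE[OF uc half]) (rule that; assumption)
  obtain J :: nat where J: "R / d < J" using reals_Archimedean2 by blast
  have J0: "J > 0" using J R(1) d(1) by (metis divide_pos_pos less_trans of_nat_0_less_iff)
  define h where "h = R / J"
  have h: "h > 0" "h < d" "J * h = R" using J J0 R(1) d(1) by (auto simp: h_def field_simps)
  \<comment> \<open>For fixed \<open>k\<close> the points \<open>j * h - k * h\<close> subdivide an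
    interval of length \<open>R\<close>. The Riemann error and the short sides contribute
    \<open>R / 2\<close> each, so division by \<open>R\<close> gives \<open>C + 1\<close> for every
    \<open>k\<close>.\<close>
  have fin: "norm (\<Sum>j<J. of_real (1 / J) * F (of_real (j * h - k * h) + \<i> * of_real \<beta>)) <= C + 1" if k: "k < J" for k
  proof -
    let ?t = "%j. j * h - k * h"
    have "norm (P (Top (?t (Suc j))) - P (Top (?t j)) - F (Top (?t j)) * of_real h) <= 1 / 2 * h" if j: "j < J" for j
    proof -
      have t: "?t (Suc j) - ?t j = h" by (simp add: algebra_simps)
      have "k * h <= J * h" "real (Suc j) * h <= J * h" using k j h(1) by (auto simp del: of_nat_Suc)
      then have r: "- R <= ?t j" "?t (Suc j) <= R"
        unfolding h(3) using h(1) diff_mono[of 0 "j * h" "k * h" R] diff_mono[of "Suc j * h" R 0 "k * h"] by simp_all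
      have "Top b - Top a = of_real (b - a)" for a b by (simp add: Top_def)
      then have dT: "Top (?t (Suc j)) - Top (?t j) = of_real h" by (simp only: t)
      have B: "norm (F z - F (Top (?t j))) <= 1 / 2" if z: "z : closed_segment (Top (?t j)) (Top (?t (Suc j)))" for z
      proof -
        obtain v where v: "0 <= v" "v <= 1" "z = Top (?t j) + of_real (v * h)"
          using z dT unfolding closed_segment_def by (auto simp: scaleR_conv_of_real algebra_simps)
        have w: "z = Top (?t j + v * h)" "0 <= v * h" "v * h <= h" using v h(1) by (auto simp: Top_def)
        have "x : {- R..R} & x + w : {- R..R} & dist (x + w) x < d"
          if "y - x = h" "0 <= w" "w <= h" "- R <= x" "y <= R" for x y w using that h(2) by (auto simp: dist_norm)
        from this[OF t w(2,3) r] show ?thesis using d(2) unfolding w(1) dist_norm by (meson less_imp_le)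
      qed
      have "norm (P (Top (?t (Suc j))) - P (Top (?t j)) - F (Top (?t j)) * (Top (?t (Suc j)) - Top (?t j)))
          <= 1 / 2 * norm (Top (?t (Suc j)) - Top (?t j))" by (rule seg[OF Top Top B])
      then show ?thesis unfolding dT using h(1) by simp
    qed
    then have "norm (\<Sum>j<J. P (Top (?t (Suc j))) - P (Top (?t j)) - F (Top (?t j)) * of_real h) <= (\<Sum>j<J. 1 / 2 * h)"
      by (intro sum_norm_le) auto
    also have "(\<Sum>j<J. P (Top (?t (Suc j))) - P (Top (?t j)) - F (Top (?t j)) * of_real h)
        = (P (Top (?t J)) - P (Top (?t (0 :: nat)))) - (\<Sum>j<J. F (Top (?t j))) * of_real h"
      unfolding sum_lessThan_telescope[of "%j. P (Top (?t j))", symmetric] by (simp only: sum_subtractf sum_distrib_right)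
    finally have "norm ((P (Top (?t J)) - P (Top (?t (0 :: nat)))) - (\<Sum>j<J. F (Top (?t j))) * of_real h) <= R / 2"
      using h(3) by simp
    moreover have "norm (P (Top (?t J)) - P (Top (?t (0 :: nat)))) <= C * R + R / 2" by (rule long) (simp add: h)
    ultimately have "norm ((\<Sum>j<J. F (Top (?t j))) * of_real h) <= C * R + R"
      using norm_triangle_sub[of "(\<Sum>j<J. F (Top (?t j))) * of_real h" "P (Top (?t J)) - P (Top (?t (0 :: nat)))"]
      by (simp add: norm_minus_commute)
    then have "norm (\<Sum>j<J. F (Top (?t j))) * h / R <= C + 1"
      using R(1) h(1) by (simp add: norm_mult field_simps)
    then show ?thesis using R(1) by (simp add: Top_def h_def norm_divide flip: sum_divide_distrib)
  qed
  show ?thesis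
    by (intro exI[where x = J] exI[where x = "%j::nat. j * h"] exI[where x = "%_. 1 / J"] conjI allI impI fin) (use J0 in simp_all)
qed

text \<open>After multiplication by \<open>exp (\<i> n \<beta> z)\<close>, the bound on the upper line is \<open>exp (- n \<beta>\<^sup>2) M\<close>.\<close>

lemma strip_unique:
  assumes cont: "continuous_on (strip \<beta>) H" and holo: "H holomorphic_on interior (strip \<beta>)"
    and M: "!!z. z : strip \<beta> ==> norm (H z) <= M" and z: "!!t. H (of_real t) = 0"
  shows "H (of_real t + \<i> * of_real \<beta>) = 0"
proof -
  \<comment> \<open>At height \<open>\<beta> * r\<close> the multiplier has modulus
    \<open>exp (- n * \<beta>\<^sup>2 * r)\<close>, while the product is bounded by
    \<open>exp (- n * \<beta>\<^sup>2) * M\<close>; as \<open>r < 1\<close>, letting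
    \<open>n\<close> grow gives 0. The upper line is reached by continuity.\<close>
  have H0: "H (of_real t + \<i> * of_real (\<beta> * r)) = 0" if r: "0 <= r" "r < 1" for r
  proof (cases "\<beta> = 0")
    case False
    let ?w = "of_real t + \<i> * of_real (\<beta> * r)"
    have M0: "0 <= M" using M[OF strip_real] norm_ge_zero order_trans by blast
    have ne: "norm (exp (\<i> * of_real (n * \<beta>) * z) * H z) = exp (- (n * (\<beta> * Im z))) * norm (H z)" for n :: nat and z
      by (simp add: norm_mult)
    have "norm (exp (\<i> * of_real (n * \<beta>) * ?w) * H ?w) <= exp (- (n * (\<beta> * \<beta>))) * M" for n :: nat
    proof (rule strip_max[where \<beta> = \<beta> and F = "%z. exp (\<i> * of_real (n * \<beta>) * z) * H z"])
      show "?w : strip \<beta>" using r by (auto simp: strip_def min_def mult_left_le mult_le_0_iff)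
      show "norm (exp (\<i> * of_real (n * \<beta>) * z) * H z) <= 1 * M" if "z : strip \<beta>" for z
        unfolding ne using that M[OF that] by (intro mult_mono) (auto simp: strip_def zero_le_mult_iff)
      show "norm (exp (\<i> * of_real (n * \<beta>) * (of_real s + \<i> * of_real \<beta>)) * H (of_real s + \<i> * of_real \<beta>)) <= exp (- (n * (\<beta> * \<beta>))) * M" for s
        unfolding ne using M[OF strip_top] by simp
    qed (use M0 z in \<open>auto intro!: continuous_intros holomorphic_intros cont holo\<close>)
    then have "norm (H ?w) <= exp (- (n * (\<beta> * \<beta> * (1 - r)))) * M" for n :: nat
      unfolding ne by (simp add: exp_minus exp_diff field_simps)
    moreover have "(%n. exp (- (real n * (\<beta> * \<beta> * (1 - r)))) * M) ----> 0 * M"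
    proof (intro tendsto_intros)
      have l: "(%n. exp (- (real n * c))) ----> 0" if "0 < c" for c :: real using that by real_asymp
      show "(%n. exp (- (real n * (\<beta> * \<beta> * (1 - r))))) ----> 0"
        by (rule l) (use False r(2) in \<open>auto simp: zero_less_mult_iff\<close>)
    qed
    ultimately have "norm (H ?w) <= 0 * M" by (intro LIMSEQ_le_const) auto
    then show ?thesis by simp
  qed (use z in simp)
  have "(%n. H (of_real t + \<i> * of_real (\<beta> * (1 - inverse (real (Suc n)))))) ----> H (of_real t + \<i> * of_real (\<beta> * (1 - 0)))"
  proof (rule continuous_on_tendsto_compose[OF cont])
    show "(%n. of_real t + \<i> * complex_of_real (\<beta> * (1 - inverse (real (Suc n))))) ----> of_real t + \<i> * of_real (\<beta> * (1 - 0))"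
      by (intro tendsto_intros LIMSEQ_inverse_real_of_nat)
    show "\<forall>\<^sub>F n in sequentially. of_real t + \<i> * complex_of_real (\<beta> * (1 - inverse (real (Suc n)))) : strip \<beta>" by (auto simp: strip_def min_def mult_le_0_iff field_simps)
  qed (simp add: strip_top)
  moreover have "H (of_real t + \<i> * of_real (\<beta> * (1 - inverse (real (Suc n))))) = 0" for n
    by (rule H0) (simp_all add: inverse_le_1_iff)
  ultimately show ?thesis by (simp add: LIMSEQ_const_iff)
qed

section \<open>From KMS weights to conformal functions\<close>

context cstar_weight
begin

lemma N_sum: "(!!i. i : S ==> f i : N) ==> sum f S : N"
  by (induction S rule: infinite_finite_induct) (auto intro: N_add N_0)

text \<open>Carries invariance and limits from \<open>wt\<close> over to the linear
  extension.\<close>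

lemma L_polar:
  assumes "x : N" "y : N"
  shows "L (hadj x oL y) = (of_real (wt (x + y) - wt x - wt y) - \<i> * of_real (wt (x + cscale \<i> y) - wt x - wt y)) / 2"
proof -
  let ?a = "L (hadj x oL y)" and ?b = "L (hadj y oL x)"
  have 1: "of_real (wt (x + y) - wt x - wt y) = ?a + ?b" using sq_expand[OF assms, of 1] by simp
  have 2: "of_real (wt (x + cscale \<i> y) - wt x - wt y) = \<i> * (?a - ?b)"
    using sq_expand[OF assms, of \<i>] by (simp add: algebra_simps)
  show ?thesis unfolding 1 2 by (simp add: mult.assoc)
qed

lemma fin_N: assumes "x : pos_cone A" "\<psi> x < \<infinity>" shows "x : N" using assms(1) pos_coneE assms(2) NI N_left(1) A_hadj by force

text \<open>With \<open>s = hadj r oL r\<close>, the corner condition makes \<open>s\<close> the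
  square of \<open>r oL p\<close>, which lies in the left ideal \<open>N\<close>.\<close>

lemma corner_pos:
  assumes "s : pos_cone A" "p : N" "hadj p = p" "s = p oL (s oL p)"
  shows "\<psi> s < \<infinity>" "EX w>=0. L s = of_real w"
proof -
  obtain r where r: "r : A" "s = hadj r oL r" using assms(1) by (rule pos_coneE)
  have n: "r oL p : N" using r(1) assms(2) by (rule N_left)
  show "\<psi> s < \<infinity>" "EX w>=0. L s = of_real w" using assms(2,3) assms(4) L_sq[OF n] N_fin[OF n] by (auto simp: r(2) hadj_comp AA N_A r(1) comp_assoc)
qed

end

context pgraph
begin

lemma T_sq: assumes "mu ~= []" "nu ~= []" "nu' ~= []" "dm mu nu ~= {}" shows "T mu nu oL T nu nu' = T mu nu'"
  using T_mult_right[OF assms(4,1,2), of "[]" nu'] by simp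

lemma dm_same: "dm mu mu = cyl mu" by (auto simp: dm_def elim!: cylE)

lemma T_idem: assumes "mu ~= []" shows "T mu mu oL T mu mu = T mu mu"
  using T_sq[OF assms assms assms] T_empty by (cases "dm mu mu = {}") auto

lemma al_fix: "al \<phi> t (T mu mu) = T mu mu"
  unfolding al_T unfolding T_def by (rule op_cong) (auto simp: D_def dg_def elim!: dmE)

lemma T_pos: "mu ~= [] ==> T mu mu : pos_cone AG"
  using pos_coneI[of "T mu mu"] T_A0 A0_AG by (auto simp: hadj_T T_idem)

lemma al_sum: "al \<phi> t (sum f S) = (SUM i:S. al \<phi> t (f i))"
  by (induction S rule: infinite_finite_induct) (auto simp: al_add)

end

lemma hadj_sum: "(!!i. i : S ==> f i : Adj) ==> hadj (sum f S) = (SUM i:S. hadj (f i)) & sum f S : Adj"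
  by (induction S rule: infinite_finite_induct) (auto simp: hadj_add Adj_add Adj_0)

text \<open>A Neumann inverse in the corner of \<open>p\<close>, found as the fixed point of the
  contraction that sends \<open>y\<close> to \<open>p + (?k oL y)\<close>. The contraction constant
  1/2 gives \<open>norm y <= 2\<close>.\<close>

lemma (in cstar) corner_inverse:
  assumes p: "p : A" "p oL p = p" "norm p <= 1" and z: "z : A" "norm (p - (p oL z oL p)) <= 1 / 2"
  obtains y where "y : A" "norm y <= 2" "p oL z oL y = p"
proof -
  let ?k = "p - (p oL z oL p)"
  have kA: "?k : A" using p z by (intro A_diff A_comp)
  have "EX! y:A. p + (?k oL y) = y"
  proof (rule Banach_fix[where c = "1 / 2"])
    show "complete A" using A_closed by (simp add: complete_eq_closed)
    show "(%y. p + (?k oL y)) ` A \<subseteq> A" using p kA by (auto intro: A_add A_comp)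
    show "dist (p + (?k oL x)) (p + (?k oL y)) <= 1 / 2 * dist x y" if "x : A" "y : A" for x y
    proof -
      have "dist (p + (?k oL x)) (p + (?k oL y)) = norm (?k oL (x - y))" by (simp add: dist_norm comp_diff(1))
      also have "... <= norm ?k * norm (x - y)" by (rule norm_comp_le)
      also have "... <= 1 / 2 * dist x y" unfolding dist_norm by (intro mult_right_mono z) auto
      finally show ?thesis .
    qed
  qed (use A_0 in auto)
  then obtain y where y: "y : A" "p + (?k oL y) = y" by blast
  have "norm y <= norm p + norm ?k * norm y"
    using norm_triangle_ineq[of p "?k oL y"] norm_comp_le[of ?k y] unfolding y(2) by linarith
  also have "norm ?k * norm y <= 1 / 2 * norm y" by (intro mult_right_mono z) auto
  finally have n: "norm y <= 2" using p(3) by simp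
  have pk: "p oL ?k = ?k" using p(2) by (simp add: comp_diff(1) comp_assoc[symmetric])
  have "p oL y = (p oL p) + ((p oL ?k) oL y)"
    by (subst y(2)[symmetric]) (simp only: comp_add(1) comp_assoc)
  then have "y = p + (y - (p oL z oL y))" by (metis y(2) pk p(2) comp_diff(2) comp_assoc)
  then have "p oL z oL y = p" by (simp add: algebra_simps)
  then show ?thesis using that y(1) n by blast
qed

locale pot_weight = pot G \<phi> for G :: "('v, 'e) pre_digraph" and \<phi> +
  fixes \<psi> :: "('e gpd ell2 \<Rightarrow>\<^sub>L 'e gpd ell2) => ennreal"
  assumes W: "weight_on (graph_algebra G) \<psi>"
begin

sublocale cstar_weight AG \<psi> by unfold_locales (rule W)

lemma T_N_fin: assumes "mu ~= []" "nu ~= []" "\<psi> (T nu nu) < \<infinity>" shows "T mu nu : N"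
proof (cases "dm nu mu = {}")
  case True
  then have "hadj (T nu mu) = 0" by (simp add: T_empty)
  then show ?thesis by (simp add: hadj_T N_0)
next
  case False
  show ?thesis using NI T_A0[OF assms(1,2)] A0_AG assms(3) T_sq[OF assms(2,1,2) False] by (auto simp: hadj_T)
qed

lemma inv_wt:
  assumes "pot G \<theta>" "invariant_weight AG (act G \<theta>) \<psi>" "x : N"
  shows "al \<theta> t x : N" "wt (al \<theta> t x) = wt x"
proof -
  interpret c: pot G \<theta> by fact
  have xA: "x : AG" using assms(3) by (rule N_A)
  have "hadj (al \<theta> t x) oL al \<theta> t x = act G \<theta> t (hadj x oL x)"
    using xA by (simp add: act_eq A_comp A_hadj al_comp al_hadj AA)
  moreover have "\<psi> (act G \<theta> t (hadj x oL x)) = \<psi> (hadj x oL x)"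
    using assms(2) pos_coneI[OF xA] by (simp add: invariant_weight_def)
  ultimately have e: "\<psi> (hadj (al \<theta> t x) oL al \<theta> t x) = \<psi> (hadj x oL x)" by simp
  show "al \<theta> t x : N" using assms(3) e c.al_AG by (simp add: weight_N_def)
  show "wt (al \<theta> t x) = wt x" by (simp add: wt_def e)
qed

lemma inv_L:
  assumes "pot G \<theta>" "invariant_weight AG (act G \<theta>) \<psi>" "x : N" "y : N"
  shows "L (hadj (al \<theta> t x) oL al \<theta> t y) = L (hadj x oL y)"
  using assms inv_wt
  by (simp add: L_polar N_add N_cscale flip: al_add al_cscale)

end

locale kms_pot = pot G \<phi> for G :: "('v, 'e) pre_digraph" and \<phi> +
  fixes \<beta> :: real and \<psi> :: "('e gpd ell2 \<Rightarrow>\<^sub>L 'e gpd ell2) => ennreal"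
  assumes KMS: "KMS_weight (graph_algebra G) (act G \<phi>) \<beta> \<psi>"
begin

sublocale pot_weight G \<phi> \<psi>
  by unfold_locales (use KMS in \<open>simp add: KMS_weight_def\<close>)

lemma dense: "pos_cone AG \<subseteq> closure {a : pos_cone AG. \<psi> a < \<infinity>}"
  using KMS by (simp add: KMS_weight_def densely_defined_on_def)

lemma lsc: assumes "!!n. f n : pos_cone AG" "f ----> a" "a : pos_cone AG" "!!n. \<psi> (f n) <= ennreal c" "c >= 0"
  shows "\<psi> a <= ennreal c"
proof -
  obtain T where T: "closed T" "{a : pos_cone AG. \<psi> a <= ennreal c} = pos_cone AG \<inter> T" using KMS assms(5) by (force simp: KMS_weight_def lsc_on_def closedin_closed)
  show ?thesis using T(2) assms(1,4) closed_sequentially[OF T(1)] assms(2) assms(3) by blast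
qed

lemma kms:
  assumes "a : N" "hadj a : N" "b : N" "hadj b : N"
  obtains F M where "continuous_on (strip \<beta>) F" "F holomorphic_on interior (strip \<beta>)"
    "!!z. z : strip \<beta> ==> norm (F z) <= M" "!!t. F (of_real t) = L (a oL al \<phi> t b)"
    "!!t. F (of_real t + \<i> * of_real \<beta>) = L (al \<phi> t b oL a)"
proof -
  have "EX F. continuous_on (strip \<beta>) F & bounded (F ` strip \<beta>) & F holomorphic_on interior (strip \<beta>) &
             (ALL t::real. F (of_real t) = L (a oL act G \<phi> t b) &
                        F (of_real t + \<i> * of_real \<beta>) = L (act G \<phi> t b oL a))"
    using KMS assms unfolding KMS_weight_def by blast
  then obtain F where F: "continuous_on (strip \<beta>) F" "bounded (F ` strip \<beta>)" "F holomorphic_on interior (strip \<beta>)"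
      "!!t. F (of_real t) = L (a oL act G \<phi> t b)" "!!t. F (of_real t + \<i> * of_real \<beta>) = L (act G \<phi> t b oL a)" by blast
  obtain M where "!!z. z : strip \<beta> ==> norm (F z) <= M" using F(2) unfolding bounded_iff by blast
  have e: "act G \<phi> t b = al \<phi> t b" for t by (rule act_eq[OF N_A[OF assms(3)]])
  show ?thesis by (rule that[OF F(1,3) \<open>!!z. z : strip \<beta> ==> norm (F z) <= M\<close> F(4,5)[unfolded e]])
qed

lemma inv: "pot G \<phi>" "invariant_weight AG (act G \<phi>) \<psi>"
  using KMS pot_axioms by (auto simp: KMS_weight_def)

lemmas al_N = inv_wt[OF inv] and al_L = inv_L[OF inv]

text \<open>Take \<open>x\<close> and \<open>u\<close> of finite weight near the projection
  \<open>?p\<close>, with \<open>x\<close> fixed and \<open>u\<close> approaching it. An average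
  \<open>W\<close> of the translates of \<open>u oL ?p oL x\<close> has
  \<open>\<psi> (W oL hadj W) <= K\<close> with \<open>K\<close> independent of \<open>u\<close>.
  Since \<open>W\<close> is close to \<open>?p oL Z\<close>, which is invertible in the corner, some
  \<open>q = W oL y\<close> is close to \<open>?p\<close> with a uniform bound on the weight of
  \<open>q oL hadj q\<close>. Lower semi-continuity concludes.\<close>

lemma T_finite: assumes mu: "mu ~= []" shows "\<psi> (T mu mu) < \<infinity>"
proof -
  let ?p = "T mu mu" and ?al = "al \<phi>"
  have pA: "?p : AG" using T_A0[OF mu mu] A0_AG by blast
  have ph: "hadj ?p = ?p" by (rule hadj_T)
  have pp: "?p oL ?p = ?p" by (rule T_idem[OF mu])
  have close: "EX u:pos_cone AG. \<psi> u < \<infinity> & norm (u - ?p) < e" if "e > 0" for e :: real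
    using subsetD[OF dense T_pos[OF mu]] that unfolding closure_approachable dist_norm by auto
  obtain x where x: "x : pos_cone AG" "\<psi> x < \<infinity>" "norm (x - ?p) < 1 / 2" using close[of "1/2"] by auto
  have xN: "x : N" and xh: "hadj x = x" and xA: "x : AG" using x by (auto intro: fin_N pos_cone_hadj pos_cone_A)
  define C where "C = 4 * wt x"
  define K where "K = C + 1"
  have K0: "K >= 0" by (auto simp: K_def C_def)
  have key: "EX q:AG. norm (q - ?p) <= 2 * norm x * e & \<psi> (q oL hadj q) <= ennreal (4 * K)"
    if e: "0 < e" "e <= 1" for e :: real
  proof -
    obtain u where u: "u : pos_cone AG" "\<psi> u < \<infinity>" "norm (u - ?p) < e" using close[OF e(1)] by auto
    have uN: "u : N" and uh: "hadj u = u" and uA: "u : AG" using u by (auto intro: fin_N pos_cone_hadj pos_cone_A)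
    have "norm u <= norm ?p + norm (u - ?p)" using norm_triangle_sub .
    then have nu: "norm u <= 2" using norm_T[of mu mu] u(3) e by simp
    \<comment> \<open>The right factor \<open>x\<close> bounds \<open>wt v\<close> by
      \<open>C\<close> for every \<open>u\<close>; the left factor \<open>u\<close> puts
      \<open>hadj v\<close> into \<open>N\<close>, so that the KMS condition applies.\<close>
    define v where "v = u oL ?p oL x"
    have vN: "v : N" and vhN: "hadj v : N" by (auto simp: v_def hadj_comp Adj_comp AA uA pA xA uh xh ph comp_assoc intro!: N_left(1) xN uN)
    have vA: "v : AG" by (rule N_A[OF vN])
    have "norm (u oL ?p) <= 2 * 1" by (rule order_trans[OF norm_comp_le]) (intro mult_mono nu norm_T; simp)
    then have "(norm (u oL ?p))\<^sup>2 <= 2\<^sup>2" by (intro power_mono) auto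
    then have "(norm (u oL ?p))\<^sup>2 * wt x <= C" by (auto simp: C_def intro!: mult_right_mono)
    then have wv: "wt v <= C" unfolding v_def using N_left(2)[OF A_comp[OF uA pA] xN] by linarith
    obtain F M where F: "continuous_on (strip \<beta>) F" "F holomorphic_on interior (strip \<beta>)"
      "!!z. z : strip \<beta> ==> norm (F z) <= M" "!!t. F (of_real t) = L (hadj v oL ?al t v)"
      "!!t. F (of_real t + \<i> * of_real \<beta>) = L (?al t v oL hadj v)"
      using kms[of "hadj v" v] vN vhN AA[OF vA] by auto
    have FC: "norm (F (of_real t)) <= C" for t
    proof -
      have "norm (F (of_real t)) <= sqrt (wt v) * sqrt (wt (?al t v))"
        unfolding F(4) by (rule L_CS'[OF vN al_N(1)[OF vN]])
      then show ?thesis using wv by (simp add: al_N(2)[OF vN])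
    qed
    obtain J t c where J: "!!j. j < (J::nat) ==> 0 <= c j" "(\<Sum>j<J. c j) = (1::real)"
      "!!k. k < J ==> norm (\<Sum>j<J. of_real (c j) * F (of_real (t j - t k) + \<i> * of_real \<beta>)) <= K"
      using strip_smoothing[OF F(1-3) FC] unfolding K_def by auto
    \<comment> \<open>By invariance the double sum for \<open>L (W oL hadj W)\<close> consists of
      values of \<open>F\<close> on the upper line, which the coefficients \<open>c\<close> were
      chosen to average below \<open>K\<close>.\<close>
    define W where "W = (\<Sum>j<J. c j *\<^sub>R ?al (t j) v)"
    define Z where "Z = (\<Sum>j<J. c j *\<^sub>R ?al (t j) x)"
    have WA: "W : AG" and ZA: "Z : AG" unfolding W_def Z_def by (auto intro!: A_sum A_scaleR al_AG vA xA)
    have Wh: "hadj W = (\<Sum>j<J. c j *\<^sub>R ?al (t j) (hadj v))"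
      unfolding W_def by (subst hadj_sum[THEN conjunct1]) (auto simp: hadj_scaleR al_hadj AA al_AG vA Adj_scaleR)
    have WhN: "hadj W : N" unfolding Wh by (intro N_sum N_scaleR al_N vhN)
    have trm: "L (?al s v oL ?al r (hadj v)) = F (of_real (s - r) + \<i> * of_real \<beta>)" for s r
    proof -
      have "?al s v = hadj (?al r (?al (s - r) (hadj v)))" by (simp add: al_al al_hadj AA vA hadj_in_Adj)
      then have "L (?al s v oL ?al r (hadj v)) = L (hadj (?al (s - r) (hadj v)) oL hadj v)"
        using al_L[OF al_N(1)[OF vhN] vhN] by simp
      also have "... = F (of_real (s - r) + \<i> * of_real \<beta>)" unfolding F(5) by (simp add: al_hadj hadj_in_Adj AA vA)
      finally show ?thesis .
    qed
    have "of_real (wt (hadj W)) = L (W oL hadj W)" using L_sq[OF WhN] AA[OF WA] by simp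
    also have "... = (\<Sum>k<J. of_real (c k) * (\<Sum>j<J. of_real (c j) * F (of_real (t j - t k) + \<i> * of_real \<beta>)))"
      unfolding Wh unfolding W_def comp_sum L_sum comp_scaleR L_scaleR trm
      by (simp add: mult_ac)
    also have "norm ... <= (\<Sum>k<J. c k * K)"
      by (rule sum_norm_le) (use J in \<open>auto simp: norm_mult intro!: mult_left_mono\<close>)
    also have "... = K" by (simp add: J(2) flip: sum_distrib_right)
    finally have wW: "wt (hadj W) <= K" by simp
    have pal: "?p oL ?al s a = ?al s (?p oL a)" "?al s a oL ?p = ?al s (a oL ?p)" for s a
      by (simp_all add: al_comp al_fix)
    have avg: "norm (\<Sum>j<J. c j *\<^sub>R ?al (t j) a) <= norm a" for a
    proof -
      have "norm (\<Sum>j<J. c j *\<^sub>R ?al (t j) a) <= (\<Sum>j<J. c j * norm a)"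
        by (rule sum_norm_le) (use J(1) in \<open>auto intro!: mult_left_mono norm_al\<close>)
      then show ?thesis by (simp add: J(2) flip: sum_distrib_right)
    qed
    \<comment> \<open>The action fixes \<open>?p\<close>, so averaging commutes with multiplication
      by it; closeness of \<open>u\<close> to \<open>?p\<close> is all that enters.\<close>
    have "W - (?p oL Z) = (\<Sum>j<J. c j *\<^sub>R ?al (t j) ((u - ?p) oL (?p oL x)))"
      unfolding W_def Z_def comp_sum comp_scaleR pal v_def
      by (simp add: comp_diff(2) al_diff scaleR_diff_right sum_subtractf) (simp add: comp_assoc[symmetric] pp)
    also have "norm ... <= norm ((u - ?p) oL (?p oL x))" by (rule avg)
    also have "... <= norm (u - ?p) * (norm ?p * norm x)" by (intro order_trans[OF norm_comp_le] mult_left_mono norm_comp_le) auto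
    also have "... <= e * (1 * norm x)" using u(3) norm_T e by (intro mult_mono) auto
    finally have WZ: "norm (W - (?p oL Z)) <= e * norm x" by simp
    \<comment> \<open>The distance 1/2 of \<open>x\<close> from \<open>?p\<close> survives averaging
      and compression, so \<open>?p oL Z\<close> can be inverted in the corner.\<close>
    have "?p - (?p oL Z oL ?p) = (\<Sum>j<J. c j *\<^sub>R ?al (t j) (?p oL (?p - x) oL ?p))"
      by (auto simp: comp_diff al_diff pp al_fix scaleR_diff_right sum_subtractf J(2) Z_def comp_sum comp_scaleR al_comp simp flip: scaleR_left.sum)
    also have "norm ... <= norm (?p oL (?p - x) oL ?p)" by (rule avg)
    also have "... <= norm (?p - x)" by (rule blinfun_sandwich_norm[OF norm_T norm_T])
    also have "... <= 1 / 2" using x(3) by (simp add: norm_minus_commute)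
    finally obtain y where y: "y : AG" "norm y <= 2" "?p oL Z oL y = ?p"
      by (rule corner_inverse[OF pA pp norm_T ZA])
    have "(W oL y) - ?p = (W - (?p oL Z)) oL y" by (simp only: comp_diff(2) y(3))
    also have "norm ... <= (e * norm x) * 2" by (rule order_trans[OF norm_comp_le]) (intro mult_mono WZ y; use e in simp)
    finally have 1: "norm ((W oL y) - ?p) <= 2 * norm x * e" by (simp add: mult_ac)
    have yW: "hadj (hadj y oL hadj W) = W oL y" using y(1) WA by (simp add: hadj_comp hadj_in_Adj AA)
    have "\<psi> ((W oL y) oL hadj (W oL y)) <= ennreal ((norm (hadj y))\<^sup>2) * \<psi> (W oL hadj W)"
      using \<psi>_comp_le[of "hadj y" "hadj W"] y(1) WA by (simp add: A_hadj hadj_comp AA)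
    also have "... <= ennreal 4 * ennreal K"
    proof (rule mult_mono)
      have "(norm y)\<^sup>2 <= 2\<^sup>2" using y(2) by (intro power_mono) auto
      then show "ennreal ((norm (hadj y))\<^sup>2) <= ennreal 4" using y(1) by (simp add: AA del: ennreal_numeral)
      show "\<psi> (W oL hadj W) <= ennreal K" using N_fin[OF WhN] wW AA[OF WA] by (simp add: ennreal_leI)
    qed auto
    also have "... = ennreal (4 * K)" using K0 by (simp add: ennreal_mult)
    finally show ?thesis using 1 A_comp[OF WA y(1)] by blast
  qed
  have "EX q. ALL n. q n : AG & norm (q n - ?p) <= 2 * norm x * inverse (real (Suc n)) & \<psi> (q n oL hadj (q n)) <= ennreal (4 * K)"
    using key[of "inverse (real (Suc _))"] by (intro choice allI) (auto simp: inverse_le_1_iff)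
  then obtain q where q: "!!n. q n : AG" "!!n. norm (q n - ?p) <= 2 * norm x * inverse (real (Suc n))"
     "!!n. \<psi> (q n oL hadj (q n)) <= ennreal (4 * K)" by blast
  have "(%n. 2 * norm x * inverse (real (Suc n))) ----> 2 * norm x * 0" by (intro tendsto_intros LIMSEQ_inverse_real_of_nat)
  then have ql: "q ----> ?p" using q(2) Lim_null_comparison[of "%n. q n - ?p" "%n. 2 * norm x * inverse (real (Suc n))"] by (auto simp: LIM_zero_iff)
  have "\<psi> ?p <= ennreal (4 * K)" using tendsto_comp[OF ql Adj_lim(2)[OF _ ql]] pos_coneI[OF A_hadj[OF q(1)]] AA[OF q(1)] lsc T_pos[OF mu] q(3) K0 by (force simp: hadj_T pp)
  then show ?thesis by (auto elim: le_less_trans)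
qed

end

context pgraph
begin

lemma op_pos: assumes r: "!!\<gamma>. \<gamma> : D tau tau ==> f \<gamma> = of_real (r \<gamma>) & 0 <= r \<gamma>" and b: "bdd_on f tau tau B" and m: "op f tau tau : AG"
  shows "op f tau tau : pos_cone AG"
proof (rule pos_cone_of_form[OF m])
  have c: "coord (op f tau tau xi) \<gamma> = of_real (if \<gamma> : Gam & fst \<gamma> : cyl tau then r (fst \<gamma>, 0, fst \<gamma>) else 0) * coord xi \<gamma>"
    and p: "0 <= (if \<gamma> : Gam & fst \<gamma> : cyl tau then r (fst \<gamma>, 0, fst \<gamma>) else 0)" for xi \<gamma>
  proof -
    obtain x k y where g: "\<gamma> = (x, k, y)" by (cases \<gamma>)
    have "x : cyl tau ==> (x, 0, x) : D tau tau" "x : cyl tau ==> sw tau tau x = x"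
      by (auto simp: D_def dm_same dg_def elim!: cylE)
    then show "coord (op f tau tau xi) \<gamma> = of_real (if \<gamma> : Gam & fst \<gamma> : cyl tau then r (fst \<gamma>, 0, fst \<gamma>) else 0) * coord xi \<gamma>"
      "0 <= (if \<gamma> : Gam & fst \<gamma> : cyl tau then r (fst \<gamma>, 0, fst \<gamma>) else 0)"
      using r by (auto simp: g coord_op[OF b] dm_same dg_def)
  qed
  have "is_hadj (op f tau tau) (op f tau tau)"
    unfolding is_hadj_def inner_ell2_def c by (intro allI infsum_cong) (simp add: inner_complex_def)
  then show "hadj (op f tau tau) = op f tau tau" by (rule is_hadj_hadj)
  show "0 <= op f tau tau xi \<bullet> xi" for xi
    unfolding inner_ell2_def c
  proof (rule infsum_nonneg)
    fix \<gamma> :: "'e gpd"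
    show "0 <= (of_real (if \<gamma> : Gam & fst \<gamma> : cyl tau then r (fst \<gamma>, 0, fst \<gamma>) else 0) * coord xi \<gamma>) \<bullet> coord xi \<gamma>" using p by (auto simp: inner_complex_def mult.assoc)
  qed
qed

lemma T_split: assumes "mu ~= []" shows "T mu nu = (SUM rho:E n mu. T (mu @ rho) (nu @ rho))"
proof (rule blinfun_eqI, rule ell2_eqI)
  fix xi and \<gamma> :: "'e gpd"
  obtain x k y where g: "\<gamma> = (x, k, y)" by (cases \<gamma>)
  have d: "coord (T (mu @ rho) (nu @ rho) xi) (x, k, y) = (if (x, k, y) : Gam & x : dm mu nu & x : cyl (mu @ rho) then coord xi (sw mu nu x, k - dg mu nu, y) else 0)" for rho
    unfolding coord_T dm_append dg_append using sw_append by simp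
  show "coord (T mu nu xi) \<gamma> = coord (blinfun_apply (SUM rho:E n mu. T (mu @ rho) (nu @ rho)) xi) \<gamma>"
  proof (cases "x : dm mu nu")
    case True
    then obtain rho where r: "rho : E n mu" "x : cyl (mu @ rho)" unfolding dm_def cyl_E[of mu n] by blast
    have ot: "x ~: cyl (mu @ \<sigma>)" if "\<sigma> : E n mu" "\<sigma> ~= rho" for \<sigma>
      using r that E_len by (force simp: mem_cyl)
    show ?thesis unfolding blinfun.sum_left coord_sum g d unfolding coord_T
      by (subst sum.remove[OF finite_E[OF assms] r(1)], subst sum.neutral) (use True r ot in auto)
  next
    case False
    then show ?thesis unfolding blinfun.sum_left coord_sum g d unfolding coord_T by simp
  qed
qed

end

text \<open>The second-order Taylor error, uniform for real \<open>a\<close> with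
  \<open>\<bar>a\<bar> <= B\<close>; this uniformity is what differentiates the operator-valued
  exponential in norm.\<close>

lemma exp_quadratic:
  fixes a :: real assumes a: "\<bar>a\<bar> <= B" and w: "norm (w - z) <= 1"
  shows "norm (exp (\<i> * w * of_real a) - exp (\<i> * z * of_real a) - (w - z) * (\<i> * of_real a * exp (\<i> * z * of_real a)))
    <= exp (norm z * B) * (exp B * B\<^sup>2) * (norm (w - z))\<^sup>2"
proof -
  have B: "0 <= B" using a by linarith
  define v where "v = \<i> * (w - z) * of_real a"
  have nv: "norm v <= norm (w - z) * B" using a by (simp add: v_def norm_mult mult_left_mono)
  then have nv1: "norm v <= B" using mult_right_mono[OF w B] by simp
  have "exp (\<i> * w * of_real a) - exp (\<i> * z * of_real a) - (w - z) * (\<i> * of_real a * exp (\<i> * z * of_real a))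
     = exp (\<i> * z * of_real a) * (exp v - (SUM k<=1. v ^ k / fact k))"
    by (simp add: v_def algebra_simps flip: exp_add)
  also have "norm ... <= exp (norm z * B) * (exp B * (norm (w - z) * B)\<^sup>2)"
    unfolding norm_mult
  proof (rule mult_mono)
    have "Re (\<i> * z * of_real a) <= norm (\<i> * z * of_real a)" by (rule complex_Re_le_cmod)
    also have "... <= norm z * B" using a by (simp add: norm_mult mult_left_mono)
    finally show "norm (exp (\<i> * z * of_real a)) <= exp (norm z * B)" by simp
    have "norm (exp v - (SUM k<=1. v ^ k / fact k)) <= exp \<bar>Re v\<bar> * norm v ^ Suc 1 / fact 1" by (rule Taylor_exp)
    also have "... <= exp B * (norm (w - z) * B)\<^sup>2"
      unfolding power2_eq_square using nv nv1 abs_Re_le_cmod[of v] by (auto intro!: mult_mono)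
    finally show "norm (exp v - (SUM k<=1. v ^ k / fact k)) <= exp B * (norm (w - z) * B)\<^sup>2" .
  qed auto
  finally show ?thesis by (simp add: power_mult_distrib mult_ac)
qed

section \<open>Functions of a real diagonal function, and their holomorphic dependence on a
  parameter\<close>

context pgraph
begin

context
  fixes f :: "'e gpd => real" and tau :: "'e list" and B :: real
  assumes n: "tau ~= []" and fB: "!!\<gamma>. \<gamma> : D tau tau ==> \<bar>f \<gamma>\<bar> <= B"
    and osc: "!!d. d > 0 ==> EX k. ALL rho:E k tau. ALL \<gamma>:D (tau @ rho) (tau @ rho). ALL \<gamma>':D (tau @ rho) (tau @ rho). \<bar>f \<gamma> - f \<gamma>'\<bar> < d"
begin

lemma calc_bd: fixes g :: "real => complex" assumes g: "continuous_on UNIV g"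
  shows "EX M. bdd_on (%\<gamma>. g (f \<gamma>)) tau tau M"
proof -
  have "compact (g ` {- B..B})" by (intro compact_continuous_image continuous_on_subset[OF g]) auto
  then have "EX M. ALL z:g ` {- B..B}. norm z <= M" unfolding bounded_iff[symmetric] by (rule compact_imp_bounded)
  then obtain M where M: "ALL a:{- B..B}. norm (g a) <= M" by auto
  have "norm (g (f \<gamma>)) <= max M 0" if "\<gamma> : D tau tau" for \<gamma>
    using M[rule_format, of "f \<gamma>"] fB[OF that] by (simp add: abs_le_iff)
  then have "bdd_on (%\<gamma>. g (f \<gamma>)) tau tau (max M 0)" unfolding bdd_on_def by simp
  then show ?thesis ..
qed

lemma calc_mem: fixes g :: "real => complex" assumes g: "continuous_on UNIV g"
  shows "op (%\<gamma>. g (f \<gamma>)) tau tau : AG"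
proof -
  obtain M where M: "bdd_on (%\<gamma>. g (f \<gamma>)) tau tau M" using calc_bd[OF g] ..
  have uc: "uniformly_continuous_on {- B..B} g"
    by (intro compact_uniformly_continuous continuous_on_subset[OF g]) auto
  show ?thesis unfolding graph_algebra_eq
  proof (rule op_closure[OF n n M])
    fix d :: real assume "d > 0"
    then obtain d' where d': "d' > 0" "!!a b. a : {- B..B} ==> b : {- B..B} ==> dist b a < d' ==> dist (g b) (g a) < d"
      using uniformly_continuous_onE[OF uc] by metis
    obtain k where k: "ALL rho:E k tau. ALL \<gamma>:D (tau @ rho) (tau @ rho). ALL \<gamma>':D (tau @ rho) (tau @ rho). \<bar>f \<gamma> - f \<gamma>'\<bar> < d'"
      using osc[OF d'(1)] ..
    have "dist (g (f \<gamma>)) (g (f \<gamma>')) < d"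
      if r: "rho : E k tau" and g: "\<gamma> : D (tau @ rho) (tau @ rho)" "\<gamma>' : D (tau @ rho) (tau @ rho)" for rho \<gamma> \<gamma>'
      using g fB[of \<gamma>] fB[of \<gamma>'] d'(2) k r by (auto simp: D_def dm_append dg_append sw_append abs_le_iff dist_real_def)
    then show "EX n. ALL rho:E n tau. ALL \<gamma>:D (tau @ rho) (tau @ rho). ALL \<gamma>':D (tau @ rho) (tau @ rho). dist (g (f \<gamma>)) (g (f \<gamma>')) < d" by blast
  qed
qed

lemma calc_lin: fixes g h :: "real => complex" assumes g: "continuous_on UNIV g" "continuous_on UNIV h"
  shows "op (%\<gamma>. g (f \<gamma>) - c * h (f \<gamma>)) tau tau = op (%\<gamma>. g (f \<gamma>)) tau tau - cscale c (op (%\<gamma>. h (f \<gamma>)) tau tau)"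
proof -
  have ch: "continuous_on UNIV (%a. c * h a)" by (intro continuous_intros g)
  obtain M where M: "bdd_on (%\<gamma>. g (f \<gamma>)) tau tau M" using calc_bd[OF g(1)] ..
  obtain K where K: "bdd_on (%\<gamma>. h (f \<gamma>)) tau tau K" using calc_bd[OF g(2)] ..
  obtain K' where K': "bdd_on (%\<gamma>. c * h (f \<gamma>)) tau tau K'" using calc_bd[OF ch] by blast
  show ?thesis unfolding op_diff[OF M K'] op_cmult[OF K] ..
qed

lemma calc_norm: assumes "!!a. \<bar>a\<bar> <= B ==> norm (g a) <= M" "0 <= M" shows "norm (op (%\<gamma>. g (f \<gamma>)) tau tau) <= M"
  by (rule norm_op) (use assms fB in \<open>simp add: bdd_on_def\<close>)

text \<open>The second-order estimate of the exponential holds in operator norm on the diagonal, so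
  a functional bounded by \<open>K\<close> inherits a complex derivative everywhere.\<close>

lemma calc_holo:
  fixes \<Lambda> :: "('e gpd ell2 \<Rightarrow>\<^sub>L 'e gpd ell2) => complex"
  assumes lin: "!!a b c. a : AG ==> b : AG ==> \<Lambda> (a - cscale c b) = \<Lambda> a - c * \<Lambda> b"
    and bd: "!!a. a : AG ==> norm (\<Lambda> a) <= K * norm a" and K: "0 <= K"
  shows "(%z. \<Lambda> (op (%\<gamma>. exp (\<i> * z * of_real (f \<gamma>))) tau tau)) holomorphic_on UNIV" (is "?G holomorphic_on _")
proof -
  define Dg where "Dg g = op (%\<gamma>. g (f \<gamma>)) tau tau" for g :: "real => complex"
  have L: "\<Lambda> (Dg (%a. g a - c * h a)) = \<Lambda> (Dg g) - c * \<Lambda> (Dg h)" if "continuous_on UNIV g" "continuous_on UNIV h" for g h c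
    unfolding Dg_def calc_lin[OF that] by (intro lin calc_mem that)
  have Lb: "norm (\<Lambda> (Dg g)) <= K * M" if "continuous_on UNIV g" "!!a. \<bar>a\<bar> <= B ==> norm (g a) <= M" "0 <= M" for g M
  proof -
    have "norm (Dg g) <= M" unfolding Dg_def by (rule calc_norm) (use that in auto)
    from mult_left_mono[OF this K] show ?thesis using bd[OF calc_mem[OF that(1)]] unfolding Dg_def by linarith
  qed
  have G: "?G z = \<Lambda> (Dg (%a. exp (\<i> * z * of_real a)))" for z by (simp add: Dg_def)
  have ce: "continuous_on UNIV (%a. exp (\<i> * z * complex_of_real a))" for z by (intro continuous_intros)
  have "(?G has_field_derivative \<Lambda> (Dg (%a. \<i> * of_real a * exp (\<i> * z * of_real a)))) (at z)" for z
  proof -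
    let ?d = "\<Lambda> (Dg (%a. \<i> * of_real a * exp (\<i> * z * of_real a)))"
    let ?K = "K * (exp (norm z * B) * (exp B * B\<^sup>2))"
    have cd: "continuous_on UNIV (%a. \<i> * complex_of_real a * exp (\<i> * z * of_real a))" by (intro continuous_intros)
    have est: "norm (?G w - ?G z - (w - z) * ?d) <= ?K * (norm (w - z))\<^sup>2" if w: "norm (w - z) <= 1" for w
    proof -
      have c1: "continuous_on UNIV (%a. exp (\<i> * w * complex_of_real a) - 1 * exp (\<i> * z * of_real a))" by (intro continuous_intros)
      have "?G w - ?G z - (w - z) * ?d = \<Lambda> (Dg (%a. (exp (\<i> * w * of_real a) - 1 * exp (\<i> * z * of_real a)) - (w - z) * (\<i> * of_real a * exp (\<i> * z * of_real a))))"
        unfolding L[OF c1 cd] L[OF ce ce] G by simp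
      also have "norm ... <= K * (exp (norm z * B) * (exp B * B\<^sup>2) * (norm (w - z))\<^sup>2)"
        using exp_quadratic[OF _ w] by (intro Lb continuous_intros) auto
      finally show ?thesis by (simp add: mult_ac)
    qed
    have "((%w. (?G w - ?G z) / (w - z) - ?d) \<longlongrightarrow> 0) (at z)"
    proof (rule Lim_null_comparison)
      show "((%w. ?K * norm (w - z)) \<longlongrightarrow> 0) (at z)"
        by (rule tendsto_eq_intros LIM_zero tendsto_ident_at | simp)+
      have "\<forall>\<^sub>F w in at z. dist w z < 1 & w ~= z" unfolding eventually_at by (auto intro: exI[of _ 1])
      then show "\<forall>\<^sub>F w in at z. norm ((?G w - ?G z) / (w - z) - ?d) <= ?K * norm (w - z)"
      proof eventually_elim
        case (elim w)
        then have w: "w - z ~= 0" "norm (w - z) <= 1" by (auto simp: dist_norm)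
        have "norm ((?G w - ?G z) / (w - z) - ?d) = norm (?G w - ?G z - (w - z) * ?d) / norm (w - z)"
          using w(1) by (simp add: field_simps flip: norm_divide)
        also have "... <= ?K * (norm (w - z))\<^sup>2 / norm (w - z)" by (intro divide_right_mono est[OF w(2)]) auto
        also have "... = ?K * norm (w - z)" by (simp add: power2_eq_square)
        finally show ?case .
      qed
    qed
    then show ?thesis unfolding has_field_derivative_iff by (simp add: LIM_zero_iff)
  qed
  then show ?thesis by (auto simp: holomorphic_on_open)
qed

end

end

context kms_pot
begin

definition mass :: "'e list => real" where "mass mu = enn2real (\<psi> (T mu mu))"

lemma T_N: "mu ~= [] ==> nu ~= [] ==> T mu nu : N" using T_N_fin T_finite by blast

lemma wt_T: "mu ~= [] ==> wt (T mu mu) = mass mu"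
  by (simp add: wt_def mass_def hadj_T T_idem)

lemma L_T: "mu ~= [] ==> L (T mu mu) = of_real (mass mu)"
  using L_sq[OF T_N, of mu mu] by (simp add: wt_T hadj_T T_idem)

text \<open>The extension of a weight need not be bounded, but compression by an element of
  \<open>N\<close> makes it a norm-bounded functional, to which density and holomorphy arguments
  apply.\<close>

lemma L_corner: assumes q: "q : N" "hadj q = q" and a: "a : AG"
  shows "norm (L (q oL (a oL q))) <= norm a * wt q"
proof -
  have "norm (L (hadj q oL (a oL q))) <= sqrt (wt q) * sqrt (wt (a oL q))" using N_left(1)[OF a q(1)] q(1) L_CS' by simp
  also have "... <= sqrt (wt q) * sqrt ((norm a)\<^sup>2 * wt q)"
    by (intro mult_left_mono real_sqrt_le_mono N_left(2)[OF a q(1)]) auto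
  also have "... = norm a * wt q" by (simp add: real_sqrt_mult)
  finally show ?thesis by (simp add: q(2))
qed

lemma mass_split: assumes "mu ~= []" shows "mass mu = (SUM rho:E n mu. mass (mu @ rho))"
proof -
  have "\<psi> (T mu mu) = (SUM rho:E n mu. \<psi> (T (mu @ rho) (mu @ rho)))"
    by (subst T_split[OF assms, of mu n], rule \<psi>_sum, rule T_pos) (simp add: assms)
  then show ?thesis unfolding mass_def using T_finite assms by (simp add: enn2real_sum)
qed

text \<open>\<open>?V\<close> is a partial isometry from \<open>T tau tau\<close> to
  \<open>T (e # tau) (e # tau)\<close>, and \<open>hadj ?V oL al \<phi> t ?V\<close> is the diagonal
  function \<open>exp (\<i> * t * \<phi> (cat [e] x))\<close>. Its value under \<open>L\<close>
  extends to an entire function, which \<open>strip_unique\<close> identifies with the KMS function.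
  At height \<beta> this expresses \<open>mass (e # tau)\<close> by the diagonal function
  \<open>exp (- \<beta> * \<phi>)\<close>, and positivity gives both bounds.\<close>

lemma mass_step:
  assumes n: "tau ~= []" and ne: "cyl (e # tau) ~= {}"
    and lo: "!!x. x : cyl (e # tau) ==> lo <= exp (- \<beta> * \<phi> x) & exp (- \<beta> * \<phi> x) <= hi"
  shows "lo * mass tau <= mass (e # tau)" "mass (e # tau) <= hi * mass tau"
proof -
  let ?p = "T tau tau" and ?V = "T (e # tau) tau"
  define f where "f \<gamma> = \<phi> (cat [e] (fst \<gamma>))" for \<gamma> :: "'e gpd"
  have ph: "hadj ?p = ?p" by (rule hadj_T)
  have pN: "?p : N" by (rule T_N[OF n n])
  obtain w0 where w0: "cat (e # tau) w0 : X" using ne cylE by blast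
  have ex: "cat [e] x : cyl (e # tau)" if x: "x : cyl tau" for x
  proof -
    obtain z where z: "x = cat tau z" "z : X" "x : X" using x by (metis cylE)
    have "cat [e] x : X" by (metis n w0 z(3) z cat_0 cat_Cons cat1_X)
    then show ?thesis using x by simp
  qed
  have dV: "dm (e # tau) tau = cyl (e # tau)" "dm tau (e # tau) = cyl tau"
  proof -
    have "cat (e # tau) w0 : dm (e # tau) tau" using w0 cat_X_tail[of "[e]" "cat tau w0"] by (simp add: dm_cat flip: cat_Cons)
    then show "dm (e # tau) tau = cyl (e # tau)" "dm tau (e # tau) = cyl tau"
      using dm_sw n by (intro dm_full; blast)+
  qed
  obtain B where B: "!!x. x : cyl (e # tau) ==> \<bar>\<phi> x\<bar> <= B" using u_bd[of "e # tau"] by auto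
  have fB: "\<bar>f \<gamma>\<bar> <= B" if "\<gamma> : D tau tau" for \<gamma>
    using that B[OF ex] by (auto simp: f_def D_def dm_same)
  define Dg where "Dg g = op (%\<gamma>. g (f \<gamma>)) tau tau" for g :: "real => complex"
  have osc: "EX k. ALL rho:E k tau. ALL \<gamma>:D (tau @ rho) (tau @ rho). ALL \<gamma>':D (tau @ rho) (tau @ rho). \<bar>f \<gamma> - f \<gamma>'\<bar> < d" if d: "d > 0" for d
  proof -
    obtain k where k: "ALL x:X. ALL y:X. pre k x = pre k y --> \<bar>\<phi> x - \<phi> y\<bar> <= d / 2" using vr[of "d/2"] d by auto
    have "\<bar>f \<gamma> - f \<gamma>'\<bar> < d"
      if r: "rho : E k tau" and g: "\<gamma> : D (tau @ rho) (tau @ rho)" "\<gamma>' : D (tau @ rho) (tau @ rho)" for rho \<gamma> \<gamma>'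
    proof -
      have x: "fst \<gamma> : cyl (tau @ rho)" "fst \<gamma>' : cyl (tau @ rho)" using g by (auto simp: D_def dm_same)
      then have c: "fst \<gamma> : cyl tau" "fst \<gamma>' : cyl tau" using cyl_append_subset by blast+
      have "pre k (cat [e] (fst \<gamma>)) = pre k (cat [e] (fst \<gamma>'))" using x E_len[OF r] by (auto simp: cylinder_def pre_eq_iff cat_def)
      then show ?thesis using k ex[OF c(1)] ex[OF c(2)] d by (force simp: f_def)
    qed
    then show ?thesis by blast
  qed
  note calc = n fB osc
  have mem: "Dg g : AG" if "continuous_on UNIV g" for g unfolding Dg_def by (rule calc_mem[OF calc that])
  have coD: "coord (Dg g xi) (x, k, y) = (if (x, k, y) : Gam & x : cyl tau then g (\<phi> (cat [e] x)) * coord xi (x, k, y) else 0)"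
    if g: "continuous_on UNIV g" for g xi x k y using calc_bd[OF calc g] dm_same by (auto simp: Dg_def coord_op dg_def f_def elim!: cylE)
  have cop: "coord (?p xi) (x, k, y) = (if (x, k, y) : Gam & x : cyl tau then coord xi (x, k, y) else 0)" for xi x k y
    unfolding coord_T dm_same by (auto simp: dg_def elim!: cylE)
  have corner: "Dg g = ?p oL (Dg g oL ?p)" if g: "continuous_on UNIV g" for g
    by (rule blinfun_eqI, rule ell2_eqI, rename_tac \<gamma>, case_tac \<gamma>) (simp add: coD[OF g] cop)
  have lin: "L (Dg (%a. g a - c * h a)) = L (Dg g) - c * L (Dg h)" if "continuous_on UNIV g" "continuous_on UNIV h" for g h c
    unfolding Dg_def using calc_lin[OF calc that, of c] by (simp add: L_diff L_cscale)
  define G' where "G' z = L (Dg (%a. exp (\<i> * z * of_real a)))" for z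
  have ce: "continuous_on UNIV (%a. exp (\<i> * z * complex_of_real a))" for z by (intro continuous_intros)
  have "(%z. L (?p oL (op (%\<gamma>. exp (\<i> * z * of_real (f \<gamma>))) tau tau oL ?p))) holomorphic_on UNIV"
    using calc_holo[OF calc, where \<Lambda> = "%a. L (?p oL (a oL ?p))" and K = "wt ?p"] L_corner pN ph by (auto simp: comp_diff cscale_left cscale_right AdjD(2) T_Adj L_diff L_cscale mult.commute)
  then have hol: "G' holomorphic_on UNIV"
    by (rule holomorphic_transform) (simp add: G'_def Dg_def corner[OF ce, unfolded Dg_def, symmetric])
  have VN: "?V : N" "hadj ?V : N" using T_N n by (auto simp: hadj_T)
  obtain F M where F: "continuous_on (strip \<beta>) F" "F holomorphic_on interior (strip \<beta>)"
    "!!z. z : strip \<beta> ==> norm (F z) <= M"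
    "!!t. F (of_real t) = L (hadj ?V oL al \<phi> t ?V)" "!!t. F (of_real t + \<i> * of_real \<beta>) = L (al \<phi> t ?V oL hadj ?V)"
    using kms[of "hadj ?V" ?V] VN T_Adj by (metis hadj_hadj)
  have FG: "F (of_real t) = G' (of_real t)" for t
  proof -
    have "hadj ?V oL al \<phi> t ?V = Dg (%a. exp (\<i> * of_real t * of_real a))"
    proof (rule blinfun_eqI, rule ell2_eqI)
      fix xi and \<gamma> :: "'e gpd"
      obtain x k y where g: "\<gamma> = (x, k, y)" by (cases \<gamma>)
      show "coord ((hadj ?V oL al \<phi> t ?V) xi) \<gamma> = coord (Dg (%a. exp (\<i> * of_real t * of_real a)) xi) \<gamma>"
      proof (cases "(x, k, y) : Gam & x : cyl tau")
        case True
        obtain z where z: "x = cat tau z" using True by (metis cylE)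
        have s: "sw tau (e # tau) x = cat [e] x" "sw (e # tau) tau (cat [e] x) = x"
          unfolding z cat_Cons[symmetric] sw_cat by (rule refl)+
        have d: "dg tau (e # tau) = - 1" "dg (e # tau) tau = 1" by (simp_all add: dg_def)
        have xd: "x : dm tau (e # tau)" "cat [e] x : dm (e # tau) tau" using True ex dV by auto
        have "coord (al \<phi> t ?V xi) (cat [e] x, k + 1, y) = cis (t * \<phi> (cat [e] x)) * coord xi (x, k, y)" using Gam_op[of x k y tau "e # tau"] True xd coc_eq[of 1 "cat [e] x" 0 x 1 \<phi>] s d by (auto simp: birkhoff_sum_def al_T coord_op[OF cis_coc_bdd])
        moreover have "coord ((hadj ?V oL al \<phi> t ?V) xi) \<gamma> = coord (al \<phi> t ?V xi) (cat [e] x, k + 1, y)"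
          using True xd unfolding g hadj_T blinfun_apply_blinfun_compose coord_T s d by simp
        moreover have "coord (Dg (%a. exp (\<i> * of_real t * of_real a)) xi) \<gamma> = cis (t * \<phi> (cat [e] x)) * coord xi (x, k, y)"
          unfolding g coD[OF ce] using True by (simp add: cis_conv_exp mult.assoc)
        ultimately show ?thesis by simp
      next
        case False
        then show ?thesis unfolding g hadj_T blinfun_apply_blinfun_compose coord_T coD[OF ce] dV by auto
      qed
    qed
    then show ?thesis unfolding F(4) G'_def by simp
  qed
  have "F (of_real 0 + \<i> * of_real \<beta>) - G' (of_real 0 + \<i> * of_real \<beta>) = 0"
  proof (rule strip_unique[of \<beta> "%z. F z - G' z"])
    show "norm (F z - G' z) <= M + exp (\<bar>\<beta>\<bar> * B) * wt ?p" if z: "z : strip \<beta>" for z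
    proof (rule order_trans[OF norm_triangle_ineq4 add_mono[OF F(3)[OF z]]])
      have "norm (Dg (%a. exp (\<i> * z * of_real a))) <= exp (\<bar>\<beta>\<bar> * B)" unfolding Dg_def
      proof (rule calc_norm[OF calc])
        fix a assume a: "\<bar>a\<bar> <= B"
        have "- (Im z * a) <= \<bar>Im z\<bar> * \<bar>a\<bar>" by (metis abs_ge_minus_self abs_mult)
        also have "... <= \<bar>\<beta>\<bar> * B" using z a by (intro mult_mono) (auto simp: strip_def)
        finally show "norm (exp (\<i> * z * of_real a)) <= exp (\<bar>\<beta>\<bar> * B)" by simp
      qed auto
      then have "norm (Dg (%a. exp (\<i> * z * of_real a))) * wt ?p <= exp (\<bar>\<beta>\<bar> * B) * wt ?p" by (intro mult_right_mono) auto
      then show "norm (G' z) <= exp (\<bar>\<beta>\<bar> * B) * wt ?p"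
        unfolding G'_def using L_corner[OF pN ph mem[OF ce[of z]]] corner[OF ce[of z]] by simp
    qed
    show "continuous_on (strip \<beta>) (%z. F z - G' z)"
      by (intro continuous_intros F(1) holomorphic_on_imp_continuous_on holomorphic_on_subset[OF hol]) auto
    show "(%z. F z - G' z) holomorphic_on interior (strip \<beta>)"
      by (intro holomorphic_intros F(2) holomorphic_on_subset[OF hol]) auto
  qed (simp_all add: FG)
  then have "L (?V oL hadj ?V) = G' (\<i> * of_real \<beta>)" unfolding F(5) by simp
  moreover have "?V oL hadj ?V = T (e # tau) (e # tau)"
    unfolding hadj_T using n ne by (intro T_sq) (auto simp: dV)
  ultimately have main: "of_real (mass (e # tau)) = L (Dg (%a. of_real (exp (- \<beta> * a))))"
    unfolding G'_def using L_T by (simp add: exp_of_real[symmetric])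
  have one: "Dg (%a. 1) = ?p" unfolding Dg_def T_def ..
  have cx: "continuous_on UNIV (%a. complex_of_real (exp (- \<beta> * a)))" "continuous_on UNIV (%a::real. 1::complex)"
    by (intro continuous_intros)+
  \<comment> \<open>The sign \<open>s\<close> treats the lower and the upper bound at once.\<close>
  have nonneg: "0 <= s * (mass (e # tau) - c * mass tau)"
    if s: "s = 1 \<or> s = - 1" and h: "!!x. x : cyl (e # tau) ==> 0 <= s * (exp (- \<beta> * \<phi> x) - c)" for s c :: real
  proof -
    let ?g = "%a. complex_of_real (s * (exp (- \<beta> * a) - c))"
    have cg: "continuous_on UNIV ?g" by (intro continuous_intros)
    obtain M where M: "bdd_on (%\<gamma>. ?g (f \<gamma>)) tau tau M" using calc_bd[OF calc cg] ..
    have "Dg ?g : pos_cone AG" unfolding Dg_def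
    proof (rule op_pos[OF _ M mem[OF cg, unfolded Dg_def]])
      fix \<gamma> assume "\<gamma> : D tau tau"
      then show "?g (f \<gamma>) = of_real (s * (exp (- \<beta> * f \<gamma>) - c)) & 0 <= s * (exp (- \<beta> * f \<gamma>) - c)" using ex h by (auto simp: D_def dm_same f_def)
    qed
    from corner_pos(2)[OF this pN ph corner[OF cg]] obtain w where w: "w >= 0" "L (Dg ?g) = of_real w" by blast
    have "L (Dg ?g) = of_real s * (L (Dg (%a. of_real (exp (- \<beta> * a)))) - of_real c * L (Dg (%a. 1)))"
    proof -
      have c0: "continuous_on UNIV (%a::real. 0::complex)" and c2: "continuous_on UNIV (%a. complex_of_real (exp (- \<beta> * a)) - of_real c * 1)"
        by (intro continuous_intros)+
      show ?thesis using lin[OF c0 c0, of 1] lin[OF c0 c2, of "- of_real s"] lin[OF cx, of "of_real c"] by simp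
    qed
    also have "... = of_real (s * (mass (e # tau) - c * mass tau))" unfolding main[symmetric] one L_T[OF n] by simp
    finally have "of_real w = complex_of_real (s * (mass (e # tau) - c * mass tau))" unfolding w(2) .
    then show ?thesis using w(1) of_real_eq_iff by metis
  qed
  show "lo * mass tau <= mass (e # tau)" using nonneg[of 1 lo] lo by simp
  show "mass (e # tau) <= hi * mass tau" using nonneg[of "- 1" hi] lo by simp
qed

end

section \<open>Projections onto finitely many initial edges\<close>

context pgraph
begin

text \<open>For finite \<open>F\<close> this projection lies in the algebra and is fixed by the
  actions; along \<open>Fin n\<close> it is an approximate unit.\<close>

definition Pr :: "'e set => 'e gpd ell2 \<Rightarrow>\<^sub>L 'e gpd ell2" where
  "Pr F = wco (%\<gamma>. if \<gamma> : Gam & fst \<gamma> 0 : F then 1 else 0) id"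

lemma Pr_data: "wco_data (%\<gamma>. if \<gamma> : Gam & fst \<gamma> 0 : F then 1 else 0) id 1" by standard auto

lemma coord_Pr: "coord (Pr F xi) \<gamma> = (if \<gamma> : Gam & fst \<gamma> 0 : F then coord xi \<gamma> else 0)"
  unfolding Pr_def wco_data.coord_wco[OF Pr_data] by simp

lemma norm_Pr: "norm (Pr F) <= 1" unfolding Pr_def by (rule wco_data.norm_wco[OF Pr_data])

lemma hadj_Pr: "hadj (Pr F) = Pr F"
  by (rule is_hadj_hadj, unfold Pr_def, rule is_hadj_wco[OF Pr_data Pr_data]) (auto split: if_splits)

lemma Pr_Pr: "Pr F oL Pr F = Pr F"
  by (rule blinfun_eqI, rule ell2_eqI) (simp add: coord_Pr)

lemma Pr_sum: assumes "finite F" shows "Pr F = (SUM e:F. T [e] [e])"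
proof (rule blinfun_eqI, rule ell2_eqI)
  fix xi and \<gamma> :: "'e gpd"
  obtain x k y where g: "\<gamma> = (x, k, y)" by (cases \<gamma>)
  have "coord (T [e] [e] xi) (x, k, y) = (if e = x 0 then if (x, k, y) : Gam then coord xi (x, k, y) else 0 else 0)" for e
  proof -
    have "sw [e] [e] x = x" if "x : cyl [e]" using that by (auto elim!: cylE)
    moreover have "x : cyl [e] \<longleftrightarrow> x 0 = e" if "(x, k, y) : Gam" using Gam_X[OF that] by (simp add: mem_cyl pre_def)
    ultimately show ?thesis unfolding coord_T dm_same by (auto simp: dg_def)
  qed
  then show "coord (Pr F xi) \<gamma> = coord (blinfun_apply (SUM e:F. T [e] [e]) xi) \<gamma>"
    using assms by (simp add: g coord_Pr blinfun.sum_left coord_sum)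
qed

lemma Pr_A: "finite F ==> Pr F : AG"
  unfolding Pr_sum using A0_AG by (intro A_sum) (auto intro: T_A0)

lemma Pr_fix: "finite F ==> al \<phi> t (Pr F) = Pr F" by (simp add: Pr_sum al_sum al_fix)

lemma Pr_T: assumes "mu ~= []" shows "Pr F oL T mu nu = (if hd mu : F then T mu nu else 0)"
proof (rule blinfun_eqI, rule ell2_eqI)
  fix xi and \<gamma> :: "'e gpd"
  obtain x k y where g: "\<gamma> = (x, k, y)" by (cases \<gamma>)
  show "coord ((Pr F oL T mu nu) xi) \<gamma> = coord (blinfun_apply (if hd mu : F then T mu nu else 0) xi) \<gamma>" using assms by (auto simp: cat_0 g coord_Pr coord_T elim!: dmE)
qed

lemma T_Pr: assumes "nu ~= []" "finite F" shows "T mu nu oL Pr F = (if hd nu : F then T mu nu else 0)"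
  using arg_cong[OF Pr_T[OF assms(1), of F mu], of hadj] Pr_A[OF assms(2)]
  by (simp add: hadj_comp T_Adj AA hadj_T hadj_Pr cong: if_cong)

definition Fin :: "nat => 'e set" where "Fin n = {e : arcs G. to_nat_on (arcs G) e < n}"

lemma finite_Fin: "finite (Fin n)"
proof -
  have "to_nat_on (arcs G) ` Fin n \<subseteq> {..<n}" by (auto simp: Fin_def)
  moreover have "inj_on (to_nat_on (arcs G)) (Fin n)"
    by (rule inj_on_subset[OF inj_on_to_nat_on[OF cnt]]) (auto simp: Fin_def)
  ultimately show ?thesis using finite_subset finite_imageD by blast
qed

text \<open>On \<open>A0\<close> the product is eventually equal to the element itself, because only
  finitely many initial edges occur; the projections are contractions, so density extends
  this.\<close>

lemma Pr_lim1: assumes a: "a : AG" shows "(%n. Pr (Fin n) oL a) ----> a"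
proof -
  have A0: "EX n0. ALL n>=n0. Pr (Fin n) oL b = b" if "b : A0" for b
    using that
  proof (induction rule: A0_induct)
    case (add c mu nu b)
    then obtain n0 where n0: "!!n. n >= n0 ==> Pr (Fin n) oL b = b" by blast
    have P: "Pr (Fin n) oL T mu nu = T mu nu" if "n > to_nat_on (arcs G) (hd mu)" for n
    proof (cases "dm mu nu = {}")
      case False
      then have "hd mu : arcs G" using last_arc[OF add(1)] hd_in_set[OF add(1)] by (auto simp: dm_def)
      then show ?thesis using that by (simp add: Pr_T[OF add(1)] Fin_def)
    qed (simp add: T_empty)
    show ?case
      by (rule exI[of _ "max n0 (Suc (to_nat_on (arcs G) (hd mu)))"])
        (simp add: comp_add cscale_right AdjD(2) AA Pr_A finite_Fin P n0)
  qed simp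
  show ?thesis
  proof (rule LIMSEQ_I)
    fix r :: real assume "r > 0"
    then obtain b where b: "b : A0" "dist b a < r / 2"
      using a unfolding graph_algebra_eq closure_approachable by (metis half_gt_zero)
    obtain n0 where n0: "!!n. n >= n0 ==> Pr (Fin n) oL b = b" using A0[OF b(1)] by blast
    have "norm ((Pr (Fin n) oL a) - a) < r" if n: "n >= n0" for n
    proof -
      have "(Pr (Fin n) oL a) - a = (Pr (Fin n) oL (a - b)) + (b - a)" using n0[OF n] by (simp add: comp_diff)
      also have "norm ... <= norm (Pr (Fin n)) * norm (a - b) + norm (b - a)"
        by (intro norm_triangle_mono norm_comp_le) auto
      also have "... <= 1 * norm (a - b) + norm (b - a)" by (intro add_mono mult_right_mono norm_Pr) auto
      also have "... < r" using b(2) by (simp add: dist_norm norm_minus_commute)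
      finally show ?thesis .
    qed
    then show "EX n0. ALL n>=n0. norm ((Pr (Fin n) oL a) - a) < r" by blast
  qed
qed

lemma Pr_lim: assumes a: "a : AG" shows "(%n. Pr (Fin n) oL (a oL Pr (Fin n))) ----> a"
proof -
  have PA: "Pr (Fin n) : AG" for n by (rule Pr_A[OF finite_Fin])
  have r: "(%n. a oL Pr (Fin n)) ----> a"
    using Adj_lim(2)[OF _ Pr_lim1[OF A_hadj[OF a]]] a PA by (simp add: hadj_comp Adj_comp hadj_in_Adj AA hadj_Pr)
  have "(%n. Pr (Fin n) oL ((a oL Pr (Fin n)) - a)) ----> 0"
  proof (rule Lim_null_comparison)
    show "(%n. norm ((a oL Pr (Fin n)) - a)) ----> 0" using r by (simp add: tendsto_norm_zero_iff LIM_zero_iff)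
    show "\<forall>\<^sub>F n in sequentially. norm (Pr (Fin n) oL ((a oL Pr (Fin n)) - a)) <= norm ((a oL Pr (Fin n)) - a)" using order_trans[OF norm_comp_le mult_right_mono[OF norm_Pr norm_ge_zero]] by simp
  qed
  from tendsto_add[OF this Pr_lim1[OF a]] show ?thesis by (simp add: comp_diff)
qed

lemma pot_const: "pot G (%_. c)" by unfold_locales auto

end

lemma (in pot) pot_cmult: "pot G (%x. c * u x)"
proof
  fix e :: real assume e: "e > 0"
  then obtain k where k: "ALL x:X. ALL y:X. pre k x = pre k y --> \<bar>u x - u y\<bar> <= e / (\<bar>c\<bar> + 1)"
    using vr[of "e / (\<bar>c\<bar> + 1)"] by auto
  have "\<bar>c * a - c * b\<bar> <= e" if "\<bar>a - b\<bar> <= e / (\<bar>c\<bar> + 1)" for a b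
  proof -
    have "\<bar>c * a - c * b\<bar> = \<bar>c\<bar> * \<bar>a - b\<bar>" by (simp add: abs_mult flip: right_diff_distrib)
    also have "... <= \<bar>c\<bar> * (e / (\<bar>c\<bar> + 1))" using that by (intro mult_left_mono) auto
    also have "... <= e" using e by (simp add: field_simps)
    finally show ?thesis .
  qed
  then show "EX k. ALL x:X. ALL y:X. pre k x = pre k y --> \<bar>c * u x - c * u y\<bar> <= e" using k by blast
qed

context kms_pot
begin

text \<open>For a fixed \<open>q\<close> the KMS function is constant on the real line, hence by
  \<open>strip_unique\<close> also on the upper line.\<close>

lemma centralizer:
  assumes q: "q : N" "hadj q : N" "!!t. al \<phi> t q = q" and a: "a : N" "hadj a : N"
  shows "L (q oL a) = L (a oL q)"
proof -
  obtain F M where F: "continuous_on (strip \<beta>) F" "F holomorphic_on interior (strip \<beta>)"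
    "!!z. z : strip \<beta> ==> norm (F z) <= M"
    "!!t. F (of_real t) = L (a oL al \<phi> t q)" "!!t. F (of_real t + \<i> * of_real \<beta>) = L (al \<phi> t q oL a)"
    using kms[OF a q(1,2)] by metis
  have "F (of_real 0 + \<i> * of_real \<beta>) - L (a oL q) = 0"
    by (rule strip_unique[of \<beta> "%z. F z - L (a oL q)" "M + norm (L (a oL q))"])
      (auto simp: F q(3) intro!: continuous_intros holomorphic_intros order_trans[OF norm_triangle_ineq4])
  then show ?thesis by (simp only: F(5)) simp
qed

lemma Pr_N: "finite F ==> F \<subseteq> arcs G ==> Pr F : N" by (auto simp: Pr_sum intro!: N_sum T_N)

lemma Pr_N': "finite F ==> Pr F : N" by (auto simp: Pr_sum intro!: N_sum T_N)

lemma cut_pos: assumes "a : pos_cone AG" "finite F" shows "Pr F oL (a oL Pr F) : pos_cone AG"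
proof -
  obtain r where r: "r : AG" "a = hadj r oL r" using assms(1) by (rule pos_coneE)
  then show ?thesis using Pr_A[OF assms(2)] pos_coneI[OF A_comp[OF r(1) Pr_A[OF assms(2)]]] by (auto simp: hadj_comp AA hadj_Pr comp_assoc)
qed

text \<open>A compression of \<open>a\<close> need not lie below \<open>a\<close>, so positivity
  alone is not enough. With a root \<open>b\<close> of \<open>a\<close> and \<open>q\<close> in the
  centralizer, the weight of the square of \<open>b - (b oL q)\<close> is the difference of the two
  sides.\<close>

lemma cut_le: assumes a: "a : pos_cone AG" and F: "finite F" shows "\<psi> (Pr F oL (a oL Pr F)) <= \<psi> a"
proof (cases "\<psi> a < \<infinity>")
  case True
  let ?q = "Pr F"
  obtain b where b: "b : AG" "hadj b = b" "b oL b = a"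
    using pos_sqrt[OF pos_cone_A[OF a] pos_cone_hadj[OF a] pos_cone_form[OF a]] by metis
  have bN: "b : N" using b True by (intro NI) auto
  have qN: "?q : N" and qA: "?q : AG" using Pr_N'[OF F] Pr_A[OF F] by auto
  have aN: "a : N" by (rule fin_N[OF a True])
  have aq: "a oL ?q : N" "hadj (a oL ?q) : N" "hadj a : N"
    using N_left(1)[OF N_A[OF aN] qN] N_left(1)[OF qA aN] aN AA[OF N_A[OF aN]] AA[OF qA]
    by (simp_all add: hadj_comp hadj_Pr pos_cone_hadj[OF a])
  have c: "L (?q oL x) = L (x oL ?q)" if "x : N" "hadj x : N" for x
    by (rule centralizer) (use qN hadj_Pr Pr_fix[OF F] that in auto)
  have bq: "b oL ?q : N" by (rule N_left(1)[OF b(1) qN])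
  have sq: "hadj (b oL ?q) oL (b oL ?q) = ?q oL (a oL ?q)"
    using AA[OF b(1)] AA[OF qA] by (simp add: hadj_comp hadj_Pr b(2) comp_assoc flip: b(3))
  have "of_real (wt (b - (b oL ?q))) = (L a - L (a oL ?q)) - (L (a oL ?q) - L (?q oL (a oL ?q)))" using AA[OF b(1)] AA[OF qA] L_sq[OF N_diff[OF bN bq]] c[OF aN aq(3)] by (auto simp: hadj_diff Adj_comp hadj_comp hadj_Pr b(2) comp_diff comp_assoc L_diff simp flip: b(3))
  also have "L (a oL ?q) = L (?q oL (a oL ?q))" using c[OF aq(1,2)] by (simp add: comp_assoc Pr_Pr)
  also have "L (?q oL (a oL ?q)) = of_real (wt (b oL ?q))" using L_sq[OF bq] by (simp add: sq)
  also have "L a = of_real (wt b)" using L_sq[OF bN] by (simp add: b)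
  finally have "complex_of_real (wt (b - (b oL ?q))) = of_real (wt b - wt (b oL ?q))" by simp
  then have "wt (b oL ?q) <= wt b" unfolding of_real_eq_iff using wt_nonneg[of "b - (b oL ?q)"] by auto
  then show ?thesis using N_fin[OF bq] N_fin[OF bN] by (simp add: sq b)
qed (simp add: not_less top_unique)

text \<open>With \<open>cut_le\<close>, the weight is the supremum of its values on the corners,
  hence determined by them.\<close>

lemma cut_lsc: assumes a: "a : pos_cone AG" and c: "!!n. \<psi> (Pr (Fin n) oL (a oL Pr (Fin n))) <= ennreal c" "0 <= c"
  shows "\<psi> a <= ennreal c"
  by (rule lsc[OF cut_pos[OF a finite_Fin] Pr_lim[OF pos_cone_A[OF a]] a c])

lemma cut_L: assumes "a : pos_cone AG" "finite F"
  shows "\<psi> (Pr F oL (a oL Pr F)) = ennreal (Re (L (Pr F oL (a oL Pr F))))"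
proof -
  have "Pr F oL (a oL Pr F) = Pr F oL ((Pr F oL (a oL Pr F)) oL Pr F)"
    by (simp add: comp_assoc) (simp add: comp_assoc[symmetric] Pr_Pr)
  then show ?thesis using corner_pos(1)[OF cut_pos[OF assms] Pr_N'[OF assms(2)] hadj_Pr] L_pos[OF cut_pos[OF assms]] by simp
qed

text \<open>If all masses vanished, the projections \<open>Pr (Fin n)\<close> would have weight 0,
  and the bound of \<open>L_corner\<close> would annihilate every corner.\<close>

lemma mass_nonzero: "EX mu. mu ~= [] & 0 < mass mu"
proof (rule ccontr)
  assume n: "~?thesis"
  have m0: "mass mu = 0" if "mu ~= []" for mu
  proof -
    have "0 <= mass mu" by (simp add: mass_def)
    then show ?thesis using n that by (metis less_eq_real_def)
  qed
  have "\<psi> a <= ennreal 0" if a: "a : pos_cone AG" for a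
  proof (rule cut_lsc[OF a])
    fix n
    let ?q = "Pr (Fin n)"
    have qN: "?q : N" by (rule Pr_N'[OF finite_Fin])
    have "L ?q = 0" unfolding Pr_sum[OF finite_Fin] L_sum by (simp add: L_T m0)
    then have "wt ?q = 0" using L_sq[OF qN] by (simp add: hadj_Pr Pr_Pr)
    then have "L (?q oL (a oL ?q)) = 0" using L_corner[OF qN hadj_Pr pos_cone_A[OF a]] by simp
    then show "\<psi> (?q oL (a oL ?q)) <= ennreal 0" by (simp add: cut_L[OF a finite_Fin])
  qed simp
  then show False using KMS by (auto simp: KMS_weight_def)
qed

lemma mass_conf: "pot.conf G (%x. - \<beta> * \<phi> x) mass"
  unfolding pot.conf_def[OF pot_cmult]
proof (intro conjI allI impI)
  show "0 <= mass mu" for mu by (simp add: mass_def)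
  show "mass mu = (SUM rho:E 1 mu. mass (mu @ rho))" if "mu ~= []" for mu by (rule mass_split[OF that])
qed (use mass_step in blast)+

end

locale gauge_kms = kms_pot +
  assumes GI: "gauge_invariant G \<psi>"
begin

text \<open>For words of equal length, \<open>T mu mu\<close> lies in the centralizer and
  annihilates \<open>T mu nu\<close> from the right. For different lengths the gauge action moves
  \<open>T mu nu\<close>.\<close>

lemma L_T_off: assumes n: "mu ~= []" "nu ~= []" "mu ~= nu" shows "L (T mu nu) = 0"
proof (cases "dm mu nu = {}")
  case True then show ?thesis by (simp add: T_empty L_0)
next
  case False
  have pre: "T mu mu oL T mu nu = T mu nu" using T_sq[OF n(1,1,2)] False by (auto simp: dm_same dm_def)
  show ?thesis
  proof (cases "length mu = length nu")
    case True
    have "L (T mu mu oL T mu nu) = L (T mu nu oL T mu mu)"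
      by (rule centralizer) (use n T_N in \<open>auto simp: hadj_T al_fix\<close>)
    also have "T mu nu oL T mu mu = 0" using True n by (intro T_mult_zero) auto
    finally show ?thesis by (simp add: pre L_0)
  next
    case False
    \<comment> \<open>At this time the gauge action multiplies \<open>T mu nu\<close> by -1.\<close>
    define t where "t = pi / of_int (dg mu nu)"
    have "al (%_. 1) t (T mu nu) = op (%_. cis (t * of_int (dg mu nu)) * 1) mu nu"
      unfolding al_T by (rule op_cong) (use D_Gam in \<open>auto simp: D_def coc_gauge[OF dm_Gam]\<close>)
    also have "... = (- 1) *\<^sub>R T mu nu"
      using False by (subst op_cmult[OF bdd_1]) (simp add: T_def t_def dg_def)
    finally have e: "al (%_. 1) t (T mu nu) = (- 1) *\<^sub>R T mu nu" .
    have "L (hadj (al (%_. 1) t (T mu mu)) oL al (%_. 1) t (T mu nu)) = L (hadj (T mu mu) oL T mu nu)"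
      by (rule inv_L[OF pot_const]) (use GI T_N n in \<open>auto simp: gauge_invariant_def\<close>)
    then have "- L (T mu nu) = L (T mu nu)"
      unfolding e al_fix hadj_T comp_scaleR L_scaleR pre by simp
    then show ?thesis by simp
  qed
qed

lemma L_cut_T: assumes "mu ~= []" "nu ~= []" "finite F"
  shows "L (Pr F oL (T mu nu oL Pr F)) = (if mu = nu & hd mu : F then of_real (mass mu) else 0)"
  using assms by (cases "mu = nu") (simp_all add: T_Pr Pr_T L_0 L_T L_T_off)

end

text \<open>On a corner both extensions are norm-bounded, and they are proportional on matrix units
  by \<open>L_cut_T\<close>, hence everywhere on it. Passing to the supremum over corners gives one
  inequality; exchanging the weights gives the other.\<close>

lemma compare_KMS:
  assumes "gauge_kms G \<phi> \<beta> \<psi>" "gauge_kms G \<phi> \<beta> \<psi>'" and c: "c > 0"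
    and m: "!!mu. mu ~= [] ==> kms_pot.mass G \<psi>' mu = c * kms_pot.mass G \<psi> mu"
    and a: "a : pos_cone (graph_algebra G)"
  shows "\<psi>' a <= ennreal c * \<psi> a"
proof -
  interpret w: gauge_kms G \<phi> \<beta> \<psi> by fact
  interpret w': gauge_kms G \<phi> \<beta> \<psi>' by fact
  have eq: "w'.L (w.Pr F oL (a oL w.Pr F)) = of_real c * w.L (w.Pr F oL (a oL w.Pr F))"
    if F: "finite F" and a: "a : w.AG" for F a
  proof -
    define d where "d b = w'.L (w.Pr F oL (b oL w.Pr F)) - of_real c * w.L (w.Pr F oL (b oL w.Pr F))" for b
    have d0: "d b = 0" if "b : w.A0" for b
      using that
    proof (induction rule: w.A0_induct)
      case zero then show ?case by (simp add: d_def w.L_0 w'.L_0)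
    next
      case (add s mu nu b)
      have "d (cscale s (w.T mu nu) + b) = s * d (w.T mu nu) + d b"
        by (simp add: d_def comp_add cscale_left cscale_right AdjD(2) w.AA w.Pr_A[OF F] w.L_add w.L_cscale w'.L_add w'.L_cscale algebra_simps)
      also have "d (w.T mu nu) = 0" unfolding d_def w.L_cut_T[OF add(1,2) F] w'.L_cut_T[OF add(1,2) F] by (cases "mu = nu") (simp_all add: m add)
      finally show ?case using add by simp
    qed
    define K where "K = w'.wt (w.Pr F) + c * w.wt (w.Pr F)"
    have dK: "norm (d b) <= norm b * K" if "b : w.AG" for b
    proof -
      have "norm (d b) <= norm b * w'.wt (w.Pr F) + c * (norm b * w.wt (w.Pr F))"
        unfolding d_def
        using w.L_corner[OF w.Pr_N'[OF F] w.hadj_Pr that] w'.L_corner[OF w'.Pr_N'[OF F] w.hadj_Pr that] c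
        by (intro order_trans[OF norm_triangle_ineq4] add_mono) (auto simp: norm_mult)
      then show ?thesis by (simp add: K_def algebra_simps)
    qed
    obtain f where f: "!!n. f n : w.A0" "f ----> a" using a unfolding w.graph_algebra_eq closure_sequential by blast
    have "norm (d a) <= norm (a - f n) * K" for n
      using d0 f(1) dK[OF w.A_diff[OF a], of "f n"] w.A0_AG by (auto simp: d_def comp_diff w.L_diff w'.L_diff algebra_simps)
    moreover have "(%n. norm (a - f n) * K) ----> norm (a - a) * K" by (intro tendsto_intros f(2))
    ultimately have "norm (d a) <= norm (a - a) * K" by (intro LIMSEQ_le_const) auto
    then show ?thesis by (simp add: d_def)
  qed
  show ?thesis
  proof (cases "\<psi> a = \<infinity>")
    case True
    then show ?thesis using c by (simp add: ennreal_mult_top)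
  next
    case False
    then obtain s where s: "\<psi> a = ennreal s" "s >= 0" by (cases "\<psi> a") auto
    have "\<psi>' a <= ennreal (c * s)"
    proof (rule w'.cut_lsc[OF a])
      fix n
      let ?q = "w.Pr (w.Fin n)"
      have "\<psi>' (?q oL (a oL ?q)) = ennreal c * \<psi> (?q oL (a oL ?q))"
        using c unfolding w.cut_L[OF a w.finite_Fin] w'.cut_L[OF a w.finite_Fin] eq[OF w.finite_Fin w.pos_cone_A[OF a]]
        by (simp add: ennreal_mult' )
      also have "... <= ennreal c * ennreal s" unfolding s(1)[symmetric] by (intro mult_left_mono w.cut_le a w.finite_Fin) simp
      finally show "\<psi>' (?q oL (a oL ?q)) <= ennreal (c * s)" using c s by (simp add: ennreal_mult)
    qed (use c s in simp)
    then show ?thesis using c s by (simp add: ennreal_mult)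
  qed
qed

lemma KMS_unique:
  assumes "gauge_kms G \<phi> \<beta> \<psi>" "gauge_kms G \<phi> \<beta> \<psi>'" and c: "c > 0"
    and m: "!!mu. mu ~= [] ==> kms_pot.mass G \<psi>' mu = c * kms_pot.mass G \<psi> mu"
    and a: "a : pos_cone (graph_algebra G)"
  shows "\<psi>' a = ennreal c * \<psi> a"
proof (rule antisym)
  show "\<psi>' a <= ennreal c * \<psi> a" by (rule compare_KMS[OF assms])
  have "\<psi> a <= ennreal (1 / c) * \<psi>' a"
    by (rule compare_KMS[OF assms(2,1) _ _ a]) (use c m in auto)
  then have "ennreal c * \<psi> a <= ennreal c * (ennreal (1 / c) * \<psi>' a)" by (intro mult_left_mono) auto
  also have "... = \<psi>' a" using c by (simp add: mult.assoc[symmetric] flip: ennreal_mult)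
  finally show "ennreal c * \<psi> a <= \<psi>' a" .
qed

section \<open>From conformal functions to KMS weights\<close>

lemma inner_basis_vec: "x \<bullet> basis_vec i = Re (coord x i)" "x \<bullet> mult_i (basis_vec i) = Im (coord x i)"
proof -
  have "(\<Sum>\<^sub>\<infinity>j. coord x j \<bullet> (w * (if j = i then 1 else 0))) = (\<Sum>\<^sub>\<infinity>j\<in>{i}. coord x j \<bullet> w)" for w
    by (rule infsum_cong_neutral) auto
  from this[of 1] this[of \<i>] show "x \<bullet> basis_vec i = Re (coord x i)" "x \<bullet> mult_i (basis_vec i) = Im (coord x i)"
    by (simp_all add: inner_ell2_def)
qed

text \<open>The entry is real because \<open>r\<close> commutes with \<open>mult_i\<close>, and
  multiplication by \<i> is skew for the real inner product.\<close>

lemma coord_square: assumes r: "r : Adj"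
  shows "coord ((hadj r oL r) (basis_vec i)) i = of_real ((norm (r (basis_vec i)))\<^sup>2)"
proof -
  let ?d = "basis_vec i" and ?v = "(hadj r oL r) (basis_vec i)"
  have "?v \<bullet> y = r ?d \<bullet> r y" for y
    using hadj_inner[OF r, of y "r ?d"] by (simp add: inner_commute)
  moreover have "r ?d \<bullet> r (mult_i ?d) = 0"
    using mult_i_inner[of "r ?d" "r ?d"] AdjD(2)[OF r] by (simp add: clin_def inner_commute)
  ultimately show ?thesis
    using inner_basis_vec[of ?v i] by (simp add: complex_eq_iff power2_norm_eq_inner)
qed

context pgraph
begin

text \<open>The value at the unit \<open>x\<close> of the conditional expectation onto the
  diagonal.\<close>

definition ent :: "('e gpd ell2 \<Rightarrow>\<^sub>L 'e gpd ell2) => (nat => 'e) => complex" where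
  "ent a x = coord (a (basis_vec (x, 0, x))) (x, 0, x)"

lemma ent_add: "ent (a + b) x = ent a x + ent b x" and ent_diff: "ent (a - b) x = ent a x - ent b x"
  and ent_cscale: "ent (cscale c a) x = c * ent a x" and ent_0 [simp]: "ent 0 x = 0"
  by (simp_all add: ent_def blinfun.add_left blinfun.diff_left)

lemma norm_ent: "norm (ent a x) <= norm a"
proof -
  have "norm (ent a x) <= norm (a (basis_vec (x, 0, x)))" unfolding ent_def by (rule norm_coord_le)
  also have "... <= norm a * norm (basis_vec (x, 0 :: int, x))" by (rule norm_blinfun)
  finally show ?thesis by simp
qed

lemma ent_Pr: assumes "x : X"
  shows "ent (Pr F oL a) x = (if x 0 : F then ent a x else 0)" "ent (a oL Pr F) x = (if x 0 : F then ent a x else 0)"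
proof -
  have "Pr F (basis_vec (x, 0, x)) = (if x 0 : F then basis_vec (x, 0, x) else 0)"
    by (rule ell2_eqI) (auto simp: coord_Pr Gam_unit[OF assms])
  then show "ent (a oL Pr F) x = (if x 0 : F then ent a x else 0)" by (simp add: ent_def)
  show "ent (Pr F oL a) x = (if x 0 : F then ent a x else 0)" by (simp add: ent_def coord_Pr Gam_unit[OF assms])
qed

lemma ent_al: assumes "x : X" shows "ent (al \<theta> t a) x = ent a x"
proof -
  have "Ut \<theta> (- t) (basis_vec (x, 0, x)) = basis_vec (x, 0, x)"
    by (rule ell2_eqI) (auto simp: coord_Ut Uw_def)
  then show ?thesis by (simp add: ent_def coord_al Uw_def)
qed

lemma ent_op: assumes "bdd_on f mu mu B" "x : X" shows "ent (op f mu mu) x = (if x : cyl mu then f (x, 0, x) else 0)"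
  unfolding ent_def coord_op[OF assms(1)] dm_same using Gam_unit by (auto simp: dg_def elim!: cylE)

text \<open>A diagonal entry survives only if the second factor leads back to the unit from which
  the first one departs. The equal lengths of the inner words force \<open>nu = nu'\<close>, and
  total degree 0 then forces \<open>mu = mu'\<close>.\<close>

lemma ent_op_T:
  assumes b: "bdd_on f nu' mu' B" and l: "length nu = length nu'" and x: "x : X"
  shows "ent (T mu nu oL op f nu' mu') x =
      (if mu = mu' & nu = nu' & x : dm mu nu then f (sw mu nu x, dg nu mu, x) else 0)"
    "ent (op f nu' mu' oL T mu nu) x =
      (if mu = mu' & nu = nu' & x : dm nu mu then f (x, dg nu mu, sw nu mu x) else 0)"
proof -
  let ?\<delta> = "basis_vec (x, 0 :: int, x)"
  have dg: "dg nu mu = - dg mu nu" by (simp add: dg_def)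
  have 1: "ent (T mu nu oL op f nu' mu') x = (if x : dm mu nu & sw mu nu x : dm nu' mu' then
     f (sw mu nu x, dg nu' mu', sw nu' mu' (sw mu nu x)) * coord ?\<delta> (sw nu' mu' (sw mu nu x), - dg mu nu - dg nu' mu', x) else 0)"
    unfolding ent_def blinfun_apply_blinfun_compose coord_T coord_op[OF b] using Gam_unit[OF x] Gam_op[of x 0 x mu nu] by simp
  have "mu = mu' & nu = nu'" if a: "x : dm mu nu" "sw mu nu x : dm nu' mu'" "sw nu' mu' (sw mu nu x) = x" "- dg mu nu - dg nu' mu' = 0"
  proof -
    obtain w where w: "x = cat mu w" by (rule dmE[OF a(1)])
    obtain z where z: "sw mu nu x = cat nu' z" by (rule dmE[OF a(2)])
    have "nu = nu'" "w = z" using z unfolding w by (auto simp: cat_eq_iff[OF l])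
    moreover have "length mu' = length mu" using a(4) l by (simp add: dg_def)
    ultimately show ?thesis using a(3) by (auto simp: w cat_eq_iff)
  qed
  then show "ent (T mu nu oL op f nu' mu') x =
      (if mu = mu' & nu = nu' & x : dm mu nu then f (sw mu nu x, dg nu mu, x) else 0)"
    unfolding 1 using dm_sw[of x mu nu] sw_sw[of x mu nu] dg by auto
  have 2: "ent (op f nu' mu' oL T mu nu) x = (if x : dm nu' mu' & sw nu' mu' x : dm mu nu then
     f (x, dg nu' mu', sw nu' mu' x) * coord ?\<delta> (sw mu nu (sw nu' mu' x), - dg nu' mu' - dg mu nu, x) else 0)"
    unfolding ent_def blinfun_apply_blinfun_compose coord_op[OF b] coord_T using Gam_unit[OF x] Gam_op[of x 0 x nu' mu'] by simp
  have "mu = mu' & nu = nu'" if a: "x : dm nu' mu'" "sw nu' mu' x : dm mu nu" "sw mu nu (sw nu' mu' x) = x" "- dg nu' mu' - dg mu nu = 0"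
  proof -
    obtain w where w: "x = cat nu' w" by (rule dmE[OF a(1)])
    obtain z where z: "sw nu' mu' x = cat mu z" by (rule dmE[OF a(2)])
    show ?thesis using a(4) l z a(3) by (auto simp: dg_def w cat_eq_iff)
  qed
  then show "ent (op f nu' mu' oL T mu nu) x =
      (if mu = mu' & nu = nu' & x : dm nu mu then f (x, dg nu mu, sw nu mu x) else 0)"
    unfolding 2 using dm_sw[of x nu mu] sw_sw[of x nu mu] dg by auto
qed

lemma ent_T_off: assumes "mu ~= nu" shows "ent (T mu nu) x = 0" using dmE assms by (force simp: dg_def cat_eq_iff ent_def coord_T)

definition pt :: "'e list => nat => 'e" where "pt mu = (SOME x. x : cyl mu)"

lemma pt: "cyl mu ~= {} ==> pt mu : cyl mu" by (simp add: pt_def some_in_eq)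

lemma pt_E: "rho : E n mu ==> pt (mu @ rho) : cyl (mu @ rho)" by (rule pt) (simp add: E_def)

end

locale conf_pot = pot G \<phi> for G :: "('v, 'e) pre_digraph" and \<phi> +
  fixes \<beta> :: real and m :: "'e list => real"
  assumes m: "pot.conf G (%x. - \<beta> * \<phi> x) m" and m_nz: "EX mu. mu ~= [] & 0 < m mu"
begin

interpretation b: pot G "%x. - \<beta> * \<phi> x" by (rule pot_cmult)

lemmas m_nonneg = b.conf_nonneg[OF m] and m_split = b.conf_split[OF m]
  and m_empty = b.conf_empty[OF m] and m_approx = b.conf_approx[OF m]

text \<open>Riemann sums for the integral of \<open>ent a\<close> over the paths starting with \<open>e\<close>.\<close>

definition rs :: "nat => 'e => ('e gpd ell2 \<Rightarrow>\<^sub>L 'e gpd ell2) => complex" where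
  "rs n e a = (SUM rho:E n [e]. of_real (m (e # rho)) * ent a (pt (e # rho)))"

lemma rs_diff: "rs n e (a - b) = rs n e a - rs n e b" and rs_add: "rs n e (a + b) = rs n e a + rs n e b"
  and rs_cscale: "rs n e (cscale c a) = c * rs n e a"
  by (simp_all add: rs_def ent_diff ent_add ent_cscale algebra_simps sum.distrib sum_subtractf sum_distrib_left)

lemma rs_bd: "norm (rs n e a) <= m [e] * norm a"
proof -
  have "norm (rs n e a) <= (SUM rho:E n [e]. m (e # rho) * norm a)"
    unfolding rs_def by (rule sum_norm_le) (auto simp: norm_mult m_nonneg intro!: mult_mono norm_ent)
  also have "... = m [e] * norm a" using m_split[of "[e]" n] by (simp flip: sum_distrib_right)
  finally show ?thesis .
qed

lemma rs_cong: assumes "!!x. x : X ==> x 0 = e ==> ent a x = c * ent b x" shows "rs n e a = c * rs n e b"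
  unfolding rs_def sum_distrib_left
proof (rule sum.cong)
  fix rho assume "rho : E n [e]"
  then show "of_real (m (e # rho)) * ent a (pt (e # rho)) = c * (of_real (m (e # rho)) * ent b (pt (e # rho)))" using pt_E[of rho n "[e]"] cyl_X cyl_nth[of _ "e # rho" 0] assms by simp
qed simp

text \<open>Only pieces inside \<open>cyl (e # \<sigma>)\<close> meet the support, so the sum
  restarts from that word.\<close>

lemma rs_cyl:
  assumes "!!x. x : X ==> ent a x = (if x : cyl (e # \<sigma>) then f x else 0)"
  shows "rs (length \<sigma> + j) e a = (SUM tau:E j (e # \<sigma>). of_real (m (e # \<sigma> @ tau)) * f (pt (e # \<sigma> @ tau)))"
proof -
  let ?g = "%rho. of_real (m (e # rho)) * ent a (pt (e # rho))"
  have "rs (length \<sigma> + j) e a = (SUM rho:E (length \<sigma>) [e]. SUM tau:E j ([e] @ rho). ?g (rho @ tau))"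
    unfolding rs_def by (rule sum_E_add) simp
  also have "... = (SUM rho:E (length \<sigma>) [e]. if rho = \<sigma> then SUM tau:E j (e # \<sigma>). of_real (m (e # \<sigma> @ tau)) * f (pt (e # \<sigma> @ tau)) else 0)"
  proof (rule sum.cong)
    fix rho assume r: "rho : E (length \<sigma>) [e]"
    have "?g (rho @ tau) = (if rho = \<sigma> then of_real (m (e # \<sigma> @ tau)) * f (pt (e # \<sigma> @ tau)) else 0)"
      if t: "tau : E j ([e] @ rho)" for tau
      using pt_E[OF t] cyl_append_subset[of "e # rho" tau] E_len[OF r] assms by (auto simp: mem_cyl)
    then show "(SUM tau:E j ([e] @ rho). ?g (rho @ tau)) = (if rho = \<sigma> then SUM tau:E j (e # \<sigma>). of_real (m (e # \<sigma> @ tau)) * f (pt (e # \<sigma> @ tau)) else 0)"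
      by simp
  qed simp
  also have "... = (SUM tau:E j (e # \<sigma>). of_real (m (e # \<sigma> @ tau)) * f (pt (e # \<sigma> @ tau)))"
  proof (cases "\<sigma> : E (length \<sigma>) [e]")
    case False
    then have "E j (e # \<sigma>) = {}" by (intro E_empty) (simp add: E_def)
    then show ?thesis by (simp add: finite_E)
  qed (simp add: finite_E)
  finally show ?thesis .
qed

text \<open>For such \<open>n\<close> the diagonal entry is constant on every piece, so the Riemann
  sum is exact.\<close>

lemma rs_T: "length mu <= n ==> mu ~= [] ==> rs n e (T mu nu) = (if mu = nu & hd mu = e then of_real (m mu) else 0)"
proof -
  assume l: "length mu <= n" "mu ~= []"
  have eT: "ent (T mu mu) x = (if x : cyl mu then 1 else 0)" if "x : X" for x
    unfolding T_def by (rule ent_op[OF bdd_1 that])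
  show ?thesis
  proof (cases "mu = nu")
    case False then show ?thesis by (simp add: rs_def ent_T_off)
  next
    case True
    obtain e' \<sigma> where s: "mu = e' # \<sigma>" using l(2) by (cases mu) auto
    show ?thesis
    proof (cases "e' = e")
      case True
      have "rs (length \<sigma> + (n - length \<sigma>)) e (T mu mu) = (SUM tau:E (n - length \<sigma>) (e # \<sigma>). of_real (m (e # \<sigma> @ tau)) * 1)"
        by (rule rs_cyl) (use eT s True in simp)
      also have "... = of_real (m mu)" using m_split[of "e # \<sigma>" "n - length \<sigma>"] by (simp add: s True)
      finally show ?thesis using l s True \<open>mu = nu\<close> by simp
    next
      case False
      have "rs n e (T mu mu) = 0 * rs n e 0"
      proof (rule rs_cong)
        fix x assume "x : X" "x 0 = e"
        then show "ent (T mu mu) x = 0 * ent 0 x" using eT cyl_nth[of x mu 0] False s by auto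
      qed
      then show ?thesis using False s \<open>mu = nu\<close> by simp
    qed
  qed
qed

text \<open>The integral of the diagonal entries over \<open>cyl [e]\<close>. There is one
  functional for each edge because the masses of the edges may have an infinite sum.\<close>

definition om :: "'e => ('e gpd ell2 \<Rightarrow>\<^sub>L 'e gpd ell2) => complex" where "om e a = lim (%n. rs n e a)"

text \<open>The sums stabilise on \<open>A0\<close>, and \<open>rs_bd\<close> is uniform in
  \<open>n\<close>; density makes them Cauchy on the whole algebra.\<close>

lemma rs_lim: assumes a: "a : AG" shows "(%n. rs n e a) ----> om e a"
proof -
  have A0: "EX n0 c. ALL n>=n0. rs n e b = c" if "b : A0" for b
    using that
  proof (induction rule: A0_induct)
    case zero show ?case using rs_cscale[of _ e 0 0] by auto
  next
    case (add s mu nu b)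
    then obtain n0 c where n0: "!!n. n >= n0 ==> rs n e b = c" by blast
    show ?case
      by (rule exI[of _ "max n0 (length mu)"]) (simp add: rs_add rs_cscale n0 rs_T add)
  qed
  have "Cauchy (%n. rs n e a)"
  proof (rule metric_CauchyI)
    fix d :: real assume d: "d > 0"
    define d' where "d' = d / (2 * (m [e] + 1))"
    have d': "d' > 0" using d m_nonneg[of "[e]"] by (simp add: d'_def)
    then obtain b where b: "b : A0" "dist b a < d'" using a unfolding graph_algebra_eq closure_approachable by blast
    obtain n0 c where n0: "!!n. n >= n0 ==> rs n e b = c" using A0[OF b(1)] by blast
    have *: "dist (rs n e a) c < d / 2" if "n >= n0" for n
    proof -
      have "dist (rs n e a) c = norm (rs n e (a - b))" using n0[OF that] by (simp add: dist_norm rs_diff)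
      also have "... <= m [e] * norm (a - b)" by (rule rs_bd)
      also have "... <= m [e] * d'" using b(2) m_nonneg by (intro mult_left_mono) (auto simp: dist_norm norm_minus_commute)
      also have "... < (m [e] + 1) * d'" using d' by simp
      also have "(m [e] + 1) * d' = d / 2" using m_nonneg[of "[e]"] by (simp add: d'_def field_simps)
      finally show ?thesis .
    qed
    then show "EX M. ALL i>=M. ALL j>=M. dist (rs i e a) (rs j e a) < d"
      by (intro exI[of _ n0]) (blast intro: dist_triangle_half_l)
  qed
  then show ?thesis unfolding om_def using Cauchy_convergent convergent_LIMSEQ_iff by blast
qed

lemma om_eq: "(%n. rs n e a) ----> c ==> om e a = c" unfolding om_def by (rule limI)

lemma om_diff: "a : AG ==> b : AG ==> om e (a - b) = om e a - om e b"
  and om_add: "a : AG ==> b : AG ==> om e (a + b) = om e a + om e b"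
  and om_cscale: "a : AG ==> om e (cscale c a) = c * om e a"
  by (rule om_eq, simp add: rs_diff rs_add rs_cscale, intro tendsto_intros rs_lim; assumption)+

lemma om_bd: "a : AG ==> norm (om e a) <= m [e] * norm a"
  by (rule LIMSEQ_le_const2[OF tendsto_norm[OF rs_lim]]) (auto simp: rs_bd)

lemma om_cong: assumes "b : AG" "!!x. x : X ==> x 0 = e ==> ent a x = c * ent b x" shows "om e a = c * om e b"
  by (rule om_eq) (simp add: rs_cong[OF assms(2)] tendsto_mult_left rs_lim[OF assms(1)])

lemma om_pos: assumes "a : pos_cone AG" shows "om e a = of_real (Re (om e a))" "0 <= Re (om e a)"
proof -
  obtain r where r: "r : AG" "a = hadj r oL r" using assms by (rule pos_coneE)
  have e: "ent a x = of_real ((norm (r (basis_vec (x, 0, x))))\<^sup>2)" for x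
    unfolding ent_def r(2) by (rule coord_square[OF AA[OF r(1)]])
  have s: "Im (rs n e a) = 0" "0 <= Re (rs n e a)" for n
    unfolding rs_def e by (auto simp: m_nonneg intro!: sum_nonneg)
  note l = rs_lim[OF pos_cone_A[OF assms], of e]
  have "Im (om e a) = 0" using LIMSEQ_unique[OF tendsto_Im[OF l]] s by simp
  then show "om e a = of_real (Re (om e a))" by (simp add: complex_eq_iff)
  show "0 <= Re (om e a)" using s(2) by (intro LIMSEQ_le_const[OF tendsto_Re[OF l]]) auto
qed

lemma om_T: assumes "mu ~= []" shows "om e (T mu nu) = (if mu = nu & hd mu = e then of_real (m mu) else 0)"
proof -
  have "rs n e (T mu nu) = (if mu = nu & hd mu = e then of_real (m mu) else 0)" if "length mu <= n" for n
    by (rule rs_T[OF that assms])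
  then show ?thesis by (intro om_eq tendsto_eventually eventually_sequentiallyI[of "length mu"]) blast
qed

definition Om :: "nat => ('e gpd ell2 \<Rightarrow>\<^sub>L 'e gpd ell2) => complex" where "Om n a = (SUM e:Fin n. om e a)"

text \<open>A supremum of norm-continuous functionals, increasing on the positive cone; lower
  semi-continuity and additivity both come from this form.\<close>

definition wgt :: "('e gpd ell2 \<Rightarrow>\<^sub>L 'e gpd ell2) => ennreal" where "wgt a = (SUP n. ennreal (Re (Om n a)))"

lemma Om_diff: "a : AG ==> b : AG ==> Om n (a - b) = Om n a - Om n b"
  and Om_add: "a : AG ==> b : AG ==> Om n (a + b) = Om n a + Om n b"
  and Om_cscale: "a : AG ==> Om n (cscale c a) = c * Om n a"
  by (simp_all add: Om_def om_diff om_add om_cscale sum.distrib sum_subtractf sum_distrib_left)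

lemma Om_scaleR: "a : AG ==> Om n (r *\<^sub>R a) = of_real r * Om n a"
  using Om_cscale[of a n "of_real r"] by (simp add: cscale_of_real)

lemma Om_bd: "a : AG ==> norm (Om n a) <= (SUM e:Fin n. m [e]) * norm a"
  unfolding Om_def sum_distrib_right by (rule sum_norm_le) (rule om_bd)

lemma Om_lim: assumes "!!k. f k : AG" "f ----> a" shows "(%k. Om n (f k)) ----> Om n a"
proof -
  have a: "a : AG" by (rule A_lim[OF assms])
  have "(%k. Om n (f k) - Om n a) ----> 0"
  proof (rule Lim_null_comparison)
    show "\<forall>\<^sub>F k in sequentially. norm (Om n (f k) - Om n a) <= (SUM e:Fin n. m [e]) * norm (f k - a)"
      using Om_bd[OF A_diff[OF assms(1) a]] by (simp add: Om_diff assms(1) a)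
    show "(%k. (SUM e:Fin n. m [e]) * norm (f k - a)) ----> 0" by (metis assms(2) tendsto_mult_right_zero tendsto_norm_zero_iff LIM_zero_iff)
  qed
  then show ?thesis by (simp add: LIM_zero_iff)
qed

lemma Om_pos: assumes "a : pos_cone AG" shows "Om n a = of_real (Re (Om n a))" "0 <= Re (Om n a)"
proof -
  show "0 <= Re (Om n a)" unfolding Om_def Re_sum by (rule sum_nonneg) (rule om_pos(2)[OF assms])
  show "Om n a = of_real (Re (Om n a))" using sum.cong[OF refl om_pos(1)[OF assms]] by (auto simp: Om_def)
qed

lemma Om_mono: assumes "a : pos_cone AG" "n <= k" shows "Re (Om n a) <= Re (Om k a)"
  unfolding Om_def Re_sum using assms(2)
  by (intro sum_mono2 finite_Fin om_pos(2)[OF assms(1)]) (auto simp: Fin_def)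

lemma Om_inc: "a : pos_cone AG ==> incseq (%n. ennreal (Re (Om n a)))"
  by (intro monoI ennreal_leI Om_mono)

lemma Om_le: "ennreal (Re (Om n a)) <= wgt a" unfolding wgt_def by (rule SUP_upper) simp

lemma wgt_weight: "weight_on AG wgt"
  unfolding weight_on_def
  using Om_pos(2) ennreal_SUP_add Om_inc by (auto simp: Om_add pos_cone_A wgt_def Om_scaleR ennreal_mult SUP_mult_left_ennreal)

sublocale pot_weight G \<phi> wgt by unfold_locales (rule wgt_weight)

lemma Om_cut: assumes a: "a : AG"
  shows "Om n (Pr (Fin k) oL (a oL Pr (Fin k))) = Om (min n k) a" "Om n (Pr (Fin k) oL a) = Om (min n k) a" "Om n (a oL Pr (Fin k)) = Om (min n k) a"
proof -
  let ?q = "Pr (Fin k)"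
  have o: "om e (?q oL (a oL ?q)) = (if e : Fin k then 1 else 0) * om e a" "om e (?q oL a) = (if e : Fin k then 1 else 0) * om e a"
    "om e (a oL ?q) = (if e : Fin k then 1 else 0) * om e a" for e
    by (rule om_cong[OF a]; simp add: ent_Pr)+
  have "Fin (min n k) = Fin n \<inter> Fin k" by (auto simp: Fin_def)
  then show "Om n (?q oL (a oL ?q)) = Om (min n k) a" "Om n (?q oL a) = Om (min n k) a" "Om n (a oL ?q) = Om (min n k) a"
    unfolding Om_def o by (simp_all add: sum.inter_restrict finite_Fin if_distrib[of "%c. c * _"] cong: if_cong)
qed

lemma wgt_cut: assumes "a : AG" "Pr (Fin k) oL (a oL Pr (Fin k)) : pos_cone AG"
  shows "wgt (Pr (Fin k) oL (a oL Pr (Fin k))) = ennreal (Re (Om k a))"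
proof (rule antisym)
  show "wgt (Pr (Fin k) oL (a oL Pr (Fin k))) <= ennreal (Re (Om k a))"
    unfolding wgt_def
  proof (rule SUP_least)
    fix n
    have "Re (Om n (Pr (Fin k) oL (a oL Pr (Fin k)))) <= Re (Om (max n k) (Pr (Fin k) oL (a oL Pr (Fin k))))"
      by (rule Om_mono[OF assms(2)]) simp
    then show "ennreal (Re (Om n (Pr (Fin k) oL (a oL Pr (Fin k))))) <= ennreal (Re (Om k a))"
      by (simp add: Om_cut[OF assms(1)] ennreal_leI)
  qed
  show "ennreal (Re (Om k a)) <= wgt (Pr (Fin k) oL (a oL Pr (Fin k)))"
    using Om_le[of k "Pr (Fin k) oL (a oL Pr (Fin k))"] by (simp add: Om_cut[OF assms(1)])
qed

lemma Pr_hadj_cut: "r : AG ==> hadj (r oL Pr (Fin k)) oL (r oL Pr (Fin k)) = Pr (Fin k) oL ((hadj r oL r) oL Pr (Fin k))"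
  using Pr_A[OF finite_Fin] by (simp add: hadj_comp AA hadj_Pr comp_assoc)

lemma Pr_AG: "Pr (Fin k) : AG" by (rule Pr_A[OF finite_Fin])

lemma wgt_dense: "densely_defined_on AG wgt"
  unfolding densely_defined_on_def
proof
  fix a assume "a : pos_cone AG"
  then obtain r where r: "r : AG" "a = hadj r oL r" by (rule pos_coneE)
  have aA: "a : AG" using r by (auto intro: A_comp A_hadj)
  show "a : closure {a : pos_cone AG. wgt a < \<infinity>}" using pos_coneI[OF A_comp[OF r(1) Pr_AG]] r(2) exI[of _ "%k. Pr (Fin k) oL (a oL Pr (Fin k))"] aA Pr_lim by (auto simp: Pr_hadj_cut[OF r(1)] closure_sequential wgt_cut)
qed

lemma wgt_lsc: "lsc_on AG wgt"
  unfolding lsc_on_def closedin_closed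
proof (intro allI impI)
  fix c :: real assume c: "0 <= c"
  let ?C = "closure {a : pos_cone AG. wgt a <= ennreal c}"
  have "wgt a <= ennreal c" if a: "a : pos_cone AG" "a : ?C" for a
    unfolding wgt_def
  proof (rule SUP_least)
    fix n
    obtain f where f: "!!k. f k : pos_cone AG" "!!k. wgt (f k) <= ennreal c" "f ----> a"
      using a(2) unfolding closure_sequential by blast
    have "Re (Om n (f k)) <= c" for k using order_trans[OF Om_le f(2)] c by simp
    then show "ennreal (Re (Om n a)) <= ennreal c" by (metis LIMSEQ_le_const2 tendsto_Re Om_lim pos_cone_A f(1) f(3) ennreal_leI)
  qed
  then have "{a : pos_cone AG. wgt a <= ennreal c} = pos_cone AG \<inter> ?C"
    by (intro equalityI subsetI) (auto intro: subsetD[OF closure_subset])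
  then show "EX T. closed T & {a : pos_cone AG. wgt a <= ennreal c} = pos_cone AG \<inter> T" by blast
qed

lemma wgt_T: assumes "mu ~= []" shows "wgt (T mu mu) = ennreal (m mu)"
proof -
  have O: "Om n (T mu mu) = (if hd mu : Fin n then of_real (m mu) else 0)" for n
    unfolding Om_def om_T[OF assms] by (simp add: finite_Fin)
  show ?thesis
  proof (rule antisym)
    show "wgt (T mu mu) <= ennreal (m mu)" unfolding wgt_def by (rule SUP_least) (simp add: O)
    show "ennreal (m mu) <= wgt (T mu mu)"
    proof (cases "cyl mu = {}")
      case False
      then have "hd mu : Fin (Suc (to_nat_on (arcs G) (hd mu)))" using last_arc assms by (force simp: Fin_def)
      then show ?thesis using Om_le[of "Suc (to_nat_on (arcs G) (hd mu))" "T mu mu"] by (simp add: O)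
    qed (simp add: m_empty[OF assms])
  qed
qed

lemma wgt_nz: "EX a:pos_cone AG. wgt a ~= 0"
  using m_nz wgt_T T_pos by (metis ennreal_eq_0_iff not_le)

text \<open>The implementing unitaries fix the basis vectors at units, so diagonal entries do not
  change; this covers the action of \<phi> and the gauge action alike.\<close>

lemma wgt_inv: assumes "pot G \<theta>" shows "invariant_weight AG (act G \<theta>) wgt"
  unfolding invariant_weight_def
proof (intro allI ballI)
  fix t a assume a: "a : pos_cone AG"
  have aA: "a : AG" by (rule pos_cone_A[OF a])
  have "om e (al \<theta> t a) = 1 * om e a" for e by (rule om_cong[OF aA]) (simp add: ent_al)
  then show "wgt (act G \<theta> t a) = wgt a" by (simp add: wgt_def Om_def act_eq[OF aA])
qed

lemma Om_polar: assumes x: "x : AG" and y: "y : AG"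
  shows "Om n (hadj x oL y) = (of_real (Re (Om n (hadj (x + y) oL (x + y))) - Re (Om n (hadj x oL x)) - Re (Om n (hadj y oL y)))
    - \<i> * of_real (Re (Om n (hadj (x + cscale \<i> y) oL (x + cscale \<i> y))) - Re (Om n (hadj x oL x)) - Re (Om n (hadj y oL y)))) / 2"
proof -
  have r: "of_real (Re (Om n (hadj z oL z))) = Om n (hadj z oL z)" if "z : AG" for z
    using Om_pos(1)[OF pos_coneI[OF that]] by simp
  have c: "Om n (hadj (x + cscale c y) oL (x + cscale c y)) = Om n (hadj x oL x) + c * Om n (hadj x oL y) + cnj c * Om n (hadj y oL x)
     + c * cnj c * Om n (hadj y oL y)" for c
    using x y by (auto simp: hadj_add AA comp_add hadj_cscale cscale_left cscale_right AdjD(2) Om_add Om_cscale A_add A_cscale A_comp A_hadj)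
  show ?thesis
    unfolding of_real_diff r[OF x] r[OF y] r[OF A_add[OF x y]] r[OF A_add[OF x A_cscale[OF y]]]
    unfolding c c[of 1, simplified] by (simp add: algebra_simps)
qed

lemma Om_wt: assumes "x : N" shows "(%n. Re (Om n (hadj x oL x))) ----> wt x" "Re (Om n (hadj x oL x)) <= wt x"
proof -
  have p: "hadj x oL x : pos_cone AG" by (rule pos_coneI[OF N_A[OF assms]])
  show "(%n. Re (Om n (hadj x oL x))) ----> wt x" using LIMSEQ_SUP[OF Om_inc[OF p]] N_fin[OF assms] Om_pos(2)[OF p] by (auto simp: wgt_def)
  show "Re (Om n (hadj x oL x)) <= wt x" using Om_le[of n "hadj x oL x"] N_fin[OF assms] by simp
qed

lemma Om_L: assumes "x : N" "y : N" shows "(%n. Om n (hadj x oL y)) ----> L (hadj x oL y)"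
  unfolding L_polar[OF assms] Om_polar[OF N_A[OF assms(1)] N_A[OF assms(2)]]
  by (intro tendsto_intros Om_wt N_add N_cscale assms) simp

end

section \<open>Pairs of boundary values of bounded holomorphic functions on a strip\<close>

definition strip_bdry :: "real => (real => complex) => (real => complex) => bool" where
  "strip_bdry \<beta> f g \<longleftrightarrow> (EX F. continuous_on (strip \<beta>) F & bounded (F ` strip \<beta>) & F holomorphic_on interior (strip \<beta>) &
     (ALL t. F (of_real t) = f t & F (of_real t + \<i> * of_real \<beta>) = g t))"

lemma strip_bdry_0: "strip_bdry \<beta> (%_. 0) (%_. 0)"
  unfolding strip_bdry_def by (rule exI[of _ "%_. 0"]) (auto simp: bounded_iff)

lemma strip_bdry_lin: assumes "strip_bdry \<beta> f g" "strip_bdry \<beta> f' g'"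
  shows "strip_bdry \<beta> (%t. c * f t + f' t) (%t. c * g t + g' t)"
proof -
  obtain F where F: "continuous_on (strip \<beta>) F" "bounded (F ` strip \<beta>)" "F holomorphic_on interior (strip \<beta>)"
     "!!t. F (of_real t) = f t" "!!t. F (of_real t + \<i> * of_real \<beta>) = g t" using assms(1) unfolding strip_bdry_def by blast
  obtain F' where F': "continuous_on (strip \<beta>) F'" "bounded (F' ` strip \<beta>)" "F' holomorphic_on interior (strip \<beta>)"
     "!!t. F' (of_real t) = f' t" "!!t. F' (of_real t + \<i> * of_real \<beta>) = g' t" using assms(2) unfolding strip_bdry_def by blast
  obtain M M' where M: "!!z. z : strip \<beta> ==> norm (F z) <= M" "!!z. z : strip \<beta> ==> norm (F' z) <= M'"
    using F(2) F'(2) unfolding bounded_iff by blast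
  have "norm (c * F z + F' z) <= norm c * M + M'" if "z : strip \<beta>" for z
    by (rule order_trans[OF norm_triangle_ineq add_mono]) (auto simp: norm_mult M that intro: mult_left_mono)
  then have "bounded ((%z. c * F z + F' z) ` strip \<beta>)" unfolding bounded_iff by blast
  then show ?thesis unfolding strip_bdry_def
    by (intro exI[of _ "%z. c * F z + F' z"]) (simp add: F F' continuous_intros holomorphic_intros)
qed

lemma strip_bdry_sum: "(!!i. i : S ==> strip_bdry \<beta> (f i) (g i)) ==> strip_bdry \<beta> (%t. SUM i:S. f i t) (%t. SUM i:S. g i t)"
proof (induction S rule: infinite_finite_induct)
  case (insert x F)
  then show ?case using strip_bdry_lin[of \<beta> "f x" "g x" _ _ 1] by simp
qed (simp_all add: strip_bdry_0)

text \<open>By the maximum principle \<open>strip_max\<close>, uniform closeness on the two boundary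
  lines holds throughout the strip, so the extensions converge uniformly.\<close>

lemma strip_bdry_lim:
  assumes k: "!!k. strip_bdry \<beta> (f k) (g k)"
    and l: "r ----> 0" "!!k t. norm (f k t - f' t) <= r k" "!!k t. norm (g k t - g' t) <= r k"
  shows "strip_bdry \<beta> f' g'"
proof -
  have "EX F. ALL k. continuous_on (strip \<beta>) (F k) & bounded (F k ` strip \<beta>) & F k holomorphic_on interior (strip \<beta>) &
     (ALL t. F k (of_real t) = f k t & F k (of_real t + \<i> * of_real \<beta>) = g k t)"
    using k unfolding strip_bdry_def by (rule choice[OF allI])
  then obtain F where F: "!!k. continuous_on (strip \<beta>) (F k)" "!!k. bounded (F k ` strip \<beta>)" "!!k. F k holomorphic_on interior (strip \<beta>)"
     "!!k t. F k (of_real t) = f k t" "!!k t. F k (of_real t + \<i> * of_real \<beta>) = g k t" by blast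
  have diff: "norm (F i z - F j z) <= r i + r j" if z: "z : strip \<beta>" for i j z
  proof -
    obtain M M' where M: "!!z. z : strip \<beta> ==> norm (F i z) <= M" "!!z. z : strip \<beta> ==> norm (F j z) <= M'"
      using F(2) unfolding bounded_iff by blast
    have tri: "norm (a - b) <= r i + r j" if "norm (a - c) <= r i" "norm (b - c) <= r j" for a b c :: complex
      using norm_triangle_ineq4[of "a - c" "b - c"] that by simp
    show ?thesis
    proof (rule strip_max[where F = "%z. F i z - F j z" and \<beta> = \<beta>])
      show "norm (F i z - F j z) <= M + M'" if "z : strip \<beta>" for z
        by (rule order_trans[OF norm_triangle_ineq4 add_mono]) (simp_all add: M that)
      show "norm (F i (of_real t) - F j (of_real t)) <= r i + r j"
        "norm (F i (of_real t + \<i> * of_real \<beta>) - F j (of_real t + \<i> * of_real \<beta>)) <= r i + r j" for t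
        unfolding F(4,5) by (rule tri[OF l(2) l(2)] tri[OF l(3) l(3)])+
    qed (auto intro!: continuous_intros holomorphic_intros F z)
  qed
  have "uniformly_Cauchy_on (strip \<beta>) F"
    unfolding uniformly_Cauchy_on_def
  proof (intro allI impI)
    fix e :: real assume "e > 0"
    then obtain K where K: "!!i. i >= K ==> r i < e / 2" using order_tendstoD(2)[OF l(1), of "e/2"] by (auto simp: eventually_sequentially)
    then have "dist (F i z) (F j z) < e" if "z : strip \<beta>" "i >= K" "j >= K" for i j z
      using diff[OF that(1), of i j] K[OF that(2)] K[OF that(3)] by (simp add: dist_norm)
    then show "EX K. ALL z:strip \<beta>. ALL i>=K. ALL j>=K. dist (F i z) (F j z) < e" by blast
  qed
  then obtain H where H: "uniform_limit (strip \<beta>) F H sequentially"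
    using Cauchy_uniformly_convergent unfolding uniformly_convergent_on_def by blast
  have pt: "(%k. F k z) ----> H z" if "z : strip \<beta>" for z by (rule tendsto_uniform_limitI[OF H that])
  have "continuous_on (strip \<beta>) H" by (rule uniform_limit_theorem[OF _ H]) (simp_all add: F)
  moreover have "bounded (H ` strip \<beta>)"
  proof -
    have "bounded (UN k:{0}. F k ` strip \<beta>)" using F(2) by simp
    obtain M where M: "!!z. z : strip \<beta> ==> norm (F 0 z) <= M" using F(2) unfolding bounded_iff by blast
    obtain B where B: "!!k. \<bar>r k\<bar> <= B" using convergent_imp_Bseq[of r] l(1) by (auto simp: convergent_def Bseq_def)
    have "norm (F k z) <= M + (B + B)" if "z : strip \<beta>" for k z
      using norm_triangle_sub[of "F k z" "F 0 z"] diff[OF that, of k 0] M[OF that] B[of k] B[of 0] by (simp add: abs_le_iff)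
    then have "norm (H z) <= M + (B + B)" if "z : strip \<beta>" for z
      by (intro LIMSEQ_le_const2[OF tendsto_norm[OF pt[OF that]]]) (use that in auto)
    then show ?thesis unfolding bounded_iff by blast
  qed
  moreover have "H holomorphic_on interior (strip \<beta>)"
    by (metis holomorphic_uniform_sequence open_interior F(3) open_contains_cball uniform_limit_on_subset H interior_subset)
  moreover have "H (of_real t) = f' t" for t
    by (rule LIMSEQ_unique[OF pt[OF strip_real]], unfold F(4), rule LIM_zero_cancel, rule Lim_null_comparison[OF _ l(1)]) (simp add: l)
  moreover have "H (of_real t + \<i> * of_real \<beta>) = g' t" for t
    by (rule LIMSEQ_unique[OF pt[OF strip_top]], unfold F(5), rule LIM_zero_cancel, rule Lim_null_comparison[OF _ l(1)]) (simp add: l)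
  ultimately show ?thesis unfolding strip_bdry_def by blast
qed

context conf_pot
begin

interpretation b: pot G "%x. - \<beta> * \<phi> x" by (rule pot_cmult)

lemma T_N: "mu ~= [] ==> nu ~= [] ==> T mu nu : N" by (rule T_N_fin) (simp_all add: wgt_T)

lemma L_of_om:
  assumes x: "x : N" "y : N" and a: "a = hadj x oL y" and h: "!!z. z : X ==> z 0 ~= e ==> ent a z = 0" and e: "e : arcs G"
  shows "L a = om e a"
proof -
  have aA: "a : AG" using x a by (simp add: A_comp A_hadj N_A)
  have o: "om e' a = 0" if "e' ~= e" for e' using om_cong[OF aA, of e' a 0] h that by auto
  have "Om n a = om e a" if "n > to_nat_on (arcs G) e" for n
  proof -
    have "e : Fin n" using that e by (simp add: Fin_def)
    then show ?thesis unfolding Om_def using sum.remove[OF finite_Fin, of e n "%e. om e a"] o by simp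
  qed
  then have "(%n. Om n a) ----> om e a"
    by (intro tendsto_eventually eventually_sequentiallyI[of "Suc (to_nat_on (arcs G) e)"]) auto
  then show ?thesis using Om_L[OF x] LIMSEQ_unique unfolding a by blast
qed

lemma L_zero: assumes x: "x : N" "y : N" and a: "a = hadj x oL y" and h: "!!z. z : X ==> ent a z = 0" shows "L a = 0"
proof -
  have aA: "a : AG" using x a by (simp add: A_comp A_hadj N_A)
  have "om e a = 0" for e using om_cong[OF aA, of e a 0] h by auto
  then show ?thesis using Om_L[OF x] by (auto simp: Om_def LIMSEQ_const_iff simp flip: a)
qed

text \<open>Unless \<open>mu = mu'\<close> and \<open>nu = nu'\<close>, both products have zero
  diagonal. Otherwise both are integrals of \<open>cis (t * c)\<close>, one over
  \<open>cyl mu\<close>, the other transported to \<open>cyl nu\<close>. Continuing the first to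
  height \<beta> inserts \<open>exp (- \<beta> * c)\<close>, which conformality identifies as the
  density of exchanging \<open>mu\<close> for \<open>nu\<close>.\<close>

lemma KMS_pair:
  assumes n: "mu ~= []" "nu ~= []" "mu' ~= []" "nu' ~= []" and l: "length nu = length nu'"
  shows "strip_bdry \<beta> (%t. L (T mu nu oL al \<phi> t (T nu' mu'))) (%t. L (al \<phi> t (T nu' mu') oL T mu nu))"
proof -
  let ?a = "%t. T mu nu oL al \<phi> t (T nu' mu')" and ?b = "%t. al \<phi> t (T nu' mu') oL T mu nu"
  note ent = ent_op_T[OF cis_coc_bdd l, folded al_T]
  have N: "T nu mu : N" "al \<phi> t (T nu' mu') : N" "al \<phi> t (T mu' nu') : N" "T mu nu : N" for t using wgt_inv pot_axioms T_N n inv_wt(1) by auto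
  have h: "?a t = hadj (T nu mu) oL al \<phi> t (T nu' mu')" "?b t = hadj (al \<phi> t (T mu' nu')) oL T mu nu" for t
    by (simp_all add: hadj_T al_hadj T_Adj)
  show ?thesis
  proof (cases "mu = mu' & nu = nu' & dm mu nu ~= {}")
    case False
    have "dm nu mu = {} \<longleftrightarrow> dm mu nu = {}" using dm_sw by blast
    then have e: "ent (?a t) z = 0" "ent (?b t) z = 0" if "z : X" for t z unfolding ent(1)[OF that] ent(2)[OF that] using False by auto
    show ?thesis using L_zero[OF N(1,2) h(1) e(1)] L_zero[OF N(3,4) h(2) e(2)] by (auto simp: strip_bdry_0)
  next
    case True
    then have eq: "mu' = mu" "nu' = nu" and ne: "dm mu nu ~= {}" by auto
    have f: "dm mu nu = cyl mu" by (rule dm_full[OF ne n(1,2)])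
    have f': "dm nu mu = cyl nu" by (rule dm_full) (use ne dm_sw n in blast)+
    obtain e \<sigma> where mu: "mu = e # \<sigma>" using n(1) by (cases mu) auto
    obtain e' \<sigma>' where nu: "nu = e' # \<sigma>'" using n(2) by (cases nu) auto
    have arcs: "e : arcs G" "e' : arcs G"
      using last_arc[of mu] last_arc[of nu] ne dm_sw unfolding f[symmetric] f'[symmetric] by (auto simp: mu nu)
    have hd: "x : cyl mu ==> x 0 = e" "x : cyl nu ==> x 0 = e'" for x
      using cyl_nth[of x mu 0] cyl_nth[of x nu 0] by (simp_all add: mu nu)
    define c where "c \<gamma> = coc \<phi> (sw mu nu (fst \<gamma>), dg nu mu, fst \<gamma>)" for \<gamma> :: "'e gpd"
    have inD: "(sw mu nu x, dg nu mu, x) : D (nu @ rho) (mu @ rho)" if "x : cyl (mu @ rho)" for x rho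
    proof -
      have "x : dm (mu @ rho) (nu @ rho)" using that cyl_append_subset unfolding dm_append f by blast
      then show ?thesis using dm_sw sw_sw that by (force simp: D_def dg_append sw_append)
    qed
    obtain B where B: "!!\<gamma>. \<gamma> : D nu mu ==> \<bar>coc \<phi> \<gamma>\<bar> <= B" using coc_bd[OF n(2,1)] by blast
    have cB: "\<bar>c \<gamma>\<bar> <= B" if "\<gamma> : D mu mu" for \<gamma>
      unfolding c_def by (rule B) (use that inD[of _ "[]"] in \<open>auto simp: D_def dm_same\<close>)
    have osc: "EX k. ALL rho:E k mu. ALL \<gamma>:D (mu @ rho) (mu @ rho). ALL \<gamma>':D (mu @ rho) (mu @ rho). \<bar>c \<gamma> - c \<gamma>'\<bar> < d" if d: "d > 0" for d
    proof -
      obtain k where k: "ALL rho. k <= length rho --> (ALL \<gamma>:D (nu @ rho) (mu @ rho). ALL \<gamma>':D (nu @ rho) (mu @ rho). \<bar>coc \<phi> \<gamma> - coc \<phi> \<gamma>'\<bar> < d)"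
        using coc_osc[OF d] ..
      have "\<bar>c \<gamma> - c \<gamma>'\<bar> < d" if "rho : E k mu" "\<gamma> : D (mu @ rho) (mu @ rho)" "\<gamma>' : D (mu @ rho) (mu @ rho)" for rho \<gamma> \<gamma>'
      proof -
        have "fst \<gamma> : cyl (mu @ rho)" "fst \<gamma>' : cyl (mu @ rho)" using that(2,3) by (auto simp: D_def dm_same)
        from k[rule_format, OF _ inD[OF this(1)] inD[OF this(2)]] show ?thesis unfolding c_def using E_len[OF that(1)] by simp
      qed
      then show ?thesis by blast
    qed
    note calc = n(1) cB osc
    define G' where "G' z = om e (op (%\<gamma>. exp (\<i> * z * of_real (c \<gamma>))) mu mu)" for z
    have ce: "continuous_on UNIV (%a. exp (\<i> * z * complex_of_real a))" for z by (intro continuous_intros)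
    have mem: "op (%\<gamma>. exp (\<i> * z * of_real (c \<gamma>))) mu mu : AG" for z by (rule calc_mem[OF calc ce])
    have bd: "EX M. bdd_on (%\<gamma>. exp (\<i> * z * of_real (c \<gamma>))) mu mu M" for z by (rule calc_bd[OF calc ce])
    have entG: "ent (op (%\<gamma>. exp (\<i> * z * of_real (c \<gamma>))) mu mu) x = (if x : cyl mu then exp (\<i> * z * of_real (c (x, 0, x))) else 0)" if "x : X" for z x
      using bd ent_op[OF _ that] by blast
    have hol: "G' holomorphic_on UNIV" unfolding G'_def
      by (rule calc_holo[OF calc, where K = "m [e]"]; (assumption | simp add: om_diff om_cscale A_cscale om_bd m_nonneg))
    have bnd: "norm (G' z) <= m [e] * exp (\<bar>\<beta>\<bar> * B)" if "z : strip \<beta>" for z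
    proof -
      have "norm (op (%\<gamma>. exp (\<i> * z * of_real (c \<gamma>))) mu mu) <= exp (\<bar>\<beta>\<bar> * B)"
      proof (rule norm_op, unfold bdd_on_def, intro conjI ballI)
        fix \<gamma> assume g: "\<gamma> : D mu mu"
        have "- (Im z * c \<gamma>) <= \<bar>Im z\<bar> * \<bar>c \<gamma>\<bar>" by (metis abs_ge_minus_self abs_mult)
        also have "... <= \<bar>\<beta>\<bar> * B" using that cB[OF g] by (intro mult_mono) (auto simp: strip_def)
        finally show "norm (exp (\<i> * z * of_real (c \<gamma>))) <= exp (\<bar>\<beta>\<bar> * B)" by simp
      qed simp
      then show ?thesis unfolding G'_def using om_bd[OF mem, of e z] m_nonneg by (meson mult_left_mono order_trans)
    qed
    have La: "L (?a t) = G' (of_real t)" for t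
    proof -
      have "L (?a t) = om e (?a t)"
        by (rule L_of_om[OF N(1,2) h(1) _ arcs(1)]) (use hd f in \<open>auto simp: ent\<close>)
      also have "... = 1 * om e (op (%\<gamma>. exp (\<i> * of_real t * of_real (c \<gamma>))) mu mu)"
      proof (rule om_cong[OF mem])
        fix x assume x: "x : X"
        show "ent (?a t) x = 1 * ent (op (%\<gamma>. exp (\<i> * of_real t * of_real (c \<gamma>))) mu mu) x"
          unfolding entG[OF x] ent(1)[OF x] by (simp add: eq f c_def cis_conv_exp mult.assoc)
      qed
      finally show ?thesis by (simp add: G'_def)
    qed
    have Lb: "L (?b t) = G' (of_real t + \<i> * of_real \<beta>)" for t
    proof -
      let ?z = "of_real t + \<i> * of_real \<beta>"
      have bA: "?b t : AG" using N by (simp add: A_comp A_hadj N_A)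
      have Lo: "L (?b t) = om e' (?b t)"
        by (rule L_of_om[OF N(3,4) h(2) _ arcs(2)]) (use hd f' in \<open>auto simp: ent\<close>)
      define p where "p tau = pt (mu @ tau)" for tau
      define q where "q tau = pt (nu @ tau)" for tau
      define c' where "c' x = coc \<phi> (x, dg nu mu, sw nu mu x)" for x
      define cp where "cp tau = c (p tau, 0, p tau)" for tau
      \<comment> \<open>The depths are shifted by the lengths of the words, so that the pieces of
        both Riemann sums are indexed by the same extensions \<open>tau\<close>.\<close>
      define A where "A j = rs (length \<sigma> + j) e (op (%\<gamma>. exp (\<i> * ?z * of_real (c \<gamma>))) mu mu)" for j
      define Q where "Q j = rs (length \<sigma>' + j) e' (?b t)" for j
      have shiftl: "(%j. s (k + j)) ----> x" if "s ----> x" for s :: "nat => complex" and k x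
        using LIMSEQ_ignore_initial_segment[OF that, of k] by (simp add: add.commute)
      have lA: "A ----> G' ?z" unfolding A_def G'_def by (rule shiftl[OF rs_lim[OF mem]])
      have lQ: "Q ----> om e' (?b t)" unfolding Q_def by (rule shiftl[OF rs_lim[OF bA]])
      have EE: "E j nu = E j mu" for j
      proof -
        have "cyl (nu @ rho) ~= {} \<longleftrightarrow> cyl (mu @ rho) ~= {}" for rho
        proof -
          have "dm (mu @ rho) (nu @ rho) = cyl (mu @ rho)" "dm (nu @ rho) (mu @ rho) = cyl (nu @ rho)"
            unfolding dm_append f f' using cyl_append_subset by blast+
          then show ?thesis using dm_sw by blast
        qed
        then show ?thesis by (simp add: E_def)
      qed
      have Aj: "A j = (SUM tau:E j mu. of_real (m (mu @ tau)) * exp (\<i> * ?z * of_real (cp tau)))" for j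
        unfolding A_def cp_def p_def mu append_Cons
        by (rule rs_cyl) (rule entG[unfolded mu])
      have rb: "ent (?b t) x = (if x : cyl nu then cis (t * c' x) else 0)" if "x : X" for x
        unfolding ent(2)[OF that] by (simp add: eq f' c'_def)
      have Qj: "Q j = (SUM tau:E j mu. of_real (m (nu @ tau)) * cis (t * c' (q tau)))" for j
        unfolding EE[symmetric] Q_def q_def unfolding nu append_Cons
        by (rule rs_cyl) (rule rb[unfolded nu])
      have est: "EX J. ALL j>=J. norm (A j - Q j) <= 2 * (m mu * exp (\<bar>\<beta>\<bar> * B)) * \<theta>" if th: "\<theta> > 0" for \<theta> :: real
      proof -
        define k where "k = real (length mu + length nu)"
        \<comment> \<open>Keeps the combined conformal error \<open>exp (k * \<epsilon>)\<close> of
          removing \<open>mu\<close> and adding \<open>nu\<close> below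
          \<open>1 + \<theta>\<close>.\<close>
        define \<epsilon> where "\<epsilon> = ln (1 + \<theta>) / (k + 1)"
        have k0: "k >= 0" by (simp add: k_def)
        have eps: "\<epsilon> > 0" using th k0 by (simp add: \<epsilon>_def)
        have "k * \<epsilon> <= (k + 1) * \<epsilon>" using eps by (intro mult_right_mono) auto
        also have "... = ln (1 + \<theta>)" using k0 by (simp add: \<epsilon>_def)
        finally have ek: "exp (k * \<epsilon>) <= 1 + \<theta>" using th by (simp add: ln_ge_iff)
        obtain J1 where J1: "ALL tau rho x. J1 <= length rho --> x : cyl (tau @ rho) -->
           exp (b.bs (length tau) x - length tau * \<epsilon>) * m rho <= m (tau @ rho) & m (tau @ rho) <= exp (b.bs (length tau) x + length tau * \<epsilon>) * m rho"
          using m_approx[OF eps] by blast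
        have "0 < \<theta> / (\<bar>t\<bar> + 1)" using th by simp
        from coc_osc[OF this, of nu mu] obtain J2 where
          J2: "ALL rho. J2 <= length rho --> (ALL \<gamma>:D (nu @ rho) (mu @ rho). ALL \<gamma>':D (nu @ rho) (mu @ rho). \<bar>coc \<phi> \<gamma> - coc \<phi> \<gamma>'\<bar> < \<theta> / (\<bar>t\<bar> + 1))" ..
        have "norm (A j - Q j) <= 2 * (m mu * exp (\<bar>\<beta>\<bar> * B)) * \<theta>" if j: "j >= max J1 J2" for j
        proof -
          have "norm (of_real (m (mu @ tau)) * exp (\<i> * ?z * of_real (cp tau)) - of_real (m (nu @ tau)) * cis (t * c' (q tau)))
             <= m (mu @ tau) * (exp (\<bar>\<beta>\<bar> * B) * (2 * \<theta>))" if t: "tau : E j mu" for tau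
          proof -
            have len: "J1 <= length tau" "J2 <= length tau" using E_len[OF t] j by auto
            have P: "p tau : cyl (mu @ tau)" unfolding p_def by (rule pt_E[OF t])
            have q: "q tau : cyl (nu @ tau)" unfolding q_def by (rule pt_E) (use t EE in simp)
            have g1: "(sw mu nu (p tau), dg nu mu, p tau) : D (nu @ tau) (mu @ tau)" by (rule inD[OF P])
            have g2: "(q tau, dg nu mu, sw nu mu (q tau)) : D (nu @ tau) (mu @ tau)"
              using q cyl_append_subset by (auto simp: D_def dm_append f' dg_append sw_append)
            have cc: "\<bar>cp tau - c' (q tau)\<bar> < \<theta> / (\<bar>t\<bar> + 1)"
              using J2 len(2) g1 g2 by (simp add: cp_def c_def c'_def)
            have sp: "sw mu nu (p tau) : cyl (nu @ tau)" using g1 by (auto simp: D_def dm_def)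
            have pm: "p tau : dm mu nu" using P cyl_append_subset unfolding f by blast
            have cv: "cp tau = bs (length nu) (sw mu nu (p tau)) - bs (length mu) (p tau)" using coc_D[OF dm_sw[OF pm], of \<phi>] by (auto simp: sw_sw[OF pm] cp_def c_def)
            have a1: "exp (- \<beta> * bs (length mu) (p tau) - length mu * \<epsilon>) * m tau <= m (mu @ tau)"
              "m (mu @ tau) <= exp (- \<beta> * bs (length mu) (p tau) + length mu * \<epsilon>) * m tau"
              "exp (- \<beta> * bs (length nu) (sw mu nu (p tau)) - length nu * \<epsilon>) * m tau <= m (nu @ tau)"
              "m (nu @ tau) <= exp (- \<beta> * bs (length nu) (sw mu nu (p tau)) + length nu * \<epsilon>) * m tau" using J1[rule_format, OF len(1) P] J1[rule_format, OF len(1) sp] by (auto simp: birkhoff_sum_def sum_distrib_left)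
            \<comment> \<open>The modulus of the continued exponential, and by conformality nearly
              the ratio of \<open>m (nu @ tau)\<close> to \<open>m (mu @ tau)\<close>.\<close>
            define r where "r = exp (- \<beta> * cp tau)"
            have re: "exp (- \<beta> * cp tau + k * \<epsilon>) = r * exp (k * \<epsilon>)" "exp (- \<beta> * cp tau - k * \<epsilon>) = r * exp (- (k * \<epsilon>))"
              by (simp_all add: r_def flip: exp_add)
            have "m (nu @ tau) <= exp (- \<beta> * cp tau + k * \<epsilon>) * (exp (- \<beta> * bs (length mu) (p tau) - length mu * \<epsilon>) * m tau)"
              using a1(4) by (simp add: cv k_def algebra_simps flip: exp_add)
            also have "... <= exp (- \<beta> * cp tau + k * \<epsilon>) * m (mu @ tau)" using a1(1) by (intro mult_left_mono) auto
            also have "... = r * m (mu @ tau) * exp (k * \<epsilon>)" unfolding re by simp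
            also have "... <= r * m (mu @ tau) * (1 + \<theta>)" using ek m_nonneg by (intro mult_left_mono) (auto simp: r_def)
            finally have up: "m (nu @ tau) <= r * m (mu @ tau) * (1 + \<theta>)" .
            have "1 - \<theta> <= 1 / (1 + \<theta>)" using th by (simp add: field_simps)
            also have "... <= exp (- (k * \<epsilon>))" using ek th by (simp add: exp_minus field_simps)
            finally have "r * m (mu @ tau) * (1 - \<theta>) <= r * m (mu @ tau) * exp (- (k * \<epsilon>))" using m_nonneg by (intro mult_left_mono) (auto simp: r_def)
            also have "... = exp (- \<beta> * cp tau - k * \<epsilon>) * m (mu @ tau)" unfolding re by simp
            also have "... <= exp (- \<beta> * cp tau - k * \<epsilon>) * (exp (- \<beta> * bs (length mu) (p tau) + length mu * \<epsilon>) * m tau)"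
              using a1(2) by (intro mult_left_mono) auto
            also have "... = exp (- \<beta> * bs (length nu) (sw mu nu (p tau)) - length nu * \<epsilon>) * m tau"
              by (simp add: cv k_def algebra_simps flip: exp_add)
            finally have lo: "r * m (mu @ tau) * (1 - \<theta>) <= m (nu @ tau)" using a1(3) by linarith
            have mm: "\<bar>r * m (mu @ tau) - m (nu @ tau)\<bar> <= r * m (mu @ tau) * \<theta>" using up lo by (simp add: algebra_simps)
            have "\<bar>t * cp tau - t * c' (q tau)\<bar> = \<bar>t\<bar> * \<bar>cp tau - c' (q tau)\<bar>" by (simp add: abs_mult flip: right_diff_distrib)
            also have "... <= \<bar>t\<bar> * (\<theta> / (\<bar>t\<bar> + 1))" using cc by (intro mult_left_mono) auto
            also have "... <= \<theta>" using th by (simp add: field_simps)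
            finally have cd: "norm (cis (t * cp tau) - cis (t * c' (q tau))) <= \<theta>" using norm_cis_diff order_trans by blast
            have r0: "r >= 0" "r <= exp (\<bar>\<beta>\<bar> * B)"
            proof -
              have "(p tau, 0, p tau) : D mu mu" using pm by (auto simp: f D_def dm_same dg_def elim!: cylE)
              then have "- \<beta> * cp tau <= \<bar>\<beta>\<bar> * B" using cB abs_ge_minus_self[of "\<beta> * cp tau"] mult_left_mono[of "\<bar>cp tau\<bar>" B "\<bar>\<beta>\<bar>"] by (auto simp: cp_def abs_mult)
              then show "r >= 0" "r <= exp (\<bar>\<beta>\<bar> * B)" by (simp_all add: r_def)
            qed
            have "exp (\<i> * ?z * of_real (cp tau)) = of_real r * cis (t * cp tau)"
              by (simp add: r_def cis_conv_exp exp_of_real[symmetric] algebra_simps flip: exp_add)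
            then have "of_real (m (mu @ tau)) * exp (\<i> * ?z * of_real (cp tau)) - of_real (m (nu @ tau)) * cis (t * c' (q tau))
               = of_real (r * m (mu @ tau) - m (nu @ tau)) * cis (t * c' (q tau)) + of_real (r * m (mu @ tau)) * (cis (t * cp tau) - cis (t * c' (q tau)))"
              by (simp add: algebra_simps)
            also have "norm ... <= \<bar>r * m (mu @ tau) - m (nu @ tau)\<bar> + r * m (mu @ tau) * norm (cis (t * cp tau) - cis (t * c' (q tau)))"
              by (rule order_trans[OF norm_triangle_ineq]) (use r0 m_nonneg in \<open>simp add: norm_mult del: of_real_diff of_real_mult\<close>)
            also have "... <= r * m (mu @ tau) * \<theta> + r * m (mu @ tau) * \<theta>"
              using mm cd r0 m_nonneg by (intro add_mono mult_left_mono) auto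
            also have "... = m (mu @ tau) * (r * (2 * \<theta>))" by (simp add: algebra_simps)
            also have "... <= m (mu @ tau) * (exp (\<bar>\<beta>\<bar> * B) * (2 * \<theta>))"
              using r0 th m_nonneg by (intro mult_left_mono mult_right_mono) auto
            finally show ?thesis .
          qed
          then have "norm (A j - Q j) <= (SUM tau:E j mu. m (mu @ tau) * (exp (\<bar>\<beta>\<bar> * B) * (2 * \<theta>)))"
            unfolding Aj Qj sum_subtractf[symmetric] by (rule sum_norm_le)
          also have "... = 2 * (m mu * exp (\<bar>\<beta>\<bar> * B)) * \<theta>" using m_split[OF n(1), of j] by (simp flip: sum_distrib_right)
          finally show ?thesis .
        qed
        then show ?thesis by blast
      qed
      have "norm (G' ?z - om e' (?b t)) <= 0"
      proof (rule field_le_epsilon)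
        fix d :: real assume d: "d > 0"
        define \<theta> where "\<theta> = d / (2 * (m mu * exp (\<bar>\<beta>\<bar> * B)) + 1)"
        have K: "0 <= 2 * (m mu * exp (\<bar>\<beta>\<bar> * B))" using m_nonneg by simp
        have th: "\<theta> > 0" using d K by (simp add: \<theta>_def)
        obtain J where J: "!!j. j >= J ==> norm (A j - Q j) <= 2 * (m mu * exp (\<bar>\<beta>\<bar> * B)) * \<theta>" using est[OF th] by blast
        have "norm (G' ?z - om e' (?b t)) <= 2 * (m mu * exp (\<bar>\<beta>\<bar> * B)) * \<theta>"
          by (rule LIMSEQ_le_const2[OF tendsto_norm[OF tendsto_diff[OF lA lQ]]]) (use J in blast)
        also have "... <= (2 * (m mu * exp (\<bar>\<beta>\<bar> * B)) + 1) * \<theta>" using th by simp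
        also have "... = d" using K by (simp add: \<theta>_def)
        finally show "norm (G' ?z - om e' (?b t)) <= 0 + d" by simp
      qed
      then show ?thesis unfolding Lo by simp
    qed
    show ?thesis unfolding strip_bdry_def
    proof (intro exI[of _ G'] conjI allI)
      show "continuous_on (strip \<beta>) G'" by (rule holomorphic_on_imp_continuous_on[OF holomorphic_on_subset[OF hol]]) simp
      show "G' holomorphic_on interior (strip \<beta>)" by (rule holomorphic_on_subset[OF hol]) simp
      show "bounded (G' ` strip \<beta>)" using bnd unfolding bounded_iff by blast
    qed (simp_all add: La Lb)
  qed
qed

end

section \<open>Extension of the KMS condition from matrix units to the whole domain\<close>

context conf_pot
begin

abbreviation KMS_ok :: "('e gpd ell2 \<Rightarrow>\<^sub>L 'e gpd ell2) => ('e gpd ell2 \<Rightarrow>\<^sub>L 'e gpd ell2) => bool" where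
  "KMS_ok a b \<equiv> strip_bdry \<beta> (%t. L (a oL al \<phi> t b)) (%t. L (al \<phi> t b oL a))"

text \<open>\<open>KMS_pair\<close> wants inner words of equal length; the matrix unit with the
  shorter one is split until the lengths match.\<close>

lemma KMS_T: assumes n: "mu ~= []" "nu ~= []" "mu' ~= []" "nu' ~= []" shows "KMS_ok (T mu nu) (T nu' mu')"
proof (cases "length nu <= length nu'")
  case True
  show ?thesis unfolding T_split[OF n(1), of nu "length nu' - length nu"] comp_sum L_sum
    by (intro strip_bdry_sum KMS_pair) (use n True E_len in auto)
next
  case False
  show ?thesis unfolding T_split[OF n(4), of mu' "length nu - length nu'"] al_sum comp_sum L_sum
    by (intro strip_bdry_sum KMS_pair) (use n False E_len in auto)
qed

lemma KMS_A0: assumes a: "a : A0" and b: "b : A0" shows "KMS_ok a b"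
proof -
  have 1: "KMS_ok (T mu nu) b" if n: "mu ~= []" "nu ~= []" for mu nu
    using b
  proof (induction rule: A0_induct)
    case (add c nu' mu' b)
    show ?case using strip_bdry_lin[OF KMS_T[OF n add(2,1)] add(4), of c]
      by (simp add: al_add al_cscale comp_add cscale_left cscale_right AdjD(2) T_Adj L_add L_cscale)
  qed (simp add: strip_bdry_0 L_0)
  have cl: "clin (al \<phi> t b)" for t
    using AdjD(2) AA al_AG A0_AG b by blast
  show ?thesis using a
  proof (induction rule: A0_induct)
    case (add c mu nu a)
    show ?case using strip_bdry_lin[OF 1[OF add(1,2)] add(4), of c]
      by (simp add: comp_add cscale_left cscale_right cl L_add L_cscale)
  qed (simp add: strip_bdry_0 L_0)
qed

lemma Pr_N: "Pr (Fin n) : N" unfolding Pr_sum[OF finite_Fin] by (intro N_sum T_N) auto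

lemma wt_add_le: assumes "x : N" "y : N" shows "wt (x + y) <= 2 * wt x + 2 * wt y"
proof -
  have "ennreal (wt (x + y)) <= 2 * ennreal (wt x) + 2 * ennreal (wt y)"
    using parallelogram[OF N_A[OF assms(1)] N_A[OF assms(2)]] N_fin N_add assms by simp
  also have "... = ennreal (2 * wt x + 2 * wt y)" by (simp add: ennreal_mult)
  finally show ?thesis by (subst (asm) ennreal_le_iff) auto
qed

text \<open>Cutting on the right restricts the integral of the diagonal entries of
  \<open>hadj x oL x\<close> to the edges in \<open>Fin n\<close>.\<close>

lemma cut_right: assumes x: "x : N" shows "wt (x - (x oL Pr (Fin n))) <= wt x - Re (Om n (hadj x oL x))"
proof -
  let ?q = "Pr (Fin n)" and ?a = "hadj x oL x"
  have xA: "x : AG" and aA: "?a : AG" using x by (auto simp: N_A A_comp A_hadj)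
  have xq: "x - (x oL ?q) : N" by (intro N_diff x N_left(1)[OF xA Pr_N])
  have e: "hadj (x - (x oL ?q)) oL (x - (x oL ?q)) = (?a - (?a oL ?q)) - ((?q oL ?a) - (?q oL (?a oL ?q)))"
    using xA Pr_AG by (simp add: hadj_diff hadj_comp AA Adj_comp hadj_Pr comp_diff comp_assoc)
  have "Re (Om k (hadj (x - (x oL ?q)) oL (x - (x oL ?q)))) <= wt x - Re (Om n ?a)" for k using Om_cut aA Pr_AG Om_wt(2)[OF x, of k] Om_wt(2)[OF x, of n] by (auto simp: e Om_diff A_diff A_comp)
  then show ?thesis by (intro LIMSEQ_le_const2[OF Om_wt(1)[OF xq]]) blast
qed

text \<open>A cut on the left is not a restriction of the integral. Instead,
  \<open>wt (x - (?q oL x)) + wt (?q oL x) = wt x\<close> for the projection \<open>?q\<close>, and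
  the second summand comes close to \<open>wt x\<close> because each \<open>Om k\<close> is
  norm-continuous.\<close>

lemma cut_left: assumes x: "x : N" shows "(%n. wt (x - (Pr (Fin n) oL x))) ----> 0"
proof (rule LIMSEQ_I)
  fix e :: real assume e: "e > 0"
  have xA: "x : AG" using x by (rule N_A)
  have aA: "hadj x oL y : AG" if "y : AG" for y using xA that by (simp add: A_comp A_hadj)
  obtain k where k: "Re (Om k (hadj x oL x)) > wt x - e"
    using order_tendstoD(1)[OF Om_wt(1)[OF x], of "wt x - e"] e by (auto simp: eventually_sequentially)
  have "(%n. hadj x oL (Pr (Fin n) oL x)) ----> (hadj x oL x)" by (intro tendsto_comp tendsto_const Pr_lim1 xA)
  then have l: "(%n. Re (Om k (hadj x oL (Pr (Fin n) oL x)))) ----> Re (Om k (hadj x oL x))"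
    by (intro tendsto_Re Om_lim aA A_comp Pr_AG xA)
  then obtain n0 where n0: "!!n. n >= n0 ==> Re (Om k (hadj x oL (Pr (Fin n) oL x))) > wt x - e"
    using order_tendstoD(1)[OF l k] by (auto simp: eventually_sequentially)
  have "norm (wt (x - (Pr (Fin n) oL x)) - 0) < e" if n: "n >= n0" for n
  proof -
    let ?q = "Pr (Fin n)"
    have qN: "?q oL x : N" and dN: "x - (?q oL x) : N" using N_left(1)[OF Pr_AG x] x by (auto intro: N_diff)
    have h: "hadj (?q oL x) oL (?q oL x) = hadj x oL (?q oL x)"
      using xA Pr_AG by (simp add: hadj_comp AA hadj_Pr comp_assoc) (simp add: comp_assoc[symmetric] Pr_Pr)
    have "(hadj (x - (?q oL x)) oL (x - (?q oL x))) + (hadj (?q oL x) oL (?q oL x)) = hadj x oL x" using xA Pr_AG by (simp add: hadj_diff hadj_comp AA Adj_comp hadj_Pr comp_diff comp_assoc)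
        (simp add: comp_assoc[symmetric] Pr_Pr)
    from arg_cong[OF this, of L] have "complex_of_real (wt (x - (?q oL x)) + wt (?q oL x)) = of_real (wt x)"
      unfolding L_add L_sq[OF x] L_sq[OF qN] L_sq[OF dN] by simp
    then have "wt (x - (?q oL x)) + wt (?q oL x) = wt x" unfolding of_real_eq_iff .
    moreover have "wt x - e < wt (?q oL x)" using n0[OF n] Om_wt(2)[OF qN, of k] unfolding h by linarith
    ultimately show ?thesis by simp
  qed
  then show "EX n0. ALL n>=n0. norm (wt (x - (Pr (Fin n) oL x)) - 0) < e" by blast
qed

lemma cut_wt: assumes x: "x : N" shows "(%n. wt (x - (Pr (Fin n) oL (x oL Pr (Fin n))))) ----> 0"
proof (rule Lim_null_comparison)
  let ?q = "%n. Pr (Fin n)"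
  have "wt (x - (?q n oL (x oL ?q n))) <= 2 * wt (x - (?q n oL x)) + 2 * (wt x - Re (Om n (hadj x oL x)))" for n
  proof -
    have xq: "x - (x oL ?q n) : N" by (intro N_diff x N_left(1)[OF N_A[OF x] Pr_N])
    have eq: "x - (?q n oL (x oL ?q n)) = (x - (?q n oL x)) + (?q n oL (x - (x oL ?q n)))" by (simp add: comp_diff)
    have "wt (x - (?q n oL (x oL ?q n))) <= 2 * wt (x - (?q n oL x)) + 2 * wt (?q n oL (x - (x oL ?q n)))"
      unfolding eq by (rule wt_add_le[OF N_diff[OF x N_left(1)[OF Pr_AG x]] N_left(1)[OF Pr_AG xq]])
    also have "wt (?q n oL (x - (x oL ?q n))) <= (norm (?q n))\<^sup>2 * wt (x - (x oL ?q n))" by (rule N_left(2)[OF Pr_AG xq])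
    also have "... <= 1\<^sup>2 * wt (x - (x oL ?q n))" by (intro mult_right_mono power_mono norm_Pr) auto
    also have "... <= wt x - Re (Om n (hadj x oL x))" using cut_right[OF x] by simp
    finally show ?thesis by simp
  qed
  then show "\<forall>\<^sub>F n in sequentially. norm (wt (x - (?q n oL (x oL ?q n)))) <= 2 * wt (x - (?q n oL x)) + 2 * (wt x - Re (Om n (hadj x oL x)))"
    by simp
  have "(%n. 2 * wt (x - (?q n oL x)) + 2 * (wt x - Re (Om n (hadj x oL x)))) ----> 2 * 0 + 2 * (wt x - wt x)"
    by (intro tendsto_intros cut_left Om_wt x)
  then show "(%n. 2 * wt (x - (?q n oL x)) + 2 * (wt x - Re (Om n (hadj x oL x)))) ----> 0" by simp
qed

text \<open>Compression to a corner is close in \<open>wt\<close> for \<open>x\<close> and its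
  adjoint simultaneously; inside a corner of finite weight \<open>wt\<close> is controlled by the
  norm, so norm density of \<open>A0\<close> suffices there.\<close>

lemma A0_core: assumes x: "x : N" "hadj x : N" and e: "e > 0"
  shows "EX y:A0. y : N & hadj y : N & wt (x - y) <= e & wt (hadj x - hadj y) <= e"
proof -
  have xA: "x : AG" using x(1) by (rule N_A)
  have "\<forall>\<^sub>F n in sequentially. wt (x - (Pr (Fin n) oL (x oL Pr (Fin n)))) < e / 4 & wt (hadj x - (Pr (Fin n) oL (hadj x oL Pr (Fin n)))) < e / 4"
    by (intro eventually_conj order_tendstoD(2)[OF cut_wt[OF x(1)]] order_tendstoD(2)[OF cut_wt[OF x(2)]]) (use e in auto)
  then obtain n where n: "wt (x - (Pr (Fin n) oL (x oL Pr (Fin n)))) < e / 4" "wt (hadj x - (Pr (Fin n) oL (hadj x oL Pr (Fin n)))) < e / 4"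
    by (auto simp: eventually_sequentially)
  let ?q = "Pr (Fin n)"
  \<comment> \<open>The bound 1 gives \<open>d\<^sup>2 <= d\<close>, the other one
    \<open>d * wt ?q <= e / 4\<close>; with the factors 2 of \<open>wt_add_le\<close> both errors
    add up to \<open>e\<close>.\<close>
  define d where "d = min 1 (e / (4 * (wt ?q + 1)))"
  have d: "d > 0" using e by (simp add: d_def add_nonneg_pos)
  obtain y0 where y0: "y0 : A0" "dist y0 x < d" using xA d unfolding graph_algebra_eq closure_approachable by blast
  have qA0: "?q : A0" unfolding Pr_sum[OF finite_Fin] by (intro A0_sum T_A0) auto
  define y where "y = ?q oL (y0 oL ?q)"
  have y0A: "y0 : AG" using y0 A0_AG by blast
  have yh: "hadj y = ?q oL (hadj y0 oL ?q)" using y0A Pr_AG by (simp add: y_def hadj_comp AA Adj_comp hadj_Pr comp_assoc)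
  have corner: "?q oL (z oL ?q) : N" if "z : AG" for z by (intro N_left(1) Pr_AG Pr_N that)
  have est: "wt (z - (?q oL (w oL ?q))) <= e"
    if z: "z : N" "w : AG" "norm (z - w) < d" "wt (z - (?q oL (z oL ?q))) < e / 4" for z w
  proof -
    have zA: "z : AG" by (rule N_A[OF z(1)])
    have "wt (z - (?q oL (w oL ?q))) <= 2 * wt (z - (?q oL (z oL ?q))) + 2 * wt ((?q oL (z - w)) oL ?q)" using wt_add_le[OF N_diff[OF z(1) corner[OF zA]] corner[OF A_diff[OF zA z(2)]]] by (auto simp: comp_diff comp_assoc)
    also have "wt ((?q oL (z - w)) oL ?q) <= (norm (?q oL (z - w)))\<^sup>2 * wt ?q"
      by (intro N_left(2) Pr_N A_comp Pr_AG A_diff zA z(2))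
    also have "... <= d * wt ?q"
    proof (rule mult_right_mono)
      have "norm (?q oL (z - w)) <= 1 * norm (z - w)" by (rule order_trans[OF norm_comp_le mult_right_mono[OF norm_Pr]]) simp
      then have "(norm (?q oL (z - w)))\<^sup>2 <= d\<^sup>2" using z(3) by (intro power_mono) auto
      also have "... <= d * 1" unfolding power2_eq_square using d by (intro mult_left_mono) (auto simp: d_def)
      finally show "(norm (?q oL (z - w)))\<^sup>2 <= d" by simp
    qed simp
    also have "d * wt ?q <= e / 4"
    proof -
      have "d * wt ?q <= e / (4 * (wt ?q + 1)) * (wt ?q + 1)" using e by (intro mult_mono) (auto simp: d_def)
      also have "... = e / 4"
      proof -
        have "wt ?q + 1 ~= 0" using wt_nonneg[of ?q] by linarith
        then show ?thesis by (metis divide_divide_eq_left nonzero_eq_divide_eq)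
      qed
      finally show ?thesis .
    qed
    finally show ?thesis using z(4) by simp
  qed
  have nh: "norm (hadj x - hadj y0) = norm (x - y0)" using xA y0A by (simp add: AA Adj_diff flip: hadj_diff)
  show ?thesis
  proof (intro bexI[of _ y] conjI)
    show "y : A0" unfolding y_def by (intro A0_comp qA0 y0)
    show "y : N" "hadj y : N" unfolding yh unfolding y_def by (auto intro!: corner A_hadj y0A)
    show "wt (x - y) <= e" unfolding y_def
      by (rule est) (use x y0A y0(2) n in \<open>auto simp: dist_norm norm_minus_commute\<close>)
    show "wt (hadj x - hadj y) <= e" unfolding yh
      by (rule est) (use x A_hadj[OF y0A] y0(2) n nh in \<open>auto simp: dist_norm norm_minus_commute\<close>)
  qed
qed

text \<open>By Cauchy-Schwarz one boundary value is controlled by \<open>wt (hadj a)\<close> and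
  \<open>wt b\<close>, the other by \<open>wt (hadj b)\<close> and \<open>wt a\<close>; hence
  approximation of an element together with its adjoint.\<close>

lemma KMS_N:
  assumes a: "a : N" "hadj a : N" and b: "b : N" "hadj b : N" shows "KMS_ok a b"
proof -
  let ?e = "%k. inverse (real (Suc k))"
  have "EX f. ALL k. f k : A0 & f k : N & hadj (f k) : N & wt (x - f k) <= ?e k & wt (hadj x - hadj (f k)) <= ?e k"
    if "x : N" "hadj x : N" for x
    using A0_core[OF that, of "?e _"] by (intro choice allI) auto
  from this[OF a] this[OF b] obtain f g where
    f: "!!k. f k : A0" "!!k. f k : N" "!!k. hadj (f k) : N" "!!k. wt (a - f k) <= ?e k" "!!k. wt (hadj a - hadj (f k)) <= ?e k"
    and g: "!!k. g k : A0" "!!k. g k : N" "!!k. hadj (g k) : N" "!!k. wt (b - g k) <= ?e k" "!!k. wt (hadj b - hadj (g k)) <= ?e k"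
    by blast
  have inv: "invariant_weight AG (act G \<phi>) wgt" by (rule wgt_inv[OF pot_axioms])
  note alN = inv_wt[OF pot_axioms inv]
  \<comment> \<open>Dominates the square roots of the weights of \<open>a\<close>, \<open>b\<close>,
    their adjoints and all \<open>f k\<close>, \<open>hadj (f k)\<close>, as
    \<open>wt (f k) <= 2 * wt a + 2\<close>.\<close>
  define C where "C = sqrt (2 * (wt a + wt (hadj a) + wt b + wt (hadj b)) + 2)"
  define r where "r k = 2 * (C * sqrt (?e k))" for k
  have C0: "C >= 0" by (simp add: C_def)
  have CS: "norm (L (x oL al \<phi> t y)) <= sqrt (wt (hadj x)) * sqrt (wt y)" "norm (L (al \<phi> t y oL x)) <= sqrt (wt (hadj y)) * sqrt (wt x)"
    if "x : N" "hadj x : N" "y : N" "hadj y : N" for x y t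
    using L_CS'[OF that(2) alN(1)[OF that(3)], of t] L_CS'[OF alN(1)[OF that(4)] that(1), of t] that AA[OF N_A[OF that(1)]] AA[OF N_A[OF that(3)]]
    by (simp_all add: alN(2) al_hadj hadj_in_Adj)
  have bnd: "sqrt (wt x) <= C" if "x = a \<or> x = hadj a \<or> x = b \<or> x = hadj b" for x
    unfolding C_def using that by (intro real_sqrt_le_mono) auto
  have e1: "?e k <= 1" for k by (simp add: inverse_le_1_iff)
  have bndf: "sqrt (wt (f k)) <= C" "sqrt (wt (hadj (f k))) <= C" for k
  proof -
    have "wt y <= 2 * wt x + 2" if "x : N" "y : N" "wt (x - y) <= ?e k" for x y
    proof -
      have "wt (y - x) = wt (x - y)" using N_cscale(2)[OF N_diff[OF that(1,2)], of "- 1"] by (simp add: cop.scale_minus_left)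
      then show ?thesis using wt_add_le[OF that(1) N_diff[OF that(2,1)]] that(3) e1[of k] by simp
    qed
    from this[OF a(1) f(2,4)] this[OF a(2) f(3,5)] show "sqrt (wt (f k)) <= C" "sqrt (wt (hadj (f k))) <= C"
      unfolding C_def using wt_nonneg[of a] wt_nonneg[of b] wt_nonneg[of "hadj a"] wt_nonneg[of "hadj b"]
      unfolding real_sqrt_le_iff distrib_left by linarith+
  qed
  have dN: "a - f k : N" "hadj (a - f k) : N" "b - g k : N" "hadj (b - g k) : N" for k
    using a b f g N_A AA by (auto simp: hadj_diff intro!: N_diff)
  have dh: "hadj (a - f k) = hadj a - hadj (f k)" "hadj (b - g k) = hadj b - hadj (g k)" for k
    using a b f g N_A AA by (auto simp: hadj_diff)
  show ?thesis
  proof (rule strip_bdry_lim[OF KMS_A0[OF f(1) g(1)], where r = r])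
    have "(%k. 2 * (C * sqrt (?e k))) ----> 2 * (C * sqrt 0)" by (intro tendsto_intros LIMSEQ_inverse_real_of_nat)
    then show "r ----> 0" unfolding r_def by simp
    fix k t
    have e: "L (f k oL al \<phi> t (g k)) - L (a oL al \<phi> t b) = - (L ((a - f k) oL al \<phi> t b) + L (f k oL al \<phi> t (b - g k)))"
      "L (al \<phi> t (g k) oL f k) - L (al \<phi> t b oL a) = - (L (al \<phi> t b oL (a - f k)) + L (al \<phi> t (b - g k) oL f k))" by (auto simp: comp_diff al_diff L_diff)
    have "norm (L ((a - f k) oL al \<phi> t b) + L (f k oL al \<phi> t (b - g k))) <= sqrt (?e k) * C + C * sqrt (?e k)"
      by (rule order_trans[OF norm_triangle_ineq], rule add_mono, rule order_trans[OF CS(1)[OF dN(1,2) b]], rule mult_mono,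
          simp only: dh real_sqrt_le_iff f, simp add: bnd, simp, simp, rule order_trans[OF CS(1)[OF f(2,3) dN(3,4)]], rule mult_mono)
        (simp_all add: bndf g C0 del: of_nat_Suc)
    then show "norm (L (f k oL al \<phi> t (g k)) - L (a oL al \<phi> t b)) <= r k" unfolding e r_def norm_minus_cancel by simp
    have "norm (L (al \<phi> t b oL (a - f k)) + L (al \<phi> t (b - g k) oL f k)) <= C * sqrt (?e k) + sqrt (?e k) * C"
      by (rule order_trans[OF norm_triangle_ineq], rule add_mono, rule order_trans[OF CS(2)[OF dN(1,2) b]], rule mult_mono,
          simp add: bnd, simp add: f del: of_nat_Suc, rule C0, simp, rule order_trans[OF CS(2)[OF f(2,3) dN(3,4)]], rule mult_mono)
        (simp_all add: bndf g dh del: of_nat_Suc)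
    then show "norm (L (al \<phi> t (g k) oL f k) - L (al \<phi> t b oL a)) <= r k" unfolding e r_def norm_minus_cancel by simp
  qed
qed

lemma wgt_KMS: "gauge_inv_KMS_weight G \<phi> \<beta> wgt"
  using KMS_N N_A wgt_weight wgt_nz wgt_dense wgt_lsc wgt_inv[OF pot_axioms] wgt_inv[OF pot_const] by (auto simp: strip_bdry_def act_eq gauge_inv_KMS_weight_def KMS_weight_def gauge_invariant_def)

end

section \<open>From the hypotheses on the graph and the potential to the three cases\<close>

context pgraph
begin

lemma pot_of_var: assumes "(%k. var G \<phi> k) ----> 0" shows "pot G \<phi>"
proof
  fix e :: real assume "e > 0"
  then obtain k where k: "var G \<phi> k < ennreal e"
    using order_tendstoD(2)[OF assms, of "ennreal e"] by (auto simp: eventually_sequentially)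
  have "\<bar>\<phi> x - \<phi> y\<bar> <= e" if "x : X" "y : X" "pre k x = pre k y" for x y
  proof -
    have "ennreal \<bar>\<phi> x - \<phi> y\<bar> <= var G \<phi> k"
      unfolding var_def by (rule Sup_upper) (use that in \<open>auto simp: pre_eq_iff\<close>)
    then have "ennreal \<bar>\<phi> x - \<phi> y\<bar> < ennreal e" using k by (rule le_less_trans)
    then show ?thesis by (simp add: ennreal_less_iff)
  qed
  then show "EX k. ALL x:X. ALL y:X. pre k x = pre k y --> \<bar>\<phi> x - \<phi> y\<bar> <= e" by blast
qed

end

context pot
begin

lemma gauge_kmsI: "gauge_inv_KMS_weight G u \<beta> \<psi> ==> gauge_kms G u \<beta> \<psi>"
  using pot_axioms by (simp add: gauge_inv_KMS_weight_def gauge_kms_def gauge_kms_axioms_def kms_pot_def kms_pot_axioms_def)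

lemma KMS_iff_conf:
  "(EX \<psi>. gauge_inv_KMS_weight G u \<beta> \<psi>) \<longleftrightarrow> (EX m. pot.conf G (%x. - \<beta> * u x) m & (EX mu. mu ~= [] & m mu ~= 0))"
proof
  assume "EX \<psi>. gauge_inv_KMS_weight G u \<beta> \<psi>"
  then obtain \<psi> where "gauge_inv_KMS_weight G u \<beta> \<psi>" ..
  then interpret k: gauge_kms G u \<beta> \<psi> by (rule gauge_kmsI)
  show "EX m. pot.conf G (%x. - \<beta> * u x) m & (EX mu. mu ~= [] & m mu ~= 0)"
    using k.mass_conf k.mass_nonzero less_irrefl by metis
next
  assume "EX m. pot.conf G (%x. - \<beta> * u x) m & (EX mu. mu ~= [] & m mu ~= 0)"
  then obtain m mu where m: "pot.conf G (%x. - \<beta> * u x) m" "mu ~= []" "m mu ~= 0" by blast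
  have "0 <= m mu" by (rule pot.conf_nonneg[OF pot_cmult m(1)])
  then interpret c: conf_pot G u \<beta> m by unfold_locales (use m in auto)
  show "EX \<psi>. gauge_inv_KMS_weight G u \<beta> \<psi>" by (rule exI[of _ c.wgt], rule c.wgt_KMS)
qed

end

theorem theorem7p2:
  fixes G :: "('v, 'e) pre_digraph" and \<phi> :: "(nat \<Rightarrow> 'e) \<Rightarrow> real" and \<beta> :: real
  assumes "wf_digraph G" "countable (verts G)" "countable (arcs G)" "verts G \<noteq> {}"
    and "cofinal_graph G"
    and "(\<lambda>k. var G \<phi> k) ----> 0"
  shows "(NW G = {} \<longrightarrow> (\<forall>\<beta>::real. \<exists>\<psi>. gauge_inv_KMS_weight G \<phi> \<beta> \<psi>)) \<and>
    (NW G \<noteq> {} \<and> finite (NW G) \<and> bowen_on_NW G \<phi> \<longrightarrow>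
       ((\<exists>\<psi>. gauge_inv_KMS_weight G \<phi> \<beta> \<psi>) \<longleftrightarrow> pressure G (\<lambda>x. - \<beta> * \<phi> x) = 0) \<and>
       (\<forall>\<psi> \<psi>'. gauge_inv_KMS_weight G \<phi> \<beta> \<psi> \<and> gauge_inv_KMS_weight G \<phi> \<beta> \<psi>' \<longrightarrow>
          (\<exists>c>0. \<forall>a \<in> pos_cone (graph_algebra G). \<psi>' a = ennreal c * \<psi> a))) \<and>
    (infinite (NW G) \<longrightarrow>
       ((\<exists>\<psi>. gauge_inv_KMS_weight G \<phi> \<beta> \<psi>) \<longleftrightarrow> pressure G (\<lambda>x. - \<beta> * \<phi> x) \<le> 0))"
proof -
  interpret pgraph G
    by (rule pgraph.intro) (use assms(1,3,5) in \<open>auto simp: cofinal_graph_def\<close>)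
  interpret p: pot G \<phi> by (rule pot_of_var[OF assms(6)])
  have cp: "cpot G (%x. - b * \<phi> x)" for b
    using p.pot_cmult[of "- b"] assms(5) by (auto simp: cpot_def cpot_axioms_def cofinal_graph_def)
  interpret c: cpot G "%x. - \<beta> * \<phi> x" by (rule cp)
  have le: "pressure G (%x. - \<beta> * \<phi> x) <= 0" if "gauge_inv_KMS_weight G \<phi> \<beta> \<psi>" for \<psi>
    using that p.KMS_iff_conf c.conf_pressure[OF assms(4)] by blast
  show ?thesis
  proof (intro conjI impI allI iffI)
    fix b assume "NW G = {}"
    then show "EX \<psi>. gauge_inv_KMS_weight G \<phi> b \<psi>"
      unfolding p.KMS_iff_conf by (rule cpot.exists_conf_wandering[OF cp _ assms(4)])
  next
    assume "infinite (NW G)" "EX \<psi>. gauge_inv_KMS_weight G \<phi> \<beta> \<psi>"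
    then show "pressure G (%x. - \<beta> * \<phi> x) <= 0" using le by blast
  next
    assume i: "infinite (NW G)" "pressure G (%x. - \<beta> * \<phi> x) <= 0"
    then show "EX \<psi>. gauge_inv_KMS_weight G \<phi> \<beta> \<psi>"
      unfolding p.KMS_iff_conf using c.exists_conf_infinite c.pressure_le_0_iff[OF assms(4)] by blast
  next
    assume B: "NW G ~= {} & finite (NW G) & bowen_on_NW G \<phi>"
    then obtain C where C: "!!n x y. n >= 1 ==> x : inf_paths (NW_graph G) ==> y : inf_paths (NW_graph G) ==>
      (ALL i<n. x i = y i) ==> \<bar>\<Sum>i<n. \<phi> ((shift ^^ i) x) - \<phi> ((shift ^^ i) y)\<bar> <= C"
      unfolding bowen_on_NW_def by blast
    \<comment> \<open>Heredity of \<open>NW\<close> turns a condition on the first edge into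
      membership in the subgraph, where Bowen's condition is available.\<close>
    have NWp: "x : inf_paths (NW_graph G)" if x: "x : X" "x 0 : c.NWA" for x
    proof -
      have "x i : c.NWA" for i using c.NWA_her[OF x(1), of 0 i] x(2) by simp
      then show ?thesis using x(1) by (auto simp: inf_paths_def NW_graph_def c.NWA_def)
    qed
    \<comment> \<open>Birkhoff sums of \<open>- \<beta> * \<phi>\<close> scale Bowen's constant for
      \<phi> by \<open>\<bar>\<beta>\<bar>\<close>.\<close>
    interpret bowen_pot G "%x. - \<beta> * \<phi> x" "\<bar>\<beta>\<bar> * C"
    proof
      fix x y n assume x: "x : X" "y : X" "x 0 : c.NWA" "pre n x = pre n y" "1 <= n"
      have "\<bar>\<Sum>i<n. \<phi> ((shift ^^ i) x) - \<phi> ((shift ^^ i) y)\<bar> <= C" using C NWp x by (auto simp: pre_eq_iff)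
      moreover have "c.bs n x - c.bs n y = - \<beta> * (\<Sum>i<n. \<phi> ((shift ^^ i) x) - \<phi> ((shift ^^ i) y))"
        by (simp add: birkhoff_sum_def sum_distrib_left sum_subtractf right_diff_distrib)
      ultimately show "\<bar>c.bs n x - c.bs n y\<bar> <= \<bar>\<beta>\<bar> * C" by (simp add: abs_mult mult_left_mono)
    qed (use B in auto)
    obtain e0 where e0: "e0 : c.NWA" using c.NWA_ne B by blast
    {
      assume "EX \<psi>. gauge_inv_KMS_weight G \<phi> \<beta> \<psi>"
      then show "pressure G (%x. - \<beta> * \<phi> x) = 0"
        using le p.KMS_iff_conf c.pressure_ge_0[OF _ e0] B antisym by metis
    next
      assume "pressure G (%x. - \<beta> * \<phi> x) = 0"
      then show "EX \<psi>. gauge_inv_KMS_weight G \<phi> \<beta> \<psi>" unfolding p.KMS_iff_conf by (rule exists_conf_finite)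
    next
      fix \<psi> \<psi>' assume "gauge_inv_KMS_weight G \<phi> \<beta> \<psi> & gauge_inv_KMS_weight G \<phi> \<beta> \<psi>'"
      then have k: "gauge_kms G \<phi> \<beta> \<psi>" "gauge_kms G \<phi> \<beta> \<psi>'" by (auto intro: p.gauge_kmsI)
      interpret k: gauge_kms G \<phi> \<beta> \<psi> by (rule k(1))
      interpret k': gauge_kms G \<phi> \<beta> \<psi>' by (rule k(2))
      obtain mu mu' where "mu ~= []" "0 < k.mass mu" "mu' ~= []" "0 < k'.mass mu'" using k.mass_nonzero k'.mass_nonzero by blast
      then obtain d where d: "d > 0" "!!mu. mu ~= [] ==> k'.mass mu = d * k.mass mu"
        using conf_unique[OF k.mass_conf k'.mass_conf, of mu mu'] by auto
      then show "EX c>0. ALL a:pos_cone AG. \<psi>' a = ennreal c * \<psi> a" using KMS_unique[OF k] by blast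
    }
  qed
qed

end
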